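(* Let $M$ be a complex manifold, $z\in M$ and $X\in T_zM$. Suppose that $M$ is hyperbolic at $z$ and that $\kappa_M$, regarded as a function on the tangent bundle $TM$, is continuous at $(z,X)$. Then $$\kappa_M(z;X)=\mathcal D\tilde k_M(z;X)=\underline{\mathcal D}\tilde k_M(z;X).$$
   Context: $\mathbb D\subset\mathbb C$ is the open unit disc and $\mathcal O(\mathbb D,M)$ denotes the holomorphic maps $\mathbb D\to M$. For a complex manifold $M$ of dimension $n$, $z,w\in M$ and $X\in T_zM$ (complex tangent space): - Lempert function: $\tilde k^\ast_M(z,w)=\inf\{|\alpha|:\exists f\in\mathcal O(\mathbb D,M),\ f(0)=z,\ f(\alpha)=w\}$ and $\tilde k_M=\tanh^{-1}\tilde k^\ast_M$. - Kobayashi–Royden pseudometric: $\kappa_M(z;X)=\inf\{|\alpha|:\exists f\in\mathcal O(\mathbb D,M),\ f(0)=z,\ \alpha f_\ast(d/d\zeta)=X\}$. - For $m\in\mathbb N$: $k^{(m)}_M(z,w)=\inf\{\sum_{j=1}^m\tilde k_M(z_{j-1},z_j): z_0,\dots,z_m\in M,\ z_0=z,\ z_m=w\}$ (so $k^{(1)}_M=\tilde k_M$), and the Kobayashi pseudodistance is $k_M=k^{(\infty)}_M:=\inf_m k^{(m)}_M$. - $M$ is hyperbolic at $z$ if $k_M(z,w)>0$ for every $w\in M$, $w\neq z$. - "Derivatives": for $m\in\mathbb N\cup\{\infty\}$ and a holomorphic chart $(U,\varphi)$ near $z$, $$\mathcal D k^{(m)}_M(z;X)=\limsup_{t\to 0,\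 t\in\mathbb C\setminus\{0\},\ w\to z,\ Y\to\varphi_\ast X}\frac{k^{(m)}_M\big(w,\varphi^{-1}(\varphi(w)+tY)\big)}{|t|},$$ and $\underline{\mathcal D}k^{(m)}_M(z;X)$ is defined identically with $\liminf$ in place of $\limsup$ (both are independent of the chart). $\mathcal D\tilde k_M$ and $\underline{\mathcal D}\tilde k_M$ denote these for $m=1$. *)

theory Defs
  imports "HOL-Analysis.Analysis"
begin

text \<open>Holomorphic maps between open subsets of complex coordinate spaces:
  the (real) Frechet derivative exists and is complex linear, i.e. given by a
  complex matrix.\<close>
definition cholo_on :: "(complex ^ 'n) set \<Rightarrow> (complex ^ 'n \<Rightarrow> complex ^ 'm) \<Rightarrow> bool" where
  "cholo_on S g \<longleftrightarrow>
     (\<forall>x\<in>S. \<exists>A :: complex ^ 'n ^ 'm. (g has_derivative (\<lambda>h. A *v h)) (at x))"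

definition complex_atlas :: "('a::topological_space set \<times> ('a \<Rightarrow> complex ^ 'n)) set \<Rightarrow> bool" where
  "complex_atlas A \<longleftrightarrow>
     (\<forall>(U, \<phi>)\<in>A. open U \<and> open (\<phi> ` U) \<and> homeomorphism U (\<phi> ` U) \<phi> (inv_into U \<phi>)) \<and>
     (\<forall>(U, \<phi>)\<in>A. \<forall>(V, \<psi>)\<in>A. cholo_on (\<phi> ` (U \<inter> V)) (\<psi> \<circ> inv_into U \<phi>)) \<and>
     (\<Union>(fst ` A) = UNIV)"

definition holo_disc :: "('a::topological_space set \<times> ('a \<Rightarrow> complex ^ 'n)) set \<Rightarrow> (complex \<Rightarrow> 'a) \<Rightarrow> bool" where
  "holo_disc A f \<longleftrightarrow>
     continuous_on (ball 0 1) f \<and>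
     (\<forall>(U, \<phi>)\<in>A. \<forall>i. (\<lambda>\<zeta>. \<phi> (f \<zeta>) $ i) holomorphic_on (ball 0 1 \<inter> f -` U))"

text \<open>Lempert function (starred version and the tanh^-1 version); Inf {} = \<infinity>.\<close>
definition lempert_star :: "('a::topological_space set \<times> ('a \<Rightarrow> complex ^ 'n)) set \<Rightarrow> 'a \<Rightarrow> 'a \<Rightarrow> ereal" where
  "lempert_star A z w = Inf {ereal (cmod \<alpha>) | \<alpha>. \<alpha> \<in> ball 0 1 \<and>
       (\<exists>f. holo_disc A f \<and> f 0 = z \<and> f \<alpha> = w)}"

definition lempert :: "('a::topological_space set \<times> ('a \<Rightarrow> complex ^ 'n)) set \<Rightarrow> 'a \<Rightarrow> 'a \<Rightarrow> ereal" where
  "lempert A z w =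
     (if lempert_star A z w < 1 then ereal (artanh (real_of_ereal (lempert_star A z w))) else \<infinity>)"

definition kchain :: "('a::topological_space set \<times> ('a \<Rightarrow> complex ^ 'n)) set \<Rightarrow> nat \<Rightarrow> 'a \<Rightarrow> 'a \<Rightarrow> ereal" where
  "kchain A m z w = Inf {(\<Sum>j<m. lempert A (c j) (c (Suc j))) | c. c 0 = z \<and> c m = w}"

definition kobayashi :: "('a::topological_space set \<times> ('a \<Rightarrow> complex ^ 'n)) set \<Rightarrow> 'a \<Rightarrow> 'a \<Rightarrow> ereal" where
  "kobayashi A z w = (INF m\<in>{1..}. kchain A m z w)"

definition hyperbolic_at :: "('a::topological_space set \<times> ('a \<Rightarrow> complex ^ 'n)) set \<Rightarrow> 'a \<Rightarrow> bool" where
  "hyperbolic_at A z \<longleftrightarrow> (\<forall>w. w \<noteq> z \<longrightarrow> kobayashi A z w > 0)"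

text \<open>Kobayashi--Royden pseudometric at z of the tangent vector whose coordinate
  representation in the chart phi is X (phi a chart of A around z).\<close>
definition kappa :: "('a::topological_space set \<times> ('a \<Rightarrow> complex ^ 'n)) set \<Rightarrow> ('a \<Rightarrow> complex ^ 'n)
     \<Rightarrow> 'a \<Rightarrow> complex ^ 'n \<Rightarrow> ereal" where
  "kappa A \<phi> z X = Inf {ereal (cmod \<alpha>) | \<alpha>. \<exists>f v. holo_disc A f \<and> f 0 = z \<and>
       ((\<lambda>\<zeta>. \<phi> (f \<zeta>)) has_derivative (\<lambda>h. h *s v)) (at 0) \<and> \<alpha> *s v = X}"

definition dquot :: "('a \<Rightarrow> 'a \<Rightarrow> ereal) \<Rightarrow> 'a set \<Rightarrow> ('a \<Rightarrow> complex ^ 'n)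
     \<Rightarrow> complex \<times> 'a \<times> (complex ^ 'n) \<Rightarrow> ereal" where
  "dquot d U \<phi> = (\<lambda>(t, w, Y). d w (inv_into U \<phi> (\<phi> w + t *s Y)) / ereal (cmod t))"

definition Dupper :: "('a::topological_space \<Rightarrow> 'a \<Rightarrow> ereal) \<Rightarrow> 'a set \<Rightarrow> ('a \<Rightarrow> complex ^ 'n)
     \<Rightarrow> 'a \<Rightarrow> complex ^ 'n \<Rightarrow> ereal" where
  "Dupper d U \<phi> z X = Limsup (at (0::complex) \<times>\<^sub>F nhds z \<times>\<^sub>F nhds X) (dquot d U \<phi>)"

definition Dlower :: "('a::topological_space \<Rightarrow> 'a \<Rightarrow> ereal) \<Rightarrow> 'a set \<Rightarrow> ('a \<Rightarrow> complex ^ 'n)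
     \<Rightarrow> 'a \<Rightarrow> complex ^ 'n \<Rightarrow> ereal" where
  "Dlower d U \<phi> z X = Liminf (at (0::complex) \<times>\<^sub>F nhds z \<times>\<^sub>F nhds X) (dquot d U \<phi>)"

end

theory Submission
  imports Defs "HOL-Complex_Analysis.Complex_Analysis"
begin

text \<open>
  Upper bound: let f be an analytic disc through z and r < 1. A neighbourhood of the graph of f over
  the disc of radius r is biholomorphic, over the disc, to a product with a ball. This holds near
  every point by means of a chart, and two trivializations over adjacent rectangles are glued in
  three steps: the linear part of the transition map is made close to the identity by a frame that
  extends across the second rectangle, the remaining small transition map is factored by a nonlinear
  Cousin splitting, and the two corrected trivializations then agree on the overlap. In the
  trivialization F of the disc, the curves F(\<zeta>, a + \<zeta> b) with small a and b are discs joining every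
  pair of nearby points w and w + tY, so their Lempert function is at most about |t| times the
  infimum defining \<kappa>.

  Lower bound: by hyperbolicity at z, a uniform fraction of every disc centred near z stays in a fixed
  chart ball. If such a disc g joins w to w + tY at parameter \<beta>, Taylor's formula shows that
  (\<beta>/t) g'(0) is close to Y, and continuity of \<kappa> at (z, X) bounds |\<beta>/t| from below.
\<close>

text \<open>The upper bound must hold with a factor arbitrarily close to one, so the discs through
  nearby points have to be deformations of f over radii close to 1, and the image of such a disc
  need not lie in one chart. Nor is f assumed injective or immersed; its graph is always embedded,
  which is why the neighbourhood is taken in a product with the plane. Over a square every overlap
  is a rectangle, where the Cousin problem is solved by explicit Cauchy integrals with a weight on
  the boundary; a Riemann map leads back to the disc. The linear part of a transition map does not
  become small when the fibre radius shrinks, and this is why it needs a frame of its own; the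
  nonlinear remainder is quadratic in the fibre radius and does become small. In the lower bound the
  vector (\<beta>/t) g'(0) is based at w and only close to X, so \<kappa> has to be controlled
  around (z, X) and not just at that point. Hyperbolicity supplies the radius that makes the Taylor
  error uniform over all discs.\<close>

no_notation fps_nth (infixl "$" 75)

section \<open>Bounds and parameter integrals for holomorphic functions\<close>

lemma schwarz_bound:
  assumes hol: "g holomorphic_on ball 0 r" and r: "0 < r" and g0: "g 0 = 0"
    and m: "\<And>x. x \<in> ball 0 r \<Longrightarrow> cmod (g x) \<le> m" and x: "x \<in> ball 0 r"
  shows "cmod (g x) \<le> m / r * cmod x"
proof (rule field_le_epsilon)
  fix e :: real assume e: "e > 0"
  have m0: "m \<ge> 0" using m[of 0] r g0 by simp
  \<comment> \<open>The Schwarz lemma asks for a strict bound by one, and m may vanish; the slack e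
    is positive and is let go to zero at the end.\<close>
  define m' where "m' = m + e"
  have m'0: "m' > 0" using m0 e by (simp add: m'_def)
  define h where "h = (\<lambda>y. g (of_real r * y) / of_real m')"
  have "norm (h (x / of_real r)) \<le> norm (x / of_real r)"
  proof (rule Schwarz_Lemma(1))
    show "h holomorphic_on ball 0 1"
      unfolding h_def using r m'0
      by (intro holomorphic_intros holomorphic_on_compose_gen[OF _ hol, unfolded o_def])
         (auto simp: norm_mult)
    show "h 0 = 0" by (simp add: h_def g0)
    show "norm (h z) < 1" if "norm z < 1" for z
    proof -
      have "of_real r * z \<in> ball 0 r" using that r by (simp add: norm_mult)
      from m[OF this] have "cmod (g (of_real r * z)) < m'" using e by (simp add: m'_def)
      thus ?thesis using m'0 by (simp add: h_def norm_divide)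
    qed
    show "norm (x / of_real r) < 1" using x r by (simp add: norm_divide)
  qed
  hence "cmod (g x) \<le> m' / r * cmod x"
    using r m'0 by (simp add: h_def norm_divide field_simps)
  also have "\<dots> = m / r * cmod x + e * (cmod x / r)" by (simp add: m'_def add_divide_distrib distrib_right)
  also have "\<dots> \<le> m / r * cmod x + e * 1"
    using x r e by (intro add_left_mono mult_left_mono) (auto simp: field_simps)
  finally show "cmod (g x) \<le> m / r * cmod x + e" by simp
qed

text \<open>Schwarz's lemma, applied to the increment, is preferred to a Cauchy estimate because it
  gives a Lipschitz bound with respect to the centre on the whole ball, with no loss of radius. The
  factor two comes from bounding the increment by twice the maximum.\<close>

lemma increment_bound:
  assumes hol: "g holomorphic_on ball a r" and r: "0 < r"
    and m: "\<And>x. x \<in> ball a r \<Longrightarrow> cmod (g x) \<le> m" and x: "x \<in> ball a r"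
  shows "cmod (g x - g a) \<le> 2 * m / r * cmod (x - a)"
proof -
  have "cmod ((\<lambda>y. g (a + y) - g a) (x - a)) \<le> 2 * m / r * cmod (x - a)"
  proof (rule schwarz_bound[OF _ r])
    show "(\<lambda>y. g (a + y) - g a) holomorphic_on ball 0 r"
      by (intro holomorphic_intros holomorphic_on_compose_gen[OF _ hol, unfolded o_def])
         (auto simp: dist_norm)
    show "cmod (g (a + y) - g a) \<le> 2 * m" if "y \<in> ball 0 r" for y
    proof -
      have "cmod (g (a + y)) \<le> m" "cmod (g a) \<le> m" using that r by (auto intro!: m simp: dist_norm)
      thus ?thesis using norm_triangle_ineq4[of "g (a+y)" "g a"] by linarith
    qed
    show "x - a \<in> ball 0 r" using x by (auto simp: dist_norm norm_minus_commute)
  qed simp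
  thus ?thesis by simp
qed

text \<open>The difference quotient at a extends holomorphically across a and is bounded by
  \<open>2 * m / r\<close>; a second use of \<open>increment_bound\<close> gives the quadratic
  remainder, hence the constant four.\<close>

lemma taylor1_bound:
  assumes hol: "g holomorphic_on ball a r" and r: "0 < r"
    and m: "\<And>x. x \<in> ball a r \<Longrightarrow> cmod (g x) \<le> m" and x: "x \<in> ball a r"
  shows "cmod (g x - g a - deriv g a * (x - a)) \<le> 4 * m / r\<^sup>2 * (cmod (x - a))\<^sup>2"
proof -
  define q where "q = (\<lambda>y. if y = a then deriv g a else (g y - g a) / (y - a))"
  have holq: "q holomorphic_on ball a r"
    unfolding q_def by (rule pole_lemma_open[OF hol open_ball])
  have ga: "(g has_field_derivative deriv g a) (at a)"
    using hol r by (intro holomorphic_derivI[OF hol]) auto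
  have qb: "cmod (q y) \<le> 2 * m / r" if "y \<in> ball a r" for y
  proof (cases "y = a")
    case False
    thus ?thesis using increment_bound[OF hol r m that]
      by (simp add: q_def norm_divide field_simps)
  next
    case True
    have "(\<lambda>y. (g y - g a) / (y - a)) \<midarrow>a\<rightarrow> deriv g a"
      using ga by (simp add: has_field_derivative_iff)
    hence "((\<lambda>y. cmod ((g y - g a) / (y - a))) \<longlongrightarrow> cmod (deriv g a)) (at a)"
      by (intro tendsto_norm)
    moreover have "\<forall>\<^sub>F y in at a. cmod ((g y - g a) / (y - a)) \<le> 2 * m / r"
    proof -
      have "\<forall>\<^sub>F y in at a. y \<in> ball a r \<and> y \<noteq> a"
        using r by (intro eventually_conj eventually_at_in_open' eventually_neq_at_within) auto
      thus ?thesis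
      proof eventually_elim
        case (elim y)
        thus ?case using increment_bound[OF hol r m, of y]
          by (simp add: norm_divide field_simps)
      qed
    qed
    ultimately have "cmod (deriv g a) \<le> 2 * m / r"
      by (intro tendsto_upperbound[of _ _ "at a"]) auto
    thus ?thesis using True by (simp add: q_def)
  qed
  have "cmod (q x - q a) \<le> 2 * (2 * m / r) / r * cmod (x - a)"
    by (rule increment_bound[OF holq r qb x])
  hence "cmod (q x - q a) * cmod (x - a) \<le> 4 * m / r\<^sup>2 * cmod (x - a) * cmod (x - a)"
    by (intro mult_right_mono) (auto simp: power2_eq_square)
  moreover have "(q x - q a) * (x - a) = g x - g a - deriv g a * (x - a)"
    by (cases "x = a") (auto simp: q_def field_simps)
  ultimately show ?thesis by (simp add: norm_mult[symmetric] power2_eq_square mult.assoc)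
qed

lemma quadratic_remainder_imp_derivative:
  fixes g :: "complex \<Rightarrow> complex"
  assumes r: "0 < r" and b: "\<And>x. x \<in> ball a r \<Longrightarrow> cmod (g x - g a - D * (x - a)) \<le> C * (cmod (x - a))\<^sup>2"
  shows "(g has_field_derivative D) (at a)"
proof -
  have "((\<lambda>x. (g x - g a) / (x - a) - D) \<longlongrightarrow> 0) (at a)"
  proof (rule Lim_null_comparison)
    show "\<forall>\<^sub>F x in at a. norm ((g x - g a) / (x - a) - D) \<le> C * cmod (x - a)"
    proof -
      have "\<forall>\<^sub>F y in at a. y \<in> ball a r \<and> y \<noteq> a"
        using r by (intro eventually_conj eventually_at_in_open' eventually_neq_at_within) auto
      thus ?thesis
      proof eventually_elim
        case (elim y)
        have "(g y - g a) / (y - a) - D = (g y - g a - D * (y - a)) / (y - a)"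
          using elim by (simp add: field_simps)
        thus ?case using b[of y] elim by (simp add: norm_divide divide_simps power2_eq_square)
      qed
    qed
    show "((\<lambda>x. C * cmod (x - a)) \<longlongrightarrow> 0) (at a)"
      by (rule tendsto_eq_intros refl | simp)+
  qed
  thus ?thesis by (simp add: has_field_derivative_iff LIM_zero_iff)
qed

text \<open>The mixed second difference is the increment in y of an increment in x, so
  \<open>increment_bound\<close> applies twice. On the diagonal the result is quadratic, which is
  what lets the separate expansions add up.\<close>

lemma mixed_difference_bound:
  assumes r: "0 < r"
    and h1: "\<And>y. y \<in> ball b r \<Longrightarrow> (\<lambda>x. H x y) holomorphic_on ball a r"
    and h2: "\<And>x. x \<in> ball a r \<Longrightarrow> H x holomorphic_on ball b r"
    and m: "\<And>x y. x \<in> ball a r \<Longrightarrow> y \<in> ball b r \<Longrightarrow> cmod (H x y) \<le> m"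
    and x: "x \<in> ball a r" and y: "y \<in> ball b r"
  shows "cmod (H x y - H x b - H a y + H a b) \<le> 4 * m / r\<^sup>2 * cmod (x - a) * cmod (y - b)"
proof -
  have 1: "cmod (H x y - H a y) \<le> 2 * m / r * cmod (x - a)" if "y \<in> ball b r" for y
    using increment_bound[OF h1[OF that] r m[OF _ that] x] .
  have "cmod ((\<lambda>y. H x y - H a y) y - (\<lambda>y. H x y - H a y) b)
      \<le> 2 * (2 * m / r * cmod (x - a)) / r * cmod (y - b)"
    by (rule increment_bound[OF _ r 1 y]) (intro holomorphic_intros h2 x, use r in auto)
  thus ?thesis by (simp add: power2_eq_square algebra_simps)
qed

text \<open>Osgood's lemma in a two-variable diagonal form. The expansion of H(x, x) is the sum of
  the expansions in each variable and of the mixed difference, all with quadratic errors; joint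
  continuity supplies the local bound m.\<close>

lemma diagonal_derivative:
  assumes T: "open T" and a: "a \<in> T"
    and h1: "\<And>y. y \<in> T \<Longrightarrow> (\<lambda>x. H x y) holomorphic_on T"
    and h2: "\<And>x. x \<in> T \<Longrightarrow> H x holomorphic_on T"
    and cont: "continuous_on (T \<times> T) (\<lambda>(x, y). H x y)"
  shows "((\<lambda>x. H x x) has_field_derivative (deriv (\<lambda>x. H x a) a + deriv (H a) a)) (at a)"
proof -
    obtain r where r: "0 < r" and rT: "cball a r \<subseteq> T" using T a open_contains_cball by blast
    have "compact ((\<lambda>(x, y). H x y) ` (cball a r \<times> cball a r))"
      by (intro compact_continuous_image compact_Times compact_cball
            continuous_on_subset[OF cont]) (use rT in auto)
    from compact_imp_bounded[OF this] obtain m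
      where m: "\<And>x y. x \<in> cball a r \<Longrightarrow> y \<in> cball a r \<Longrightarrow> cmod (H x y) \<le> m"
      by (force simp: bounded_iff)
    have bT: "ball a r \<subseteq> T" using rT by force
    have aT: "a \<in> ball a r" using r by simp
    have h1': "(\<lambda>x. H x y) holomorphic_on ball a r" if "y \<in> ball a r" for y
      by (rule holomorphic_on_subset[OF h1]) (use that bT in auto)
    have h2': "H x holomorphic_on ball a r" if "x \<in> ball a r" for x
      by (rule holomorphic_on_subset[OF h2]) (use that bT in auto)
    have m': "cmod (H x y) \<le> m" if "x \<in> ball a r" "y \<in> ball a r" for x y
      using m that by auto
    let ?D1 = "deriv (\<lambda>x. H x a) a" and ?D2 = "deriv (H a) a"
    show ?thesis
    proof (rule quadratic_remainder_imp_derivative[OF r])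
      fix x assume x: "x \<in> ball a r"
      have 1: "cmod (H x x - H x a - H a x + H a a) \<le> 4 * m / r\<^sup>2 * cmod (x - a) * cmod (x - a)"
        by (rule mixed_difference_bound[OF r h1' h2' m' x x])
      have 2: "cmod (H x a - H a a - ?D1 * (x - a)) \<le> 4 * m / r\<^sup>2 * (cmod (x - a))\<^sup>2"
        by (rule taylor1_bound[OF h1'[OF aT] r m'[OF _ aT] x])
      have 3: "cmod (H a x - H a a - ?D2 * (x - a)) \<le> 4 * m / r\<^sup>2 * (cmod (x - a))\<^sup>2"
        by (rule taylor1_bound[OF h2'[OF aT] r m'[OF aT] x])
      have "H x x - H a a - (?D1 + ?D2) * (x - a) =
        (H x x - H x a - H a x + H a a) + (H x a - H a a - ?D1 * (x - a)) + (H a x - H a a - ?D2 * (x - a))"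
        by (simp add: algebra_simps)
      also have "cmod \<dots> \<le> 4 * m / r\<^sup>2 * cmod (x - a) * cmod (x - a) + 4 * m / r\<^sup>2 * (cmod (x - a))\<^sup>2
          + 4 * m / r\<^sup>2 * (cmod (x - a))\<^sup>2"
        by (intro order.trans[OF norm_triangle_ineq] add_mono 1 2 3)
      also have "\<dots> = 12 * m / r\<^sup>2 * (cmod (x - a))\<^sup>2" by (simp add: power2_eq_square)
      finally show "cmod (H x x - H a a - (?D1 + ?D2) * (x - a)) \<le> 12 * m / r\<^sup>2 * (cmod (x - a))\<^sup>2" .
    qed
qed

lemma osgood_diagonal:
  assumes T: "open T"
    and h1: "\<And>y. y \<in> T \<Longrightarrow> (\<lambda>x. H x y) holomorphic_on T"
    and h2: "\<And>x. x \<in> T \<Longrightarrow> H x holomorphic_on T"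
    and cont: "continuous_on (T \<times> T) (\<lambda>(x, y). H x y)"
  shows "(\<lambda>x. H x x) holomorphic_on T"
  unfolding holomorphic_on_open[OF T]
proof
  fix a assume "a \<in> T"
  from diagonal_derivative[OF T this h1 h2 cont] show "\<exists>D. ((\<lambda>x. H x x) has_field_derivative D) (at a)"
    by (rule exI)
qed

text \<open>Taylor remainders are quadratic uniformly in t because H is bounded on a compact
  product, so they integrate to a quadratic remainder.\<close>

lemma holomorphic_parameter_integral:
  fixes H :: "real \<Rightarrow> complex \<Rightarrow> complex"
  assumes T: "open T" and cont: "continuous_on ({0..1} \<times> T) (\<lambda>(t, x). H t x)"
    and hol: "\<And>t. t \<in> {0..1} \<Longrightarrow> H t holomorphic_on T"
  shows "(\<lambda>x. integral {0..1} (\<lambda>t. H t x)) holomorphic_on T"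
proof -
  have ci: "continuous_on {0..1} (\<lambda>t. H t x)" if "x \<in> T" for x
  proof -
    have "continuous_on {0..1} (\<lambda>t. (\<lambda>(t, x). H t x) (t, x))"
      by (rule continuous_on_compose2[OF cont], intro continuous_intros) (use that in auto)
    thus ?thesis by simp
  qed
  have int: "(\<lambda>t. H t x) integrable_on {0..1}" if "x \<in> T" for x
    by (intro integrable_continuous_real ci that)
  have "\<exists>D. ((\<lambda>x. integral {0..1} (\<lambda>t. H t x)) has_field_derivative D) (at a)" if a: "a \<in> T" for a
  proof -
    obtain r where r: "0 < r" and rT: "cball a r \<subseteq> T" using T a open_contains_cball by blast
    have "compact ((\<lambda>(t, x). H t x) ` ({0..1} \<times> cball a r))"
      by (intro compact_continuous_image compact_Times compact_cball compact_Icc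
            continuous_on_subset[OF cont]) (use rT in auto)
    from compact_imp_bounded[OF this] obtain m
      where m: "\<And>t x. t \<in> {0..1} \<Longrightarrow> x \<in> cball a r \<Longrightarrow> cmod (H t x) \<le> m"
      by (force simp: bounded_iff)
    have m0: "m \<ge> 0" using order.trans[OF norm_ge_zero m[of 0 a]] r by simp
    have bT: "ball a r \<subseteq> T" using rT by force
    have tay: "cmod (H t x - H t a - deriv (H t) a * (x - a)) \<le> 4 * m / r\<^sup>2 * (cmod (x - a))\<^sup>2"
      if "t \<in> {0..1}" "x \<in> ball a r" for t x
      by (rule taylor1_bound[OF _ r _ that(2)])
         (use that m bT in \<open>auto intro!: holomorphic_on_subset[OF hol]\<close>)
    \<comment> \<open>The derivative must be integrable in t before its integral can serve as a
      derivative. Along these steps the difference quotients converge to it uniformly in t; the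
      summand 2 keeps each step strictly inside the ball.\<close>
    define \<epsilon> where "\<epsilon> = (\<lambda>k. r / (real k + 2))"
    have \<epsilon>: "0 < \<epsilon> k" "\<epsilon> k < r" for k
      using r by (auto simp: \<epsilon>_def field_simps intro!: add_pos_nonneg)
    define q where "q = (\<lambda>k t. (H t (a + of_real (\<epsilon> k)) - H t a) / of_real (\<epsilon> k))"
    have ul: "uniform_limit {0..1} q (\<lambda>t. deriv (H t) a) sequentially"
    proof (rule uniform_limitI)
      fix e :: real assume e: "e > 0"
      have "((\<lambda>k. 4 * m / r\<^sup>2 * \<epsilon> k) \<longlongrightarrow> 0) sequentially"
        unfolding \<epsilon>_def by real_asymp
      hence "\<forall>\<^sub>F k in sequentially. 4 * m / r\<^sup>2 * \<epsilon> k < e"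
        using e by (rule order_tendstoD)
      thus "\<forall>\<^sub>F k in sequentially. \<forall>t\<in>{0..1}. dist (q k t) (deriv (H t) a) < e"
      proof eventually_elim
        case (elim k)
        show ?case
        proof
          fix t :: real assume t: "t \<in> {0..1}"
          have "q k t - deriv (H t) a = (H t (a + of_real (\<epsilon> k)) - H t a - deriv (H t) a * (of_real (\<epsilon> k))) / of_real (\<epsilon> k)"
            using \<epsilon>(1)[of k] by (simp add: q_def field_simps)
          also have "cmod \<dots> \<le> 4 * m / r\<^sup>2 * \<epsilon> k"
          proof -
            have "cmod (H t (a + of_real (\<epsilon> k)) - H t a - deriv (H t) a * (of_real (\<epsilon> k))) \<le> 4 * m / r\<^sup>2 * (\<epsilon> k)\<^sup>2"
              using tay[OF t, of "a + of_real (\<epsilon> k)"] \<epsilon>[of k] by (simp add: dist_norm)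
            thus ?thesis unfolding norm_divide using \<epsilon>(1)[of k]
              by (subst pos_divide_le_eq) (auto simp: power2_eq_square mult.assoc)
          qed
          also note elim
          finally show "dist (q k t) (deriv (H t) a) < e" by (simp add: dist_norm)
        qed
      qed
    qed
    have "continuous_on {0..1} (\<lambda>t. deriv (H t) a)"
    proof (rule uniform_limit_theorem[OF _ ul])
      have "continuous_on {0..1} (q k)" for k
      proof -
        have "a + of_real (\<epsilon> k) \<in> T" using \<epsilon>[of k] by (intro subsetD[OF rT]) (simp add: dist_norm)
        thus ?thesis unfolding q_def using \<epsilon>(1)[of k] a by (intro continuous_intros ci) auto
      qed
      thus "\<forall>\<^sub>F k in sequentially. continuous_on {0..1} (q k)" by simp
    qed simp
    hence intD: "(\<lambda>t. deriv (H t) a) integrable_on {0..1}" by (rule integrable_continuous_real)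
    let ?D = "integral {0..1} (\<lambda>t. deriv (H t) a)"
    have "((\<lambda>x. integral {0..1} (\<lambda>t. H t x)) has_field_derivative ?D) (at a)"
    proof (rule quadratic_remainder_imp_derivative[OF r])
      fix x assume x: "x \<in> ball a r"
      hence xT: "x \<in> T" using bT by auto
      have "integral {0..1} (\<lambda>t. H t x) - integral {0..1} (\<lambda>t. H t a) - ?D * (x - a) =
         integral {0..1} (\<lambda>t. H t x - H t a - deriv (H t) a * (x - a))"
        by (simp add: integral_diff integrable_diff integrable_on_mult_left int xT a intD)
      also have "cmod \<dots> \<le> integral {0..1} (\<lambda>t::real. 4 * m / r\<^sup>2 * (cmod (x - a))\<^sup>2)"
        by (intro integral_norm_bound_integral tay x integrable_diff integrable_on_mult_left int xT a intD
              integrable_const_ivl)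
      finally show "cmod (integral {0..1} (\<lambda>t. H t x) - integral {0..1} (\<lambda>t. H t a) - ?D * (x - a))
         \<le> 4 * m / r\<^sup>2 * (cmod (x - a))\<^sup>2" by simp
    qed
    thus ?thesis by blast
  qed
  thus ?thesis using T by (auto simp: holomorphic_on_open)
qed

section \<open>Vector-valued and jointly holomorphic functions\<close>

lemma norm_smult_vec: "norm (c *s (x :: complex ^ 'n)) = cmod c * norm x"
  by (simp add: norm_vec_def norm_mult L2_set_right_distrib)

lemma norm_vec_le_card:
  fixes x :: "complex ^ 'n"
  assumes "\<And>i. cmod (x $ i) \<le> c"
  shows "norm x \<le> real CARD('n) * c"
proof -
  have "norm x \<le> (\<Sum>i\<in>UNIV. cmod (x $ i))" by (simp add: norm_vec_def L2_set_le_sum)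
  also have "\<dots> \<le> real CARD('n) * c" using sum_bounded_above[of UNIV "\<lambda>i. cmod (x $ i)" c] assms by simp
  finally show ?thesis .
qed

definition vholo :: "complex set \<Rightarrow> (complex \<Rightarrow> complex ^ 'n) \<Rightarrow> bool" where
  "vholo T \<sigma> \<longleftrightarrow> (\<forall>i. (\<lambda>\<tau>. \<sigma> \<tau> $ i) holomorphic_on T)"

lemma vholo_continuous: "vholo T \<sigma> \<Longrightarrow> continuous_on T \<sigma>"
  unfolding vholo_def
  using continuous_on_vec_lambda[of T "\<lambda>i \<tau>. \<sigma> \<tau> $ i"] holomorphic_on_imp_continuous_on by simp

lemma vholo_const [intro!]: "vholo T (\<lambda>\<tau>. c)"
  and vholo_add [intro]: "vholo T \<sigma> \<Longrightarrow> vholo T \<rho> \<Longrightarrow> vholo T (\<lambda>\<tau>. \<sigma> \<tau> + \<rho> \<tau>)"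
  and vholo_diff [intro]: "vholo T \<sigma> \<Longrightarrow> vholo T \<rho> \<Longrightarrow> vholo T (\<lambda>\<tau>. \<sigma> \<tau> - \<rho> \<tau>)"
  and vholo_minus [intro]: "vholo T \<sigma> \<Longrightarrow> vholo T (\<lambda>\<tau>. - \<sigma> \<tau>)"
  and vholo_smult [intro]: "g holomorphic_on T \<Longrightarrow> vholo T \<sigma> \<Longrightarrow> vholo T (\<lambda>\<tau>. g \<tau> *s \<sigma> \<tau>)"
  by (auto simp: vholo_def intro!: holomorphic_intros)

lemma vholo_subset: "vholo T \<sigma> \<Longrightarrow> T' \<subseteq> T \<Longrightarrow> vholo T' \<sigma>"
  by (auto simp: vholo_def intro: holomorphic_on_subset)

lemma vholo_cong: "(\<And>x. x \<in> T \<Longrightarrow> \<sigma> x = \<rho> x) \<Longrightarrow> vholo T \<sigma> \<longleftrightarrow> vholo T \<rho>"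
  unfolding vholo_def by (intro all_cong1 holomorphic_cong) auto

lemma vholo_compose: "vholo T \<sigma> \<Longrightarrow> g holomorphic_on T' \<Longrightarrow> g ` T' \<subseteq> T \<Longrightarrow> vholo T' (\<lambda>\<tau>. \<sigma> (g \<tau>))"
  unfolding vholo_def by (auto intro: holomorphic_on_compose_gen[unfolded o_def])

lemma vholo_local:
  assumes "\<And>x. x \<in> T \<Longrightarrow> \<exists>T'. open T' \<and> x \<in> T' \<and> vholo T' \<sigma>"
  shows "vholo T \<sigma>"
  unfolding vholo_def holomorphic_on_def
proof (intro allI ballI)
  fix i x assume "x \<in> T"
  then obtain T' where "open T'" "x \<in> T'" "vholo T' \<sigma>" using assms by blast
  thus "(\<lambda>\<tau>. \<sigma> \<tau> $ i) field_differentiable at x within T"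
    by (auto simp: vholo_def dest!: spec[of _ i]
         intro: holomorphic_on_imp_differentiable_at field_differentiable_at_within)
qed

lemma vholo_uniform_limit:
  assumes T: "open T" and h: "\<And>k. vholo T (u k)"
    and lim: "\<And>x. x \<in> T \<Longrightarrow> \<exists>d>0. cball x d \<subseteq> T \<and> uniform_limit (cball x d) u l sequentially"
  shows "vholo T l"
  unfolding vholo_def
proof
  fix i
  show "(\<lambda>\<tau>. l \<tau> $ i) holomorphic_on T"
  proof (rule holomorphic_uniform_sequence[OF T, of "\<lambda>k \<tau>. u k \<tau> $ i"])
    show "(\<lambda>\<tau>. u k \<tau> $ i) holomorphic_on T" for k using h by (auto simp: vholo_def)
    fix x assume "x \<in> T"
    then obtain d where d: "d > 0" "cball x d \<subseteq> T" "uniform_limit (cball x d) u l sequentially"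
      using lim by blast
    have "uniform_limit (cball x d) (\<lambda>k \<tau>. u k \<tau> $ i) (\<lambda>\<tau>. l \<tau> $ i) sequentially"
      using bounded_linear.uniform_limit[OF bounded_linear_vec_nth d(3)] .
    with d show "\<exists>d>0. cball x d \<subseteq> T \<and> uniform_limit (cball x d) (\<lambda>k \<tau>. u k \<tau> $ i) (\<lambda>\<tau>. l \<tau> $ i) sequentially"
      by blast
  qed
qed

text \<open>Joint holomorphy in the base and fibre variables is expressed through holomorphic curves, so
  that it composes without any multivariate calculus and also makes sense on sets that are
  not open.\<close>

definition jholo :: "(complex \<times> (complex ^ 'n)) set \<Rightarrow> (complex \<times> (complex ^ 'n) \<Rightarrow> complex ^ 'm) \<Rightarrow> bool" where
  "jholo W u \<longleftrightarrow> continuous_on W u \<and>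
     (\<forall>T g \<sigma>. open T \<longrightarrow> g holomorphic_on T \<longrightarrow> vholo T \<sigma> \<longrightarrow> (\<forall>\<tau>\<in>T. (g \<tau>, \<sigma> \<tau>) \<in> W)
        \<longrightarrow> vholo T (\<lambda>\<tau>. u (g \<tau>, \<sigma> \<tau>)))"

lemma jholo_continuous: "jholo W u \<Longrightarrow> continuous_on W u"
  by (simp add: jholo_def)

lemma jholo_curve:
  "jholo W u \<Longrightarrow> open T \<Longrightarrow> g holomorphic_on T \<Longrightarrow> vholo T \<sigma> \<Longrightarrow> (\<And>\<tau>. \<tau> \<in> T \<Longrightarrow> (g \<tau>, \<sigma> \<tau>) \<in> W)
    \<Longrightarrow> vholo T (\<lambda>\<tau>. u (g \<tau>, \<sigma> \<tau>))"
  by (simp add: jholo_def)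

lemma jholo_subset: "jholo W u \<Longrightarrow> W' \<subseteq> W \<Longrightarrow> jholo W' u"
  unfolding jholo_def by (blast intro: continuous_on_subset)

lemma jholo_cong:
  assumes "\<And>p. p \<in> W \<Longrightarrow> u p = v p" and "jholo W u" shows "jholo W v"
proof -
  have "continuous_on W v" using assms by (auto simp: jholo_def cong: continuous_on_cong)
  moreover have "vholo T (\<lambda>\<tau>. v (g \<tau>, \<sigma> \<tau>))"
    if "open T" "g holomorphic_on T" "vholo T \<sigma>" "\<forall>\<tau>\<in>T. (g \<tau>, \<sigma> \<tau>) \<in> W" for T g \<sigma>
  proof -
    have "vholo T (\<lambda>\<tau>. u (g \<tau>, \<sigma> \<tau>))" using jholo_curve[OF assms(2)] that by blast
    thus ?thesis using vholo_cong[of T "\<lambda>\<tau>. u (g \<tau>, \<sigma> \<tau>)" "\<lambda>\<tau>. v (g \<tau>, \<sigma> \<tau>)"] assms(1) that by auto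
  qed
  ultimately show ?thesis by (simp add: jholo_def)
qed

lemma jholo_const: "jholo W (\<lambda>p. c)"
  and jholo_snd: "jholo W snd"
  and jholo_add: "jholo W u \<Longrightarrow> jholo W v \<Longrightarrow> jholo W (\<lambda>p. u p + v p)"
  and jholo_diff: "jholo W u \<Longrightarrow> jholo W v \<Longrightarrow> jholo W (\<lambda>p. u p - v p)"
  and jholo_minus: "jholo W u \<Longrightarrow> jholo W (\<lambda>p. - u p)"
  by (auto simp: jholo_def intro!: continuous_intros)

lemma jholo_compose:
  assumes u: "jholo W' u" and v: "jholo W v" and W: "\<And>p. p \<in> W \<Longrightarrow> (fst p, v p) \<in> W'"
  shows "jholo W (\<lambda>p. u (fst p, v p))"
proof -
  have "continuous_on W (\<lambda>p. u (fst p, v p))"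
    by (rule continuous_on_compose2[OF jholo_continuous[OF u]])
       (use W in \<open>auto intro!: continuous_intros jholo_continuous[OF v]\<close>)
  moreover have "vholo T (\<lambda>\<tau>. u (g \<tau>, v (g \<tau>, \<sigma> \<tau>)))"
    if "open T" "g holomorphic_on T" "vholo T \<sigma>" "\<forall>\<tau>\<in>T. (g \<tau>, \<sigma> \<tau>) \<in> W" for T g \<sigma>
  proof (rule jholo_curve[OF u that(1,2)])
    show "vholo T (\<lambda>\<tau>. v (g \<tau>, \<sigma> \<tau>))" by (rule jholo_curve[OF v that(1-3)]) (use that in blast)
    show "(g \<tau>, v (g \<tau>, \<sigma> \<tau>)) \<in> W'" if "\<tau> \<in> T" for \<tau>
      using W[of "(g \<tau>, \<sigma> \<tau>)"] that \<open>\<forall>\<tau>\<in>T. (g \<tau>, \<sigma> \<tau>) \<in> W\<close> by simp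
  qed
  ultimately show ?thesis by (simp add: jholo_def)
qed

text \<open>A holomorphic curve (g, \<sigma>) is the diagonal of the two-variable function
  \<open>u (g x, \<sigma> y)\<close>, so Osgood's lemma reduces joint holomorphy to the base
  direction and to curves inside a fibre.\<close>

lemma jholo_osgood:
  fixes u :: "complex \<times> (complex ^ 'n) \<Rightarrow> complex ^ 'm"
  assumes cont: "continuous_on (\<Omega> \<times> B) u"
    and h1: "\<And>s. s \<in> B \<Longrightarrow> vholo \<Omega> (\<lambda>\<zeta>. u (\<zeta>, s))"
    and h2: "\<And>\<zeta> T \<sigma>. \<zeta> \<in> \<Omega> \<Longrightarrow> open T \<Longrightarrow> vholo T \<sigma> \<Longrightarrow> \<sigma> ` T \<subseteq> B \<Longrightarrow> vholo T (\<lambda>\<tau>. u (\<zeta>, \<sigma> \<tau>))"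
  shows "jholo (\<Omega> \<times> B) u"
  unfolding jholo_def
proof (intro conjI allI impI)
  show "continuous_on (\<Omega> \<times> B) u" by fact
  fix T g and \<sigma> :: "complex \<Rightarrow> complex ^ 'n"
  assume T: "open T" and g: "g holomorphic_on T" and \<sigma>: "vholo T \<sigma>" and W: "\<forall>\<tau>\<in>T. (g \<tau>, \<sigma> \<tau>) \<in> \<Omega> \<times> B"
  show "vholo T (\<lambda>\<tau>. u (g \<tau>, \<sigma> \<tau>))"
    unfolding vholo_def
  proof
    fix i
    show "(\<lambda>\<tau>. u (g \<tau>, \<sigma> \<tau>) $ i) holomorphic_on T"
    proof (rule osgood_diagonal[OF T, of "\<lambda>x y. u (g x, \<sigma> y) $ i"])
      show "(\<lambda>x. u (g x, \<sigma> y) $ i) holomorphic_on T" if "y \<in> T" for y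
        using vholo_compose[OF h1 g, of "\<sigma> y"] W that by (auto simp: vholo_def)
      show "(\<lambda>y. u (g x, \<sigma> y) $ i) holomorphic_on T" if "x \<in> T" for x
        using h2[of "g x", OF _ T \<sigma>] W that by (auto simp: vholo_def)
      have "continuous_on (T \<times> T) (\<lambda>p. u (g (fst p), \<sigma> (snd p)))"
        by (rule continuous_on_compose2[OF cont])
           (use W in \<open>auto intro!: continuous_intros continuous_on_compose2[OF holomorphic_on_imp_continuous_on[OF g]]
               continuous_on_compose2[OF vholo_continuous[OF \<sigma>]]\<close>)
      thus "continuous_on (T \<times> T) (\<lambda>(x, y). u (g x, \<sigma> y) $ i)"
        by (auto simp: case_prod_unfold intro!: bounded_linear.continuous_on[OF bounded_linear_vec_nth])
    qed
  qed
qed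

lemma jholo_uniform_limit:
  fixes u :: "nat \<Rightarrow> complex \<times> (complex ^ 'n) \<Rightarrow> complex ^ 'm"
  assumes h: "\<And>k. jholo W (u k)" and lim: "uniform_limit W u l sequentially"
  shows "jholo W l"
  unfolding jholo_def
proof (intro conjI allI impI)
  show "continuous_on W l"
    by (rule uniform_limit_theorem[OF _ lim]) (auto intro!: always_eventually jholo_continuous h)
  fix T g and \<sigma> :: "complex \<Rightarrow> complex ^ 'n"
  assume T: "open T" and g: "g holomorphic_on T" and \<sigma>: "vholo T \<sigma>" and W: "\<forall>\<tau>\<in>T. (g \<tau>, \<sigma> \<tau>) \<in> W"
  show "vholo T (\<lambda>\<tau>. l (g \<tau>, \<sigma> \<tau>))"
  proof (rule vholo_uniform_limit[OF T, of "\<lambda>k \<tau>. u k (g \<tau>, \<sigma> \<tau>)"])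
    show "vholo T (\<lambda>\<tau>. u k (g \<tau>, \<sigma> \<tau>))" for k using jholo_curve[OF h T g \<sigma>] W by blast
    fix x assume "x \<in> T"
    then obtain d where d: "d > 0" "cball x d \<subseteq> T" using T open_contains_cball by blast
    have "uniform_limit (cball x d) (\<lambda>k \<tau>. u k (g \<tau>, \<sigma> \<tau>)) (\<lambda>\<tau>. l (g \<tau>, \<sigma> \<tau>)) sequentially"
      using lim d W unfolding uniform_limit_iff by (fastforce elim!: eventually_mono)
    with d show "\<exists>d>0. cball x d \<subseteq> T \<and> uniform_limit (cball x d) (\<lambda>k \<tau>. u k (g \<tau>, \<sigma> \<tau>)) (\<lambda>\<tau>. l (g \<tau>, \<sigma> \<tau>)) sequentially"
      by blast
  qed
qed

lemma vholo_affine: "vholo T (\<lambda>\<tau>. a + \<tau> *s b)"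
  by (intro vholo_add vholo_const vholo_smult holomorphic_intros)

text \<open>The estimate is fibrewise, so that it also applies to slices over boundary points of a
  rectangle. Increments are taken along the complex line through s' and s; the factor
  \<open>CARD('m)\<close> passes from components to the norm.\<close>

lemma jholo_lipschitz:
  fixes u :: "complex \<times> (complex ^ 'n) \<Rightarrow> complex ^ 'm"
  assumes u: "jholo W u" and W: "{\<zeta>} \<times> ball 0 R \<subseteq> W"
    and m: "\<And>s. s \<in> ball 0 R \<Longrightarrow> norm (u (\<zeta>, s)) \<le> m"
    and s: "s \<in> ball 0 (R/2)" and s': "s' \<in> ball 0 (R/2)"
  shows "norm (u (\<zeta>, s) - u (\<zeta>, s')) \<le> real CARD('m) * (4 * m / R) * norm (s - s')"
proof (cases "s = s'")
  case False
  have R: "R > 0" using s norm_ge_zero[of s] by (simp del: norm_ge_zero)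
  have m0: "m \<ge> 0" using order.trans[OF norm_ge_zero m[of 0]] R by simp
  define l where "l = norm (s - s')"
  have l: "l > 0" using False by (simp add: l_def)
  define d where "d = of_real (1 / l) *s (s - s')"
  have d: "norm d = 1" unfolding d_def norm_smult_vec using l by (simp add: l_def norm_divide)
  \<comment> \<open>On the line, the disc of radius R/2 about s' stays in the ball of radius R.
    Points at least R/2 apart need only the trivial bound 2m.\<close>
  have "cmod ((u (\<zeta>, s) - u (\<zeta>, s')) $ i) \<le> 4 * m / R * l" for i
  proof (cases "l < R / 2")
    case True
    define g where "g = (\<lambda>\<tau>. u (\<zeta>, s' + \<tau> *s d) $ i)"
    have inW: "s' + \<tau> *s d \<in> ball 0 R" if "\<tau> \<in> ball 0 (R/2)" for \<tau>
      using norm_triangle_ineq[of s' "\<tau> *s d"] s' that d by (simp add: norm_smult_vec)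
    have "cmod (g (of_real l) - g 0) \<le> 2 * m / (R / 2) * cmod (of_real l - 0)"
    proof (rule increment_bound)
      have "vholo (ball 0 (R/2)) (\<lambda>\<tau>. u (\<zeta>, s' + \<tau> *s d))"
        by (rule jholo_curve[OF u open_ball _ vholo_affine]) (use W inW in \<open>auto\<close>)
      thus "g holomorphic_on ball 0 (R/2)" by (simp add: vholo_def g_def)
      show "cmod (g x) \<le> m" if "x \<in> ball 0 (R/2)" for x
        using order.trans[OF Finite_Cartesian_Product.norm_nth_le m[OF inW[OF that]]] by (simp add: g_def)
    qed (use R True l in auto)
    moreover have "s' + of_real l *s d = s" using l by (simp add: d_def vector_smult_assoc flip: of_real_mult)
    ultimately show ?thesis using l by (simp add: g_def)
  next
    case False
    have "cmod ((u (\<zeta>, s) - u (\<zeta>, s')) $ i) \<le> norm (u (\<zeta>, s) - u (\<zeta>, s'))" by (rule Finite_Cartesian_Product.norm_nth_le)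
    also have "\<dots> \<le> 2 * m" using m[of s] m[of s'] s s' R norm_triangle_ineq4[of "u (\<zeta>, s)" "u (\<zeta>, s')"]
      by (auto simp: mem_ball_0)
    also have "\<dots> \<le> 4 * m / R * l"
    proof -
      have "R / 2 \<le> l" using False by simp
      hence "4 * m / R * (R / 2) \<le> 4 * m / R * l" using m0 R by (intro mult_left_mono) auto
      thus ?thesis using R by simp
    qed
    finally show ?thesis .
  qed
  from norm_vec_le_card[OF this] show ?thesis by (simp add: l_def mult.assoc)
qed simp

section \<open>The linear part of a family along the zero section\<close>

definition jmat :: "(complex \<times> (complex ^ 'n) \<Rightarrow> complex ^ 'm) \<Rightarrow> complex \<Rightarrow> complex ^ 'n ^ 'm" where
  "jmat u \<zeta> = (\<chi> i j. deriv (\<lambda>\<tau>. u (\<zeta>, \<tau> *s axis j 1) $ i) 0)"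

text \<open>The directional derivative L at the zero section is homogeneous by the chain rule and
  additive by \<open>diagonal_derivative\<close>, hence equal to multiplication by
  \<open>jmat\<close>. The estimate is then the one-variable Taylor bound on the line through
  s.\<close>

lemma jholo_linearization:
  fixes u :: "complex \<times> (complex ^ 'n) \<Rightarrow> complex ^ 'm"
  assumes u: "jholo W u" and W: "{\<zeta>} \<times> ball 0 R \<subseteq> W"
    and m: "\<And>s. s \<in> ball 0 R \<Longrightarrow> norm (u (\<zeta>, s)) \<le> m"
    and s: "s \<in> ball 0 R"
  shows "norm (u (\<zeta>, s) - u (\<zeta>, 0) - jmat u \<zeta> *v s) \<le> real CARD('m) * (4 * m / R\<^sup>2) * (norm s)\<^sup>2"
proof -
  have R: "R > 0" using s norm_ge_zero[of s] by (simp del: norm_ge_zero)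
  have line: "vholo (ball 0 r) (\<lambda>\<tau>. u (\<zeta>, a + \<tau> *s b))"
    if "norm a + r * norm b \<le> R" "r > 0" "a \<in> ball 0 R" for a b r
  proof (rule jholo_curve[OF u open_ball _ vholo_affine])
    fix \<tau> assume \<tau>: "\<tau> \<in> ball (0::complex) r"
    have "norm (a + \<tau> *s b) < R"
    proof (cases "b = 0")
      case False
      have "norm (a + \<tau> *s b) \<le> norm a + cmod \<tau> * norm b" by (metis norm_smult_vec norm_triangle_ineq)
      also have "\<dots> < norm a + r * norm b" using \<tau> False by simp
      finally show ?thesis using that by simp
    qed (use that in simp)
    thus "(\<zeta>, a + \<tau> *s b) \<in> W" using W by auto
  qed auto
  define L where "L = (\<lambda>a. \<chi> i. deriv (\<lambda>\<tau>. u (\<zeta>, \<tau> *s a) $ i) 0)"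
  have line0: "(\<lambda>\<tau>. u (\<zeta>, \<tau> *s a) $ i) holomorphic_on ball 0 (R / (1 + norm a))" for a i
    using line[of 0 "R / (1 + norm a)" a] R by (simp add: vholo_def field_simps add_pos_nonneg)
  have L': "((\<lambda>\<tau>. u (\<zeta>, \<tau> *s a) $ i) has_field_derivative L a $ i) (at 0)" for a i
  proof -
    have "((\<lambda>\<tau>. u (\<zeta>, \<tau> *s a) $ i) has_field_derivative deriv (\<lambda>\<tau>. u (\<zeta>, \<tau> *s a) $ i) 0) (at 0)"
      by (rule holomorphic_derivI[OF line0[of a] open_ball]) (use R in \<open>auto simp: add_pos_nonneg\<close>)
    thus ?thesis by (simp add: L_def)
  qed
  have Lc: "L (c *s a) = c *s L a" for c a
  proof (intro vec_eq_iff[THEN iffD2] allI)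
    fix i
    have "((\<lambda>\<tau>. u (\<zeta>, (c * \<tau>) *s a) $ i) has_field_derivative L a $ i * c) (at 0)"
      using DERIV_chain2[OF _ DERIV_cmult_Id, of "\<lambda>\<tau>. u (\<zeta>, \<tau> *s a) $ i" "L a $ i" c 0 UNIV] L'[of a i] by simp
    moreover have "(\<lambda>\<tau>. u (\<zeta>, (c * \<tau>) *s a) $ i) = (\<lambda>\<tau>. u (\<zeta>, \<tau> *s (c *s a)) $ i)"
      by (simp add: vector_smult_assoc mult.commute)
    ultimately show "L (c *s a) $ i = (c *s L a) $ i" using L'[of "c *s a" i] DERIV_unique by (simp add: mult.commute) blast
  qed
  have Ladd: "L (a + b) = L a + L b" for a b
  proof (intro vec_eq_iff[THEN iffD2] allI)
    fix i
    \<comment> \<open>Small enough that x a + y b stays in the ball of radius R for all x and y of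
      modulus below r.\<close>
    define r where "r = R / (1 + norm a + norm b)"
    have n: "1 + norm a + norm b > 0" by (simp add: add_pos_nonneg)
    have r: "r > 0" using R n by (simp add: r_def)
    have rb: "norm (x *s a) + r * norm b \<le> R \<and> x *s a \<in> ball 0 R" if "x \<in> ball 0 r" for x
    proof -
      have "cmod x * norm a \<le> r * norm a" using that by (intro mult_right_mono) auto
      moreover have "r + r * norm a + r * norm b = R"
      proof -
        have "r + r * norm a + r * norm b = r * (1 + norm a + norm b)" by (simp add: algebra_simps)
        thus ?thesis using n by (simp add: r_def)
      qed
      moreover have "0 \<le> r * norm b" using r by simp
      ultimately show ?thesis using r unfolding norm_smult_vec mem_ball_0 by linarith
    qed
    have rb': "norm (x *s b) + r * norm a \<le> R \<and> x *s b \<in> ball 0 R" if "x \<in> ball 0 r" for x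
    proof -
      have "cmod x * norm b \<le> r * norm b" using that by (intro mult_right_mono) auto
      moreover have "r + r * norm a + r * norm b = R"
      proof -
        have "r + r * norm a + r * norm b = r * (1 + norm a + norm b)" by (simp add: algebra_simps)
        thus ?thesis using n by (simp add: r_def)
      qed
      moreover have "0 \<le> r * norm a" using r by simp
      ultimately show ?thesis using r unfolding norm_smult_vec mem_ball_0 by linarith
    qed
    define H where "H = (\<lambda>x y. u (\<zeta>, x *s a + y *s b) $ i)"
    have "((\<lambda>x. H x x) has_field_derivative (deriv (\<lambda>x. H x 0) 0 + deriv (H 0) 0)) (at 0)"
    proof (rule diagonal_derivative[OF open_ball])
      show "0 \<in> ball (0::complex) r" using r by simp
      show "H x holomorphic_on ball 0 r" if "x \<in> ball 0 r" for x
        using line[of "x *s a" r b] rb[OF that] r by (auto simp: H_def vholo_def)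
      show "(\<lambda>x. H x y) holomorphic_on ball 0 r" if "y \<in> ball 0 r" for y
        using line[of "y *s b" r a] rb'[OF that] r by (auto simp: H_def vholo_def add.commute)
      have "continuous_on (ball 0 r \<times> ball 0 r) (\<lambda>p. u (\<zeta>, fst p *s a + snd p *s b))"
      proof (rule continuous_on_compose2[OF jholo_continuous[OF u]])
        have smc: "continuous_on X (\<lambda>p. f p *s (c :: complex ^ 'n))" if "continuous_on X f" for X c and f :: "complex \<times> complex \<Rightarrow> complex"
          unfolding vector_scalar_mult_def using that by (intro continuous_on_vec_lambda continuous_intros)
        show "continuous_on (ball 0 r \<times> ball 0 r) (\<lambda>p. (\<zeta>, fst p *s a + snd p *s b))"
          by (intro continuous_intros smc)
        show "(\<lambda>p. (\<zeta>, fst p *s a + snd p *s b)) ` (ball 0 r \<times> ball 0 r) \<subseteq> W"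
        proof clarsimp
          fix x y :: complex assume xy: "cmod x < r" "cmod y < r"
          have "norm (x *s a + y *s b) \<le> cmod x * norm a + cmod y * norm b"
            by (metis norm_smult_vec norm_triangle_ineq)
          also have "\<dots> \<le> r * norm a + r * norm b" using xy by (intro add_mono mult_right_mono) auto
          also have "\<dots> < r * (1 + norm a + norm b)" using r by (simp add: algebra_simps)
          also have "\<dots> = R" using n by (simp add: r_def)
          finally show "(\<zeta>, x *s a + y *s b) \<in> W" using W by auto
        qed
      qed
      thus "continuous_on (ball 0 r \<times> ball 0 r) (\<lambda>(x, y). H x y)"
        by (auto simp: H_def case_prod_unfold intro!: bounded_linear.continuous_on[OF bounded_linear_vec_nth])
    qed
    moreover have "deriv (\<lambda>x. H x 0) 0 = L a $ i" "deriv (H 0) 0 = L b $ i"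
      using DERIV_imp_deriv[OF L'[of a i]] DERIV_imp_deriv[OF L'[of b i]] by (simp_all add: H_def)
    moreover have "(\<lambda>x. H x x) = (\<lambda>x. u (\<zeta>, x *s (a + b)) $ i)" by (simp add: H_def vector_add_ldistrib)
    ultimately show "L (a + b) $ i = (L a + L b) $ i" using L'[of "a + b" i] DERIV_unique by simp blast
  qed
  have "Vector_Spaces.linear (*s) (*s) L"
    by (rule Vector_Spaces.linear.intro) (use Lc Ladd in \<open>unfold_locales, auto\<close>)
  from matrix_works[OF this] have "matrix L *v s = L s" .
  moreover have "matrix L = jmat u \<zeta>" by (simp add: matrix_def L_def jmat_def)
  ultimately have Ls: "jmat u \<zeta> *v s = L s" by simp
  show ?thesis
  proof (cases "s = 0")
    case True
    thus ?thesis using R by simp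
  next
    case False
    define l where "l = norm s"
    have l: "l > 0" using False by (simp add: l_def)
    define d where "d = of_real (1 / l) *s s"
    have d: "norm d = 1" unfolding d_def norm_smult_vec using l by (simp add: l_def norm_divide)
    have sd: "of_real l *s d = s" using l by (simp add: d_def vector_smult_assoc flip: of_real_mult)
    have "cmod ((u (\<zeta>, s) - u (\<zeta>, 0) - L s) $ i) \<le> 4 * m / R\<^sup>2 * l\<^sup>2" for i
    proof -
      define g where "g = (\<lambda>\<tau>. u (\<zeta>, \<tau> *s d) $ i)"
      have "cmod (g (of_real l) - g 0 - deriv g 0 * (of_real l - 0)) \<le> 4 * m / R\<^sup>2 * (cmod (of_real l - 0))\<^sup>2"
      proof (rule taylor1_bound)
        show "g holomorphic_on ball 0 R" using line[of 0 R d] R d by (simp add: g_def vholo_def)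
        show "cmod (g x) \<le> m" if "x \<in> ball 0 R" for x
          using order.trans[OF Finite_Cartesian_Product.norm_nth_le m[of "x *s d"]] that d
          by (simp add: g_def norm_smult_vec)
      qed (use R s l in \<open>auto simp: l_def\<close>)
      moreover have "deriv g 0 = L d $ i" using DERIV_imp_deriv[OF L'[of d i]] by (simp add: g_def)
      moreover have "L d $ i * of_real l = L s $ i" using arg_cong[OF Lc[of "of_real l" d], of "\<lambda>v. v $ i"] sd by (simp add: mult.commute)
      ultimately show ?thesis using l sd by (simp add: g_def)
    qed
    from norm_vec_le_card[OF this] show ?thesis by (simp add: Ls l_def mult.assoc)
  qed
qed

text \<open>Cauchy's formula for the derivative, over a fixed circle in the fibre, turns each entry
  into a parameter integral of functions holomorphic in \<zeta>.\<close>

lemma jmat_holomorphic: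
  fixes u :: "complex \<times> (complex ^ 'n) \<Rightarrow> complex ^ 'm"
  assumes u: "jholo W u" and \<Omega>: "open \<Omega>" and W: "\<Omega> \<times> ball 0 R \<subseteq> W" and R: "R > 0"
  shows "(\<lambda>\<zeta>. jmat u \<zeta> $ i $ j) holomorphic_on \<Omega>"
proof -
  define r where "r = R / 2"
  have r: "r > 0" "r < R" using R by (auto simp: r_def)
  have nax: "norm (axis j (1::complex)) = 1" by simp
  define c where "c = (\<lambda>t. circlepath 0 r t)"
  have cn: "cmod (c t) = r" for t using r by (simp add: c_def circlepath norm_mult)
  have eq: "jmat u \<zeta> $ i $ j = integral {0..1} (\<lambda>t. u (\<zeta>, c t *s axis j 1) $ i / (c t)\<^sup>2 * (2 * pi * \<i> * r * exp (2 * pi * \<i> * t))) / (2 * pi * \<i>)"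
    if "\<zeta> \<in> \<Omega>" for \<zeta>
  proof -
    let ?f = "\<lambda>\<tau>. u (\<zeta>, \<tau> *s axis j 1) $ i"
    have hol: "?f holomorphic_on ball 0 R"
    proof -
      have "vholo (ball 0 R) (\<lambda>\<tau>. u (\<zeta>, 0 + \<tau> *s axis j 1))"
        by (rule jholo_curve[OF u open_ball _ vholo_affine]) (use W that nax in \<open>auto simp: norm_smult_vec\<close>)
      thus ?thesis by (simp add: vholo_def)
    qed
    have sub: "cball 0 r \<subseteq> ball (0::complex) R" using r by auto
    have "(?f has_field_derivative (1 / (2 * of_real pi * \<i>) * contour_integral (circlepath 0 r) (\<lambda>w. ?f w / (w - 0)\<^sup>2))) (at 0)"
      by (rule Cauchy_derivative_integral_circlepath(2))
         (use r sub hol in \<open>auto intro!: holomorphic_on_imp_continuous_on intro: holomorphic_on_subset\<close>)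
    from DERIV_imp_deriv[OF this] show ?thesis
      by (simp add: jmat_def contour_integral_integral vector_derivative_circlepath c_def)
  qed
  have "(\<lambda>\<zeta>. integral {0..1} (\<lambda>t. u (\<zeta>, c t *s axis j 1) $ i / (c t)\<^sup>2 * (2 * pi * \<i> * r * exp (2 * pi * \<i> * t)))) holomorphic_on \<Omega>"
  proof (rule holomorphic_parameter_integral[OF \<Omega>])
    have smc: "continuous_on X (\<lambda>p. f p *s (b :: complex ^ 'n))" if "continuous_on X f" for X b and f :: "real \<times> complex \<Rightarrow> complex"
      unfolding vector_scalar_mult_def using that by (intro continuous_on_vec_lambda continuous_intros)
    have cc: "continuous_on X (\<lambda>p. c (fst p))" for X :: "(real \<times> complex) set"
      unfolding c_def circlepath by (intro continuous_intros)
    have in_W: "(\<zeta>, c t *s axis j 1) \<in> W" if "\<zeta> \<in> \<Omega>" for \<zeta> t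
      using W that r by (auto simp: norm_smult_vec cn intro!: subsetD[OF W])
    have "continuous_on ({0..1} \<times> \<Omega>) (\<lambda>p. u (snd p, c (fst p) *s axis j 1))"
      by (rule continuous_on_compose2[OF jholo_continuous[OF u]])
         (auto intro!: continuous_intros smc cc in_W)
    moreover have "c t \<noteq> 0" for t using cn[of t] r by auto
    ultimately show "continuous_on ({0..1} \<times> \<Omega>) (\<lambda>(t, \<zeta>). u (\<zeta>, c t *s axis j 1) $ i / (c t)\<^sup>2 * (2 * pi * \<i> * r * exp (2 * pi * \<i> * t)))"
      unfolding case_prod_unfold by (intro continuous_intros cc bounded_linear.continuous_on[OF bounded_linear_vec_nth]) auto
    show "(\<lambda>\<zeta>. u (\<zeta>, c t *s axis j 1) $ i / (c t)\<^sup>2 * (2 * pi * \<i> * r * exp (2 * pi * \<i> * t))) holomorphic_on \<Omega>" for t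
    proof -
      have "vholo \<Omega> (\<lambda>\<zeta>. u (\<zeta>, c t *s axis j 1))"
        by (rule jholo_curve[OF u \<Omega>]) (auto intro!: in_W)
      thus ?thesis using cn[of t] r by (auto simp: vholo_def intro!: holomorphic_intros)
    qed
  qed
  hence "(\<lambda>\<zeta>. integral {0..1} (\<lambda>t. u (\<zeta>, c t *s axis j 1) $ i / (c t)\<^sup>2 * (2 * pi * \<i> * r * exp (2 * pi * \<i> * t))) / (2 * pi * \<i>)) holomorphic_on \<Omega>"
    by (intro holomorphic_intros) auto
  thus ?thesis by (rule holomorphic_transform) (use eq in auto)
qed

section \<open>Cauchy integrals over rectangles and the nonlinear splitting\<close>

text \<open>The contribution of one edge to a Cauchy integral, without the factor 1/(2 pi i). As an
  integral over the unit interval it also has a value for \<zeta> on the edge, where the integrand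
  is 0 at the singular parameter by division by zero.\<close>

definition cint :: "complex \<Rightarrow> complex \<Rightarrow> (complex \<Rightarrow> complex) \<Rightarrow> complex \<Rightarrow> complex" where
  "cint x y f \<zeta> = integral {0..1} (\<lambda>t. f (linepath x y t) / (linepath x y t - \<zeta>)) * (y - x)"

lemma linepath_in_segment: "t \<in> {0..1} \<Longrightarrow> linepath x y t \<in> closed_segment x y"
  by (metis imageI path_image_def path_image_linepath)

text \<open>The growth condition says that f cancels the kernel at \<zeta>: the integrand is
  bounded, and it is continuous away from the at most one parameter at which the segment meets
  \<zeta>.\<close>

lemma cint_integrable:
  assumes f: "continuous_on (closed_segment x y) f" and M: "\<And>w. w \<in> closed_segment x y \<Longrightarrow> cmod (f w) \<le> M * cmod (w - \<zeta>)"
    and xy: "x \<noteq> y"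
  shows "(\<lambda>t. f (linepath x y t) / (linepath x y t - \<zeta>)) integrable_on {0..1}"
proof -
  define N where "N = {t \<in> {0..1}. linepath x y t = \<zeta>}"
  have "\<exists>t. N \<subseteq> {t}"
  proof (rule ccontr)
    assume "\<not> ?thesis"
    then obtain s t where "s \<in> N" "t \<in> N" "s \<noteq> t" by blast
    hence "linepath x y s = linepath x y t" by (simp add: N_def)
    hence "(of_real (s - t)) * (y - x) = 0" by (simp add: linepath_def scaleR_conv_of_real algebra_simps)
    thus False using xy \<open>s \<noteq> t\<close> by simp
  qed
  then obtain t where "N \<subseteq> {t}" by blast
  hence finN: "finite N" using finite_subset by blast
  let ?g = "\<lambda>t. f (linepath x y t) / (linepath x y t - \<zeta>)"
  have "?g integrable_on ({0..1} - N)"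
  proof (rule measurable_bounded_by_integrable_imp_integrable[where g = "\<lambda>t. \<bar>M\<bar>"])
    have cf: "continuous_on ({0..1} - N) (\<lambda>t. f (linepath x y t))"
      by (rule continuous_on_compose2[OF f]) (auto intro!: continuous_intros linepath_in_segment)
    have "continuous_on ({0..1} - N) ?g"
      by (intro continuous_intros cf) (auto simp: N_def)
    moreover have S: "{0..1} - N \<in> sets lebesgue"
      using finN by (intro sets.Diff) (auto intro: negligible_imp_sets)
    ultimately show "?g \<in> borel_measurable (lebesgue_on ({0..1} - N))" "{0..1} - N \<in> sets lebesgue"
      using continuous_imp_measurable_on_sets_lebesgue by blast+
    show "(\<lambda>t::real. \<bar>M\<bar>) integrable_on {0..1} - N"
      by (rule integrable_spike_set[of _ "{0..1}"]) (use finN in \<open>auto intro!: negligible_subset[OF negligible_finite[OF finN]]\<close>)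
    fix t assume t: "t \<in> {0..1} - N"
    hence "linepath x y t \<noteq> \<zeta>" by (simp add: N_def)
    moreover have "cmod (f (linepath x y t)) \<le> \<bar>M\<bar> * cmod (linepath x y t - \<zeta>)"
      by (rule order.trans[OF M mult_right_mono]) (use t linepath_in_segment in auto)
    ultimately show "norm (?g t) \<le> \<bar>M\<bar>" by (simp add: norm_divide field_simps)
  qed
  thus ?thesis by (rule integrable_spike_set) (use finN in \<open>auto intro!: negligible_subset[OF negligible_finite[OF finN]]\<close>)
qed

lemma cint_bound:
  assumes M: "\<And>w. w \<in> closed_segment x y \<Longrightarrow> cmod (f w) \<le> M * cmod (w - \<zeta>)" and M0: "M \<ge> 0"
  shows "cmod (cint x y f \<zeta>) \<le> M * cmod (y - x)"
proof -
  have b: "cmod (f (linepath x y t) / (linepath x y t - \<zeta>)) \<le> M" if "t \<in> {0..1}" for t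
  proof (cases "linepath x y t = \<zeta>")
    case False
    thus ?thesis using M[OF linepath_in_segment[OF that]] by (simp add: norm_divide field_simps)
  qed (use M0 in simp)
  have "cmod (integral {0..1} (\<lambda>t. f (linepath x y t) / (linepath x y t - \<zeta>))) \<le> M"
  proof (cases "(\<lambda>t. f (linepath x y t) / (linepath x y t - \<zeta>)) integrable_on {0..1}")
    case True
    have "cmod (integral {0..1} (\<lambda>t. f (linepath x y t) / (linepath x y t - \<zeta>))) \<le> integral {0..1} (\<lambda>t::real. M)"
      by (intro integral_norm_bound_integral True b) auto
    thus ?thesis by simp
  next
    case False
    \<comment> \<open>A function that is not integrable has integral 0 by convention.\<close>
    thus ?thesis using M0 by (simp add: not_integrable_integral)
  qed
  thus ?thesis unfolding cint_def norm_mult by (intro mult_right_mono) auto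
qed

lemma cint_diff:
  assumes "(\<lambda>t. f (linepath x y t) / (linepath x y t - \<zeta>)) integrable_on {0..1}"
    and "(\<lambda>t. g (linepath x y t) / (linepath x y t - \<zeta>)) integrable_on {0..1}"
  shows "cint x y (\<lambda>w. f w - g w) \<zeta> = cint x y f \<zeta> - cint x y g \<zeta>"
  unfolding cint_def diff_divide_distrib integral_diff[OF assms] by (simp add: left_diff_distrib)

lemma cint_cmult: "cint x y (\<lambda>w. a * f w) \<zeta> = a * cint x y f \<zeta>"
  unfolding cint_def by (simp flip: times_divide_eq_right)

lemma cint_cong: "(\<And>w. w \<in> closed_segment x y \<Longrightarrow> f w = g w) \<Longrightarrow> cint x y f \<zeta> = cint x y g \<zeta>"
  unfolding cint_def by (intro arg_cong2[of _ _ _ _ "(*)"] refl integral_cong) (simp add: linepath_in_segment)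

lemma off_segment_integrable:
  fixes f :: "complex \<Rightarrow> complex"
  assumes f: "continuous_on (closed_segment x y) f" and z: "\<zeta> \<notin> closed_segment x y"
  shows "(\<lambda>t. f (linepath x y t) / (linepath x y t - \<zeta>)) integrable_on {0..1}"
proof (rule integrable_continuous_real)
  have cf: "continuous_on {0..1} (\<lambda>t. f (linepath x y t))"
    by (rule continuous_on_compose2[OF f]) (auto intro!: continuous_intros linepath_in_segment)
  show "continuous_on {0..1} (\<lambda>t. f (linepath x y t) / (linepath x y t - \<zeta>))"
    by (intro continuous_intros cf) (use z linepath_in_segment[of _ x y] in auto)
qed

text \<open>Continuity of the splitting up to the boundary rests on this: the evaluation point may
  move onto the edge. The growth condition dominates all integrands by one constant, and pointwise
  convergence can fail at most at the parameter where the edge meets the limit point.\<close>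

lemma cint_tendsto:
  assumes f: "\<And>k. continuous_on (closed_segment x y) (f k)"
    and M: "\<And>k w. w \<in> closed_segment x y \<Longrightarrow> cmod (f k w) \<le> M * cmod (w - \<zeta> k)"
    and z: "\<zeta> \<longlonglongrightarrow> \<zeta>0" and lim: "\<And>w. w \<in> closed_segment x y \<Longrightarrow> (\<lambda>k. f k w) \<longlonglongrightarrow> f0 w"
    and xy: "x \<noteq> y"
  shows "(\<lambda>k. cint x y (f k) (\<zeta> k)) \<longlonglongrightarrow> cint x y f0 \<zeta>0"
proof -
  define N where "N = {t \<in> {0..1}. linepath x y t = \<zeta>0}"
  have "\<exists>t. N \<subseteq> {t}"
  proof (rule ccontr)
    assume "\<not> ?thesis"
    then obtain s t where "s \<in> N" "t \<in> N" "s \<noteq> t" by blast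
    hence "linepath x y s = linepath x y t" by (simp add: N_def)
    hence "(of_real (s - t)) * (y - x) = 0" by (simp add: linepath_def scaleR_conv_of_real algebra_simps)
    thus False using xy \<open>s \<noteq> t\<close> by simp
  qed
  then obtain t where "N \<subseteq> {t}" by blast
  hence finN: "finite N" using finite_subset by blast
  hence negN: "negligible N" by (rule negligible_finite)
  let ?g = "\<lambda>k t. f k (linepath x y t) / (linepath x y t - \<zeta> k)"
  \<comment> \<open>Redefining the integrands on the exceptional set makes convergence hold
    everywhere, since the limit integrand is 0 at a singular parameter as well.\<close>
  let ?g' = "\<lambda>k t. if t \<in> N then 0 else ?g k t"
  have i: "?g k integrable_on {0..1}" for k by (rule cint_integrable[OF f M xy])
  have "(\<lambda>k. integral {0..1} (?g' k)) \<longlonglongrightarrow> integral {0..1} (\<lambda>t. f0 (linepath x y t) / (linepath x y t - \<zeta>0))"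
  proof (rule dominated_convergence(2)[where h = "\<lambda>t. \<bar>M\<bar>"])
    show "?g' k integrable_on {0..1}" for k
      by (rule integrable_spike[OF i[of k] negN]) auto
    show "norm (?g' k t) \<le> \<bar>M\<bar>" if t: "t \<in> {0..1}" for k t
    proof (cases "linepath x y t = \<zeta> k")
      case False
      have "cmod (f k (linepath x y t)) \<le> \<bar>M\<bar> * cmod (linepath x y t - \<zeta> k)"
        by (rule order.trans[OF M mult_right_mono]) (use t linepath_in_segment in auto)
      thus ?thesis using False by (simp add: norm_divide field_simps)
    qed simp
    show "(\<lambda>k. ?g' k t) \<longlonglongrightarrow> f0 (linepath x y t) / (linepath x y t - \<zeta>0)" if t: "t \<in> {0..1}" for t
    proof (cases "t \<in> N")
      case False
      hence "linepath x y t - \<zeta>0 \<noteq> 0" using t by (simp add: N_def)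
      thus ?thesis using False t by (auto intro!: tendsto_intros lim z linepath_in_segment)
    qed (simp add: N_def)
  qed auto
  moreover have "integral {0..1} (?g' k) = integral {0..1} (?g k)" for k
    by (rule integral_spike[OF negN]) auto
  ultimately show ?thesis unfolding cint_def by (intro tendsto_mult tendsto_const) simp
qed

text \<open>The corners p and q are lower left and upper right, and the edges run counterclockwise
  as in \<open>rectpath\<close>. They are kept apart because later some edges drop out of the sum
  and one is replaced by an entire function.\<close>

definition bsum :: "complex \<Rightarrow> complex \<Rightarrow> (complex \<Rightarrow> complex \<Rightarrow> complex) \<Rightarrow> complex" where
  "bsum p q F = F p (Complex (Re q) (Im p)) + F (Complex (Re q) (Im p)) q
     + F q (Complex (Re p) (Im q)) + F (Complex (Re p) (Im q)) p"

definition rcauchy :: "complex \<Rightarrow> complex \<Rightarrow> (complex \<Rightarrow> complex) \<Rightarrow> complex \<Rightarrow> complex" where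
  "rcauchy p q f \<zeta> = bsum p q (\<lambda>x y. cint x y f \<zeta>) / (2 * of_real pi * \<i>)"

definition edges :: "complex \<Rightarrow> complex \<Rightarrow> (complex \<times> complex) set" where
  "edges p q = {(p, Complex (Re q) (Im p)), (Complex (Re q) (Im p), q),
     (q, Complex (Re p) (Im q)), (Complex (Re p) (Im q), p)}"

lemma bsum_cong: "(\<And>x y. (x, y) \<in> edges p q \<Longrightarrow> F x y = G x y) \<Longrightarrow> bsum p q F = bsum p q G"
  by (simp add: bsum_def edges_def)

lemma edge_subset:
  assumes "Re p < Re q" "Im p < Im q" "(x, y) \<in> edges p q"
  shows "closed_segment x y \<subseteq> cbox p q" "closed_segment x y \<inter> box p q = {}" "x \<noteq> y"
    "cmod (y - x) \<le> (Re q - Re p) + (Im q - Im p)"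
proof -
  have "x \<in> cbox p q" "y \<in> cbox p q" using assms by (auto simp: edges_def in_cbox_complex_iff)
  thus "closed_segment x y \<subseteq> cbox p q" by (intro closed_segment_subset) auto
  show "closed_segment x y \<inter> box p q = {}" using assms
    by (auto simp: edges_def in_box_complex_iff closed_segment_same_Re closed_segment_same_Im closed_segment_eq_real_ivl)
  show "x \<noteq> y" using assms by (auto simp: edges_def complex_eq_iff)
  show "cmod (y - x) \<le> (Re q - Re p) + (Im q - Im p)"
    by (rule order.trans[OF cmod_le]) (use assms in \<open>auto simp: edges_def\<close>)
qed

lemma rcauchy_formula:
  assumes pq: "Re p < Re q" "Im p < Im q" and f: "continuous_on (cbox p q) f" "f holomorphic_on box p q"
    and z: "\<zeta> \<in> box p q"
  shows "rcauchy p q f \<zeta> = f \<zeta>"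
proof -
  have "((\<lambda>w. f w / (w - \<zeta>)) has_contour_integral (2*pi * \<i> * winding_number (rectpath p q) \<zeta> * f \<zeta>)) (rectpath p q)"
  proof (rule Cauchy_integral_formula_weak[where k = "{}" and S = "cbox p q"])
    show "path_image (rectpath p q) \<subseteq> cbox p q - {\<zeta>}"
      using path_image_rectpath_cbox_minus_box[of p q] pq z by auto
    show "f field_differentiable at x" if "x \<in> interior (cbox p q) - {}" for x
      using f(2) that by (auto simp: interior_cbox intro: holomorphic_on_imp_differentiable_at)
  qed (use f z pq in \<open>auto simp: interior_cbox rectpath_def Let_def\<close>)
  hence "((\<lambda>w. f w / (w - \<zeta>)) has_contour_integral (2*pi * \<i> * f \<zeta>)) (rectpath p q)"
    using winding_number_rectpath[of \<zeta> p q] z by simp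
  hence "contour_integral (rectpath p q) (\<lambda>w. f w / (w - \<zeta>)) = 2*pi * \<i> * f \<zeta>"
    by (rule contour_integral_unique)
  note 1 = this
  have ci: "(\<lambda>w. f w / (w - \<zeta>)) contour_integrable_on linepath x y" if "(x, y) \<in> edges p q" for x y
  proof (rule contour_integrable_continuous_linepath)
    show "continuous_on (closed_segment x y) (\<lambda>w. f w / (w - \<zeta>))"
      using edge_subset(1,2)[OF pq that] z by (intro continuous_intros continuous_on_subset[OF f(1)]) auto
  qed
  have hi: "((\<lambda>w. f w / (w - \<zeta>)) has_contour_integral contour_integral (linepath x y) (\<lambda>w. f w / (w - \<zeta>))) (linepath x y)"
    if "(x, y) \<in> edges p q" for x y
    using ci[OF that] by (rule has_contour_integral_integral)
  have "((\<lambda>w. f w / (w - \<zeta>)) has_contour_integral bsum p q (\<lambda>x y. contour_integral (linepath x y) (\<lambda>w. f w / (w - \<zeta>)))) (rectpath p q)"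
    unfolding rectpath_def Let_def bsum_def add.assoc
    by (intro has_contour_integral_join hi valid_path_join valid_path_linepath) (auto simp: edges_def)
  hence "contour_integral (rectpath p q) (\<lambda>w. f w / (w - \<zeta>)) = bsum p q (\<lambda>x y. contour_integral (linepath x y) (\<lambda>w. f w / (w - \<zeta>)))"
    by (rule contour_integral_unique)
  moreover note 1
  moreover have "contour_integral (linepath x y) (\<lambda>w. f w / (w - \<zeta>)) = cint x y f \<zeta>" for x y
    by (simp add: contour_integral_integral cint_def flip: integral_mult_left)
  ultimately have "bsum p q (\<lambda>x y. cint x y f \<zeta>) = 2 * of_real pi * \<i> * f \<zeta>" by simp
  thus ?thesis by (simp add: rcauchy_def)
qed

lemma rcauchy_bound:
  assumes pq: "Re p < Re q" "Im p < Im q" and M0: "M \<ge> 0"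
    and M: "\<And>w. w \<in> cbox p q \<Longrightarrow> cmod (f w) \<le> M * cmod (w - \<zeta>)"
  shows "cmod (rcauchy p q f \<zeta>) \<le> M * ((Re q - Re p) + (Im q - Im p))"
proof -
  let ?l = "(Re q - Re p) + (Im q - Im p)"
  have b: "cmod (cint x y f \<zeta>) \<le> M * ?l" if "(x, y) \<in> edges p q" for x y
  proof -
    have "cmod (cint x y f \<zeta>) \<le> M * cmod (y - x)"
      by (rule cint_bound[OF M M0]) (use edge_subset(1)[OF pq that] in auto)
    also have "\<dots> \<le> M * ?l" by (intro mult_left_mono edge_subset(4)[OF pq that] M0)
    finally show ?thesis .
  qed
  have "cmod (bsum p q (\<lambda>x y. cint x y f \<zeta>)) \<le> M * ?l + M * ?l + M * ?l + M * ?l"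
    unfolding bsum_def by (intro order.trans[OF norm_triangle_ineq] add_mono b) (auto simp: edges_def)
  \<comment> \<open>Every edge is at most as long as width plus height, so there are four equal
    bounds, and \<open>4 \<le> 2 * pi\<close> absorbs them into the normalization.\<close>
  also have "\<dots> \<le> M * ?l * (2 * pi)"
  proof -
    have "M * ?l * 4 \<le> M * ?l * (2 * pi)" using pi_ge_two pq M0 by (intro mult_left_mono) auto
    thus ?thesis by (simp add: algebra_simps)
  qed
  finally show ?thesis unfolding rcauchy_def by (simp add: norm_divide norm_mult field_simps)
qed

text \<open>The cut-off of the Cousin problem: 0 on the left edge and to its left, 1 on the right
  edge and beyond. Integrals weighted by it lose the left edge, those weighted by it minus one lose
  the right edge. Piecewise linear is enough, since what matters is its Lipschitz constant.\<close>

definition rchi :: "complex \<Rightarrow> complex \<Rightarrow> complex \<Rightarrow> real" where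
  "rchi p q \<zeta> = max 0 (min 1 ((Re \<zeta> - Re p) / (Re q - Re p)))"

lemma rchi_props:
  assumes pq: "Re p < Re q"
  shows "0 \<le> rchi p q \<zeta>" "rchi p q \<zeta> \<le> 1" "Re \<zeta> \<le> Re p \<Longrightarrow> rchi p q \<zeta> = 0" "Re q \<le> Re \<zeta> \<Longrightarrow> rchi p q \<zeta> = 1"
    "\<bar>rchi p q w - rchi p q \<zeta>\<bar> \<le> 1 / (Re q - Re p) * cmod (w - \<zeta>)" "continuous_on X (rchi p q)"
proof -
  show "0 \<le> rchi p q \<zeta>" "rchi p q \<zeta> \<le> 1" by (auto simp: rchi_def)
  show "rchi p q \<zeta> = 0" if "Re \<zeta> \<le> Re p"
  proof -
    have "(Re \<zeta> - Re p) / (Re q - Re p) \<le> 0" using that pq by (intro divide_nonpos_pos) auto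
    thus ?thesis by (simp add: rchi_def)
  qed
  show "rchi p q \<zeta> = 1" if "Re q \<le> Re \<zeta>"
  proof -
    have "(Re \<zeta> - Re p) / (Re q - Re p) \<ge> 1" using that pq by (simp add: field_simps)
    thus ?thesis by (simp add: rchi_def)
  qed
  have "\<bar>rchi p q w - rchi p q \<zeta>\<bar> \<le> \<bar>(Re w - Re p) / (Re q - Re p) - (Re \<zeta> - Re p) / (Re q - Re p)\<bar>"
    unfolding rchi_def by linarith
  also have "\<dots> = 1 / (Re q - Re p) * \<bar>Re (w - \<zeta>)\<bar>" using pq by (simp add: diff_divide_distrib[symmetric] abs_divide)
  also have "\<dots> \<le> 1 / (Re q - Re p) * cmod (w - \<zeta>)" using pq by (intro mult_left_mono abs_Re_le_cmod) auto
  finally show "\<bar>rchi p q w - rchi p q \<zeta>\<bar> \<le> 1 / (Re q - Re p) * cmod (w - \<zeta>)" .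
  show "continuous_on X (rchi p q)" unfolding rchi_def[abs_def] using pq by (intro continuous_intros) auto
qed

section \<open>Families continuous up to the boundary of a rectangle, and their additive
  splitting\<close>

lemma continuous_on_smult_vec:
  "continuous_on X f \<Longrightarrow> continuous_on X g \<Longrightarrow> continuous_on X (\<lambda>x. f x *s (g x :: complex ^ 'n))"
  unfolding vector_scalar_mult_def
  by (intro continuous_on_vec_lambda continuous_intros bounded_linear.continuous_on[OF bounded_linear_vec_nth])

lemma jholo_cmult: "jholo W u \<Longrightarrow> jholo W (\<lambda>p. c *s u p)"
  by (auto simp: jholo_def intro!: continuous_on_smult_vec continuous_intros)

definition chol :: "complex \<Rightarrow> complex \<Rightarrow> (complex ^ 'n) set \<Rightarrow> (complex \<times> (complex ^ 'n) \<Rightarrow> complex ^ 'm) \<Rightarrow> bool" where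
  "chol p q B h \<longleftrightarrow> continuous_on (cbox p q \<times> B) h \<and> jholo (box p q \<times> B) h"

text \<open>Holomorphy in the fibre over boundary points is inherited from the interior: w is
  approached along the segment from the centre of the rectangle, and uniform continuity on compact
  sets makes the limit locally uniform.\<close>

lemma chol_param:
  fixes h :: "complex \<times> (complex ^ 'n) \<Rightarrow> complex ^ 'm"
  assumes pq: "Re p < Re q" "Im p < Im q" and h: "chol p q B h" and w: "w \<in> cbox p q"
    and T: "open T" and \<sigma>: "vholo T \<sigma>" and B: "\<sigma> ` T \<subseteq> B"
  shows "vholo T (\<lambda>\<tau>. h (w, \<sigma> \<tau>))"
proof (rule vholo_uniform_limit[OF T])
  define c where "c = (p + q) / 2"
  define v where "v = (\<lambda>k. w + of_real (1 / (real k + 2)) * (c - w))"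
  have vbox: "v k \<in> box p q" for k
  proof -
    define l where "l = 1 / (real k + 2)"
    have l: "0 < l" "l < 1" by (auto simp: l_def field_simps)
    have *: "x1 < x + l * ((x1 + x2) / 2 - x) \<and> x + l * ((x1 + x2) / 2 - x) < x2"
      if "x1 < x2" "x1 \<le> x" "x \<le> x2" for x x1 x2
    proof -
      have "(1 - l) * (x - x1) \<ge> 0" "(1 - l) * (x2 - x) \<ge> 0" "l * (x2 - x1) > 0" using l that by auto
      thus ?thesis by (simp add: algebra_simps) argo
    qed
    have "v k = w + of_real l * (c - w)" by (simp add: v_def l_def)
    thus ?thesis using w pq *[of "Re p" "Re q" "Re w"] *[of "Im p" "Im q" "Im w"]
      by (simp add: in_box_complex_iff in_cbox_complex_iff c_def)
  qed
  show "vholo T (\<lambda>\<tau>. h (v k, \<sigma> \<tau>))" for k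
    by (rule jholo_curve[of "box p q \<times> B", OF _ T _ \<sigma>]) (use h vbox B in \<open>auto simp: chol_def\<close>)
  fix x assume "x \<in> T"
  then obtain d where d: "d > 0" "cball x d \<subseteq> T" using T open_contains_cball by blast
  have "continuous_on (cbox p q \<times> cball x d) (\<lambda>a. h (fst a, \<sigma> (snd a)))"
  proof (rule continuous_on_compose2[of "cbox p q \<times> B" h])
    show "continuous_on (cbox p q \<times> B) h" using h by (simp add: chol_def)
    show "continuous_on (cbox p q \<times> cball x d) (\<lambda>a. (fst a, \<sigma> (snd a)))"
      by (intro continuous_intros continuous_on_compose2[OF vholo_continuous[OF \<sigma>]]) (use d in auto)
    show "(\<lambda>a. (fst a, \<sigma> (snd a))) ` (cbox p q \<times> cball x d) \<subseteq> cbox p q \<times> B"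
      using B d by force
  qed
  hence uc: "uniformly_continuous_on (cbox p q \<times> cball x d) (\<lambda>a. h (fst a, \<sigma> (snd a)))"
    by (intro compact_uniformly_continuous compact_Times) auto
  have lim: "v \<longlonglongrightarrow> w"
  proof -
    have "(\<lambda>k. 1 / (real k + 2)) \<longlonglongrightarrow> 0" by real_asymp
    hence "v \<longlonglongrightarrow> w + of_real 0 * (c - w)" unfolding v_def by (intro tendsto_intros)
    thus ?thesis by simp
  qed
  have "uniform_limit (cball x d) (\<lambda>k \<tau>. h (v k, \<sigma> \<tau>)) (\<lambda>\<tau>. h (w, \<sigma> \<tau>)) sequentially"
  proof (rule uniform_limitI)
    fix e :: real assume "e > 0"
    then obtain r where r: "r > 0"
      "\<And>a b. a \<in> cbox p q \<times> cball x d \<Longrightarrow> b \<in> cbox p q \<times> cball x d \<Longrightarrow> dist b a < r \<Longrightarrow> dist (h (fst b, \<sigma> (snd b))) (h (fst a, \<sigma> (snd a))) < e"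
      using uc unfolding uniformly_continuous_on_def by metis
    have "\<forall>\<^sub>F k in sequentially. dist (v k) w < r" using lim r(1) by (rule tendstoD)
    thus "\<forall>\<^sub>F k in sequentially. \<forall>\<tau>\<in>cball x d. dist (h (v k, \<sigma> \<tau>)) (h (w, \<sigma> \<tau>)) < e"
    proof eventually_elim
      case (elim k)
      show ?case
      proof
        fix \<tau> assume \<tau>: "\<tau> \<in> cball x d"
        show "dist (h (v k, \<sigma> \<tau>)) (h (w, \<sigma> \<tau>)) < e"
          using r(2)[of "(w, \<tau>)" "(v k, \<tau>)"] \<tau> w vbox[of k] elim box_subset_cbox[of p q] by (auto simp: dist_Pair_Pair)
      qed
    qed
  qed
  with d show "\<exists>d>0. cball x d \<subseteq> T \<and> uniform_limit (cball x d) (\<lambda>k \<tau>. h (v k, \<sigma> \<tau>)) (\<lambda>\<tau>. h (w, \<sigma> \<tau>)) sequentially"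
    by blast
qed

text \<open>Off the edge the kernel makes the integral holomorphic in \<zeta>, and the fibre
  variable enters as a parameter of the integrand; \<open>jholo_osgood\<close> combines the two. The
  condition \<open>par\<close> is imposed over the edge itself, where h will only be a boundary
  value.\<close>

lemma edge_jholo:
  fixes h :: "complex \<times> (complex ^ 'n) \<Rightarrow> complex ^ 'm" and \<omega> :: "complex \<Rightarrow> complex"
  assumes \<omega>: "continuous_on (closed_segment x y) \<omega>" and h: "continuous_on (closed_segment x y \<times> B) h"
    and par: "\<And>w T \<sigma>. w \<in> closed_segment x y \<Longrightarrow> open T \<Longrightarrow> vholo T \<sigma> \<Longrightarrow> \<sigma> ` T \<subseteq> B \<Longrightarrow> vholo T (\<lambda>\<tau>. h (w, \<sigma> \<tau>))"
    and \<Omega>: "open \<Omega>" "\<Omega> \<inter> closed_segment x y = {}"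
  shows "jholo (\<Omega> \<times> B) (\<lambda>a. \<chi> i. cint x y (\<lambda>w. \<omega> w * h (w, snd a) $ i) (fst a))"
proof (rule jholo_osgood)
  have ne: "linepath x y t \<noteq> \<zeta>" if "t \<in> {0..1}" "\<zeta> \<in> \<Omega>" for t \<zeta>
    using \<Omega>(2) that linepath_in_segment[of t x y] by blast
  have cl: "continuous_on X (\<lambda>a. linepath x y (\<rho> a))" if "continuous_on X \<rho>" for X and \<rho> :: "'x::topological_space \<Rightarrow> real"
    unfolding linepath_def using that by (intro continuous_intros)
  have cw: "continuous_on X (\<lambda>a. \<omega> (linepath x y (\<rho> a)))" if "continuous_on X \<rho>" "\<rho> ` X \<subseteq> {0..1}" for X and \<rho> :: "'x::topological_space \<Rightarrow> real"
    by (rule continuous_on_compose2[OF \<omega> cl[OF that(1)]]) (use that linepath_in_segment in blast)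
  have ch: "continuous_on X (\<lambda>a. h (linepath x y (\<rho> a), \<sigma> a) $ i)"
    if "continuous_on X \<rho>" "\<rho> ` X \<subseteq> {0..1}" "continuous_on X \<sigma>" "\<sigma> ` X \<subseteq> B" for X and \<rho> :: "'x::topological_space \<Rightarrow> real" and \<sigma> i
    by (rule bounded_linear.continuous_on[OF bounded_linear_vec_nth],
        rule continuous_on_compose2[OF h continuous_on_Pair[OF cl[OF that(1)] that(3)]])
       (use that linepath_in_segment in blast)
  show "continuous_on (\<Omega> \<times> B) (\<lambda>a. \<chi> i. cint x y (\<lambda>w. \<omega> w * h (w, snd a) $ i) (fst a))"
  proof (intro continuous_on_vec_lambda)
    fix i
    have "continuous_on (\<Omega> \<times> B) (\<lambda>a. integral (cbox 0 1) (\<lambda>t. \<omega> (linepath x y t) * h (linepath x y t, snd a) $ i / (linepath x y t - fst a)))"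
    proof (rule integral_continuous_on_param)
      show "continuous_on ((\<Omega> \<times> B) \<times> cbox 0 1) (\<lambda>(a, t). \<omega> (linepath x y t) * h (linepath x y t, snd a) $ i / (linepath x y t - fst a))"
        unfolding case_prod_unfold using ne by (intro continuous_intros cw ch cl) auto
    qed
    thus "continuous_on (\<Omega> \<times> B) (\<lambda>a. cint x y (\<lambda>w. \<omega> w * h (w, snd a) $ i) (fst a))"
      unfolding cint_def by (intro continuous_intros) simp
  qed
  show "vholo \<Omega> (\<lambda>\<zeta>. \<chi> i. cint x y (\<lambda>w. \<omega> w * h (w, snd (\<zeta>, s)) $ i) (fst (\<zeta>, s)))" if s: "s \<in> B" for s
    unfolding vholo_def
  proof
    fix i
    have "(\<lambda>\<zeta>. integral {0..1} (\<lambda>t. \<omega> (linepath x y t) * h (linepath x y t, s) $ i / (linepath x y t - \<zeta>))) holomorphic_on \<Omega>"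
    proof (rule holomorphic_parameter_integral[OF \<Omega>(1)])
      show "continuous_on ({0..1} \<times> \<Omega>) (\<lambda>(t, \<zeta>). \<omega> (linepath x y t) * h (linepath x y t, s) $ i / (linepath x y t - \<zeta>))"
        unfolding case_prod_unfold using ne s by (intro continuous_intros cw ch cl) auto
      show "(\<lambda>\<zeta>. \<omega> (linepath x y t) * h (linepath x y t, s) $ i / (linepath x y t - \<zeta>)) holomorphic_on \<Omega>" if "t \<in> {0..1}" for t
        using ne[OF that] by (intro holomorphic_intros) auto
    qed
    thus "(\<lambda>\<tau>. (\<chi> i. cint x y (\<lambda>w. \<omega> w * h (w, snd (\<tau>, s)) $ i) (fst (\<tau>, s))) $ i) holomorphic_on \<Omega>"
      unfolding cint_def by (auto intro!: holomorphic_intros)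
  qed
  show "vholo T (\<lambda>\<tau>. \<chi> i. cint x y (\<lambda>w. \<omega> w * h (w, snd (\<zeta>, \<sigma> \<tau>)) $ i) (fst (\<zeta>, \<sigma> \<tau>)))"
    if z: "\<zeta> \<in> \<Omega>" and T: "open T" and \<sigma>: "vholo T \<sigma>" "\<sigma> ` T \<subseteq> B" for \<zeta> T \<sigma>
    unfolding vholo_def
  proof
    fix i
    have "(\<lambda>\<tau>. integral {0..1} (\<lambda>t. \<omega> (linepath x y t) * h (linepath x y t, \<sigma> \<tau>) $ i / (linepath x y t - \<zeta>))) holomorphic_on T"
    proof (rule holomorphic_parameter_integral[OF T])
      have cs: "continuous_on ({0..1::real} \<times> T) (\<lambda>a. \<sigma> (snd a))"
        by (rule continuous_on_compose2[OF vholo_continuous[OF \<sigma>(1)]]) (auto intro!: continuous_intros)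
      show "continuous_on ({0..1} \<times> T) (\<lambda>(t, \<tau>). \<omega> (linepath x y t) * h (linepath x y t, \<sigma> \<tau>) $ i / (linepath x y t - \<zeta>))"
        unfolding case_prod_unfold using ne z \<sigma>(2) by (intro continuous_intros cw ch cl cs) auto
      show "(\<lambda>\<tau>. \<omega> (linepath x y t) * h (linepath x y t, \<sigma> \<tau>) $ i / (linepath x y t - \<zeta>)) holomorphic_on T" if "t \<in> {0..1}" for t
        using par[OF linepath_in_segment[OF that] T \<sigma>] ne[OF that z] unfolding vholo_def by (intro holomorphic_intros) auto
    qed
    thus "(\<lambda>\<tau>. (\<chi> i. cint x y (\<lambda>w. \<omega> w * h (w, snd (\<zeta>, \<sigma> \<tau>)) $ i) (fst (\<zeta>, \<sigma> \<tau>))) $ i) holomorphic_on T"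
      unfolding cint_def by (auto intro!: holomorphic_intros)
  qed
qed

definition Wop :: "complex \<Rightarrow> complex \<Rightarrow> (complex \<Rightarrow> real) \<Rightarrow> (complex \<times> (complex ^ 'n) \<Rightarrow> complex ^ 'm) \<Rightarrow> complex \<times> (complex ^ 'n) \<Rightarrow> complex ^ 'm" where
  "Wop p q \<omega> h = (\<lambda>a. \<chi> i. rcauchy p q (\<lambda>w. of_real (\<omega> w) * h (w, snd a) $ i) (fst a))"

text \<open>Inside the rectangle this is the Cauchy integral of the weighted function (lemma
  \<open>Uop_eq_Wop\<close>); subtracting the weight at the evaluation point cancels the singularity of
  the kernel, so that the formula stays bounded and continuous up to the boundary.\<close>

definition Uop :: "complex \<Rightarrow> complex \<Rightarrow> (complex \<times> (complex ^ 'n) \<Rightarrow> complex ^ 'm) \<Rightarrow> complex \<times> (complex ^ 'n) \<Rightarrow> complex ^ 'm" where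
  "Uop p q h = (\<lambda>a. \<chi> i. rcauchy p q (\<lambda>w. of_real (rchi p q w - rchi p q (fst a)) * h (w, snd a) $ i) (fst a)
      + of_real (rchi p q (fst a)) * h a $ i)"

text \<open>An edge on which the weight vanishes contributes nothing, so \<Omega> may cross it. This
  is how the two parts of the splitting extend beyond the rectangle into half strips.\<close>

lemma Wop_jholo:
  fixes h :: "complex \<times> (complex ^ 'n) \<Rightarrow> complex ^ 'm"
  assumes pq: "Re p < Re q" "Im p < Im q" and h: "chol p q B h" and \<Omega>: "open \<Omega>" and \<omega>: "continuous_on UNIV \<omega>"
    and e: "\<And>x y. (x, y) \<in> edges p q \<Longrightarrow> closed_segment x y \<inter> \<Omega> = {} \<or> (\<forall>w\<in>closed_segment x y. \<omega> w = 0)"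
  shows "jholo (\<Omega> \<times> B) (Wop p q \<omega> h)"
proof -
  have E: "jholo (\<Omega> \<times> B) (\<lambda>a. \<chi> i. cint x y (\<lambda>w. of_real (\<omega> w) * h (w, snd a) $ i) (fst a))" if xy: "(x, y) \<in> edges p q" for x y
    using e[OF xy]
  proof
    assume d: "closed_segment x y \<inter> \<Omega> = {}"
    show ?thesis
    proof (rule edge_jholo[OF _ _ _ \<Omega>])
      show "continuous_on (closed_segment x y) (\<lambda>w. complex_of_real (\<omega> w))"
        by (intro continuous_intros continuous_on_subset[OF \<omega>]) auto
      show "continuous_on (closed_segment x y \<times> B) h"
        using h edge_subset(1)[OF pq xy] by (auto simp: chol_def intro: continuous_on_subset)
      show "vholo T (\<lambda>\<tau>. h (w, \<sigma> \<tau>))" if "w \<in> closed_segment x y" "open T" "vholo T \<sigma>" "\<sigma> ` T \<subseteq> B" for w T \<sigma>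
        by (rule chol_param[OF pq h]) (use that edge_subset(1)[OF pq xy] in auto)
    qed (use d in auto)
  next
    assume z: "\<forall>w\<in>closed_segment x y. \<omega> w = 0"
    have "cint x y (\<lambda>w. of_real (\<omega> w) * h (w, s) $ i) \<zeta> = 0" for s i \<zeta>
      using cint_cong[of x y "\<lambda>w. of_real (\<omega> w) * h (w, s) $ i" "\<lambda>w. 0" \<zeta>] z by (simp add: cint_def)
    thus ?thesis by (simp add: jholo_const)
  qed
  have "jholo (\<Omega> \<times> B) (\<lambda>a. (1 / (2 * of_real pi * \<i>)) *s (
      (\<chi> i. cint p (Complex (Re q) (Im p)) (\<lambda>w. of_real (\<omega> w) * h (w, snd a) $ i) (fst a)) +
      (\<chi> i. cint (Complex (Re q) (Im p)) q (\<lambda>w. of_real (\<omega> w) * h (w, snd a) $ i) (fst a)) +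
      (\<chi> i. cint q (Complex (Re p) (Im q)) (\<lambda>w. of_real (\<omega> w) * h (w, snd a) $ i) (fst a)) +
      (\<chi> i. cint (Complex (Re p) (Im q)) p (\<lambda>w. of_real (\<omega> w) * h (w, snd a) $ i) (fst a))))"
    by (intro jholo_cmult jholo_add E) (auto simp: edges_def)
  thus ?thesis
    by (rule jholo_cong[rotated]) (simp add: Wop_def rcauchy_def bsum_def vec_eq_iff add_divide_distrib)
qed

lemma bsum_diff: "bsum p q (\<lambda>x y. F x y - G x y) = bsum p q F - bsum p q G"
  and bsum_cmult: "bsum p q (\<lambda>x y. c * F x y) = c * bsum p q F"
  by (simp_all add: bsum_def algebra_simps)

text \<open>Splitting off the constant weight \<omega> \<zeta> isolates a multiple of Cauchy's
  formula for h; the weight that remains vanishes at \<zeta>.\<close>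

lemma rcauchy_subtract:
  assumes pq: "Re p < Re q" "Im p < Im q" and h: "continuous_on (cbox p q) h" "h holomorphic_on box p q"
    and \<omega>: "continuous_on UNIV \<omega>" and z: "\<zeta> \<in> box p q"
  shows "rcauchy p q (\<lambda>w. of_real (\<omega> w) * h w) \<zeta> = rcauchy p q (\<lambda>w. of_real (\<omega> w - \<omega> \<zeta>) * h w) \<zeta> + of_real (\<omega> \<zeta>) * h \<zeta>"
proof -
  have c: "cint x y (\<lambda>w. of_real (\<omega> w - \<omega> \<zeta>) * h w) \<zeta> = cint x y (\<lambda>w. of_real (\<omega> w) * h w) \<zeta> - of_real (\<omega> \<zeta>) * cint x y h \<zeta>"
    if xy: "(x, y) \<in> edges p q" for x y
  proof -
    have z': "\<zeta> \<notin> closed_segment x y" using edge_subset(2)[OF pq xy] z by blast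
    have ch: "continuous_on (closed_segment x y) h" using edge_subset(1)[OF pq xy] h by (auto intro: continuous_on_subset)
    have cw: "continuous_on (closed_segment x y) (\<lambda>w. complex_of_real (\<omega> w))"
        by (intro continuous_intros continuous_on_subset[OF \<omega>]) auto
    have "cint x y (\<lambda>w. of_real (\<omega> w) * h w - of_real (\<omega> \<zeta>) * h w) \<zeta> = cint x y (\<lambda>w. of_real (\<omega> w) * h w) \<zeta> - cint x y (\<lambda>w. of_real (\<omega> \<zeta>) * h w) \<zeta>"
      by (rule cint_diff) (intro off_segment_integrable continuous_intros ch cw z')+
    thus ?thesis unfolding cint_cmult of_real_diff left_diff_distrib .
  qed
  have "bsum p q (\<lambda>x y. cint x y (\<lambda>w. of_real (\<omega> w - \<omega> \<zeta>) * h w) \<zeta>)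
     = bsum p q (\<lambda>x y. cint x y (\<lambda>w. of_real (\<omega> w) * h w) \<zeta> - of_real (\<omega> \<zeta>) * cint x y h \<zeta>)"
    by (rule bsum_cong) (rule c)
  hence "rcauchy p q (\<lambda>w. of_real (\<omega> w - \<omega> \<zeta>) * h w) \<zeta> = rcauchy p q (\<lambda>w. of_real (\<omega> w) * h w) \<zeta> - of_real (\<omega> \<zeta>) * rcauchy p q h \<zeta>"
    unfolding rcauchy_def bsum_diff bsum_cmult by (simp add: diff_divide_distrib)
  thus ?thesis using rcauchy_formula[OF pq h z] by simp
qed

lemma chol_slice:
  fixes h :: "complex \<times> (complex ^ 'n) \<Rightarrow> complex ^ 'm"
  assumes "chol p q B h" "s \<in> B"
  shows "continuous_on (cbox p q) (\<lambda>w. h (w, s) $ i)" "(\<lambda>w. h (w, s) $ i) holomorphic_on box p q"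
proof -
  show "continuous_on (cbox p q) (\<lambda>w. h (w, s) $ i)"
    by (rule bounded_linear.continuous_on[OF bounded_linear_vec_nth], rule continuous_on_compose2[of "cbox p q \<times> B" h])
       (use assms in \<open>auto simp: chol_def intro!: continuous_intros\<close>)
  have "vholo (box p q) (\<lambda>w. h (w, s))"
    by (rule jholo_curve[of "box p q \<times> B"]) (use assms in \<open>auto simp: chol_def\<close>)
  thus "(\<lambda>w. h (w, s) $ i) holomorphic_on box p q" by (simp add: vholo_def)
qed

lemma Uop_eq_Wop:
  assumes pq: "Re p < Re q" "Im p < Im q" and h: "chol p q B h" and a: "a \<in> box p q \<times> B"
  shows "Uop p q h a = Wop p q (rchi p q) h a"
  using rcauchy_subtract[OF pq chol_slice[OF h] rchi_props(6)[OF pq(1)], of "snd a" "fst a"] a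
  by (auto simp: Uop_def Wop_def vec_eq_iff)

text \<open>The two weights differ by the constant one, for which the Cauchy integral reproduces h.
  This is the additive Cousin splitting of h.\<close>

lemma Wop_split:
  assumes pq: "Re p < Re q" "Im p < Im q" and h: "chol p q B h" and a: "a \<in> box p q \<times> B"
  shows "Wop p q (rchi p q) h a - Wop p q (\<lambda>w. rchi p q w - 1) h a = h a"
proof -
  have 1: "continuous_on UNIV (\<lambda>w. rchi p q w - 1)" by (intro continuous_intros rchi_props(6)[OF pq(1)])
  show ?thesis
    using rcauchy_subtract[OF pq chol_slice[OF h] rchi_props(6)[OF pq(1)], of "snd a" "fst a"]
      rcauchy_subtract[OF pq chol_slice[OF h] 1, of "snd a" "fst a"] a
    by (auto simp: Wop_def vec_eq_iff algebra_simps)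
qed

text \<open>The bound for the splitting operator, up to the dimension: the Lipschitz constant
  1/width of the weight times width plus height bounds the integral, and 1 accounts for the added
  term, whose weight is at most one.\<close>

definition Cop :: "complex \<Rightarrow> complex \<Rightarrow> real" where
  "Cop p q = ((Re q - Re p) + (Im q - Im p)) / (Re q - Re p) + 1"

lemma Cop_pos: "Re p < Re q \<Longrightarrow> Im p < Im q \<Longrightarrow> Cop p q \<ge> 1"
  by (simp add: Cop_def)

lemma rcauchy_weight_bound:
  assumes pq: "Re p < Re q" "Im p < Im q" and m: "\<And>w. w \<in> cbox p q \<Longrightarrow> cmod (h w) \<le> m"
    and \<omega>: "\<And>w. \<bar>\<omega> w\<bar> \<le> 1 / (Re q - Re p) * cmod (w - \<zeta>)"
  shows "cmod (rcauchy p q (\<lambda>w. of_real (\<omega> w) * h w) \<zeta>) \<le> (Cop p q - 1) * m"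
proof -
  have "p \<in> cbox p q" using pq by (auto simp: in_cbox_complex_iff)
  hence m0: "m \<ge> 0" using order.trans[OF norm_ge_zero m] by blast
  have "cmod (rcauchy p q (\<lambda>w. of_real (\<omega> w) * h w) \<zeta>) \<le> (1 / (Re q - Re p) * m) * ((Re q - Re p) + (Im q - Im p))"
  proof (rule rcauchy_bound[OF pq])
    show "0 \<le> 1 / (Re q - Re p) * m" using pq m0 by simp
    fix w assume w: "w \<in> cbox p q"
    have "cmod (of_real (\<omega> w) * h w) = \<bar>\<omega> w\<bar> * cmod (h w)" by (simp add: norm_mult)
    also have "\<dots> \<le> (1 / (Re q - Re p) * cmod (w - \<zeta>)) * m"
      using pq by (intro mult_mono \<omega> m w) auto
    finally show "cmod (of_real (\<omega> w) * h w) \<le> 1 / (Re q - Re p) * m * cmod (w - \<zeta>)" by (simp add: algebra_simps)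
  qed
  thus ?thesis by (simp add: Cop_def field_simps)
qed

text \<open>The operator acts in the base variable alone, so h is needed only over the fibre point
  s. Contraction and vanishing on the zero section can therefore be read off fibre point by fibre
  point.\<close>

lemma Uop_bound:
  fixes h :: "complex \<times> (complex ^ 'n) \<Rightarrow> complex ^ 'm"
  assumes pq: "Re p < Re q" "Im p < Im q" and m: "\<And>w. w \<in> cbox p q \<Longrightarrow> norm (h (w, s)) \<le> m" and z: "\<zeta> \<in> cbox p q"
  shows "norm (Uop p q h (\<zeta>, s)) \<le> real CARD('m) * (Cop p q * m)"
proof (rule norm_vec_le_card)
  fix i
  have m': "cmod (h (w, s) $ i) \<le> m" if "w \<in> cbox p q" for w
    using order.trans[OF Finite_Cartesian_Product.norm_nth_le m[OF that]] .
  have 1: "cmod (rcauchy p q (\<lambda>w. of_real (rchi p q w - rchi p q \<zeta>) * h (w, s) $ i) \<zeta>) \<le> (Cop p q - 1) * m"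
    by (rule rcauchy_weight_bound[OF pq m' rchi_props(5)[OF pq(1)]])
  have "cmod (of_real (rchi p q \<zeta>) * h (\<zeta>, s) $ i) \<le> 1 * m"
    unfolding norm_mult using rchi_props(1,2)[OF pq(1), of \<zeta>]
    by (intro mult_mono m' z) auto
  thus "cmod (Uop p q h (\<zeta>, s) $ i) \<le> Cop p q * m" using 1
    by (auto simp: Uop_def algebra_simps intro: order.trans[OF norm_triangle_ineq])
qed

text \<open>Meant for \<zeta> on the far side of the edge that the weight removes: the weight is 0
  at \<zeta>, so its Lipschitz bound already cancels the kernel and no correction term
  arises.\<close>

lemma Wop_bound_zero:
  fixes h :: "complex \<times> (complex ^ 'n) \<Rightarrow> complex ^ 'm"
  assumes pq: "Re p < Re q" "Im p < Im q" and m: "\<And>w. w \<in> cbox p q \<Longrightarrow> norm (h (w, s)) \<le> m"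
    and \<omega>: "\<And>w. \<bar>\<omega> w\<bar> \<le> 1 / (Re q - Re p) * cmod (w - \<zeta>)"
  shows "norm (Wop p q \<omega> h (\<zeta>, s)) \<le> real CARD('m) * (Cop p q * m)"
proof (rule norm_vec_le_card)
  fix i
  have m': "cmod (h (w, s) $ i) \<le> m" if "w \<in> cbox p q" for w
    using order.trans[OF Finite_Cartesian_Product.norm_nth_le m[OF that]] .
  have "p \<in> cbox p q" using pq by (auto simp: in_cbox_complex_iff)
  hence "m \<ge> 0" using order.trans[OF norm_ge_zero m] by blast
  thus "cmod (Wop p q \<omega> h (\<zeta>, s) $ i) \<le> Cop p q * m"
    using rcauchy_weight_bound[of p q "\<lambda>w. h (w, s) $ i" m \<omega> \<zeta>, OF pq m' \<omega>] by (simp add: Wop_def algebra_simps)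
qed

lemma Uop_diff:
  fixes h h' :: "complex \<times> (complex ^ 'n) \<Rightarrow> complex ^ 'm"
  assumes pq: "Re p < Re q" "Im p < Im q" and h: "chol p q B h" and h': "chol p q B h'" and s: "s \<in> B"
  shows "Uop p q h (\<zeta>, s) - Uop p q h' (\<zeta>, s) = Uop p q (\<lambda>a. h a - h' a) (\<zeta>, s)"
proof -
  let ?k = "\<lambda>(h :: complex \<times> (complex ^ 'n) \<Rightarrow> complex ^ 'm) i w. of_real (rchi p q w - rchi p q \<zeta>) * h (w, s) $ i"
  have int: "(\<lambda>t. ?k h i (linepath x y t) / (linepath x y t - \<zeta>)) integrable_on {0..1}"
    if xy: "(x, y) \<in> edges p q" and h: "chol p q B h" for x y i h
  proof -
    have ch: "continuous_on (cbox p q) (\<lambda>w. h (w, s) $ i)" by (rule chol_slice[OF h s])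
    hence "bounded ((\<lambda>w. h (w, s) $ i) ` cbox p q)" by (intro compact_imp_bounded compact_continuous_image) auto
    then obtain m where m: "\<And>w. w \<in> cbox p q \<Longrightarrow> cmod (h (w, s) $ i) \<le> m" by (auto simp: bounded_iff)
    show ?thesis
    proof (rule cint_integrable[OF _ _ edge_subset(3)[OF pq xy]])
      show "continuous_on (closed_segment x y) (?k h i)"
        by (intro continuous_intros continuous_on_subset[OF ch] rchi_props(6)[OF pq(1)] edge_subset(1)[OF pq xy])
      fix w assume "w \<in> closed_segment x y"
      hence w: "w \<in> cbox p q" using edge_subset(1)[OF pq xy] by auto
      have "cmod (?k h i w) = \<bar>rchi p q w - rchi p q \<zeta>\<bar> * cmod (h (w, s) $ i)" by (simp add: norm_mult flip: of_real_diff)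
      also have "\<dots> \<le> (1 / (Re q - Re p) * cmod (w - \<zeta>)) * m"
        using pq by (intro mult_mono rchi_props(5) m w) auto
      finally show "cmod (?k h i w) \<le> (1 / (Re q - Re p) * m) * cmod (w - \<zeta>)" by (simp add: algebra_simps)
    qed
  qed
  have "cint x y (?k (\<lambda>a. h a - h' a) i) \<zeta> = cint x y (?k h i) \<zeta> - cint x y (?k h' i) \<zeta>" if "(x, y) \<in> edges p q" for x y i
    using cint_diff[OF int[OF that h] int[OF that h'], of i i] by (simp add: algebra_simps)
  hence "bsum p q (\<lambda>x y. cint x y (?k (\<lambda>a. h a - h' a) i) \<zeta>) = bsum p q (\<lambda>x y. cint x y (?k h i) \<zeta> - cint x y (?k h' i) \<zeta>)" for i
    by (intro bsum_cong)
  hence "rcauchy p q (?k (\<lambda>a. h a - h' a) i) \<zeta> = rcauchy p q (?k h i) \<zeta> - rcauchy p q (?k h' i) \<zeta>" for i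
    unfolding rcauchy_def bsum_diff by (simp add: diff_divide_distrib)
  thus ?thesis by (simp add: Uop_def vec_eq_iff algebra_simps)
qed

text \<open>Inside the rectangle the operator equals \<open>Wop\<close> and is holomorphic; up to
  the boundary continuity follows edge by edge from \<open>cint_tendsto\<close>, with the growth
  condition supplied by the Lipschitz weight and the bound m.\<close>

lemma Uop_chol:
  fixes h :: "complex \<times> (complex ^ 'n) \<Rightarrow> complex ^ 'm"
  assumes pq: "Re p < Re q" "Im p < Im q" and h: "chol p q B h" and m: "\<And>a. a \<in> cbox p q \<times> B \<Longrightarrow> norm (h a) \<le> m"
  shows "chol p q B (Uop p q h)"
  unfolding chol_def
proof
  have hc: "continuous_on (cbox p q \<times> B) h" using h by (simp add: chol_def)
  have "jholo (box p q \<times> B) (Wop p q (rchi p q) h)"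
    by (rule Wop_jholo[OF pq h open_box rchi_props(6)[OF pq(1)]]) (use edge_subset(2)[OF pq] in blast)
  thus "jholo (box p q \<times> B) (Uop p q h)" by (rule jholo_cong[rotated]) (simp add: Uop_eq_Wop[OF pq h])
  show "continuous_on (cbox p q \<times> B) (Uop p q h)"
    unfolding Uop_def
  proof (intro continuous_on_vec_lambda continuous_on_add)
    fix i
    have "continuous_on (cbox p q \<times> B) (\<lambda>a. rchi p q (fst a))"
      by (rule continuous_on_compose2[OF rchi_props(6)[OF pq(1), of UNIV]]) (auto intro!: continuous_intros)
    thus "continuous_on (cbox p q \<times> B) (\<lambda>a. of_real (rchi p q (fst a)) * h a $ i)"
      by (intro continuous_intros bounded_linear.continuous_on[OF bounded_linear_vec_nth] hc)
    show "continuous_on (cbox p q \<times> B) (\<lambda>a. rcauchy p q (\<lambda>w. of_real (rchi p q w - rchi p q (fst a)) * h (w, snd a) $ i) (fst a))"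
      unfolding continuous_on_sequentially o_def
    proof (intro allI ballI impI, elim conjE)
      fix X a assume a: "a \<in> cbox p q \<times> B" and X: "\<forall>n. X n \<in> cbox p q \<times> B" and lim: "X \<longlonglongrightarrow> a"
      have l1: "(\<lambda>n. fst (X n)) \<longlonglongrightarrow> fst a" using lim by (rule tendsto_fst)
      have l2: "(\<lambda>n. snd (X n)) \<longlonglongrightarrow> snd a" using lim by (rule tendsto_snd)
      have E: "(\<lambda>n. cint x y (\<lambda>w. of_real (rchi p q w - rchi p q (fst (X n))) * h (w, snd (X n)) $ i) (fst (X n)))
        \<longlonglongrightarrow> cint x y (\<lambda>w. of_real (rchi p q w - rchi p q (fst a)) * h (w, snd a) $ i) (fst a)"
        if xy: "(x, y) \<in> edges p q" for x y
      proof (rule cint_tendsto[OF _ _ l1 _ edge_subset(3)[OF pq xy]])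
        fix n
        have sB: "snd (X n) \<in> B" using X by (metis mem_Times_iff)
        show "continuous_on (closed_segment x y) (\<lambda>w. of_real (rchi p q w - rchi p q (fst (X n))) * h (w, snd (X n)) $ i)"
          by (intro continuous_intros continuous_on_subset[OF chol_slice(1)[OF h sB]] rchi_props(6)[OF pq(1)] edge_subset(1)[OF pq xy])
        fix w assume "w \<in> closed_segment x y"
        hence w: "w \<in> cbox p q" using edge_subset(1)[OF pq xy] by auto
        have "cmod (of_real (rchi p q w - rchi p q (fst (X n))) * h (w, snd (X n)) $ i) = \<bar>rchi p q w - rchi p q (fst (X n))\<bar> * cmod (h (w, snd (X n)) $ i)"
          by (simp add: norm_mult flip: of_real_diff)
        also have "\<dots> \<le> (1 / (Re q - Re p) * cmod (w - fst (X n))) * m"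
          using pq by (intro mult_mono rchi_props(5) order.trans[OF Finite_Cartesian_Product.norm_nth_le m]) (use w sB in auto)
        finally show "cmod (of_real (rchi p q w - rchi p q (fst (X n))) * h (w, snd (X n)) $ i) \<le> (1 / (Re q - Re p) * m) * cmod (w - fst (X n))"
          by (simp add: algebra_simps)
      next
        fix w assume "w \<in> closed_segment x y"
        hence w: "w \<in> cbox p q" using edge_subset(1)[OF pq xy] by auto
        have "(\<lambda>n. rchi p q (fst (X n))) \<longlonglongrightarrow> rchi p q (fst a)"
          using rchi_props(6)[OF pq(1), of UNIV] l1 by (rule continuous_on_tendsto_compose) auto
        moreover have "(\<lambda>n. h (w, snd (X n))) \<longlonglongrightarrow> h (w, snd a)"
          by (rule continuous_on_tendsto_compose[OF hc])
             (use w a X in \<open>auto intro!: tendsto_intros l2 always_eventually simp: mem_Times_iff\<close>)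
        ultimately show "(\<lambda>n. of_real (rchi p q w - rchi p q (fst (X n))) * h (w, snd (X n)) $ i) \<longlonglongrightarrow> of_real (rchi p q w - rchi p q (fst a)) * h (w, snd a) $ i"
          by (intro tendsto_intros)
      qed
      show "(\<lambda>n. rcauchy p q (\<lambda>w. of_real (rchi p q w - rchi p q (fst (X n))) * h (w, snd (X n)) $ i) (fst (X n)))
         \<longlonglongrightarrow> rcauchy p q (\<lambda>w. of_real (rchi p q w - rchi p q (fst a)) * h (w, snd a) $ i) (fst a)"
        unfolding rcauchy_def bsum_def by (intro tendsto_intros E) (auto simp: edges_def)
    qed
  qed
qed

lemma chol_jholo_slice:
  assumes pq: "Re p < Re q" "Im p < Im q" and h: "chol p q B h" and w: "w \<in> cbox p q"
  shows "jholo ({w} \<times> B) h"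
  unfolding jholo_def
proof (intro conjI allI impI)
  show "continuous_on ({w} \<times> B) h" using h w by (auto simp: chol_def intro: continuous_on_subset)
  fix T g \<sigma> assume T: "open T" "vholo T \<sigma>" and W: "\<forall>\<tau>\<in>T. (g \<tau>, \<sigma> \<tau>) \<in> {w} \<times> B"
  have "vholo T (\<lambda>\<tau>. h (w, \<sigma> \<tau>))" by (rule chol_param[OF pq h w T]) (use W in auto)
  thus "vholo T (\<lambda>\<tau>. h (g \<tau>, \<sigma> \<tau>))" using W by (subst vholo_cong[where \<rho> = "\<lambda>\<tau>. h (w, \<sigma> \<tau>)"]) auto
qed

text \<open>The contraction converges without shrinking the rectangle because the splitting operator
  is bounded in the supremum norm up to the boundary.\<close>

lemma nonlinear_splitting:
  fixes e :: "complex \<times> (complex ^ 'n) \<Rightarrow> complex ^ 'n"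
  assumes pq: "Re p < Re q" "Im p < Im q" and \<delta>: "\<delta> > 0"
    and e: "chol p q (ball 0 (4 * \<delta>)) e"
    and m: "\<And>a. a \<in> cbox p q \<times> ball 0 (4 * \<delta>) \<Longrightarrow> norm (e a) \<le> m"
    and small: "16 * real CARD('n) * (real CARD('n) * Cop p q) * m \<le> \<delta>"
    and e0: "\<And>w. w \<in> cbox p q \<Longrightarrow> e (w, 0) = 0"
  defines "\<Omega>1 \<equiv> {\<zeta>. Im p < Im \<zeta> \<and> Im \<zeta> < Im q \<and> Re \<zeta> < Re q}"
    and "\<Omega>2 \<equiv> {\<zeta>. Im p < Im \<zeta> \<and> Im \<zeta> < Im q \<and> Re p < Re \<zeta>}"
  obtains u1 u2 where "jholo (\<Omega>1 \<times> ball 0 \<delta>) u1" "jholo (\<Omega>2 \<times> ball 0 \<delta>) u2"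
    "\<And>a. a \<in> \<Omega>1 \<times> ball 0 \<delta> \<Longrightarrow> norm (u1 a) \<le> \<delta> / (8 * real CARD('n))"
    "\<And>a. a \<in> \<Omega>2 \<times> ball 0 \<delta> \<Longrightarrow> norm (u2 a) \<le> \<delta> / (8 * real CARD('n))"
    "\<And>\<zeta>. u1 (\<zeta>, 0) = 0" "\<And>\<zeta>. u2 (\<zeta>, 0) = 0"
    "\<And>\<zeta> s. \<zeta> \<in> box p q \<Longrightarrow> s \<in> ball 0 \<delta> \<Longrightarrow> e (\<zeta>, s + u1 (\<zeta>, s)) = u2 (\<zeta>, s) - u1 (\<zeta>, s)"
proof -
  let ?N = "real CARD('n)"
  define K where "K = ?N * Cop p q"
  have N1: "?N \<ge> 1" using one_le_card_finite[where 'a='n] by linarith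
  have K1: "K \<ge> 1" using mult_mono[OF N1 Cop_pos[OF pq]] by (simp add: K_def)
  have pc: "p \<in> cbox p q" using pq by (auto simp: in_cbox_complex_iff)
  have m0: "m \<ge> 0" using m[of "(p, 0)"] e0[OF pc] pc \<delta> by simp
  have sm: "K * m \<le> \<delta> / (16 * ?N)" using small N1 unfolding K_def by (simp add: field_simps)
  have Km: "K * m \<le> \<delta> / 8"
  proof -
    have "\<delta> / (16 * ?N) \<le> \<delta> / 8" using \<delta> N1 by (intro divide_left_mono; linarith)
    thus ?thesis using sm by linarith
  qed
  let ?B = "ball (0 :: complex ^ 'n) \<delta>"
  \<comment> \<open>The equation sought is \<open>u1 - u2 = - e (\<zeta>, s + u1)\<close>. Splitting
    its right-hand side with \<open>Uop\<close> turns it into the fixed point problem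
    \<open>u = Uop p q (h u)\<close>.\<close>
  define h where "h = (\<lambda>(u :: complex \<times> (complex ^ 'n) \<Rightarrow> complex ^ 'n) a. - e (fst a, snd a + u a))"
  define G where "G = (\<lambda>u :: complex \<times> (complex ^ 'n) \<Rightarrow> complex ^ 'n. chol p q ?B u \<and> (\<forall>a\<in>cbox p q \<times> ?B. norm (u a) \<le> \<delta>) \<and> (\<forall>w\<in>cbox p q. u (w, 0) = 0))"
  \<comment> \<open>Arguments of e stay within radius 2\<delta>, half of the radius on which e is
    bounded, as \<open>jholo_lipschitz\<close> requires.\<close>
  have inB: "(fst a, snd a + u a) \<in> cbox p q \<times> ball 0 (2 * \<delta>)" if "G u" "a \<in> cbox p q \<times> ?B" for u a
  proof -
    have "norm (u a) \<le> \<delta>" "norm (snd a) < \<delta>" "fst a \<in> cbox p q" using that by (auto simp: G_def)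
    thus ?thesis using norm_triangle_ineq[of "snd a" "u a"] by auto
  qed
  have inB4: "(fst a, snd a + u a) \<in> cbox p q \<times> ball 0 (4 * \<delta>)" if "G u" "a \<in> cbox p q \<times> ?B" for u a
    using inB[OF that] \<delta> by auto
  have hb: "norm (h u a) \<le> m" if "G u" "a \<in> cbox p q \<times> ?B" for u a
    using m[OF inB4[OF that]] by (simp add: h_def)
  have hchol: "chol p q ?B (h u)" if "G u" for u
    unfolding chol_def
  proof
    have uc: "continuous_on (cbox p q \<times> ?B) u" and uj: "jholo (box p q \<times> ?B) u" using that by (auto simp: G_def chol_def)
    have "continuous_on (cbox p q \<times> ?B) (\<lambda>a. e (fst a, snd a + u a))"
      by (rule continuous_on_compose2[of "cbox p q \<times> ball 0 (4 * \<delta>)" e])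
         (use e inB4[OF that] in \<open>auto simp: chol_def intro!: continuous_intros uc\<close>)
    thus "continuous_on (cbox p q \<times> ?B) (h u)" unfolding h_def by (intro continuous_intros)
    have "jholo (box p q \<times> ?B) (\<lambda>a. e (fst a, snd a + u a))"
    proof (rule jholo_compose[of "box p q \<times> ball 0 (4 * \<delta>)" e])
      show "jholo (box p q \<times> ball 0 (4 * \<delta>)) e" using e by (simp add: chol_def)
      show "jholo (box p q \<times> ?B) (\<lambda>a. snd a + u a)" by (intro jholo_add jholo_snd uj)
      show "(fst a, snd a + u a) \<in> box p q \<times> ball 0 (4 * \<delta>)" if a: "a \<in> box p q \<times> ?B" for a
        using inB4[OF \<open>G u\<close>, of a] a box_subset_cbox[of p q] by auto
    qed
    thus "jholo (box p q \<times> ?B) (h u)" unfolding h_def by (rule jholo_minus)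
  qed
  have hlip: "norm (h u a - h v a) \<le> ?N * (m / \<delta>) * norm (u a - v a)"
    if u: "G u" and v: "G v" and a: "a \<in> cbox p q \<times> ?B" for u v a
  proof -
    have "norm (e (fst a, snd a + u a) - e (fst a, snd a + v a)) \<le> ?N * (4 * m / (4 * \<delta>)) * norm ((snd a + u a) - (snd a + v a))"
    proof (rule jholo_lipschitz[OF chol_jholo_slice[OF pq e] order.refl])
      show "fst a \<in> cbox p q" using a by auto
      thus "norm (e (fst a, s)) \<le> m" if "s \<in> ball 0 (4 * \<delta>)" for s using m that by auto
      show "snd a + u a \<in> ball 0 (4 * \<delta> / 2)" "snd a + v a \<in> ball 0 (4 * \<delta> / 2)"
        using inB[OF u a] inB[OF v a] by auto
    qed
    thus ?thesis by (simp add: h_def norm_minus_commute)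
  qed
  have hlip': "norm (h u a - h v a) \<le> D / (2 * K)" if "G u" "G v" "a \<in> cbox p q \<times> ?B" "norm (u a - v a) \<le> D" for u v a D
  proof -
    have D0: "D \<ge> 0" using order.trans[OF norm_ge_zero that(4)] .
    \<comment> \<open>The Lipschitz constant beats the operator bound K by a factor two, so that the
      iteration contracts by one half.\<close>
    have "?N * (m / \<delta>) \<le> 1 / (2 * K)"
    proof -
      have "16 * (?N * K * m) \<le> \<delta>" using small by (simp add: K_def mult.assoc)
      moreover have "0 \<le> ?N * K * m" using N1 K1 m0 by simp
      ultimately have "2 * (?N * K * m) \<le> \<delta>" by linarith
      thus ?thesis using K1 \<delta> by (simp add: field_simps)
    qed
    hence "?N * (m / \<delta>) * norm (u a - v a) \<le> 1 / (2 * K) * D"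
      using that(4) K1 D0 by (intro mult_mono) auto
    thus ?thesis using hlip[OF that(1-3)] by simp
  qed
  have Ulip: "norm (Uop p q (h u) (w, s) - Uop p q (h v) (w, s)) \<le> D / 2"
    if u: "G u" and v: "G v" and w: "w \<in> cbox p q" and s: "s \<in> ?B" and D: "\<And>w. w \<in> cbox p q \<Longrightarrow> norm (u (w, s) - v (w, s)) \<le> D" for u v w s D
  proof -
    have "norm (Uop p q (\<lambda>a. h u a - h v a) (w, s)) \<le> ?N * (Cop p q * (D / (2 * K)))"
      by (rule Uop_bound[OF pq _ w]) (use hlip'[OF u v] s D in auto)
    hence "norm (Uop p q (h u) (w, s) - Uop p q (h v) (w, s)) \<le> K * (D / (2 * K))"
      unfolding Uop_diff[OF pq hchol[OF u] hchol[OF v] s] by (simp only: K_def mult.assoc)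
    thus ?thesis using K1 by simp
  qed
  have GU: "G (Uop p q (h u))" if u: "G u" for u
    unfolding G_def
  proof (intro conjI ballI)
    show "chol p q ?B (Uop p q (h u))" by (rule Uop_chol[OF pq hchol[OF u] hb[OF u]])
    fix a assume a: "a \<in> cbox p q \<times> ?B"
    obtain w s where [simp]: "a = (w, s)" by force
    have "norm (Uop p q (h u) (w, s)) \<le> ?N * (Cop p q * m)"
      by (rule Uop_bound[OF pq]) (use hb[OF u] a in auto)
    thus "norm (Uop p q (h u) a) \<le> \<delta>" using Km \<delta> by (simp add: K_def mult.assoc)
  next
    fix w assume w: "w \<in> cbox p q"
    have "h u (x, 0) = 0" if "x \<in> cbox p q" for x using u that e0 by (auto simp: G_def h_def)
    hence "norm (Uop p q (h u) (w, 0)) \<le> ?N * (Cop p q * 0)" by (intro Uop_bound[OF pq _ w]) auto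
    thus "Uop p q (h u) (w, 0) = 0" by simp
  qed
  define u where "u = rec_nat (\<lambda>_. 0) (\<lambda>_ v. Uop p q (h v))"
  have u0: "u 0 = (\<lambda>_. 0)" and uS: "\<And>k. u (Suc k) = Uop p q (h (u k))" by (auto simp: u_def)
  have Gu: "G (u k)" for k
  proof (induction k)
    case 0
    show ?case using \<delta> by (auto simp: G_def u0 chol_def jholo_const)
  qed (simp add: uS GU)
  have D: "norm (u (Suc k) (w, s) - u k (w, s)) \<le> \<delta> / 2 ^ k" if s: "s \<in> ?B" and "w \<in> cbox p q" for k w s
    using that(2)
  proof (induction k arbitrary: w)
    case 0
    thus ?case using Gu[of 1] s by (auto simp: G_def u0)
  next
    case (Suc k)
    have "norm (Uop p q (h (u (Suc k))) (w, s) - Uop p q (h (u k)) (w, s)) \<le> (\<delta> / 2 ^ k) / 2"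
      by (rule Ulip[OF Gu Gu Suc.prems s Suc.IH])
    thus ?case by (simp add: uS field_simps)
  qed
  define l where "l = (\<lambda>a. suminf (\<lambda>k. u (Suc k) a - u k a))"
  have "uniform_limit (cbox p q \<times> ?B) (\<lambda>n a. \<Sum>k<n. u (Suc k) a - u k a) l sequentially"
    unfolding l_def
  proof (rule Weierstrass_m_test)
    show "norm (u (Suc k) a - u k a) \<le> \<delta> * (1 / 2) ^ k" if "a \<in> cbox p q \<times> ?B" for k a
      using D[of "snd a" "fst a" k] that by (auto simp: power_divide)
    show "summable (\<lambda>k. \<delta> * (1 / 2) ^ k)" by (intro summable_mult summable_geometric) auto
  qed
  moreover have "(\<Sum>k<n. u (Suc k) a - u k a) = u n a" for n a
    by (induction n) (auto simp: u0)
  ultimately have ul: "uniform_limit (cbox p q \<times> ?B) u l sequentially" by simp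
  have pt: "(\<lambda>k. u k a) \<longlonglongrightarrow> l a" if "a \<in> cbox p q \<times> ?B" for a
    using tendsto_uniform_limitI[OF ul that] .
  have Gl: "G l"
    unfolding G_def
  proof (intro conjI ballI)
    show "chol p q ?B l" unfolding chol_def
    proof
      show "continuous_on (cbox p q \<times> ?B) l"
        by (rule uniform_limit_theorem[OF _ ul]) (use Gu in \<open>auto simp: G_def chol_def\<close>)
      show "jholo (box p q \<times> ?B) l"
        by (rule jholo_uniform_limit[of _ u])
           (use Gu box_subset_cbox[of p q] in \<open>auto simp: G_def chol_def intro!: uniform_limit_on_subset[OF ul]\<close>)
    qed
    show "norm (l a) \<le> \<delta>" if a: "a \<in> cbox p q \<times> ?B" for a
      using Lim_norm_ubound[OF _ pt[OF a]] Gu a by (auto simp: G_def)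
    show "l (w, 0) = 0" if w: "w \<in> cbox p q" for w
    proof (rule LIMSEQ_unique[OF pt])
      show "(\<lambda>k. u k (w, 0)) \<longlonglongrightarrow> 0" using Gu w by (simp add: G_def)
    qed (use w \<delta> in auto)
  qed
  have fixpt: "l (w, s) = Uop p q (h l) (w, s)" if w: "w \<in> cbox p q" and s: "s \<in> ?B" for w s
  proof (rule LIMSEQ_unique)
    show "(\<lambda>k. u (Suc k) (w, s)) \<longlonglongrightarrow> l (w, s)" using LIMSEQ_Suc[OF pt] w s by auto
    show "(\<lambda>k. u (Suc k) (w, s)) \<longlonglongrightarrow> Uop p q (h l) (w, s)"
    proof (rule tendstoI)
      fix r :: real assume r: "r > 0"
      have "\<forall>\<^sub>F k in sequentially. \<forall>a\<in>cbox p q \<times> ?B. dist (u k a) (l a) < r"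
        using ul r unfolding uniform_limit_iff by blast
      thus "\<forall>\<^sub>F k in sequentially. dist (u (Suc k) (w, s)) (Uop p q (h l) (w, s)) < r"
      proof eventually_elim
        case (elim k)
        have "norm (Uop p q (h (u k)) (w, s) - Uop p q (h l) (w, s)) \<le> r / 2"
          by (rule Ulip[OF Gu Gl w s]) (use elim s in \<open>auto simp: dist_norm less_imp_le\<close>)
        thus ?case using r by (simp add: uS dist_norm)
      qed
    qed
  qed
  \<comment> \<open>The solution is continued outside the rectangle: the same Cauchy integral,
    weighted by the cut-off and by the cut-off minus one, loses the left and the right edge
    respectively.\<close>
  define u1 where "u1 = Wop p q (rchi p q) (h l)"
  define u2 where "u2 = Wop p q (\<lambda>w. rchi p q w - 1) (h l)"
  have lin: "continuous_on UNIV (\<lambda>w. rchi p q w - 1)" by (intro continuous_intros rchi_props(6)[OF pq(1)])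
  have seg: "closed_segment x y \<inter> {\<zeta>. Im p < Im \<zeta> \<and> Im \<zeta> < Im q \<and> Re p < Re \<zeta> \<and> Re \<zeta> < Re q} = {}"
    if "(x, y) \<in> edges p q" for x y using edge_subset(2)[OF pq that] by (auto simp: in_box_complex_iff)
  have o1: "open \<Omega>1" and o2: "open \<Omega>2" unfolding \<Omega>1_def \<Omega>2_def
    by (intro open_Collect_conj open_Collect_less continuous_intros)+
  have j1: "jholo (\<Omega>1 \<times> ?B) u1" unfolding u1_def
  proof (rule Wop_jholo[OF pq hchol[OF Gl] o1 rchi_props(6)[OF pq(1)]])
    fix x y assume "(x, y) \<in> edges p q"
    thus "closed_segment x y \<inter> \<Omega>1 = {} \<or> (\<forall>w\<in>closed_segment x y. rchi p q w = 0)"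
      using pq by (auto simp: edges_def \<Omega>1_def closed_segment_same_Re closed_segment_same_Im intro!: rchi_props(3))
  qed
  have j2: "jholo (\<Omega>2 \<times> ?B) u2" unfolding u2_def
  proof (rule Wop_jholo[OF pq hchol[OF Gl] o2 lin])
    fix x y assume "(x, y) \<in> edges p q"
    thus "closed_segment x y \<inter> \<Omega>2 = {} \<or> (\<forall>w\<in>closed_segment x y. rchi p q w - 1 = 0)"
      using pq by (auto simp: edges_def \<Omega>2_def closed_segment_same_Re closed_segment_same_Im intro!: rchi_props(4))
  qed
  have eq1: "u1 (\<zeta>, s) = l (\<zeta>, s)" if "\<zeta> \<in> box p q" "s \<in> ?B" for \<zeta> s
    using fixpt[of \<zeta> s] Uop_eq_Wop[OF pq hchol[OF Gl], of "(\<zeta>, s)"] that box_subset_cbox[of p q] by (auto simp: u1_def)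
  have eq: "e (\<zeta>, s + u1 (\<zeta>, s)) = u2 (\<zeta>, s) - u1 (\<zeta>, s)" if "\<zeta> \<in> box p q" "s \<in> ?B" for \<zeta> s
  proof -
    have "u1 (\<zeta>, s) - u2 (\<zeta>, s) = h l (\<zeta>, s)" unfolding u1_def u2_def
      by (rule Wop_split[OF pq hchol[OF Gl]]) (use that in auto)
    also have "\<dots> = - e (\<zeta>, s + u1 (\<zeta>, s))" using eq1[OF that] by (simp add: h_def)
    finally show ?thesis by (simp add: algebra_simps)
  qed
  have bx: "norm (u1 (\<zeta>, s)) \<le> K * m" if "\<zeta> \<in> \<Omega>1" "s \<in> ?B" for \<zeta> s
  proof (cases "Re p < Re \<zeta>")
    case True
    hence z: "\<zeta> \<in> box p q" using that by (auto simp: \<Omega>1_def in_box_complex_iff)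
    have zc: "\<zeta> \<in> cbox p q" using z box_subset_cbox[of p q] by blast
    have "u1 (\<zeta>, s) = Uop p q (h l) (\<zeta>, s)" using eq1[OF z that(2)] fixpt[OF zc that(2)] by simp
    thus ?thesis using Uop_bound[OF pq, of "h l" s m \<zeta>] hb[OF Gl] that z box_subset_cbox[of p q]
      by (auto simp: K_def mult.assoc)
  next
    case False
    have "norm (u1 (\<zeta>, s)) \<le> ?N * (Cop p q * m)" unfolding u1_def
    proof (rule Wop_bound_zero[OF pq])
      show "norm (h l (w, s)) \<le> m" if "w \<in> cbox p q" for w using hb[OF Gl] that \<open>s \<in> ?B\<close> by auto
      show "\<bar>rchi p q w\<bar> \<le> 1 / (Re q - Re p) * cmod (w - \<zeta>)" for w
        using rchi_props(5)[OF pq(1), of w \<zeta>] rchi_props(3)[OF pq(1), of \<zeta>] False by simp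
    qed
    thus ?thesis by (simp add: K_def mult.assoc)
  qed
  have sm16: "K * m \<le> \<delta> / (8 * ?N)"
  proof -
    have "\<delta> / (16 * ?N) \<le> \<delta> / (8 * ?N)" using \<delta> N1 by (intro divide_left_mono mult_pos_pos; linarith)
    thus ?thesis using sm by linarith
  qed
  have bx2: "norm (u2 (\<zeta>, s)) \<le> ?N * (Cop p q * m)" if "\<not> Re \<zeta> < Re q" "s \<in> ?B" for \<zeta> s
    unfolding u2_def
  proof (rule Wop_bound_zero[OF pq])
    show "norm (h l (w, s)) \<le> m" if "w \<in> cbox p q" for w using hb[OF Gl] that \<open>s \<in> ?B\<close> by auto
    show "\<bar>rchi p q w - 1\<bar> \<le> 1 / (Re q - Re p) * cmod (w - \<zeta>)" for w
      using rchi_props(5)[OF pq(1), of w \<zeta>] rchi_props(4)[OF pq(1), of \<zeta>] that by simp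
  qed
  have bx2': "norm (u2 (\<zeta>, s)) \<le> \<delta> / (8 * ?N)" if z: "\<zeta> \<in> \<Omega>2" and s: "s \<in> ?B" for \<zeta> s
  proof (cases "Re \<zeta> < Re q")
    case True
    hence zb: "\<zeta> \<in> box p q" using z by (auto simp: \<Omega>2_def in_box_complex_iff)
    hence zc: "\<zeta> \<in> cbox p q" using box_subset_cbox[of p q] by blast
    have "u1 (\<zeta>, s) - u2 (\<zeta>, s) = h l (\<zeta>, s)" unfolding u1_def u2_def
      by (rule Wop_split[OF pq hchol[OF Gl]]) (use zb s in auto)
    hence "u2 (\<zeta>, s) = u1 (\<zeta>, s) - h l (\<zeta>, s)" by (simp add: algebra_simps)
    moreover have "norm (u1 (\<zeta>, s)) \<le> K * m" using bx[of \<zeta> s] z s True by (auto simp: \<Omega>1_def \<Omega>2_def)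
    moreover have "norm (h l (\<zeta>, s)) \<le> m" using hb[OF Gl] zc s by auto
    moreover have "m \<le> K * m" using K1 m0 by (simp add: mult_le_cancel_right1)
    \<comment> \<open>Here a factor two is lost against the bound for u1; the 16 in
      \<open>small\<close> leaves room for it and still yields
      \<open>\<delta> / (8 * ?N)\<close>.\<close>
    ultimately have "norm (u2 (\<zeta>, s)) \<le> 2 * (K * m)"
      using norm_triangle_ineq4[of "u1 (\<zeta>, s)" "h l (\<zeta>, s)"] by simp
    also have "\<dots> \<le> \<delta> / (8 * ?N)" using sm by simp
    finally show ?thesis .
  next
    case False
    have "norm (u2 (\<zeta>, s)) \<le> K * m" using bx2[OF False s] by (simp add: K_def mult.assoc)
    also have "\<dots> \<le> \<delta> / (8 * ?N)" using sm16 .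
    finally show ?thesis .
  qed
  have z0: "Wop p q \<omega> (h l) (\<zeta>, 0) = 0" for \<omega> \<zeta>
  proof -
    have z: "h l (w, 0) = 0" if "w \<in> cbox p q" for w using Gl that e0 by (auto simp: G_def h_def)
    have "cint x y (\<lambda>w. of_real (\<omega> w) * h l (w, 0) $ i) \<zeta> = 0" if "(x, y) \<in> edges p q" for x y i
      using cint_cong[of x y "\<lambda>w. of_real (\<omega> w) * h l (w, 0) $ i" "\<lambda>w. 0" \<zeta>] z edge_subset(1)[OF pq that]
      by (auto simp: cint_def subset_iff)
    thus ?thesis by (simp add: Wop_def rcauchy_def bsum_def edges_def vec_eq_iff)
  qed
  have bx1': "norm (u1 (\<zeta>, s)) \<le> \<delta> / (8 * ?N)" if "\<zeta> \<in> \<Omega>1" "s \<in> ?B" for \<zeta> s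
    using order.trans[OF bx[OF that] sm16] .
  show thesis
    by (rule that[of u1 u2, OF j1 j2 _ _ _ _ eq])
       (use bx1' bx2' in \<open>auto simp: u1_def u2_def z0\<close>)
qed

section \<open>Inverting small perturbations of the identity\<close>

lemma perturbation_solution_continuous:
  fixes u :: "complex \<times> (complex ^ 'n) \<Rightarrow> complex ^ 'n" and \<kappa> y :: "'a::topological_space \<Rightarrow> complex ^ 'n"
  assumes u: "continuous_on (\<Omega> \<times> ball 0 \<rho>) u"
    and lip: "\<And>\<zeta> s s'. \<zeta> \<in> \<Omega> \<Longrightarrow> s \<in> ball 0 \<rho> \<Longrightarrow> s' \<in> ball 0 \<rho> \<Longrightarrow> norm (u (\<zeta>, s) - u (\<zeta>, s')) \<le> 1/2 * norm (s - s')"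
    and g: "continuous_on X g" "g ` X \<subseteq> \<Omega>" and y: "continuous_on X y" and \<kappa>: "\<kappa> ` X \<subseteq> ball 0 \<rho>"
    and eq: "\<And>x. x \<in> X \<Longrightarrow> \<kappa> x + u (g x, \<kappa> x) = y x"
  shows "continuous_on X \<kappa>"
  unfolding continuous_on_def
proof
  fix a assume a: "a \<in> X"
  \<comment> \<open>The half-Lipschitz term is absorbed into the left-hand side; what is left
    involves u only at the fixed fibre point \<kappa> a.\<close>
  have b: "norm (\<kappa> x - \<kappa> a) \<le> 2 * (norm (y x - y a) + norm (u (g a, \<kappa> a) - u (g x, \<kappa> a)))" if x: "x \<in> X" for x
  proof -
    have eq': "\<kappa> x - \<kappa> a = (y x - y a) + (u (g a, \<kappa> a) - u (g x, \<kappa> a)) + (u (g x, \<kappa> a) - u (g x, \<kappa> x))"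
      using eq[OF a] eq[OF x] by (simp add: algebra_simps)
    have "norm (\<kappa> x - \<kappa> a) \<le> norm (y x - y a) + norm (u (g a, \<kappa> a) - u (g x, \<kappa> a)) + norm (u (g x, \<kappa> a) - u (g x, \<kappa> x))"
      unfolding eq' using norm_triangle_ineq[of "(y x - y a) + (u (g a, \<kappa> a) - u (g x, \<kappa> a))" "u (g x, \<kappa> a) - u (g x, \<kappa> x)"]
        norm_triangle_ineq[of "y x - y a" "u (g a, \<kappa> a) - u (g x, \<kappa> a)"] by linarith
    moreover have "norm (u (g x, \<kappa> a) - u (g x, \<kappa> x)) \<le> 1/2 * norm (\<kappa> a - \<kappa> x)"
      by (rule lip) (use g \<kappa> a x in auto)
    ultimately show ?thesis by (simp add: norm_minus_commute)
  qed
  have "((\<lambda>x. 2 * (norm (y x - y a) + norm (u (g a, \<kappa> a) - u (g x, \<kappa> a)))) \<longlongrightarrow> 2 * (norm (y a - y a) + norm (u (g a, \<kappa> a) - u (g a, \<kappa> a)))) (at a within X)"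
  proof (intro tendsto_intros)
    show "(y \<longlongrightarrow> y a) (at a within X)" using y a by (auto simp: continuous_on_def)
    have "continuous_on X (\<lambda>x. u (g x, \<kappa> a))"
      by (rule continuous_on_compose2[OF u]) (use g \<kappa> a in \<open>auto intro!: continuous_intros\<close>)
    thus "((\<lambda>x. u (g x, \<kappa> a)) \<longlongrightarrow> u (g a, \<kappa> a)) (at a within X)" using a by (auto simp: continuous_on_def)
  qed
  hence "((\<lambda>x. 2 * (norm (y x - y a) + norm (u (g a, \<kappa> a) - u (g x, \<kappa> a)))) \<longlongrightarrow> 0) (at a within X)" by simp
  hence "((\<lambda>x. \<kappa> x - \<kappa> a) \<longlongrightarrow> 0) (at a within X)"
    by (rule Lim_null_comparison[rotated]) (unfold eventually_at_filter, intro always_eventually allI impI b)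
  thus "(\<kappa> \<longlongrightarrow> \<kappa> a) (at a within X)" by (simp add: LIM_zero_iff)
qed

text \<open>Near each point the solution is the uniform limit of the Picard iteration
  \<open>y \<tau> - u (g \<tau>, w \<tau>)\<close> started at a constant, and all iterates are
  holomorphic. Continuity of \<kappa>, known beforehand, confines the solution to a small
  ball.\<close>

lemma perturbation_solution_holo:
  fixes u :: "complex \<times> (complex ^ 'n) \<Rightarrow> complex ^ 'n" and \<kappa> y :: "complex \<Rightarrow> complex ^ 'n"
  assumes u: "jholo (\<Omega> \<times> ball 0 \<rho>) u"
    and lip: "\<And>\<zeta> s s'. \<zeta> \<in> \<Omega> \<Longrightarrow> s \<in> ball 0 \<rho> \<Longrightarrow> s' \<in> ball 0 \<rho> \<Longrightarrow> norm (u (\<zeta>, s) - u (\<zeta>, s')) \<le> 1/2 * norm (s - s')"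
    and T: "open T" and g: "g holomorphic_on T" "g ` T \<subseteq> \<Omega>" and y: "vholo T y" and \<kappa>: "\<kappa> ` T \<subseteq> ball 0 \<rho>"
    and eq: "\<And>x. x \<in> T \<Longrightarrow> \<kappa> x + u (g x, \<kappa> x) = y x"
  shows "vholo T \<kappa>"
proof (rule vholo_local)
  fix \<tau>0 assume t0: "\<tau>0 \<in> T"
  have kc: "continuous_on T \<kappa>"
    by (rule perturbation_solution_continuous[OF jholo_continuous[OF u] lip holomorphic_on_imp_continuous_on[OF g(1)] g(2) vholo_continuous[OF y] \<kappa> eq])
  define s0 where "s0 = \<kappa> \<tau>0"
  have "s0 \<in> ball 0 \<rho>" using \<kappa> t0 by (auto simp: s0_def)
  then obtain r where r: "r > 0" "ball s0 (2 * r) \<subseteq> ball 0 \<rho>"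
  proof -
    obtain r' where "r' > 0" "ball s0 r' \<subseteq> ball 0 \<rho>" by (rule openE[OF open_ball \<open>s0 \<in> ball 0 \<rho>\<close>])
    thus ?thesis by (intro that[of "r' / 2"]) auto
  qed
  \<comment> \<open>The ball of radius 2r about s0 lies in the domain: \<kappa> stays within r of s0
    on this set, and the iterates stay within r of \<kappa>.\<close>
  define T' where "T' = T \<inter> \<kappa> -` ball s0 r"
  have T': "open T'" unfolding T'_def by (rule continuous_open_preimage[OF kc T open_ball])
  have t0': "\<tau>0 \<in> T'" using t0 r by (simp add: T'_def s0_def)
  define v where "v = rec_nat (\<lambda>_. s0) (\<lambda>_ w \<tau>. y \<tau> - u (g \<tau>, w \<tau>))"
  have v0: "v 0 = (\<lambda>_. s0)" and vS: "v (Suc k) = (\<lambda>\<tau>. y \<tau> - u (g \<tau>, v k \<tau>))" for k by (auto simp: v_def)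
  have vb: "norm (v k \<tau> - \<kappa> \<tau>) \<le> r * (1/2) ^ k \<and> v k \<tau> \<in> ball 0 \<rho>" if "\<tau> \<in> T'" for k \<tau>
  proof (induction k)
    case 0
    show ?case using that r by (auto simp: v0 T'_def dist_norm \<open>s0 \<in> ball 0 \<rho>\<close>[simplified])
  next
    case (Suc k)
    have tT: "\<tau> \<in> T" using that by (simp add: T'_def)
    have "v (Suc k) \<tau> - \<kappa> \<tau> = u (g \<tau>, \<kappa> \<tau>) - u (g \<tau>, v k \<tau>)"
      using eq[OF tT] by (simp add: vS algebra_simps)
    also have "norm \<dots> \<le> 1/2 * norm (\<kappa> \<tau> - v k \<tau>)" by (rule lip) (use Suc g \<kappa> tT in auto)
    also have "\<dots> \<le> 1/2 * (r * (1/2)^k)" using Suc by (simp add: norm_minus_commute)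
    finally have 1: "norm (v (Suc k) \<tau> - \<kappa> \<tau>) \<le> r * (1/2) ^ Suc k" by simp
    also have "\<dots> \<le> r * 1" using r by (intro mult_left_mono power_le_one) auto
    finally have "dist (v (Suc k) \<tau>) (\<kappa> \<tau>) \<le> r" by (simp add: dist_norm)
    moreover have "dist (\<kappa> \<tau>) s0 < r" using that by (simp add: T'_def dist_commute)
    ultimately have "dist s0 (v (Suc k) \<tau>) < 2 * r"
      using dist_triangle[of s0 "v (Suc k) \<tau>" "\<kappa> \<tau>"] by (simp add: dist_commute)
    thus ?case using 1 r by auto
  qed
  have vh: "vholo T' (v k)" for k
  proof (induction k)
    case (Suc k)
    have "vholo T' (\<lambda>\<tau>. u (g \<tau>, v k \<tau>))"
      by (rule jholo_curve[OF u T' _ Suc]) (use g vb in \<open>auto simp: T'_def intro: holomorphic_on_subset\<close>)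
    moreover have "vholo T' y" by (rule vholo_subset[OF y]) (auto simp: T'_def)
    ultimately show ?case by (simp add: vS vholo_diff)
  qed (simp add: v0 vholo_const)
  have "vholo T' \<kappa>"
  proof (rule vholo_uniform_limit[OF T' vh])
    fix x assume "x \<in> T'"
    then obtain d where d: "d > 0" "cball x d \<subseteq> T'" using T' open_contains_cball by blast
    have "uniform_limit (cball x d) v \<kappa> sequentially"
    proof (rule uniform_limitI)
      fix e :: real assume "e > 0"
      have "(\<lambda>k. r * (1/2) ^ k) \<longlonglongrightarrow> r * 0" by (intro tendsto_intros LIMSEQ_power_zero) auto
      hence "\<forall>\<^sub>F k in sequentially. r * (1/2) ^ k < e" using \<open>e > 0\<close> by (intro order_tendstoD) auto
      thus "\<forall>\<^sub>F k in sequentially. \<forall>x\<in>cball x d. dist (v k x) (\<kappa> x) < e"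
      proof eventually_elim
        case (elim k)
        show ?case using vb[of _ k] d elim by (auto simp: dist_norm intro: le_less_trans)
      qed
    qed
    with d show "\<exists>d>0. cball x d \<subseteq> T' \<and> uniform_limit (cball x d) v \<kappa> sequentially" by blast
  qed
  thus "\<exists>T'. open T' \<and> \<tau>0 \<in> T' \<and> vholo T' \<kappa>" using T' t0' by blast
qed

text \<open>A Lipschitz constant below one gives injectivity, and invariance of domain then gives
  openness, so that no preimages have to be constructed.\<close>

lemma perturbation_open_image:
  fixes u :: "complex \<times> (complex ^ 'n) \<Rightarrow> complex ^ 'n"
  assumes u: "continuous_on (\<Omega> \<times> ball 0 \<rho>) u" and \<Omega>: "open \<Omega>"
    and lip: "\<And>\<zeta> s s'. \<zeta> \<in> \<Omega> \<Longrightarrow> s \<in> ball 0 \<rho> \<Longrightarrow> s' \<in> ball 0 \<rho> \<Longrightarrow> norm (u (\<zeta>, s) - u (\<zeta>, s')) \<le> 1/2 * norm (s - s')"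
  shows "inj_on (\<lambda>a. (fst a, snd a + u a)) (\<Omega> \<times> ball 0 \<rho>)"
    and "open ((\<lambda>a. (fst a, snd a + u a)) ` (\<Omega> \<times> ball 0 \<rho>))"
proof -
  show inj: "inj_on (\<lambda>a. (fst a, snd a + u a)) (\<Omega> \<times> ball 0 \<rho>)"
  proof (rule inj_onI, clarsimp)
    fix \<zeta> s s' assume *: "\<zeta> \<in> \<Omega>" "norm s < \<rho>" "norm s' < \<rho>" "s + u (\<zeta>, s) = s' + u (\<zeta>, s')"
    have "s - s' = u (\<zeta>, s') - u (\<zeta>, s)" using *(4) by (simp add: algebra_simps)
    hence "norm (s - s') = norm (u (\<zeta>, s) - u (\<zeta>, s'))" by (simp add: norm_minus_commute)
    also have "\<dots> \<le> 1/2 * norm (s - s')" using lip * by auto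
    finally show "s = s'" by simp
  qed
  show "open ((\<lambda>a. (fst a, snd a + u a)) ` (\<Omega> \<times> ball 0 \<rho>))"
    by (rule invariance_of_domain[OF _ _ inj]) (auto intro!: continuous_intros u open_Times \<Omega>)
qed

section \<open>Approximation of holomorphic frames\<close>

lemma taylor_approximation:
  assumes h: "h holomorphic_on ball c \<rho>" and \<rho>': "0 < \<rho>'" "\<rho>' < \<rho>" and e: "e > 0"
  obtains P where "P holomorphic_on UNIV" "\<And>x. x \<in> cball c \<rho>' \<Longrightarrow> cmod (h x - P x) < e"
proof -
  define a where "a = (\<lambda>n. (deriv ^^ n) h c / fact n)"
  have sums: "(\<lambda>n. a n * (w - c) ^ n) sums h w" if "w \<in> ball c \<rho>" for w
    using holomorphic_power_series[OF h that] by (simp add: a_def)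
  \<comment> \<open>An intermediate radius: convergence at distance t gives a radius of convergence
    at least t, which exceeds \<rho>' strictly.\<close>
  define t where "t = (\<rho>' + \<rho>) / 2"
  have t: "\<rho>' < t" "t < \<rho>" using \<rho>' by (auto simp: t_def)
  have "summable (\<lambda>n. a n * (of_real t) ^ n)"
    using sums_summable[OF sums[of "c + of_real t"]] t \<rho>' by (simp add: dist_norm)
  from conv_radius_geI[OF this] have "ereal t \<le> conv_radius a" using t \<rho>' by simp
  hence "ereal \<rho>' < conv_radius a" using t(1) by (meson ereal_less_eq(3) less_ereal.simps(1) less_le_trans)
  from powser_uniform_limit[OF this, of c]
  have "\<forall>\<^sub>F n in sequentially. \<forall>x\<in>cball c \<rho>'. dist (\<Sum>i<n. a i * (x - c) ^ i) (suminf (\<lambda>i. a i * (x - c) ^ i)) < e"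
    using e unfolding uniform_limit_iff by blast
  then obtain n where n: "\<And>x. x \<in> cball c \<rho>' \<Longrightarrow> dist (\<Sum>i<n. a i * (x - c) ^ i) (suminf (\<lambda>i. a i * (x - c) ^ i)) < e"
    using eventually_happens'[OF sequentially_bot] by blast
  show thesis
  proof (rule that[of "\<lambda>x. \<Sum>i<n. a i * (x - c) ^ i"])
    show "(\<lambda>x. \<Sum>i<n. a i * (x - c) ^ i) holomorphic_on UNIV" by (intro holomorphic_intros)
    fix x assume x: "x \<in> cball c \<rho>'"
    hence "x \<in> ball c \<rho>" using \<rho>' by auto
    from sums_unique[OF sums[OF this]] n[OF x] show "cmod (h x - (\<Sum>i<n. a i * (x - c) ^ i)) < e"
      by (simp add: dist_norm norm_minus_commute)
  qed
qed

lemma cint_holomorphic: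
  assumes f: "continuous_on (closed_segment x y) f" and \<Omega>: "open \<Omega>" "\<Omega> \<inter> closed_segment x y = {}"
  shows "cint x y f holomorphic_on \<Omega>"
proof -
  have ne: "linepath x y t \<noteq> \<zeta>" if "t \<in> {0..1}" "\<zeta> \<in> \<Omega>" for t \<zeta>
    using \<Omega>(2) that linepath_in_segment[of t x y] by blast
  have cl: "continuous_on X (\<lambda>a. linepath x y (fst a))" for X :: "(real \<times> complex) set"
    unfolding linepath_def by (intro continuous_intros)
  have "(\<lambda>\<zeta>. integral {0..1} (\<lambda>t. f (linepath x y t) / (linepath x y t - \<zeta>))) holomorphic_on \<Omega>"
  proof (rule holomorphic_parameter_integral[OF \<Omega>(1)])
    have "continuous_on ({0..1} \<times> \<Omega>) (\<lambda>a. f (linepath x y (fst a)))"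
      by (rule continuous_on_compose2[OF f cl]) (auto intro!: linepath_in_segment)
    thus "continuous_on ({0..1} \<times> \<Omega>) (\<lambda>(t, \<zeta>). f (linepath x y t) / (linepath x y t - \<zeta>))"
      unfolding case_prod_unfold using ne by (intro continuous_intros cl) auto
    show "(\<lambda>\<zeta>. f (linepath x y t) / (linepath x y t - \<zeta>)) holomorphic_on \<Omega>" if "t \<in> {0..1}" for t
      using ne[OF that] by (intro holomorphic_intros) auto
  qed
  thus ?thesis unfolding cint_def by (intro holomorphic_intros)
qed

text \<open>Only the right edge of the Cauchy integral obstructs the extension to the right; its
  contribution is holomorphic on a large disc touching that edge from the left.\<close>

lemma runge_half_strip:
  assumes pq: "Re p' < Re p" "Re p < Re q" "Re q < Re q'" "Im p' < Im p" "Im p < Im q" "Im q < Im q'"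
    and f: "continuous_on (cbox p' q') f" "f holomorphic_on box p' q'" and e: "e > 0"
  obtains g where "g holomorphic_on {\<zeta>. Im p' < Im \<zeta> \<and> Im \<zeta> < Im q' \<and> Re p' < Re \<zeta>}"
    "\<And>\<zeta>. \<zeta> \<in> cbox p q \<Longrightarrow> cmod (f \<zeta> - g \<zeta>) < e"
proof -
  let ?\<Omega> = "{\<zeta>. Im p' < Im \<zeta> \<and> Im \<zeta> < Im q' \<and> Re p' < Re \<zeta>}"
  have pq': "Re p' < Re q'" "Im p' < Im q'" using pq by auto
  define a2 where "a2 = Complex (Re q') (Im p')"
  define a4 where "a4 = Complex (Re p') (Im q')"
  define \<eta> where "\<eta> = Re q' - Re q"
  define H where "H = Im q' - Im p'"
  have \<eta>: "\<eta> > 0" and H: "H > 0" using pq by (auto simp: \<eta>_def H_def)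
  \<comment> \<open>The disc of radius \<rho> about c, defined below, touches the line of the right
    edge at the lower corner. A smaller closed disc contains the inner rectangle once
    \<open>2 * \<rho> * \<eta> > \<eta>\<^sup>2 + H\<^sup>2\<close>; the other summands put c to the
    left of p.\<close>
  define \<rho> where "\<rho> = (\<eta>\<^sup>2 + H\<^sup>2) / \<eta> + (Re q' - Re p) + 1"
  have "(\<eta>\<^sup>2 + H\<^sup>2) / \<eta> > 0" using \<eta> H by (intro divide_pos_pos add_pos_pos) auto
  hence \<rho>p: "\<rho> > Re q' - Re p" "\<rho> > \<eta>" using pq unfolding \<rho>_def \<eta>_def by linarith+
  have \<rho>2: "2 * \<rho> * \<eta> > \<eta>\<^sup>2 + H\<^sup>2"
  proof -
    have "\<rho> * \<eta> = (\<eta>\<^sup>2 + H\<^sup>2) + (Re q' - Re p + 1) * \<eta>" using \<eta> by (simp add: \<rho>_def field_simps)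
    moreover have "(Re q' - Re p + 1) * \<eta> > 0" using \<eta> pq by (intro mult_pos_pos) auto
    moreover have "\<rho> * \<eta> > 0" using \<rho>p \<eta> by auto
    ultimately show ?thesis by linarith
  qed
  define c where "c = Complex (Re q' - \<rho>) (Im p')"
  define \<rho>' where "\<rho>' = sqrt ((\<rho> - \<eta>)\<^sup>2 + H\<^sup>2)"
  have \<rho>': "0 < \<rho>'" "\<rho>' < \<rho>"
  proof -
    show "0 < \<rho>'" using H by (simp add: \<rho>'_def add_nonneg_pos)
    have "(\<rho> - \<eta>)\<^sup>2 + H\<^sup>2 < \<rho>\<^sup>2" using \<rho>2 by (simp add: power2_eq_square algebra_simps)
    thus "\<rho>' < \<rho>" using \<rho>p \<eta> by (auto simp: \<rho>'_def intro!: real_less_lsqrt)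
  qed
  have sub: "cbox p q \<subseteq> cball c \<rho>'"
  proof
    fix \<zeta> assume z: "\<zeta> \<in> cbox p q"
    have "0 \<le> Re \<zeta> - Re c" "Re \<zeta> - Re c \<le> \<rho> - \<eta>" "0 \<le> Im \<zeta> - Im c" "Im \<zeta> - Im c \<le> H"
      using z \<rho>p pq by (auto simp: in_cbox_complex_iff c_def \<eta>_def H_def)
    hence "(Re \<zeta> - Re c)\<^sup>2 + (Im \<zeta> - Im c)\<^sup>2 \<le> (\<rho> - \<eta>)\<^sup>2 + H\<^sup>2" by (intro add_mono power_mono) auto
    hence "cmod (\<zeta> - c) \<le> \<rho>'" by (simp add: cmod_def \<rho>'_def)
    thus "\<zeta> \<in> cball c \<rho>'" by (simp add: dist_norm norm_minus_commute)
  qed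
  have cf: "continuous_on (closed_segment x y) f" if "(x, y) \<in> edges p' q'" for x y
    using f(1) edge_subset(1)[OF pq' that] by (rule continuous_on_subset)
  have hol: "cint a2 q' f holomorphic_on ball c \<rho>"
  proof (rule cint_holomorphic[OF cf open_ball])
    show "(a2, q') \<in> edges p' q'" by (simp add: edges_def a2_def)
    have r1: "Re w < Re q'" if "w \<in> ball c \<rho>" for w
    proof -
      have "Re w - Re c \<le> cmod (w - c)" using complex_Re_le_cmod[of "w - c"] by simp
      also have "\<dots> < \<rho>" using that by (simp add: dist_norm norm_minus_commute)
      finally show ?thesis by (simp add: c_def)
    qed
    have r2: "Re w = Re q'" if "w \<in> closed_segment a2 q'" for w
      using that by (auto simp: a2_def closed_segment_same_Re)
    show "ball c \<rho> \<inter> closed_segment a2 q' = {}" unfolding disjoint_iff by (metis r1 r2 less_irrefl)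
  qed
  obtain P where P: "P holomorphic_on UNIV" "\<And>x. x \<in> cball c \<rho>' \<Longrightarrow> cmod (cint a2 q' f x - P x) < e"
    using taylor_approximation[OF hol \<rho>' e] by blast
  \<comment> \<open>The three remaining edges do not meet the half strip; the entire function P
    replaces the right edge.\<close>
  define g where "g = (\<lambda>\<zeta>. (cint p' a2 f \<zeta> + P \<zeta> + cint q' a4 f \<zeta> + cint a4 p' f \<zeta>) / (2 * of_real pi * \<i>))"
  show thesis
  proof (rule that[of g])
    have o: "open ?\<Omega>" by (intro open_Collect_conj open_Collect_less continuous_intros)
    have "cint p' a2 f holomorphic_on ?\<Omega>" "cint q' a4 f holomorphic_on ?\<Omega>" "cint a4 p' f holomorphic_on ?\<Omega>"
      by (rule cint_holomorphic[OF cf o], simp add: edges_def a2_def a4_def,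
          auto simp: a2_def a4_def closed_segment_same_Re closed_segment_same_Im)+
    thus "g holomorphic_on ?\<Omega>" unfolding g_def by (intro holomorphic_intros holomorphic_on_subset[OF P(1)]) auto
    fix \<zeta> assume z: "\<zeta> \<in> cbox p q"
    hence "\<zeta> \<in> box p' q'" using pq by (auto simp: in_cbox_complex_iff in_box_complex_iff)
    have "f \<zeta> - g \<zeta> = (cint a2 q' f \<zeta> - P \<zeta>) / (2 * of_real pi * \<i>)"
      by (subst rcauchy_formula[OF pq' f \<open>\<zeta> \<in> box p' q'\<close>, symmetric])
         (simp add: g_def rcauchy_def bsum_def a2_def a4_def add_divide_distrib diff_divide_distrib)
    also have "cmod \<dots> = cmod (cint a2 q' f \<zeta> - P \<zeta>) / (2 * pi)" by (simp add: norm_divide norm_mult)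
    also have "\<dots> \<le> cmod (cint a2 q' f \<zeta> - P \<zeta>) / 1" using pi_ge_two by (intro divide_left_mono) auto
    also have "\<dots> < e" using P(2)[of \<zeta>] z sub by auto
    finally show "cmod (f \<zeta> - g \<zeta>) < e" .
  qed
qed

section \<open>Linear differential equations on convex domains\<close>

lemma primitive_power_bound:
  assumes \<Omega>: "convex \<Omega>" "open \<Omega>" and p: "p \<in> \<Omega>" and z: "\<zeta> \<in> \<Omega>" and C: "C \<ge> 0"
    and F: "\<And>x. x \<in> \<Omega> \<Longrightarrow> (F has_field_derivative f x) (at x)" and F0: "F p = 0"
    and f: "\<And>x. x \<in> \<Omega> \<Longrightarrow> cmod (f x) \<le> C * cmod (x - p) ^ k"
  shows "cmod (F \<zeta>) \<le> C * cmod (\<zeta> - p) ^ Suc k / real (Suc k)"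
proof -
  let ?l = "\<lambda>t::real. p + of_real t * (\<zeta> - p)"
  have l: "?l t \<in> \<Omega>" if "0 \<le> t" "t \<le> 1" for t
  proof -
    have "?l t = (1 - t) *\<^sub>R p + t *\<^sub>R \<zeta>" by (simp add: scaleR_conv_of_real algebra_simps)
    thus ?thesis using convexD_alt[OF \<Omega>(1) p z that] by simp
  qed
  have d: "((\<lambda>t. F (?l t)) has_vector_derivative f (?l t) * (\<zeta> - p)) (at t)" if "0 \<le> t" "t \<le> 1" for t
  proof -
    have "(?l has_vector_derivative (\<zeta> - p)) (at t)" by (auto intro!: derivative_eq_intros)
    from field_vector_diff_chain_at[OF this F[OF l[OF that]]] show ?thesis by (simp add: o_def mult.commute)
  qed
  \<comment> \<open>Comparison along the segment from p with a primitive of t^k: the factor 1/(k+1)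
    gained here accumulates to the factorial that makes the Picard series converge.\<close>
  have "norm (F (?l 1) - F (?l 0)) \<le> C * cmod (\<zeta> - p) ^ Suc k * (1 ^ Suc k) / real (Suc k) - C * cmod (\<zeta> - p) ^ Suc k * (0 ^ Suc k) / real (Suc k)"
  proof (rule differentiable_bound_general[OF zero_less_one])
    show "continuous_on {0..1} (\<lambda>t. F (?l t))"
      by (intro continuous_at_imp_continuous_on ballI has_vector_derivative_continuous[OF d]) auto
    show "continuous_on {0..1} (\<lambda>t. C * cmod (\<zeta> - p) ^ Suc k * (t ^ Suc k) / real (Suc k))" by (intro continuous_intros) auto
    show "((\<lambda>t. F (?l t)) has_vector_derivative f (?l t) * (\<zeta> - p)) (at t)" if "0 < t" "t < 1" for t using d that by auto
    show "((\<lambda>t. C * cmod (\<zeta> - p) ^ Suc k * (t ^ Suc k) / real (Suc k)) has_vector_derivative C * cmod (\<zeta> - p) ^ Suc k * t ^ k) (at t)" for t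
      unfolding has_real_derivative_iff_has_vector_derivative[symmetric]
      by (rule derivative_eq_intros refl | simp)+
    fix t :: real assume t: "0 < t" "t < 1"
    have "cmod (f (?l t) * (\<zeta> - p)) \<le> (C * cmod (?l t - p) ^ k) * cmod (\<zeta> - p)"
      unfolding norm_mult by (intro mult_right_mono f l) (use t in auto)
    also have "cmod (?l t - p) = t * cmod (\<zeta> - p)" using t by (simp add: norm_mult)
    finally show "norm (f (?l t) * (\<zeta> - p)) \<le> C * cmod (\<zeta> - p) ^ Suc k * t ^ k"
      by (simp add: power_mult_distrib algebra_simps)
  qed
  thus ?thesis using F0 by simp
qed

lemma matrix_vector_entry_bound:
  fixes N :: "complex ^ 'n ^ 'm" and v :: "complex ^ 'n"
  assumes "\<And>l. cmod (N $ i $ l) \<le> K" "\<And>l. cmod (v $ l) \<le> b"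
  shows "cmod ((N *v v) $ i) \<le> real CARD('n) * (K * b)"
proof -
  have "cmod ((N *v v) $ i) \<le> (\<Sum>l\<in>UNIV. cmod (N $ i $ l * v $ l))"
    by (simp add: matrix_vector_mult_def norm_sum)
  also have "\<dots> \<le> real CARD('n) * (K * b)"
  proof -
    have "cmod (N $ i $ l * v $ l) \<le> K * b" for l
      unfolding norm_mult by (intro mult_mono assms order.trans[OF norm_ge_zero assms(1)]) auto
    thus ?thesis using sum_bounded_above[of UNIV "\<lambda>l. cmod (N $ i $ l * v $ l)" "K * b"] by simp
  qed
  finally show ?thesis .
qed

text \<open>The solution is the Picard series, whose terms after the constant one are iterated
  primitives vanishing at p. An exponential series dominates it, so it converges on the whole of the
  bounded domain, however large K is.\<close>

lemma linear_ode_solution: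
  fixes N :: "complex \<Rightarrow> complex ^ 'n ^ 'n" and v0 :: "complex ^ 'n"
  assumes \<Omega>: "convex \<Omega>" "open \<Omega>" "bounded \<Omega>" and p: "p \<in> \<Omega>"
    and N: "\<And>i j. (\<lambda>\<zeta>. N \<zeta> $ i $ j) holomorphic_on \<Omega>" and K: "\<And>\<zeta> i j. \<zeta> \<in> \<Omega> \<Longrightarrow> cmod (N \<zeta> $ i $ j) \<le> K"
  obtains b where "b p = v0" "\<And>\<zeta> i. \<zeta> \<in> \<Omega> \<Longrightarrow> ((\<lambda>\<zeta>. b \<zeta> $ i) has_field_derivative (N \<zeta> *v b \<zeta>) $ i) (at \<zeta>)"
proof -
  have K0: "K \<ge> 0" using order.trans[OF norm_ge_zero K[OF p]] .
  obtain d where d: "\<And>\<zeta>. \<zeta> \<in> \<Omega> \<Longrightarrow> cmod (\<zeta> - p) \<le> d"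
  proof -
    obtain d where "\<forall>\<zeta>\<in>\<Omega>. dist p \<zeta> \<le> d" using \<Omega>(3) bounded_any_center by blast
    thus ?thesis by (intro that[of d]) (auto simp: dist_norm norm_minus_commute)
  qed
  have d0: "d \<ge> 0" using d[OF p] by simp
  let ?n = "real CARD('n)"
  \<comment> \<open>Primitives exist because \<Omega> is convex; the normalization at p leaves the
    initial value to the zeroth term alone.\<close>
  define prim where "prim = (\<lambda>f. SOME F. (\<forall>x\<in>\<Omega>. (F has_field_derivative f x) (at x)) \<and> F p = 0)"
  have prim: "(\<forall>x\<in>\<Omega>. (prim f has_field_derivative f x) (at x)) \<and> prim f p = 0" if f: "f holomorphic_on \<Omega>" for f
  proof -
    obtain g where g: "\<And>x. x \<in> \<Omega> \<Longrightarrow> (g has_field_derivative f x) (at x within \<Omega>)"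
      using holomorphic_convex_primitive'[OF \<Omega>(1,2) f] by blast
    have "(\<forall>x\<in>\<Omega>. ((\<lambda>x. g x - g p) has_field_derivative f x) (at x)) \<and> g p - g p = 0"
    proof (intro conjI ballI)
      fix x assume x: "x \<in> \<Omega>"
      have "(g has_field_derivative f x) (at x)" using g[OF x] at_within_open[OF x \<Omega>(2)] by simp
      from DERIV_diff[OF this DERIV_const] show "((\<lambda>x. g x - g p) has_field_derivative f x) (at x)" by simp
    qed simp
    thus ?thesis unfolding prim_def
      by (rule someI[of "\<lambda>F. (\<forall>x\<in>\<Omega>. (F has_field_derivative f x) (at x)) \<and> F p = 0"])
  qed
  define b where "b = rec_nat (\<lambda>_. v0) (\<lambda>_ v \<zeta>. \<chi> i. prim (\<lambda>\<zeta>. (N \<zeta> *v v \<zeta>) $ i) \<zeta>)"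
  have b0: "b 0 = (\<lambda>_. v0)" and bS: "\<And>k. b (Suc k) = (\<lambda>\<zeta>. \<chi> i. prim (\<lambda>\<zeta>. (N \<zeta> *v b k \<zeta>) $ i) \<zeta>)" by (auto simp: b_def)
  have NV: "(\<lambda>\<zeta>. (N \<zeta> *v v \<zeta>) $ i) holomorphic_on \<Omega>" if "vholo \<Omega> v" for v i
    using that N unfolding vholo_def matrix_vector_mult_def by (auto intro!: holomorphic_intros)
  have bh: "vholo \<Omega> (b k)" for k
  proof (induction k)
    case (Suc k)
    show ?case unfolding vholo_def bS using prim[OF NV[OF Suc]] \<Omega>(2) by (auto simp: holomorphic_on_open)
  qed (simp add: b0 vholo_const)
  have bd: "((\<lambda>\<zeta>. b (Suc k) \<zeta> $ i) has_field_derivative (N \<zeta> *v b k \<zeta>) $ i) (at \<zeta>)" if "\<zeta> \<in> \<Omega>" for k i \<zeta>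
    using prim[OF NV[OF bh[of k], of i]] that by (simp add: bS)
  have bp: "b (Suc k) p = 0" for k
    using prim[OF NV[OF bh[of k]]] by (simp add: bS vec_eq_iff)
  define c where "c = norm v0"
  have bb: "cmod (b k \<zeta> $ i) \<le> c * (?n * K) ^ k / fact k * cmod (\<zeta> - p) ^ k" if "\<zeta> \<in> \<Omega>" for k \<zeta> i
    using that
  proof (induction k arbitrary: \<zeta> i)
    case 0
    show ?case using Finite_Cartesian_Product.norm_nth_le[of v0 i] by (simp add: b0 c_def)
  next
    case (Suc k)
    let ?C = "?n * (K * (c * (?n * K) ^ k / fact k))"
    have C0: "?C \<ge> 0" using K0 by (auto simp: c_def)
    have "cmod (b (Suc k) \<zeta> $ i) \<le> ?C * cmod (\<zeta> - p) ^ Suc k / real (Suc k)"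
    proof (rule primitive_power_bound[OF \<Omega>(1,2) p Suc.prems C0 bd])
      show "b (Suc k) p $ i = 0" by (simp add: bp)
      fix x assume x: "x \<in> \<Omega>"
      have "cmod ((N x *v b k x) $ i) \<le> ?n * (K * (c * (?n * K) ^ k / fact k * cmod (x - p) ^ k))"
        by (rule matrix_vector_entry_bound[OF K[OF x] Suc.IH[OF x]])
      thus "cmod ((N x *v b k x) $ i) \<le> ?C * cmod (x - p) ^ k" by (simp add: mult.assoc)
    qed
    thus ?case by (simp add: field_simps)
  qed
  define M where "M = (\<lambda>k. c * (?n * K * d) ^ k / fact k)"
  have bM: "cmod (b k \<zeta> $ i) \<le> M k" if "\<zeta> \<in> \<Omega>" for k \<zeta> i
  proof -
    have "c * (?n * K) ^ k / fact k * cmod (\<zeta> - p) ^ k \<le> c * (?n * K) ^ k / fact k * d ^ k"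
      using K0 by (intro mult_left_mono power_mono d that) (auto simp: c_def)
    thus ?thesis using bb[OF that, of k i] by (simp add: M_def power_mult_distrib mult.assoc)
  qed
  have sM: "summable M"
    unfolding M_def using summable_mult[OF summable_exp[of "?n * K * d"], of c] by (simp add: field_simps)
  \<comment> \<open>Term k is differentiated to N applied to term k - 1, and the constant term to 0;
    this shift makes the differentiated series equal N applied to the sum.\<close>
  define f' where "f' = (\<lambda>i k \<zeta>. case k of 0 \<Rightarrow> 0 | Suc k \<Rightarrow> (N \<zeta> *v b k \<zeta>) $ i)"
  have f'd: "((\<lambda>\<zeta>. b k \<zeta> $ i) has_field_derivative f' i k \<zeta>) (at \<zeta> within \<Omega>)" if "\<zeta> \<in> \<Omega>" for i k \<zeta>
    using bd[OF that] by (cases k) (auto simp: f'_def b0 intro: has_field_derivative_at_within)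
  have ul: "uniform_limit \<Omega> (\<lambda>n x. \<Sum>k<n. f' i k x) (\<lambda>x. suminf (\<lambda>k. f' i k x)) sequentially" for i
  proof (rule Weierstrass_m_test)
    define M' where "M' = (\<lambda>k. case k of 0 \<Rightarrow> 0 | Suc k \<Rightarrow> ?n * (K * M k))"
    show "norm (f' i k x) \<le> M' k" if "x \<in> \<Omega>" for k x
      using matrix_vector_entry_bound[of "N x" i K _ "M (k - 1)", OF K[OF that] bM[OF that]]
      by (auto simp: f'_def M'_def split: nat.split)
    have "summable (\<lambda>k. M' (Suc k))" unfolding M'_def by (simp add: summable_mult sM)
    thus "summable M'" by (rule summable_Suc_iff[THEN iffD1])
  qed
  have "\<exists>g. \<forall>x\<in>\<Omega>. (\<lambda>k. b k x $ i) sums g x \<and> (g has_field_derivative suminf (\<lambda>k. f' i k x)) (at x within \<Omega>)" for i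
    by (rule has_field_derivative_series[OF \<Omega>(1) f'd ul p])
       (auto intro!: summable_comparison_test[OF _ sM] bM[OF p])
  then obtain g where g: "\<And>i x. x \<in> \<Omega> \<Longrightarrow> (\<lambda>k. b k x $ i) sums g i x"
     "\<And>i x. x \<in> \<Omega> \<Longrightarrow> (g i has_field_derivative suminf (\<lambda>k. f' i k x)) (at x within \<Omega>)" by metis
  have g': "suminf (\<lambda>k. f' i k x) = (N x *v (\<chi> i. g i x)) $ i" if x: "x \<in> \<Omega>" for i x
  proof -
    have "(\<lambda>k. (N x *v b k x) $ i) sums (N x *v (\<chi> i. g i x)) $ i"
      unfolding matrix_vector_mult_def using g(1)[OF x] by (auto intro!: sums_sum sums_mult)
    hence "(\<lambda>k. f' i (Suc k) x) sums (N x *v (\<chi> i. g i x)) $ i" by (simp add: f'_def)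
    hence "(\<lambda>k. f' i k x) sums ((N x *v (\<chi> i. g i x)) $ i + f' i 0 x)" by (rule sums_Suc)
    thus ?thesis by (simp add: f'_def sums_iff)
  qed
  show thesis
  proof (rule that[of "\<lambda>x. \<chi> i. g i x"])
    have "g i p = v0 $ i" for i
    proof -
      have "(\<lambda>k. b k p $ i) sums (\<Sum>k\<in>{0}. b k p $ i)"
        by (rule sums_finite) (use bp in \<open>auto simp: gr0_conv_Suc\<close>)
      thus ?thesis using g(1)[OF p, of i] sums_unique2 by (fastforce simp: b0)
    qed
    thus "(\<chi> i. g i p) = v0" by (simp add: vec_eq_iff)
    fix \<zeta> i assume z: "\<zeta> \<in> \<Omega>"
    show "((\<lambda>\<zeta>. (\<chi> i. g i \<zeta>) $ i) has_field_derivative (N \<zeta> *v (\<chi> i. g i \<zeta>)) $ i) (at \<zeta>)"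
      using g(2)[OF z, of i] g'[OF z] at_within_open[OF z \<Omega>(2)] by simp
  qed
qed

lemma matrix_mult_entry_bound:
  fixes A :: "complex ^ 'n ^ 'm" and B :: "complex ^ 'k ^ 'n"
  assumes "\<And>l. cmod (A $ i $ l) \<le> K" "\<And>l. cmod (B $ l $ j) \<le> b"
  shows "cmod ((A ** B) $ i $ j) \<le> real CARD('n) * (K * b)"
proof -
  have "(A ** B) $ i $ j = (A *v (\<chi> l. B $ l $ j)) $ i"
    by (simp add: matrix_matrix_mult_def matrix_vector_mult_def)
  thus ?thesis using matrix_vector_entry_bound[of A i K "\<chi> l. B $ l $ j" b] assms by simp
qed

lemma matrix_mult_derivative:
  fixes A :: "complex \<Rightarrow> complex ^ 'n ^ 'm" and B :: "complex \<Rightarrow> complex ^ 'k ^ 'n"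
  assumes "\<And>i j. ((\<lambda>\<zeta>. A \<zeta> $ i $ j) has_field_derivative A' $ i $ j) (at x within S)"
    and "\<And>i j. ((\<lambda>\<zeta>. B \<zeta> $ i $ j) has_field_derivative B' $ i $ j) (at x within S)"
  shows "((\<lambda>\<zeta>. (A \<zeta> ** B \<zeta>) $ i $ j) has_field_derivative (A' ** B x + A x ** B') $ i $ j) (at x within S)"
proof -
  have "((\<lambda>\<zeta>. \<Sum>l\<in>UNIV. A \<zeta> $ i $ l * B \<zeta> $ l $ j) has_field_derivative
      (\<Sum>l\<in>UNIV. A' $ i $ l * B x $ l $ j + B' $ l $ j * A x $ i $ l)) (at x within S)"
    by (intro DERIV_sum DERIV_mult assms)
  thus ?thesis by (simp add: matrix_matrix_mult_def sum.distrib mult.commute)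
qed

lemma matrix_mult_diff:
  fixes P Q S :: "complex ^ 'n ^ 'n"
  shows "(P - Q) ** S = P ** S - Q ** S" "S ** (P - Q) = S ** P - S ** Q" "(- P) ** S = - (P ** S)"
  by (simp_all add: vec_eq_iff matrix_matrix_mult_def sum_subtractf algebra_simps sum_negf)

text \<open>Columns of b solve \<open>b' = N b\<close> and rows of a solve
  \<open>a' = - a N\<close>. Then the product of a and b has derivative zero and keeps its value at
  p, so the inverse frame arises without inverting a matrix.\<close>

lemma linear_ode_fundamental_matrix:
  fixes N :: "complex \<Rightarrow> complex ^ 'n ^ 'n" and G0 G1 :: "complex ^ 'n ^ 'n"
  assumes \<Omega>: "convex \<Omega>" "open \<Omega>" "bounded \<Omega>" and p: "p \<in> \<Omega>" and G: "G1 ** G0 = mat 1"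
    and N: "\<And>i j. (\<lambda>\<zeta>. N \<zeta> $ i $ j) holomorphic_on \<Omega>" and K: "\<And>\<zeta> i j. \<zeta> \<in> \<Omega> \<Longrightarrow> cmod (N \<zeta> $ i $ j) \<le> K"
  obtains a b where "b p = G0" "a p = G1"
    "\<And>\<zeta>. \<zeta> \<in> \<Omega> \<Longrightarrow> a \<zeta> ** b \<zeta> = mat 1" "\<And>\<zeta>. \<zeta> \<in> \<Omega> \<Longrightarrow> b \<zeta> ** a \<zeta> = mat 1"
    "\<And>\<zeta> i j. \<zeta> \<in> \<Omega> \<Longrightarrow> ((\<lambda>\<zeta>. b \<zeta> $ i $ j) has_field_derivative (N \<zeta> ** b \<zeta>) $ i $ j) (at \<zeta>)"
    "\<And>\<zeta> i j. \<zeta> \<in> \<Omega> \<Longrightarrow> ((\<lambda>\<zeta>. a \<zeta> $ i $ j) has_field_derivative (- (a \<zeta> ** N \<zeta>)) $ i $ j) (at \<zeta>)"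
proof -
  have "\<exists>f. f p = (\<chi> i. G0 $ i $ j) \<and> (\<forall>\<zeta>\<in>\<Omega>. \<forall>i. ((\<lambda>\<zeta>. f \<zeta> $ i) has_field_derivative (N \<zeta> *v f \<zeta>) $ i) (at \<zeta>))" for j
    by (rule linear_ode_solution[OF \<Omega> p N K, of "\<chi> i. G0 $ i $ j"]) blast+
  then obtain f where f: "\<And>j. f j p = (\<chi> i. G0 $ i $ j)"
    "\<And>j \<zeta> i. \<zeta> \<in> \<Omega> \<Longrightarrow> ((\<lambda>\<zeta>. f j \<zeta> $ i) has_field_derivative (N \<zeta> *v f j \<zeta>) $ i) (at \<zeta>)" by metis
  have "\<exists>f. f p = (\<chi> j. G1 $ i $ j) \<and> (\<forall>\<zeta>\<in>\<Omega>. \<forall>j. ((\<lambda>\<zeta>. f \<zeta> $ j) has_field_derivative ((\<chi> k l. - (N \<zeta> $ l $ k)) *v f \<zeta>) $ j) (at \<zeta>))" for i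
  proof -
    have N': "(\<lambda>\<zeta>. (\<chi> k l. - (N \<zeta> $ l $ k)) $ i $ j) holomorphic_on \<Omega>" for i j by (auto intro!: holomorphic_intros N)
    have K': "cmod ((\<chi> k l. - (N \<zeta> $ l $ k)) $ i $ j) \<le> K" if "\<zeta> \<in> \<Omega>" for \<zeta> i j using K[OF that] by simp
    show ?thesis by (rule linear_ode_solution[OF \<Omega> p N' K', of "\<chi> j. G1 $ i $ j"]) blast+
  qed
  then obtain g where g: "\<And>i. g i p = (\<chi> j. G1 $ i $ j)"
    "\<And>i \<zeta> j. \<zeta> \<in> \<Omega> \<Longrightarrow> ((\<lambda>\<zeta>. g i \<zeta> $ j) has_field_derivative ((\<chi> k l. - (N \<zeta> $ l $ k)) *v g i \<zeta>) $ j) (at \<zeta>)" by metis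
  define b where "b = (\<lambda>\<zeta>. \<chi> i j. f j \<zeta> $ i)"
  define a where "a = (\<lambda>\<zeta>. \<chi> i j. g i \<zeta> $ j)"
  have b': "((\<lambda>\<zeta>. b \<zeta> $ i $ j) has_field_derivative (N \<zeta> ** b \<zeta>) $ i $ j) (at \<zeta>)" if "\<zeta> \<in> \<Omega>" for \<zeta> i j
    using f(2)[OF that, of j i] by (simp add: b_def matrix_matrix_mult_def matrix_vector_mult_def)
  have a': "((\<lambda>\<zeta>. a \<zeta> $ i $ j) has_field_derivative (- (a \<zeta> ** N \<zeta>)) $ i $ j) (at \<zeta>)" if "\<zeta> \<in> \<Omega>" for \<zeta> i j
    using g(2)[OF that, of i j] by (simp add: a_def matrix_matrix_mult_def matrix_vector_mult_def sum_negf mult.commute)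
  have bp: "b p = G0" and ap: "a p = G1" by (simp_all add: b_def a_def f g vec_eq_iff)
  have ab: "a \<zeta> ** b \<zeta> = mat 1" if z: "\<zeta> \<in> \<Omega>" for \<zeta>
  proof -
    have "(a \<zeta> ** b \<zeta>) $ i $ j = (a p ** b p) $ i $ j" for i j
    proof -
      have "((\<lambda>\<zeta>. (a \<zeta> ** b \<zeta>) $ i $ j) has_field_derivative 0) (at x within \<Omega>)" if x: "x \<in> \<Omega>" for x
      proof -
        have "((\<lambda>\<zeta>. (a \<zeta> ** b \<zeta>) $ i $ j) has_field_derivative (- (a x ** N x) ** b x + a x ** (N x ** b x)) $ i $ j) (at x within \<Omega>)"
          by (rule matrix_mult_derivative[OF has_field_derivative_at_within[OF a'[OF x]] has_field_derivative_at_within[OF b'[OF x]]])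
        moreover have "- (a x ** N x) ** b x + a x ** (N x ** b x) = 0"
          by (simp add: matrix_mul_assoc matrix_mult_diff)
        ultimately show ?thesis by simp
      qed
      from has_field_derivative_zero_constant[OF \<Omega>(1) this] obtain c where "\<And>x. x \<in> \<Omega> \<Longrightarrow> (a x ** b x) $ i $ j = c" by blast
      thus ?thesis using z p by simp
    qed
    thus ?thesis using G by (simp add: vec_eq_iff bp ap)
  qed
  show thesis
    by (rule that[of b a, OF bp ap ab _ b' a']) (use ab matrix_left_right_inverse in blast)+
qed

text \<open>Holomorphic frames are approximated through their logarithmic derivative: replacing
  the derivative of G times the inverse of G by a nearby function defined on a larger rectangle and
  solving the linear equation keeps invertibility.\<close>

lemma frame_approximation:
  fixes G Gi :: "complex \<Rightarrow> complex ^ 'n ^ 'n"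
  assumes pq: "Re p < Re q" "Im p < Im q" and \<eta>: "\<eta> > 0" and e: "e > 0" and E: "Re q + \<eta> \<le> E"
    and G: "\<And>i j. (\<lambda>\<zeta>. G \<zeta> $ i $ j) holomorphic_on box (p - of_real (3 * \<eta>) * (1 + \<i>)) (q + of_real (3 * \<eta>) * (1 + \<i>))"
    and Gi: "\<And>i j. (\<lambda>\<zeta>. Gi \<zeta> $ i $ j) holomorphic_on box (p - of_real (3 * \<eta>) * (1 + \<i>)) (q + of_real (3 * \<eta>) * (1 + \<i>))"
    and GGi: "\<And>\<zeta>. \<zeta> \<in> box (p - of_real (3 * \<eta>) * (1 + \<i>)) (q + of_real (3 * \<eta>) * (1 + \<i>)) \<Longrightarrow> Gi \<zeta> ** G \<zeta> = mat 1"
  defines "\<Omega> \<equiv> box (p - of_real \<eta> * (1 + \<i>)) (Complex E (Im q + \<eta>))"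
  obtains a b where "\<And>i j. (\<lambda>\<zeta>. a \<zeta> $ i $ j) holomorphic_on \<Omega>" "\<And>i j. (\<lambda>\<zeta>. b \<zeta> $ i $ j) holomorphic_on \<Omega>"
    "\<And>\<zeta>. \<zeta> \<in> \<Omega> \<Longrightarrow> a \<zeta> ** b \<zeta> = mat 1" "\<And>\<zeta>. \<zeta> \<in> \<Omega> \<Longrightarrow> b \<zeta> ** a \<zeta> = mat 1"
    "\<And>\<zeta> i j. \<zeta> \<in> cbox p q \<Longrightarrow> cmod ((a \<zeta> ** G \<zeta> - mat 1) $ i $ j) \<le> e"
proof -
  let ?n = "real CARD('n)"
  have n1: "?n \<ge> 1" using one_le_card_finite[where 'a='n] by linarith
  \<comment> \<open>Nested rectangles: the frame is given with margin 3\<eta>, its logarithmic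
    derivative is approximated from margin 2\<eta>, and the equation is solved with margin \<eta>,
    where the approximating coefficients are bounded.\<close>
  let ?p = "\<lambda>k::real. p - of_real (k * \<eta>) * (1 + \<i>)" and ?q = "\<lambda>k::real. q + of_real (k * \<eta>) * (1 + \<i>)"
  have R: "Re (?p k) = Re p - k * \<eta>" "Im (?p k) = Im p - k * \<eta>" "Re (?q k) = Re q + k * \<eta>" "Im (?q k) = Im q + k * \<eta>" for k
    by simp_all
  have sub2: "cbox (?p 2) (?q 2) \<subseteq> box (?p 3) (?q 3)" using \<eta> by (auto simp: in_cbox_complex_iff in_box_complex_iff simp del: of_real_mult)
  have sub0: "cbox p q \<subseteq> box (?p 3) (?q 3)" using \<eta> by (auto simp: in_cbox_complex_iff in_box_complex_iff simp del: of_real_mult)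
  have sub\<Omega>: "cbox p q \<subseteq> \<Omega>" using \<eta> E by (auto simp: \<Omega>_def in_cbox_complex_iff in_box_complex_iff)
  let ?B = "box (?p 3) (?q 3)"
  define G' where "G' = (\<lambda>\<zeta>. \<chi> i j. deriv (\<lambda>\<zeta>. G \<zeta> $ i $ j) \<zeta>)"
  define N where "N = (\<lambda>\<zeta>. G' \<zeta> ** Gi \<zeta>)"
  have G'd: "((\<lambda>\<zeta>. G \<zeta> $ i $ j) has_field_derivative G' \<zeta> $ i $ j) (at \<zeta>)" if "\<zeta> \<in> ?B" for \<zeta> i j
    using holomorphic_derivI[OF G open_box that] by (simp add: G'_def)
  have N: "(\<lambda>\<zeta>. N \<zeta> $ i $ j) holomorphic_on ?B" for i j
    unfolding N_def matrix_matrix_mult_def G'_def vec_lambda_beta by (intro holomorphic_intros holomorphic_deriv G Gi open_box)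
  have "compact (cbox p q)" by simp
  have bdd: "\<exists>\<gamma>. \<forall>\<zeta>\<in>cbox p q. \<forall>i j. cmod (F \<zeta> $ i $ j) \<le> \<gamma>" if F: "\<And>i j. continuous_on (cbox p q) (\<lambda>\<zeta>. F \<zeta> $ i $ j)" for F :: "complex \<Rightarrow> complex ^ 'n ^ 'n"
  proof -
    have "\<exists>c. \<forall>\<zeta>\<in>cbox p q. cmod (F \<zeta> $ i $ j) \<le> c" for i j
      using compact_imp_bounded[OF compact_continuous_image[OF F[of i j] compact_cbox]] by (auto simp: bounded_iff)
    then obtain c where c: "\<And>i j \<zeta>. \<zeta> \<in> cbox p q \<Longrightarrow> cmod (F \<zeta> $ i $ j) \<le> c i j" by metis
    have "cmod (F \<zeta> $ i $ j) \<le> Max (range (\<lambda>(i, j). c i j))" if "\<zeta> \<in> cbox p q" for \<zeta> i j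
      by (rule order.trans[OF c[OF that, of i j] Max_ge]) (auto intro!: rev_image_eqI[of "(i, j)"])
    thus ?thesis by blast
  qed
  have cG: "continuous_on (cbox p q) (\<lambda>\<zeta>. G \<zeta> $ i $ j)" "continuous_on (cbox p q) (\<lambda>\<zeta>. Gi \<zeta> $ i $ j)" for i j
    by (rule holomorphic_on_imp_continuous_on[OF holomorphic_on_subset[OF _ sub0]], rule G Gi)+
  obtain \<gamma>1 where \<gamma>1: "\<And>\<zeta> i j. \<zeta> \<in> cbox p q \<Longrightarrow> cmod (G \<zeta> $ i $ j) \<le> \<gamma>1" using bdd[of G] cG by blast
  obtain \<gamma>2 where \<gamma>2: "\<And>\<zeta> i j. \<zeta> \<in> cbox p q \<Longrightarrow> cmod (Gi \<zeta> $ i $ j) \<le> \<gamma>2" using bdd[of Gi] cG by blast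
  define \<gamma> where "\<gamma> = max 1 (max \<gamma>1 \<gamma>2)"
  have \<gamma>: "cmod (G \<zeta> $ i $ j) \<le> \<gamma>" "cmod (Gi \<zeta> $ i $ j) \<le> \<gamma>" if "\<zeta> \<in> cbox p q" for \<zeta> i j
    using \<gamma>1[OF that] \<gamma>2[OF that] by (auto simp: \<gamma>_def le_max_iff_disj)
  have \<gamma>0: "\<gamma> \<ge> 1" by (simp add: \<gamma>_def)
  define d where "d = cmod (q - p) + 1"
  have d: "cmod (x - p) \<le> d" if "x \<in> cbox p q" for x
  proof -
    have "cmod (x - p) \<le> cmod (q - p)" unfolding cmod_def
      by (intro real_sqrt_le_mono add_mono power_mono) (use that pq in \<open>auto simp: in_cbox_complex_iff\<close>)
    thus ?thesis by (simp add: d_def)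
  qed
  have d0: "d > 0" by (simp add: d_def add_nonneg_pos)
  \<comment> \<open>The bound 1/2 lets the estimate of A below absorb itself, giving entries of
    modulus at most 2; then \<open>2 * \<kappa> \<le> e\<close> concludes.\<close>
  define \<kappa> where "\<kappa> = min (1/2) (e / 2)"
  have \<kappa>: "0 < \<kappa>" "\<kappa> \<le> 1/2" "2 * \<kappa> \<le> e" using e by (auto simp: \<kappa>_def)
  \<comment> \<open>The derivative of A is a product of four matrices: three multiplications give
    three factors \<open>?n\<close>, two of the matrices are bounded by \<gamma>, and d bounds the
    distance to p.\<close>
  define e' where "e' = \<kappa> / (d * ?n * ?n * ?n * \<gamma> * \<gamma>)"
  have den: "d * ?n * ?n * ?n * \<gamma> * \<gamma> > 0" using d0 n1 \<gamma>0 by (auto intro!: mult_pos_pos)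
  have e': "e' > 0" using \<kappa> den by (simp add: e'_def)
  define H where "H = {\<zeta>. Im (?p 2) < Im \<zeta> \<and> Im \<zeta> < Im (?q 2) \<and> Re (?p 2) < Re \<zeta>}"
  have "\<exists>g. g holomorphic_on H \<and>
     (\<forall>\<zeta>\<in>cbox p q. cmod (N \<zeta> $ i $ j - g \<zeta>) < e')" for i j
  proof -
    have cN: "continuous_on (cbox (?p 2) (?q 2)) (\<lambda>\<zeta>. N \<zeta> $ i $ j)"
      by (rule holomorphic_on_imp_continuous_on[OF holomorphic_on_subset[OF N sub2]])
    have hN: "(\<lambda>\<zeta>. N \<zeta> $ i $ j) holomorphic_on box (?p 2) (?q 2)"
      by (rule holomorphic_on_subset[OF N order.trans[OF box_subset_cbox sub2]])
    have "Re (?p 2) < Re p" "Re q < Re (?q 2)" "Im (?p 2) < Im p" "Im q < Im (?q 2)" using \<eta> unfolding R by auto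
    note runge = runge_half_strip[OF this(1) pq(1) this(2,3) pq(2) this(4) cN hN e', folded H_def]
    obtain g where "g holomorphic_on H" "\<And>\<zeta>. \<zeta> \<in> cbox p q \<Longrightarrow> cmod (N \<zeta> $ i $ j - g \<zeta>) < e'"
      by (rule runge, rule that)
    thus ?thesis by (intro exI[of _ g]) simp
  qed
  then obtain g where g: "\<And>i j. g i j holomorphic_on H"
     "\<And>i j \<zeta>. \<zeta> \<in> cbox p q \<Longrightarrow> cmod (N \<zeta> $ i $ j - g i j \<zeta>) < e'" by metis
  define N2 where "N2 = (\<lambda>\<zeta>. \<chi> i j. g i j \<zeta>)"
  have clsub: "cbox (p - of_real \<eta> * (1 + \<i>)) (Complex E (Im q + \<eta>)) \<subseteq> H"
    using \<eta> by (auto simp: in_cbox_complex_iff H_def)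
  have N2h: "(\<lambda>\<zeta>. N2 \<zeta> $ i $ j) holomorphic_on \<Omega>" for i j
    using holomorphic_on_subset[OF g(1) order.trans[OF box_subset_cbox clsub]] by (simp add: N2_def \<Omega>_def)
  have "\<exists>c. \<forall>\<zeta>\<in>\<Omega>. cmod (g i j \<zeta>) \<le> c" for i j
  proof -
    have "continuous_on (cbox (p - of_real \<eta> * (1 + \<i>)) (Complex E (Im q + \<eta>))) (g i j)"
      by (rule holomorphic_on_imp_continuous_on[OF holomorphic_on_subset[OF g(1) clsub]])
    from compact_imp_bounded[OF compact_continuous_image[OF this compact_cbox]]
    obtain c where "\<forall>x\<in>g i j ` cbox (p - of_real \<eta> * (1 + \<i>)) (Complex E (Im q + \<eta>)). cmod x \<le> c"
      unfolding bounded_iff by blast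
    thus ?thesis using subsetD[OF box_subset_cbox] unfolding \<Omega>_def by (intro exI[of _ c]) blast
  qed
  then obtain c where c: "\<And>i j \<zeta>. \<zeta> \<in> \<Omega> \<Longrightarrow> cmod (g i j \<zeta>) \<le> c i j" by metis
  have N2b: "cmod (N2 \<zeta> $ i $ j) \<le> Max (range (\<lambda>(i, j). c i j))" if "\<zeta> \<in> \<Omega>" for \<zeta> i j
    unfolding N2_def by (simp, rule order.trans[OF c[OF that, of i j] Max_ge]) (auto intro!: rev_image_eqI[of "(i, j)"])
  have pc: "p \<in> cbox p q" using pq by (auto simp: in_cbox_complex_iff)
  have "convex \<Omega>" "open \<Omega>" "bounded \<Omega>" unfolding \<Omega>_def by (auto simp: convex_box bounded_box)
  note \<Omega> = this
  show thesis
  proof (rule linear_ode_fundamental_matrix[OF \<Omega> subsetD[OF sub\<Omega> pc] GGi[OF subsetD[OF sub0 pc]] N2h N2b])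
  fix a b assume ab: "b p = G p" "a p = Gi p" "\<And>\<zeta>. \<zeta> \<in> \<Omega> \<Longrightarrow> a \<zeta> ** b \<zeta> = mat 1" "\<And>\<zeta>. \<zeta> \<in> \<Omega> \<Longrightarrow> b \<zeta> ** a \<zeta> = mat 1"
    "\<And>\<zeta> i j. \<zeta> \<in> \<Omega> \<Longrightarrow> ((\<lambda>\<zeta>. b \<zeta> $ i $ j) has_field_derivative (N2 \<zeta> ** b \<zeta>) $ i $ j) (at \<zeta>)"
    "\<And>\<zeta> i j. \<zeta> \<in> \<Omega> \<Longrightarrow> ((\<lambda>\<zeta>. a \<zeta> $ i $ j) has_field_derivative (- (a \<zeta> ** N2 \<zeta>)) $ i $ j) (at \<zeta>)"
  have hol: "(\<lambda>\<zeta>. a \<zeta> $ i $ j) holomorphic_on \<Omega>" "(\<lambda>\<zeta>. b \<zeta> $ i $ j) holomorphic_on \<Omega>" for i j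
    using ab(5,6) unfolding holomorphic_on_open[OF \<Omega>(2)] by blast+
  define A where "A = (\<lambda>\<zeta>. a \<zeta> ** G \<zeta>)"
  \<comment> \<open>A would be constant if N2 were N: its derivative is A times
    \<open>N - N2\<close> conjugated by G.\<close>
  have A': "((\<lambda>\<zeta>. A \<zeta> $ i $ j) has_field_derivative (A x ** (Gi x ** ((N x - N2 x) ** G x))) $ i $ j) (at x)" if x: "x \<in> cbox p q" for x i j
  proof -
    have x': "x \<in> ?B" "x \<in> \<Omega>" using x sub0 sub\<Omega> by auto
    have "((\<lambda>\<zeta>. A \<zeta> $ i $ j) has_field_derivative (- (a x ** N2 x) ** G x + a x ** G' x) $ i $ j) (at x)"
      unfolding A_def by (rule matrix_mult_derivative) (intro ab(6) G'd x')+
    moreover have "- (a x ** N2 x) ** G x + a x ** G' x = A x ** (Gi x ** ((N x - N2 x) ** G x))"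
    proof -
      have GG: "Gi x ** G x = mat 1" "G x ** Gi x = mat 1" using GGi[OF x'(1)] matrix_left_right_inverse by blast+
      have NG: "N x ** G x = G' x" unfolding N_def by (simp add: matrix_mul_assoc[symmetric] GG)
      have "A x ** (Gi x ** ((N x - N2 x) ** G x)) = a x ** ((G x ** Gi x) ** ((N x - N2 x) ** G x))"
        by (simp add: A_def matrix_mul_assoc)
      also have "\<dots> = a x ** G' x - (a x ** N2 x) ** G x" by (simp add: GG matrix_mult_diff NG matrix_mul_assoc)
      finally show ?thesis by (simp add: matrix_mult_diff)
    qed
    ultimately show ?thesis by simp
  qed
  have cA: "continuous_on (cbox p q) (\<lambda>\<zeta>. A \<zeta> $ i $ j)" for i j
    by (intro continuous_at_imp_continuous_on ballI DERIV_isCont[OF A'])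
  define \<mu> where "\<mu> = Sup ((\<lambda>(\<zeta>, i, j). cmod (A \<zeta> $ i $ j)) ` (cbox p q \<times> UNIV))"
  obtain \<mu>1 where \<mu>1: "\<And>\<zeta> i j. \<zeta> \<in> cbox p q \<Longrightarrow> cmod (A \<zeta> $ i $ j) \<le> \<mu>1" using bdd[of A] cA by blast
  have \<mu>: "cmod (A \<zeta> $ i $ j) \<le> \<mu>" if "\<zeta> \<in> cbox p q" for \<zeta> i j
    unfolding \<mu>_def by (rule cSup_upper) (use that \<mu>1 in \<open>auto intro!: bdd_aboveI[of _ \<mu>1] rev_image_eqI[of "(\<zeta>, i, j)"]\<close>)
  have \<mu>0: "\<mu> \<ge> 0" using order.trans[OF norm_ge_zero \<mu>[OF pc]] .
  have Ap: "A p = mat 1" using GGi[OF subsetD[OF sub0 pc]] by (simp add: A_def ab)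
  have key: "cmod (A \<zeta> $ i $ j - A p $ i $ j) \<le> \<kappa> * \<mu>" if z: "\<zeta> \<in> cbox p q" for \<zeta> i j
  proof -
    have 1: "cmod ((A x ** (Gi x ** ((N x - N2 x) ** G x))) $ i $ j) \<le> ?n * (\<mu> * (?n * (\<gamma> * (?n * (e' * \<gamma>)))))" if x: "x \<in> cbox p q" for x
      by (intro matrix_mult_entry_bound \<mu> \<gamma> x) (use g(2)[OF x] in \<open>auto simp: N2_def less_imp_le\<close>)
    have "cmod (A \<zeta> $ i $ j - A p $ i $ j) \<le> (?n * (\<mu> * (?n * (\<gamma> * (?n * (e' * \<gamma>)))))) * cmod (\<zeta> - p)"
      by (rule field_differentiable_bound[OF convex_box(1) has_field_derivative_at_within[OF A'] 1 z pc])
    also have "\<dots> \<le> (?n * (\<mu> * (?n * (\<gamma> * (?n * (e' * \<gamma>)))))) * d"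
      using \<mu>0 \<gamma>0 e' by (intro mult_left_mono d z) (auto intro!: mult_nonneg_nonneg)
    also have "\<dots> = (e' * (d * ?n * ?n * ?n * \<gamma> * \<gamma>)) * \<mu>" by (simp add: mult_ac)
    also have "e' * (d * ?n * ?n * ?n * \<gamma> * \<gamma>) = \<kappa>" using den unfolding e'_def by (subst nonzero_eq_divide_eq[symmetric]) auto
    finally show ?thesis .
  qed
  \<comment> \<open>In place of Gronwall's inequality: the supremum \<mu> of the entries bounds the
    derivative, and integrating from p, where A is the identity, bounds \<mu> in terms of
    itself.\<close>
  have "\<mu> \<le> 1 + \<kappa> * \<mu>"
    unfolding \<mu>_def
  proof (rule cSup_least)
    fix y assume "y \<in> (\<lambda>(\<zeta>, i, j). cmod (A \<zeta> $ i $ j)) ` (cbox p q \<times> UNIV)"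
    then obtain \<zeta> i j where y: "\<zeta> \<in> cbox p q" "y = cmod (A \<zeta> $ i $ j)" by auto
    have "cmod (A p $ i $ j) \<le> 1" by (simp add: Ap mat_def)
    hence "y \<le> 1 + \<kappa> * \<mu>" using key[OF y(1), of i j] norm_triangle_sub[of "A \<zeta> $ i $ j" "A p $ i $ j"] y(2) by linarith
    thus "y \<le> 1 + \<kappa> * Sup ((\<lambda>(\<zeta>, i, j). cmod (A \<zeta> $ i $ j)) ` (cbox p q \<times> UNIV))" by (simp add: \<mu>_def)
  qed (use pc in auto)
  moreover have "\<kappa> * \<mu> \<le> 1/2 * \<mu>" using \<kappa> \<mu>0 by (intro mult_right_mono) auto
  ultimately have "\<mu> \<le> 2" by linarith
  hence "\<kappa> * \<mu> \<le> e" using \<kappa> mult_left_mono[of \<mu> 2 \<kappa>] by linarith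
  hence fin: "cmod ((a \<zeta> ** G \<zeta> - mat 1) $ i $ j) \<le> e" if "\<zeta> \<in> cbox p q" for \<zeta> i j
    using key[OF that, of i j] by (simp add: Ap) (simp add: A_def)
  show thesis by (rule that[of a b, OF hol ab(3,4) fin])
  qed
qed

lemma bounded_linear_smult_vec: "bounded_linear (\<lambda>z :: complex. z *s (v :: complex ^ 'n))"
  by (rule bounded_linear_intro[where K = "norm v"])
     (auto simp: vec_eq_iff norm_smult_vec algebra_simps)

lemma has_derivative_vec_iff:
  fixes f :: "complex \<Rightarrow> complex ^ 'n"
  shows "(f has_derivative (\<lambda>h. h *s v)) (at x) \<longleftrightarrow> (\<forall>i. ((\<lambda>\<tau>. f \<tau> $ i) has_field_derivative v $ i) (at x))"
proof -
  have m: "(*) (v $ i) = (\<lambda>h. h * v $ i)" for i by (simp add: fun_eq_iff mult.commute)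
  show ?thesis
  proof
  assume "(f has_derivative (\<lambda>h. h *s v)) (at x)"
  hence "((\<lambda>\<tau>. f \<tau> $ i) has_derivative (\<lambda>h. (h *s v) $ i)) (at x)" for i
    by (rule bounded_linear.has_derivative[OF bounded_linear_vec_nth])
  thus "\<forall>i. ((\<lambda>\<tau>. f \<tau> $ i) has_field_derivative v $ i) (at x)"
    unfolding has_field_derivative_def m by simp
next
  assume *: "\<forall>i. ((\<lambda>\<tau>. f \<tau> $ i) has_field_derivative v $ i) (at x)"
  have "((\<lambda>\<tau>. \<Sum>i\<in>UNIV. f \<tau> $ i *s axis i 1) has_derivative (\<lambda>h. \<Sum>i\<in>UNIV. (h * v $ i) *s axis i 1)) (at x)"
  proof (rule has_derivative_sum)
    fix i
    have "((\<lambda>\<tau>. f \<tau> $ i) has_derivative (\<lambda>h. h * v $ i)) (at x)"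
      using * unfolding has_field_derivative_def m by blast
    from bounded_linear.has_derivative[OF bounded_linear_smult_vec this]
    show "((\<lambda>\<tau>. f \<tau> $ i *s axis i 1) has_derivative (\<lambda>h. (h * v $ i) *s axis i 1)) (at x)" .
  qed
  moreover have "(\<Sum>i\<in>UNIV. (h * v $ i) *s axis i 1) = h *s v" for h :: complex
    using basis_expansion[of "h *s v"] by simp
  ultimately show "(f has_derivative (\<lambda>h. h *s v)) (at x)" by (simp add: basis_expansion)
  qed
qed

section \<open>Holomorphic curves in a manifold\<close>

definition mholo :: "('a::topological_space set \<times> ('a \<Rightarrow> complex ^ 'n)) set \<Rightarrow> complex set \<Rightarrow> (complex \<Rightarrow> 'a) \<Rightarrow> bool" where
  "mholo A T c \<longleftrightarrow> continuous_on T c \<and> (\<forall>(U, \<phi>)\<in>A. vholo (T \<inter> c -` U) (\<lambda>\<tau>. \<phi> (c \<tau>)))"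

lemma holo_disc_iff_mholo: "holo_disc A f \<longleftrightarrow> mholo A (ball 0 1) f"
  by (simp add: holo_disc_def mholo_def vholo_def)

lemma mholoI:
  "continuous_on T c \<Longrightarrow> (\<And>U \<phi>. (U, \<phi>) \<in> A \<Longrightarrow> vholo (T \<inter> c -` U) (\<lambda>\<tau>. \<phi> (c \<tau>))) \<Longrightarrow> mholo A T c"
  unfolding mholo_def by blast

lemma mholo_continuous: "mholo A T c \<Longrightarrow> continuous_on T c"
  by (simp add: mholo_def)

lemma mholo_chart: "mholo A T c \<Longrightarrow> (U, \<phi>) \<in> A \<Longrightarrow> vholo (T \<inter> c -` U) (\<lambda>\<tau>. \<phi> (c \<tau>))"
  unfolding mholo_def by blast

lemma mholo_subset: "mholo A T c \<Longrightarrow> T' \<subseteq> T \<Longrightarrow> mholo A T' c"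
  unfolding mholo_def by (blast intro: continuous_on_subset vholo_subset)

lemma mholo_compose:
  assumes "mholo A T c" "g holomorphic_on T'" "g ` T' \<subseteq> T"
  shows "mholo A T' (\<lambda>\<tau>. c (g \<tau>))"
proof (rule mholoI)
  show "continuous_on T' (\<lambda>\<tau>. c (g \<tau>))"
    by (rule continuous_on_compose2[OF mholo_continuous[OF assms(1)] holomorphic_on_imp_continuous_on[OF assms(2)] assms(3)])
  fix U \<phi> assume "(U, \<phi>) \<in> A"
  from mholo_chart[OF assms(1) this] show "vholo (T' \<inter> (\<lambda>\<tau>. c (g \<tau>)) -` U) (\<lambda>\<tau>. \<phi> (c (g \<tau>)))"
    by (rule vholo_compose) (use assms in \<open>auto intro: holomorphic_on_subset\<close>)
qed

lemma mholo_cong: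
  assumes "\<And>\<tau>. \<tau> \<in> T \<Longrightarrow> c \<tau> = c' \<tau>" and "mholo A T c" shows "mholo A T c'"
proof (rule mholoI)
  show "continuous_on T c'" using assms by (auto simp: mholo_def cong: continuous_on_cong)
  fix U \<phi> assume "(U, \<phi>) \<in> A"
  from mholo_chart[OF assms(2) this] have "vholo (T \<inter> c -` U) (\<lambda>\<tau>. \<phi> (c \<tau>))" .
  moreover have "T \<inter> c -` U = T \<inter> c' -` U" using assms(1) by auto
  ultimately show "vholo (T \<inter> c' -` U) (\<lambda>\<tau>. \<phi> (c' \<tau>))"
    using vholo_cong[of "T \<inter> c' -` U" "\<lambda>\<tau>. \<phi> (c \<tau>)" "\<lambda>\<tau>. \<phi> (c' \<tau>)"] assms(1) by auto
qed

lemma atlas_chartD: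
  assumes "complex_atlas A" "(U, \<phi>) \<in> A"
  shows "open U" "open (\<phi> ` U)" "continuous_on U \<phi>" "continuous_on (\<phi> ` U) (inv_into U \<phi>)" "inj_on \<phi> U"
    "\<And>x. x \<in> U \<Longrightarrow> inv_into U \<phi> (\<phi> x) = x"
proof -
  have *: "open U \<and> open (\<phi> ` U) \<and> homeomorphism U (\<phi> ` U) \<phi> (inv_into U \<phi>)"
    using assms unfolding complex_atlas_def by blast
  thus "open U" "open (\<phi> ` U)" "continuous_on U \<phi>" "continuous_on (\<phi> ` U) (inv_into U \<phi>)"
     "\<And>x. x \<in> U \<Longrightarrow> inv_into U \<phi> (\<phi> x) = x" by (auto simp: homeomorphism_def)
  thus "inj_on \<phi> U" by (metis inj_on_inverseI)
qed

lemma atlas_cover: "complex_atlas A \<Longrightarrow> \<exists>U \<phi>. (U, \<phi>) \<in> A \<and> x \<in> U"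
  unfolding complex_atlas_def by (force simp: set_eq_iff)

lemma mholo_local:
  assumes A: "complex_atlas A" and T: "open T" and loc: "\<And>x. x \<in> T \<Longrightarrow> \<exists>T'. open T' \<and> x \<in> T' \<and> mholo A T' c"
  shows "mholo A T c"
proof (rule mholoI)
  have "continuous (at x) c" if x: "x \<in> T" for x
  proof -
    obtain T' where "open T'" "x \<in> T'" "mholo A T' c" using loc[OF x] by blast
    thus ?thesis using mholo_continuous[of A T' c] continuous_on_eq_continuous_at by blast
  qed
  thus cont: "continuous_on T c" by (simp add: continuous_at_imp_continuous_on)
  fix U \<phi> assume U: "(U, \<phi>) \<in> A"
  show "vholo (T \<inter> c -` U) (\<lambda>\<tau>. \<phi> (c \<tau>))"
  proof (rule vholo_local)
    fix x assume x: "x \<in> T \<inter> c -` U"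
    then obtain T' where T': "open T'" "x \<in> T'" "mholo A T' c" using loc by blast
    have "open (T' \<inter> c -` U)"
      by (rule continuous_open_preimage[OF mholo_continuous[OF T'(3)] T'(1) atlas_chartD(1)[OF A U]])
    thus "\<exists>T'. open T' \<and> x \<in> T' \<and> vholo T' (\<lambda>\<tau>. \<phi> (c \<tau>))" using mholo_chart[OF T'(3) U] T' x by blast
  qed
qed

text \<open>The derivative M of a transition map is complex linear, so by the chain rule holomorphy
  of a curve in one chart containing it passes to every other chart.\<close>

lemma mholo_in_chart:
  assumes A: "complex_atlas A" and U: "(U, \<phi>) \<in> A" and T: "open T" and c: "c ` T \<subseteq> U" and v: "vholo T (\<lambda>\<tau>. \<phi> (c \<tau>))"
  shows "mholo A T c"
proof (rule mholoI)
  note cU = atlas_chartD[OF A U]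
  have "continuous_on T (\<lambda>\<tau>. inv_into U \<phi> (\<phi> (c \<tau>)))"
    by (rule continuous_on_compose2[OF cU(4) vholo_continuous[OF v]]) (use c in auto)
  thus cont: "continuous_on T c" by (rule continuous_on_cong[THEN iffD1, rotated 2]) (use c cU(6) in auto)
  fix V \<psi> assume V: "(V, \<psi>) \<in> A"
  have o: "open (T \<inter> c -` V)" by (rule continuous_open_preimage[OF cont T atlas_chartD(1)[OF A V]])
  show "vholo (T \<inter> c -` V) (\<lambda>\<tau>. \<psi> (c \<tau>))"
    unfolding vholo_def holomorphic_on_open[OF o]
  proof (intro allI ballI)
    fix i x assume x: "x \<in> T \<inter> c -` V"
    have "cholo_on (\<phi> ` (U \<inter> V)) (\<psi> \<circ> inv_into U \<phi>)" using A U V unfolding complex_atlas_def by blast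
    moreover have "\<phi> (c x) \<in> \<phi> ` (U \<inter> V)" using x c by auto
    ultimately obtain M :: "complex ^ 'b ^ 'b" where M: "((\<psi> \<circ> inv_into U \<phi>) has_derivative (\<lambda>h. M *v h)) (at (\<phi> (c x)))"
      unfolding cholo_on_def by blast
    have "\<exists>D. ((\<lambda>\<tau>. \<phi> (c \<tau>) $ j) has_field_derivative D) (at x)" for j
      using v x T unfolding vholo_def by (auto simp: holomorphic_on_open)
    then obtain D where "\<And>j. ((\<lambda>\<tau>. \<phi> (c \<tau>) $ j) has_field_derivative D j) (at x)" by metis
    hence "((\<lambda>\<tau>. \<phi> (c \<tau>)) has_derivative (\<lambda>h. h *s (\<chi> j. D j))) (at x)" by (simp add: has_derivative_vec_iff)
    from diff_chain_at[OF this M]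
    have "((\<lambda>\<tau>. \<psi> (inv_into U \<phi> (\<phi> (c \<tau>)))) has_derivative (\<lambda>h. M *v (h *s (\<chi> j. D j)))) (at x)" by (simp add: o_def)
    moreover have "M *v (h *s (\<chi> j. D j)) = h *s (M *v (\<chi> j. D j))" for h
      by (simp add: vec_eq_iff matrix_vector_mult_def sum_distrib_left mult_ac)
    ultimately have "((\<lambda>\<tau>. \<psi> (inv_into U \<phi> (\<phi> (c \<tau>)))) has_derivative (\<lambda>h. h *s (M *v (\<chi> j. D j)))) (at x)" by simp
    hence "((\<lambda>\<tau>. \<psi> (inv_into U \<phi> (\<phi> (c \<tau>))) $ i) has_field_derivative (M *v (\<chi> j. D j)) $ i) (at x)"
      by (simp add: has_derivative_vec_iff)
    hence "((\<lambda>\<tau>. \<psi> (c \<tau>) $ i) has_field_derivative (M *v (\<chi> j. D j)) $ i) (at x)"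
      by (rule has_field_derivative_transform_within_open[OF _ T]) (use x c cU(6) in auto)
    thus "\<exists>D. ((\<lambda>\<tau>. \<psi> (c \<tau>) $ i) has_field_derivative D) (at x)" by blast
  qed
qed

lemma mholo_inv_chart:
  assumes A: "complex_atlas A" and U: "(U, \<phi>) \<in> A" and T: "open T" and \<sigma>: "vholo T \<sigma>" "\<sigma> ` T \<subseteq> \<phi> ` U"
  shows "mholo A T (\<lambda>\<tau>. inv_into U \<phi> (\<sigma> \<tau>))"
proof (rule mholo_in_chart[OF A U T])
  show "(\<lambda>\<tau>. inv_into U \<phi> (\<sigma> \<tau>)) ` T \<subseteq> U" using \<sigma>(2) by (auto simp: image_subset_iff intro: inv_into_into)
  show "vholo T (\<lambda>\<tau>. \<phi> (inv_into U \<phi> (\<sigma> \<tau>)))"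
    using \<sigma>(1) by (rule vholo_cong[THEN iffD1, rotated]) (rule f_inv_into_f[symmetric], use \<sigma>(2) in blast)
qed

section \<open>Trivializations along a disc\<close>

text \<open>A family is a trivialization of a neighbourhood of the graph of f in the product of
  the plane with the manifold; the second map is the fibre coordinate.\<close>

definition fam :: "('a::t2_space set \<times> ('a \<Rightarrow> complex ^ 'n)) set \<Rightarrow> (complex \<Rightarrow> 'a) \<Rightarrow> complex set \<Rightarrow> real \<Rightarrow>
    (complex \<times> (complex ^ 'n) \<Rightarrow> 'a) \<Rightarrow> (complex \<times> 'a \<Rightarrow> complex ^ 'n) \<Rightarrow> bool" where
  "fam A f \<Omega> \<delta> F \<psi> \<longleftrightarrow> open \<Omega> \<and> 0 < \<delta> \<and> continuous_on (\<Omega> \<times> ball 0 \<delta>) F \<and>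
     (\<forall>T g \<sigma>. open T \<longrightarrow> g holomorphic_on T \<longrightarrow> vholo T \<sigma> \<longrightarrow> (\<forall>\<tau>\<in>T. (g \<tau>, \<sigma> \<tau>) \<in> \<Omega> \<times> ball 0 \<delta>) \<longrightarrow> mholo A T (\<lambda>\<tau>. F (g \<tau>, \<sigma> \<tau>))) \<and>
     (\<forall>\<zeta>\<in>\<Omega>. F (\<zeta>, 0) = f \<zeta>) \<and>
     (\<forall>a\<in>\<Omega> \<times> ball 0 \<delta>. \<psi> (fst a, F a) = snd a) \<and>
     open ((\<lambda>a. (fst a, F a)) ` (\<Omega> \<times> ball 0 \<delta>)) \<and>
     continuous_on ((\<lambda>a. (fst a, F a)) ` (\<Omega> \<times> ball 0 \<delta>)) \<psi> \<and>
     (\<forall>T g c. open T \<longrightarrow> g holomorphic_on T \<longrightarrow> mholo A T c \<longrightarrow> (\<forall>\<tau>\<in>T. (g \<tau>, c \<tau>) \<in> (\<lambda>a. (fst a, F a)) ` (\<Omega> \<times> ball 0 \<delta>))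
        \<longrightarrow> vholo T (\<lambda>\<tau>. \<psi> (g \<tau>, c \<tau>)))"

section \<open>Change of fibre coordinate and union of trivializations\<close>

lemma famD:
  assumes "fam A f \<Omega> \<delta> F \<psi>"
  shows "open \<Omega>" "0 < \<delta>" "continuous_on (\<Omega> \<times> ball 0 \<delta>) F"
    "\<And>T g \<sigma>. open T \<Longrightarrow> g holomorphic_on T \<Longrightarrow> vholo T \<sigma> \<Longrightarrow> (\<And>\<tau>. \<tau> \<in> T \<Longrightarrow> (g \<tau>, \<sigma> \<tau>) \<in> \<Omega> \<times> ball 0 \<delta>) \<Longrightarrow> mholo A T (\<lambda>\<tau>. F (g \<tau>, \<sigma> \<tau>))"
    "\<And>\<zeta>. \<zeta> \<in> \<Omega> \<Longrightarrow> F (\<zeta>, 0) = f \<zeta>" "\<And>a. a \<in> \<Omega> \<times> ball 0 \<delta> \<Longrightarrow> \<psi> (fst a, F a) = snd a"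
    "open ((\<lambda>a. (fst a, F a)) ` (\<Omega> \<times> ball 0 \<delta>))" "continuous_on ((\<lambda>a. (fst a, F a)) ` (\<Omega> \<times> ball 0 \<delta>)) \<psi>"
    "\<And>T g c. open T \<Longrightarrow> g holomorphic_on T \<Longrightarrow> mholo A T c \<Longrightarrow> (\<And>\<tau>. \<tau> \<in> T \<Longrightarrow> (g \<tau>, c \<tau>) \<in> (\<lambda>a. (fst a, F a)) ` (\<Omega> \<times> ball 0 \<delta>))
        \<Longrightarrow> vholo T (\<lambda>\<tau>. \<psi> (g \<tau>, c \<tau>))"
  using assms unfolding fam_def by blast+

text \<open>Linear changes of the fibre coordinate and changes close to the identity are both
  instances. The new neighbourhood is the part of the old one whose fibre coordinate lies in the
  image of \<theta>, hence open by continuity of \<psi>; \<kappa> undoes \<theta> there.\<close>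

lemma fam_reparam:
  assumes fm: "fam A f \<Omega> \<delta> F \<psi>" and \<Omega>': "open \<Omega>'" "\<Omega>' \<subseteq> \<Omega>" and \<delta>': "0 < \<delta>'"
    and \<theta>: "jholo (\<Omega>' \<times> ball 0 \<delta>') \<theta>" "\<And>a. a \<in> \<Omega>' \<times> ball 0 \<delta>' \<Longrightarrow> \<theta> a \<in> ball 0 \<delta>" "\<And>\<zeta>. \<zeta> \<in> \<Omega>' \<Longrightarrow> \<theta> (\<zeta>, 0) = 0"
    and I: "open ((\<lambda>a. (fst a, \<theta> a)) ` (\<Omega>' \<times> ball 0 \<delta>'))"
    and \<kappa>: "jholo ((\<lambda>a. (fst a, \<theta> a)) ` (\<Omega>' \<times> ball 0 \<delta>')) \<kappa>" "\<And>a. a \<in> \<Omega>' \<times> ball 0 \<delta>' \<Longrightarrow> \<kappa> (fst a, \<theta> a) = snd a"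
  shows "fam A f \<Omega>' \<delta>' (\<lambda>a. F (fst a, \<theta> a)) (\<lambda>b. \<kappa> (fst b, \<psi> b))"
proof -
  let ?W = "\<Omega>' \<times> ball (0 :: complex ^ 'b) \<delta>'" and ?F = "\<lambda>a. F (fst a, \<theta> a)"
  let ?I = "(\<lambda>a. (fst a, \<theta> a)) ` ?W" and ?N = "(\<lambda>a. (fst a, F a)) ` (\<Omega> \<times> ball 0 \<delta>)" and ?N' = "(\<lambda>a. (fst a, ?F a)) ` ?W"
  note fd = famD[OF fm]
  have in\<Omega>: "(fst a, \<theta> a) \<in> \<Omega> \<times> ball 0 \<delta>" if "a \<in> ?W" for a using that \<theta>(2)[OF that] \<Omega>'(2) by auto
  have N'N: "?N' \<subseteq> ?N"
  proof
    fix b assume "b \<in> ?N'"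
    then obtain a where a: "a \<in> ?W" "b = (fst a, F (fst a, \<theta> a))" by auto
    thus "b \<in> ?N" using in\<Omega>[OF a(1)] by (intro image_eqI[of _ _ "(fst a, \<theta> a)"]) auto
  qed
  have \<psi>I: "(fst b, \<psi> b) \<in> ?I" if "b \<in> ?N'" for b
  proof -
    from that obtain a where a: "a \<in> ?W" "b = (fst a, F (fst a, \<theta> a))" by auto
    have "\<psi> b = \<theta> a" using fd(6)[OF in\<Omega>[OF a(1)]] a(2) by simp
    thus ?thesis using a by force
  qed
  have N'eq: "?N' = ?N \<inter> (\<lambda>b. (fst b, \<psi> b)) -` ?I"
  proof (intro equalityI subsetI)
    fix b assume b: "b \<in> ?N \<inter> (\<lambda>b. (fst b, \<psi> b)) -` ?I"
    then obtain a0 where a0: "a0 \<in> \<Omega> \<times> ball 0 \<delta>" "b = (fst a0, F a0)" by auto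
    from b obtain a where a: "a \<in> ?W" "(fst b, \<psi> b) = (fst a, \<theta> a)" by auto
    have "\<psi> b = snd a0" using fd(6)[OF a0(1)] a0(2) by simp
    hence "a0 = (fst a, \<theta> a)" using a a0(2) by (metis Pair_inject fst_conv prod.collapse)
    thus "b \<in> ?N'" using a(1) a0(2) by (intro image_eqI[of _ _ a]) auto
  qed (use N'N \<psi>I in auto)
  have c\<psi>: "continuous_on ?N (\<lambda>b. (fst b, \<psi> b))" by (intro continuous_intros fd(8))
  show ?thesis unfolding fam_def
  proof (intro conjI allI impI ballI)
    show "open \<Omega>'" "0 < \<delta>'" by fact+
    show "continuous_on ?W ?F"
      by (rule continuous_on_compose2[OF fd(3)]) (use in\<Omega> in \<open>auto intro!: continuous_intros jholo_continuous \<theta>(1)\<close>)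
    show "mholo A T (\<lambda>\<tau>. ?F (g \<tau>, \<sigma> \<tau>))" if "open T" "g holomorphic_on T" "vholo T \<sigma>" "\<forall>\<tau>\<in>T. (g \<tau>, \<sigma> \<tau>) \<in> ?W" for T g \<sigma>
    proof -
      have "vholo T (\<lambda>\<tau>. \<theta> (g \<tau>, \<sigma> \<tau>))" by (rule jholo_curve[OF \<theta>(1) that(1-3)]) (use that in blast)
      have "mholo A T (\<lambda>\<tau>. F (g \<tau>, \<theta> (g \<tau>, \<sigma> \<tau>)))"
      proof (rule fd(4)[OF that(1,2) \<open>vholo T (\<lambda>\<tau>. \<theta> (g \<tau>, \<sigma> \<tau>))\<close>])
        show "(g \<tau>, \<theta> (g \<tau>, \<sigma> \<tau>)) \<in> \<Omega> \<times> ball 0 \<delta>" if "\<tau> \<in> T" for \<tau>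
          using in\<Omega>[of "(g \<tau>, \<sigma> \<tau>)"] that \<open>\<forall>\<tau>\<in>T. (g \<tau>, \<sigma> \<tau>) \<in> ?W\<close> by simp
      qed
      thus ?thesis by simp
    qed
    show "?F (\<zeta>, 0) = f \<zeta>" if "\<zeta> \<in> \<Omega>'" for \<zeta> using fd(5) \<theta>(3) that \<Omega>'(2) by auto
    show "\<kappa> (fst (fst a, ?F a), \<psi> (fst a, ?F a)) = snd a" if "a \<in> ?W" for a
      using fd(6)[OF in\<Omega>[OF that]] \<kappa>(2)[OF that] by simp
    show "open ?N'" unfolding N'eq by (rule continuous_open_preimage[OF c\<psi> fd(7) I])
    show "continuous_on ?N' (\<lambda>b. \<kappa> (fst b, \<psi> b))"
      by (rule continuous_on_compose2[OF jholo_continuous[OF \<kappa>(1)] continuous_on_subset[OF c\<psi> N'N]]) (use \<psi>I in blast)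
    show "vholo T (\<lambda>\<tau>. \<kappa> (fst (g \<tau>, c \<tau>), \<psi> (g \<tau>, c \<tau>)))"
      if "open T" "g holomorphic_on T" "mholo A T c" and N: "\<forall>\<tau>\<in>T. (g \<tau>, c \<tau>) \<in> ?N'" for T g c
    proof -
      have "vholo T (\<lambda>\<tau>. \<psi> (g \<tau>, c \<tau>))" by (rule fd(9)[OF that(1-3)]) (use N N'N in blast)
      hence "vholo T (\<lambda>\<tau>. \<kappa> (g \<tau>, \<psi> (g \<tau>, c \<tau>)))"
      proof (rule jholo_curve[OF \<kappa>(1) that(1,2)])
        show "(g \<tau>, \<psi> (g \<tau>, c \<tau>)) \<in> ?I" if "\<tau> \<in> T" for \<tau>
          using \<psi>I[of "(g \<tau>, c \<tau>)"] N that by simp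
      qed
      thus ?thesis by simp
    qed
  qed
qed

text \<open>Agreement of F1 and F2 over the common base forces \<psi>1 and \<psi>2 to agree as well,
  since each reads off the fibre coordinate. The rest is local: base and graph neighbourhood are
  each covered by two open sets.\<close>

lemma fam_union:
  assumes A: "complex_atlas A" and f1: "fam A f \<Omega>1 \<delta> F1 \<psi>1" and f2: "fam A f \<Omega>2 \<delta> F2 \<psi>2"
    and eq: "\<And>\<zeta> s. \<zeta> \<in> \<Omega>1 \<Longrightarrow> \<zeta> \<in> \<Omega>2 \<Longrightarrow> s \<in> ball 0 \<delta> \<Longrightarrow> F1 (\<zeta>, s) = F2 (\<zeta>, s)"
  shows "\<exists>F \<psi>. fam A f (\<Omega>1 \<union> \<Omega>2) \<delta> F \<psi>"
proof -
  define F where "F = (\<lambda>a. if fst a \<in> \<Omega>1 then F1 a else F2 a)"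
  define \<psi> where "\<psi> = (\<lambda>b. if fst b \<in> \<Omega>1 then \<psi>1 b else \<psi>2 b)"
  let ?B = "ball (0 :: complex ^ 'b) \<delta>"
  let ?N1 = "(\<lambda>a. (fst a, F1 a)) ` (\<Omega>1 \<times> ?B)" and ?N2 = "(\<lambda>a. (fst a, F2 a)) ` (\<Omega>2 \<times> ?B)"
  let ?N = "(\<lambda>a. (fst a, F a)) ` ((\<Omega>1 \<union> \<Omega>2) \<times> ?B)"
  note d1 = famD[OF f1] and d2 = famD[OF f2]
  have F1: "F a = F1 a" if "a \<in> \<Omega>1 \<times> ?B" for a using that by (auto simp: F_def)
  have F2: "F a = F2 a" if "a \<in> \<Omega>2 \<times> ?B" for a using that eq[of "fst a" "snd a"] by (auto simp: F_def)
  have N: "?N = ?N1 \<union> ?N2"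
  proof -
    have "?N = (\<lambda>a. (fst a, F a)) ` (\<Omega>1 \<times> ?B) \<union> (\<lambda>a. (fst a, F a)) ` (\<Omega>2 \<times> ?B)" by (simp add: Sigma_Un_distrib1 image_Un)
    also have "(\<lambda>a. (fst a, F a)) ` (\<Omega>1 \<times> ?B) = ?N1" by (rule image_cong) (simp_all only: F1)
    also have "(\<lambda>a. (fst a, F a)) ` (\<Omega>2 \<times> ?B) = ?N2" by (rule image_cong) (simp_all only: F2)
    finally show ?thesis .
  qed
  have \<psi>1: "\<psi> b = \<psi>1 b" if "b \<in> ?N1" for b using that by (auto simp: \<psi>_def)
  have \<psi>2: "\<psi> b = \<psi>2 b" if b: "b \<in> ?N2" for b
  proof (cases "fst b \<in> \<Omega>1")
    case True
    from b obtain a where a: "a \<in> \<Omega>2 \<times> ?B" "b = (fst a, F2 a)" by blast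
    hence a1: "a \<in> \<Omega>1 \<times> ?B" using True by (auto simp: mem_Times_iff)
    have "F1 a = F2 a" using F1[OF a1] F2[OF a(1)] by simp
    thus ?thesis using d1(6)[OF a1] d2(6)[OF a(1)] a(2) True by (simp add: \<psi>_def)
  qed (simp add: \<psi>_def)
  have oc: "continuous_on (X \<union> Y) h" if "open X" "open Y" "continuous_on X h1" "continuous_on Y h2"
     "\<And>x. x \<in> X \<Longrightarrow> h x = h1 x" "\<And>x. x \<in> Y \<Longrightarrow> h x = h2 x" for X Y :: "'x::topological_space set" and h h1 h2 :: "'x \<Rightarrow> 'y::topological_space"
    by (rule continuous_on_open_Un) (use that in \<open>auto cong: continuous_on_cong\<close>)
  have "fam A f (\<Omega>1 \<union> \<Omega>2) \<delta> F \<psi>"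
    unfolding fam_def
  proof (intro conjI allI impI ballI)
    show "open (\<Omega>1 \<union> \<Omega>2)" "0 < \<delta>" using d1 d2 by auto
    show "continuous_on ((\<Omega>1 \<union> \<Omega>2) \<times> ?B) F" unfolding Sigma_Un_distrib1
      by (rule oc[OF _ _ d1(3) d2(3)]) (use F1 F2 d1 d2 in \<open>auto intro!: open_Times\<close>)
    show "mholo A T (\<lambda>\<tau>. F (g \<tau>, \<sigma> \<tau>))" if T: "open T" and g: "g holomorphic_on T" and \<sigma>: "vholo T \<sigma>" and W: "\<forall>\<tau>\<in>T. (g \<tau>, \<sigma> \<tau>) \<in> (\<Omega>1 \<union> \<Omega>2) \<times> ?B" for T g \<sigma>
    proof -
      have gc: "continuous_on T g" using g by (rule holomorphic_on_imp_continuous_on)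
      have o: "open (T \<inter> g -` \<Omega>1)" "open (T \<inter> g -` \<Omega>2)" using continuous_open_preimage[OF gc T] d1(1) d2(1) by auto
      have 1: "mholo A (T \<inter> g -` \<Omega>1) (\<lambda>\<tau>. F (g \<tau>, \<sigma> \<tau>))"
      proof (rule mholo_cong[rotated])
        show "mholo A (T \<inter> g -` \<Omega>1) (\<lambda>\<tau>. F1 (g \<tau>, \<sigma> \<tau>))"
          by (rule d1(4)[OF o(1) holomorphic_on_subset[OF g] vholo_subset[OF \<sigma>]]) (use W in auto)
      qed (use F1 W in auto)
      have 2: "mholo A (T \<inter> g -` \<Omega>2) (\<lambda>\<tau>. F (g \<tau>, \<sigma> \<tau>))"
      proof (rule mholo_cong[rotated])
        show "mholo A (T \<inter> g -` \<Omega>2) (\<lambda>\<tau>. F2 (g \<tau>, \<sigma> \<tau>))"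
          by (rule d2(4)[OF o(2) holomorphic_on_subset[OF g] vholo_subset[OF \<sigma>]]) (use W in auto)
      qed (use F2 W in auto)
      show ?thesis
      proof (rule mholo_local[OF A T])
        fix x assume "x \<in> T"
        hence "x \<in> T \<inter> g -` \<Omega>1 \<or> x \<in> T \<inter> g -` \<Omega>2" using W by auto
        thus "\<exists>T'. open T' \<and> x \<in> T' \<and> mholo A T' (\<lambda>\<tau>. F (g \<tau>, \<sigma> \<tau>))" using 1 2 o by blast
      qed
    qed
    show "F (\<zeta>, 0) = f \<zeta>" if "\<zeta> \<in> \<Omega>1 \<union> \<Omega>2" for \<zeta> using that d1(5) d2(5) by (auto simp: F_def)
    show "\<psi> (fst a, F a) = snd a" if "a \<in> (\<Omega>1 \<union> \<Omega>2) \<times> ?B" for a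
    proof -
      have "a \<in> \<Omega>1 \<times> ?B \<or> a \<in> \<Omega>2 \<times> ?B" using that by auto
      thus ?thesis
      proof
        assume a: "a \<in> \<Omega>1 \<times> ?B"
        have "\<psi> (fst a, F1 a) = \<psi>1 (fst a, F1 a)" by (rule \<psi>1) (use a in blast)
        thus ?thesis using d1(6)[OF a] F1[OF a] by simp
      next
        assume a: "a \<in> \<Omega>2 \<times> ?B"
        have "\<psi> (fst a, F2 a) = \<psi>2 (fst a, F2 a)" by (rule \<psi>2) (use a in blast)
        thus ?thesis using d2(6)[OF a] F2[OF a] by simp
      qed
    qed
    show "open ?N" unfolding N using d1(7) d2(7) by auto
    show "continuous_on ?N \<psi>" unfolding N by (rule oc[OF d1(7) d2(7) d1(8) d2(8) \<psi>1 \<psi>2])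
    show "vholo T (\<lambda>\<tau>. \<psi> (g \<tau>, c \<tau>))" if T: "open T" and g: "g holomorphic_on T" and c: "mholo A T c" and W: "\<forall>\<tau>\<in>T. (g \<tau>, c \<tau>) \<in> ?N" for T g c
    proof -
      have gc: "continuous_on T (\<lambda>\<tau>. (g \<tau>, c \<tau>))"
        by (intro continuous_intros holomorphic_on_imp_continuous_on[OF g] mholo_continuous[OF c])
      let ?T1 = "T \<inter> (\<lambda>\<tau>. (g \<tau>, c \<tau>)) -` ?N1" and ?T2 = "T \<inter> (\<lambda>\<tau>. (g \<tau>, c \<tau>)) -` ?N2"
      have o: "open ?T1" "open ?T2" using continuous_open_preimage[OF gc T] d1(7) d2(7) by auto
      have "vholo ?T1 (\<lambda>\<tau>. \<psi>1 (g \<tau>, c \<tau>))"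
        by (rule d1(9)[OF o(1) holomorphic_on_subset[OF g] mholo_subset[OF c]]) auto
      hence 1: "vholo ?T1 (\<lambda>\<tau>. \<psi> (g \<tau>, c \<tau>))" by (rule vholo_cong[THEN iffD1, rotated]) (drule IntD2, drule vimageD, rule \<psi>1[symmetric])
      have "vholo ?T2 (\<lambda>\<tau>. \<psi>2 (g \<tau>, c \<tau>))"
        by (rule d2(9)[OF o(2) holomorphic_on_subset[OF g] mholo_subset[OF c]]) auto
      hence 2: "vholo ?T2 (\<lambda>\<tau>. \<psi> (g \<tau>, c \<tau>))" by (rule vholo_cong[THEN iffD1, rotated]) (drule IntD2, drule vimageD, rule \<psi>2[symmetric])
      show ?thesis
      proof (rule vholo_local)
        fix x assume "x \<in> T"
        hence "x \<in> ?T1 \<or> x \<in> ?T2" using W N by auto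
        thus "\<exists>T'. open T' \<and> x \<in> T' \<and> vholo T' (\<lambda>\<tau>. \<psi> (g \<tau>, c \<tau>))" using 1 2 o by blast
      qed
    qed
  qed
  thus ?thesis by blast
qed

section \<open>Linear and small nonlinear changes of the fibre coordinate, and transition
  maps\<close>

lemma compact_matrix_entries_bounded:
  fixes F :: "complex \<Rightarrow> complex ^ 'n ^ 'm"
  assumes K: "compact K" and F: "\<And>i j. continuous_on K (\<lambda>\<zeta>. F \<zeta> $ i $ j)"
  obtains c where "c \<ge> 1" "\<And>\<zeta> i j. \<zeta> \<in> K \<Longrightarrow> cmod (F \<zeta> $ i $ j) \<le> c"
proof -
  have "\<exists>c. \<forall>\<zeta>\<in>K. cmod (F \<zeta> $ i $ j) \<le> c" for i j
    using compact_imp_bounded[OF compact_continuous_image[OF F[of i j] K]] by (auto simp: bounded_iff)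
  then obtain c where c: "\<And>i j \<zeta>. \<zeta> \<in> K \<Longrightarrow> cmod (F \<zeta> $ i $ j) \<le> c i j" by metis
  have "cmod (F \<zeta> $ i $ j) \<le> max 1 (Max (range (\<lambda>(i, j). c i j)))" if "\<zeta> \<in> K" for \<zeta> i j
    by (rule max.coboundedI2, rule order.trans[OF c[OF that, of i j] Max_ge]) (auto intro!: rev_image_eqI[of "(i, j)"])
  thus ?thesis by (intro that[of "max 1 (Max (range (\<lambda>(i, j). c i j)))"]) auto
qed

lemma matrix_vector_norm_bound:
  fixes M :: "complex ^ 'n ^ 'm"
  assumes "\<And>i j. cmod (M $ i $ j) \<le> K"
  shows "norm (M *v x) \<le> real CARD('m) * (real CARD('n) * (K * norm x))"
  by (rule norm_vec_le_card, rule matrix_vector_entry_bound[OF assms Finite_Cartesian_Product.norm_nth_le])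

lemma jholo_matrix_vector:
  fixes M :: "complex \<Rightarrow> complex ^ 'n ^ 'm" and u :: "complex \<times> (complex ^ 'k) \<Rightarrow> complex ^ 'n"
  assumes M: "\<And>i j. (\<lambda>\<zeta>. M \<zeta> $ i $ j) holomorphic_on \<Omega>" and W: "fst ` W \<subseteq> \<Omega>" and u: "jholo W u"
  shows "jholo W (\<lambda>a. M (fst a) *v u a)"
  unfolding jholo_def
proof (intro conjI allI impI)
  have cM: "continuous_on W (\<lambda>a. M (fst a) $ i $ j)" for i j
    by (rule continuous_on_compose2[OF holomorphic_on_imp_continuous_on[OF M]]) (use W in \<open>auto intro!: continuous_intros\<close>)
  have cu: "continuous_on W (\<lambda>a. u a $ j)" for j
    by (rule bounded_linear.continuous_on[OF bounded_linear_vec_nth jholo_continuous[OF u]])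
  show "continuous_on W (\<lambda>a. M (fst a) *v u a)"
    unfolding matrix_vector_mult_def by (intro continuous_on_vec_lambda continuous_on_sum continuous_on_mult cM cu)
  fix T g and \<sigma> :: "complex \<Rightarrow> complex ^ 'k"
  assume T: "open T" "g holomorphic_on T" "vholo T \<sigma>" and gW: "\<forall>\<tau>\<in>T. (g \<tau>, \<sigma> \<tau>) \<in> W"
  have "vholo T (\<lambda>\<tau>. u (g \<tau>, \<sigma> \<tau>))" by (rule jholo_curve[OF u T]) (use gW in blast)
  moreover have "(\<lambda>\<tau>. M (g \<tau>) $ i $ j) holomorphic_on T" for i j
    by (rule holomorphic_on_compose_gen[OF T(2) M, unfolded o_def]) (use gW W in force)
  ultimately show "vholo T (\<lambda>\<tau>. M (fst (g \<tau>, \<sigma> \<tau>)) *v u (g \<tau>, \<sigma> \<tau>))"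
    unfolding vholo_def matrix_vector_mult_def by (auto intro!: holomorphic_intros)
qed

lemma fam_linear:
  fixes a b :: "complex \<Rightarrow> complex ^ 'n ^ 'n"
  assumes fm: "fam A f \<Omega> \<delta> F \<psi>" and \<Omega>': "open \<Omega>'" "\<Omega>' \<subseteq> \<Omega>" and \<delta>': "0 < \<delta>'"
    and a: "\<And>i j. (\<lambda>\<zeta>. a \<zeta> $ i $ j) holomorphic_on \<Omega>'" and b: "\<And>i j. (\<lambda>\<zeta>. b \<zeta> $ i $ j) holomorphic_on \<Omega>'"
    and ab: "\<And>\<zeta>. \<zeta> \<in> \<Omega>' \<Longrightarrow> a \<zeta> ** b \<zeta> = mat 1" "\<And>\<zeta>. \<zeta> \<in> \<Omega>' \<Longrightarrow> b \<zeta> ** a \<zeta> = mat 1"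
    and small: "\<And>\<zeta> s. \<zeta> \<in> \<Omega>' \<Longrightarrow> s \<in> ball 0 \<delta>' \<Longrightarrow> b \<zeta> *v s \<in> ball 0 \<delta>"
  shows "fam A f \<Omega>' \<delta>' (\<lambda>x. F (fst x, b (fst x) *v snd x)) (\<lambda>y. a (fst y) *v \<psi> y)"
proof -
  let ?I = "(\<lambda>x. (fst x, b (fst x) *v snd x)) ` (\<Omega>' \<times> ball 0 \<delta>')"
  have ja: "jholo (\<Omega>' \<times> UNIV) (\<lambda>x. a (fst x) *v snd x)" by (rule jholo_matrix_vector[OF a _ jholo_snd]) auto
  \<comment> \<open>Describing the image through the inverse frame makes its openness a matter of
    continuity.\<close>
  have I: "?I = (\<Omega>' \<times> UNIV) \<inter> (\<lambda>x. a (fst x) *v snd x) -` ball 0 \<delta>'"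
  proof (intro equalityI subsetI)
    fix y assume "y \<in> ?I"
    then obtain \<zeta> s where y: "\<zeta> \<in> \<Omega>'" "s \<in> ball 0 \<delta>'" "y = (\<zeta>, b \<zeta> *v s)" by auto
    have "a \<zeta> *v (b \<zeta> *v s) = s" using ab(1)[OF y(1)] by (simp add: matrix_vector_mul_assoc)
    thus "y \<in> (\<Omega>' \<times> UNIV) \<inter> (\<lambda>x. a (fst x) *v snd x) -` ball 0 \<delta>'" using y by auto
  next
    fix y assume y: "y \<in> (\<Omega>' \<times> UNIV) \<inter> (\<lambda>x. a (fst x) *v snd x) -` ball 0 \<delta>'"
    hence "b (fst y) *v (a (fst y) *v snd y) = snd y" using ab(2)[of "fst y"] by (auto simp: matrix_vector_mul_assoc)
    thus "y \<in> ?I" using y by (intro image_eqI[of _ _ "(fst y, a (fst y) *v snd y)"]) auto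
  qed
  have "fam A f \<Omega>' \<delta>' (\<lambda>x. F (fst x, (\<lambda>x. b (fst x) *v snd x) x)) (\<lambda>y. (\<lambda>x. a (fst x) *v snd x) (fst y, \<psi> y))"
  proof (rule fam_reparam[OF fm \<Omega>' \<delta>'])
    show "jholo (\<Omega>' \<times> ball 0 \<delta>') (\<lambda>x. b (fst x) *v snd x)" by (rule jholo_matrix_vector[OF b _ jholo_snd]) auto
    show "open ?I" unfolding I
      by (rule continuous_open_preimage[OF jholo_continuous[OF ja]]) (use \<Omega>' in \<open>auto intro!: open_Times\<close>)
    show "jholo ?I (\<lambda>x. a (fst x) *v snd x)" unfolding I by (rule jholo_subset[OF ja]) auto
    show "a (fst (fst x, b (fst x) *v snd x)) *v snd (fst x, b (fst x) *v snd x) = snd x" if "x \<in> \<Omega>' \<times> ball 0 \<delta>'" for x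
      using ab(1)[of "fst x"] that by (auto simp: matrix_vector_mul_assoc)
  qed (use small in auto)
  thus ?thesis by simp
qed

text \<open>The bound \<open>\<delta>' / (8 * real CARD('n))\<close> is chosen so that
  \<open>jholo_lipschitz\<close> gives the Lipschitz constant 1/2 on half the radius, which makes
  the fibre map injective with open image and holomorphic inverse.\<close>

lemma fam_perturb:
  fixes u :: "complex \<times> (complex ^ 'n) \<Rightarrow> complex ^ 'n"
  assumes fm: "fam A f \<Omega> \<delta> F \<psi>" and \<Omega>': "open \<Omega>'" "\<Omega>' \<subseteq> \<Omega>" and \<delta>': "0 < \<delta>'" "\<delta>' \<le> \<delta>"
    and u: "jholo (\<Omega>' \<times> ball 0 \<delta>') u" "\<And>a. a \<in> \<Omega>' \<times> ball 0 \<delta>' \<Longrightarrow> norm (u a) \<le> \<delta>' / (8 * real CARD('n))" "\<And>\<zeta>. u (\<zeta>, 0) = 0"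
  shows "\<exists>\<psi>'. fam A f \<Omega>' (\<delta>' / 2) (\<lambda>a. F (fst a, snd a + u a)) \<psi>'"
proof -
  let ?W = "\<Omega>' \<times> ball (0 :: complex ^ 'n) (\<delta>' / 2)" and ?\<Theta> = "\<lambda>a. (fst a, snd a + u a)"
  have n1: "real CARD('n) \<ge> 1" using one_le_card_finite[where 'a='n] by linarith
  have sub: "?W \<subseteq> \<Omega>' \<times> ball 0 \<delta>'" using \<delta>' by auto
  have j: "jholo ?W u" by (rule jholo_subset[OF u(1) sub])
  have lip: "norm (u (\<zeta>, s) - u (\<zeta>, s')) \<le> 1/2 * norm (s - s')" if "\<zeta> \<in> \<Omega>'" "s \<in> ball 0 (\<delta>' / 2)" "s' \<in> ball 0 (\<delta>' / 2)" for \<zeta> s s'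
  proof -
    have "norm (u (\<zeta>, s) - u (\<zeta>, s')) \<le> real CARD('n) * (4 * (\<delta>' / (8 * real CARD('n))) / \<delta>') * norm (s - s')"
      by (rule jholo_lipschitz[OF u(1)]) (use that u(2) in auto)
    also have "real CARD('n) * (4 * (\<delta>' / (8 * real CARD('n))) / \<delta>') = 1/2" using \<delta>' n1 by (simp add: field_simps)
    finally show ?thesis .
  qed
  have inj: "inj_on ?\<Theta> ?W" and op: "open (?\<Theta> ` ?W)"
    using perturbation_open_image[OF jholo_continuous[OF j] \<Omega>'(1) lip] by auto
  define \<kappa> where "\<kappa> = (\<lambda>b. snd (inv_into ?W ?\<Theta> b))"
  have \<kappa>: "\<kappa> (?\<Theta> a) = snd a" if "a \<in> ?W" for a using inv_into_f_f[OF inj that] by (simp add: \<kappa>_def)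
  have \<kappa>in: "fst b \<in> \<Omega>' \<and> \<kappa> b \<in> ball 0 (\<delta>' / 2) \<and> \<kappa> b + u (fst b, \<kappa> b) = snd b" if b: "b \<in> ?\<Theta> ` ?W" for b
  proof -
    from b obtain a where a: "a \<in> ?W" "b = ?\<Theta> a" by blast
    thus ?thesis using \<kappa>[OF a(1)] by auto
  qed
  have j\<kappa>: "jholo (?\<Theta> ` ?W) \<kappa>" unfolding jholo_def
  proof (intro conjI allI impI)
    show "continuous_on (?\<Theta> ` ?W) \<kappa>"
      by (rule perturbation_solution_continuous[OF jholo_continuous[OF j] lip continuous_on_fst[OF continuous_on_id] _ continuous_on_snd[OF continuous_on_id]])
         (use \<kappa>in in blast)+
    fix T g and \<sigma> :: "complex \<Rightarrow> complex ^ 'n"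
    assume T: "open T" "g holomorphic_on T" "vholo T \<sigma>" and gW: "\<forall>\<tau>\<in>T. (g \<tau>, \<sigma> \<tau>) \<in> ?\<Theta> ` ?W"
    have *: "g \<tau> \<in> \<Omega>' \<and> \<kappa> (g \<tau>, \<sigma> \<tau>) \<in> ball 0 (\<delta>' / 2) \<and> \<kappa> (g \<tau>, \<sigma> \<tau>) + u (g \<tau>, \<kappa> (g \<tau>, \<sigma> \<tau>)) = \<sigma> \<tau>" if "\<tau> \<in> T" for \<tau>
      using \<kappa>in[of "(g \<tau>, \<sigma> \<tau>)"] gW that by simp
    show "vholo T (\<lambda>\<tau>. \<kappa> (g \<tau>, \<sigma> \<tau>))"
      by (rule perturbation_solution_holo[OF j lip T(1,2) _ T(3)]) (use * in blast)+
  qed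
  have "fam A f \<Omega>' (\<delta>' / 2) (\<lambda>a. F (fst a, snd a + u a)) (\<lambda>b. \<kappa> (fst b, \<psi> b))"
  proof (rule fam_reparam[OF fm \<Omega>' _ _ _ _ op j\<kappa> \<kappa>])
    show "jholo ?W (\<lambda>a. snd a + u a)" by (intro jholo_add jholo_snd j)
    show "snd a + u a \<in> ball 0 \<delta>" if a: "a \<in> ?W" for a
    proof -
      have "\<delta>' / (8 * real CARD('n)) \<le> \<delta>' / 2" using \<delta>' n1 by (intro divide_left_mono; linarith)
      moreover have "norm (u a) \<le> \<delta>' / (8 * real CARD('n))" using u(2) a sub by blast
      moreover have "norm (snd a) < \<delta>' / 2" using a by auto
      ultimately show ?thesis using norm_triangle_ineq[of "snd a" "u a"] \<delta>' by simp
    qed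
  qed (use \<delta>' u(3) in auto)
  thus ?thesis by blast
qed

text \<open>The transition map expresses points of the first trivialization in the fibre coordinate
  of the second. Both send the zero section to f, so it is defined near that section, and
  compactness of K gives a uniform radius.\<close>

lemma fam_transition:
  assumes f1: "fam A f \<Omega>1 \<delta>1 F1 \<psi>1" and f2: "fam A f \<Omega>2 \<delta>2 F2 \<psi>2" and K: "compact K" "K \<subseteq> \<Omega>1" "K \<subseteq> \<Omega>2"
  obtains \<delta>0 where "0 < \<delta>0" "\<delta>0 \<le> \<delta>1" "jholo (K \<times> ball 0 \<delta>0) (\<lambda>a. \<psi>2 (fst a, F1 a))"
    "\<And>\<zeta>. \<zeta> \<in> K \<Longrightarrow> \<psi>2 (\<zeta>, F1 (\<zeta>, 0)) = 0"
    "\<And>a. a \<in> K \<times> ball 0 \<delta>0 \<Longrightarrow> norm (\<psi>2 (fst a, F1 a)) < \<delta>2"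
    "\<And>a. a \<in> K \<times> ball 0 \<delta>0 \<Longrightarrow> F2 (fst a, \<psi>2 (fst a, F1 a)) = F1 a"
proof -
  note d1 = famD[OF f1] and d2 = famD[OF f2]
  let ?N2 = "(\<lambda>a. (fst a, F2 a)) ` (\<Omega>2 \<times> ball 0 \<delta>2)"
  define O1 where "O1 = (\<Omega>1 \<times> ball 0 \<delta>1) \<inter> (\<lambda>a. (fst a, F1 a)) -` ?N2"
  have "continuous_on (\<Omega>1 \<times> ball 0 \<delta>1) (\<lambda>a. (fst a, F1 a))" by (intro continuous_intros d1(3))
  hence "open O1" unfolding O1_def by (rule continuous_open_preimage) (use d1(1) d2(7) in \<open>auto intro!: open_Times\<close>)
  have N0: "(\<zeta>, F1 (\<zeta>, 0)) \<in> ?N2 \<and> F1 (\<zeta>, 0) = F2 (\<zeta>, 0)" if "\<zeta> \<in> K" for \<zeta>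
  proof -
    have "F1 (\<zeta>, 0) = F2 (\<zeta>, 0)" using d1(5) d2(5) K that by (metis subsetD)
    thus ?thesis using that K d2(2) by (auto intro!: image_eqI[of _ _ "(\<zeta>, 0)"])
  qed
  have "compact (K \<times> {0 :: complex ^ 'b})" by (intro compact_Times K) auto
  moreover have "(\<zeta>, 0) \<in> O1" if "\<zeta> \<in> K" for \<zeta>
    unfolding O1_def using N0[OF that, THEN conjunct1] K d1(2) that by auto
  hence "K \<times> {0} \<subseteq> O1" by blast
  ultimately obtain \<epsilon> where \<epsilon>: "\<epsilon> > 0" "(\<Union>x\<in>K \<times> {0}. ball x \<epsilon>) \<subseteq> O1"
    using compact_subset_open_imp_ball_epsilon_subset[OF _ \<open>open O1\<close>] by blast
  define \<delta>0 where "\<delta>0 = min \<epsilon> \<delta>1"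
  have inO: "a \<in> O1" if "a \<in> K \<times> ball 0 \<delta>0" for a
  proof -
    obtain \<zeta> s where a: "a = (\<zeta>, s)" "\<zeta> \<in> K" "norm s < \<epsilon>" using \<open>a \<in> K \<times> ball 0 \<delta>0\<close> by (cases a) (auto simp: \<delta>0_def)
    hence "(\<zeta>, s) \<in> ball (\<zeta>, 0) \<epsilon>" by (simp add: dist_Pair_Pair)
    hence "(\<zeta>, s) \<in> (\<Union>x\<in>K \<times> {0}. ball x \<epsilon>)" using a(2) by blast
    thus ?thesis using \<epsilon>(2) a(1) by blast
  qed
  have N: "(fst a, F1 a) \<in> ?N2" if "a \<in> K \<times> ball 0 \<delta>0" for a using inO[OF that] by (simp add: O1_def)
  have N': "norm (\<psi>2 (fst a, F1 a)) < \<delta>2 \<and> F2 (fst a, \<psi>2 (fst a, F1 a)) = F1 a" if a: "a \<in> K \<times> ball 0 \<delta>0" for a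
  proof -
    obtain x where x: "x \<in> \<Omega>2 \<times> ball 0 \<delta>2" "(fst a, F1 a) = (fst x, F2 x)" using N[OF a] by blast
    have "\<psi>2 (fst a, F1 a) = snd x" using d2(6)[OF x(1)] x(2) by simp
    thus ?thesis using x by auto
  qed
  have sub: "K \<times> ball 0 \<delta>0 \<subseteq> \<Omega>1 \<times> ball (0 :: complex ^ 'b) \<delta>1" using K by (auto simp: \<delta>0_def)
  have j: "jholo (K \<times> ball 0 \<delta>0) (\<lambda>a. \<psi>2 (fst a, F1 a))" unfolding jholo_def
  proof (intro conjI allI impI)
    show "continuous_on (K \<times> ball 0 \<delta>0) (\<lambda>a. \<psi>2 (fst a, F1 a))"
      by (rule continuous_on_compose2[OF d2(8)]) (use N in \<open>auto intro!: continuous_intros continuous_on_subset[OF d1(3) sub]\<close>)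
    fix T g and \<sigma> :: "complex \<Rightarrow> complex ^ 'b"
    assume T: "open T" "g holomorphic_on T" "vholo T \<sigma>" and gW: "\<forall>\<tau>\<in>T. (g \<tau>, \<sigma> \<tau>) \<in> K \<times> ball 0 \<delta>0"
    have "mholo A T (\<lambda>\<tau>. F1 (g \<tau>, \<sigma> \<tau>))" by (rule d1(4)[OF T]) (use gW sub in blast)
    from d2(9)[OF T(1,2) this] have "vholo T (\<lambda>\<tau>. \<psi>2 (g \<tau>, F1 (g \<tau>, \<sigma> \<tau>)))"
      using N[of "(g _, \<sigma> _)"] gW by simp
    thus "vholo T (\<lambda>\<tau>. \<psi>2 (fst (g \<tau>, \<sigma> \<tau>), F1 (g \<tau>, \<sigma> \<tau>)))" by simp
  qed
  show thesis
  proof (rule that[OF _ _ j])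
    show "\<psi>2 (\<zeta>, F1 (\<zeta>, 0)) = 0" if "\<zeta> \<in> K" for \<zeta>
      using N0[OF that] d2(6)[of "(\<zeta>, 0)"] d2(2) that K by auto
  qed (use N' \<epsilon> d1(2) in \<open>auto simp: \<delta>0_def\<close>)
qed

text \<open>This differentiates \<open>\<gamma>' (\<zeta>, \<gamma> (\<zeta>, s)) = s\<close> at the
  zero section, with the quadratic remainders of \<open>jholo_linearization\<close> in place of a
  chain rule in several variables.\<close>

lemma linear_part_inverse:
  fixes \<gamma> \<gamma>' :: "complex \<times> (complex ^ 'n) \<Rightarrow> complex ^ 'n"
  assumes r: "0 < r" and \<gamma>: "jholo ({\<zeta>} \<times> ball 0 r) \<gamma>" "\<gamma> (\<zeta>, 0) = 0" "\<And>s. s \<in> ball 0 r \<Longrightarrow> norm (\<gamma> (\<zeta>, s)) \<le> m"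
    and \<gamma>': "jholo ({\<zeta>} \<times> ball 0 r) \<gamma>'" "\<gamma>' (\<zeta>, 0) = 0" "\<And>s. s \<in> ball 0 r \<Longrightarrow> norm (\<gamma>' (\<zeta>, s)) \<le> m"
    and inv: "\<And>s. s \<in> ball 0 r \<Longrightarrow> \<gamma> (\<zeta>, s) \<in> ball 0 r \<Longrightarrow> \<gamma>' (\<zeta>, \<gamma> (\<zeta>, s)) = s"
  shows "jmat \<gamma>' \<zeta> ** jmat \<gamma> \<zeta> = mat 1"
proof -
  define G where "G = jmat \<gamma> \<zeta>"
  define G' where "G' = jmat \<gamma>' \<zeta>"
  let ?n = "real CARD('n)"
  define C where "C = ?n * (4 * m / r\<^sup>2)"
  have m0: "m \<ge> 0" using order.trans[OF norm_ge_zero \<gamma>(3)[of 0]] r by simp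
  have C0: "C \<ge> 0" using m0 by (simp add: C_def)
  have lin: "norm (\<gamma> (\<zeta>, s) - G *v s) \<le> C * (norm s)\<^sup>2" "norm (\<gamma>' (\<zeta>, s) - G' *v s) \<le> C * (norm s)\<^sup>2" if "s \<in> ball 0 r" for s
    using jholo_linearization[OF \<gamma>(1) order.refl \<gamma>(3) that] jholo_linearization[OF \<gamma>'(1) order.refl \<gamma>'(3) that] \<gamma>(2) \<gamma>'(2)
    by (simp_all add: G_def G'_def C_def)
  define D where "D = (\<lambda>M :: complex ^ 'n ^ 'n. ?n * (?n * norm M))"
  have D: "norm (M *v x) \<le> D M * norm x" for M :: "complex ^ 'n ^ 'n" and x
  proof -
    have "cmod (M $ i $ j) \<le> norm M" for i j
      by (rule order.trans[OF Finite_Cartesian_Product.norm_nth_le Finite_Cartesian_Product.norm_nth_le])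
    from matrix_vector_norm_bound[OF this, of x] show ?thesis by (simp add: D_def mult.assoc)
  qed
  have D0: "D M \<ge> 0" for M by (simp add: D_def)
  have "G' *v (G *v s) = s" for s
  proof -
    define w where "w = s - G' *v (G *v s)"
    define \<nu> where "\<nu> = norm s + 1"
    have \<nu>: "\<nu> > 0" by (simp add: \<nu>_def add_nonneg_pos)
    define E where "E = D G' * (C * \<nu>\<^sup>2) + C * (D G * \<nu> + C * \<nu>\<^sup>2)\<^sup>2"
    define L where "L = D G * \<nu> + C * \<nu>\<^sup>2"
    have L0: "L \<ge> 0" using D0 C0 \<nu> by (simp add: L_def)
    \<comment> \<open>For the argument t s the defect is linear in t while all errors are quadratic,
      so the defect of s is O(t) and vanishes as t tends to 0.\<close>
    have key: "norm w \<le> t * E" if t: "0 < t" "t < 1" "t * \<nu> < r" "t * L < r" for t :: real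
    proof -
      let ?s = "of_real t *s s"
      have ns: "norm ?s \<le> t * \<nu>" using t by (simp add: norm_smult_vec \<nu>_def)
      hence sr: "?s \<in> ball 0 r" using t by simp
      have sq: "(norm ?s)\<^sup>2 \<le> (t * \<nu>)\<^sup>2" using ns by (intro power_mono) auto
      have t2: "t\<^sup>2 \<le> t" using t by (simp add: power2_eq_square)
      have g1: "norm (\<gamma> (\<zeta>, ?s) - G *v ?s) \<le> C * (t * \<nu>)\<^sup>2"
        using lin(1)[OF sr] mult_left_mono[OF sq C0] by linarith
      have "norm (G *v ?s) \<le> D G * (t * \<nu>)" using D[of G ?s] mult_left_mono[OF ns D0[of G]] by linarith
      moreover have "norm (\<gamma> (\<zeta>, ?s)) \<le> norm (G *v ?s) + norm (\<gamma> (\<zeta>, ?s) - G *v ?s)" by (metis norm_triangle_sub)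
      moreover have "C * (t * \<nu>)\<^sup>2 \<le> C * (t * \<nu>\<^sup>2)"
        using C0 \<nu> t2 by (intro mult_left_mono) (auto simp: power_mult_distrib)
      ultimately have "norm (\<gamma> (\<zeta>, ?s)) \<le> D G * (t * \<nu>) + C * (t * \<nu>\<^sup>2)" using g1 by linarith
      also have "\<dots> = t * L" by (simp add: L_def algebra_simps)
      finally have gb: "norm (\<gamma> (\<zeta>, ?s)) \<le> t * L" .
      hence gr: "\<gamma> (\<zeta>, ?s) \<in> ball 0 r" using t by simp
      have eq: "?s - G' *v (G *v ?s) = (\<gamma>' (\<zeta>, \<gamma> (\<zeta>, ?s)) - G' *v \<gamma> (\<zeta>, ?s)) + G' *v (\<gamma> (\<zeta>, ?s) - G *v ?s)"
        using inv[OF sr gr] by (simp add: matrix_vector_mult_diff_distrib)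
      have "norm (\<gamma>' (\<zeta>, \<gamma> (\<zeta>, ?s)) - G' *v \<gamma> (\<zeta>, ?s)) \<le> C * (t * L)\<^sup>2"
        by (rule order.trans[OF lin(2)[OF gr]]) (intro mult_left_mono power_mono gb C0, simp)
      moreover have "norm (G' *v (\<gamma> (\<zeta>, ?s) - G *v ?s)) \<le> D G' * (C * (t * \<nu>)\<^sup>2)"
        by (rule order.trans[OF D]) (intro mult_left_mono g1 D0)
      ultimately have "norm (?s - G' *v (G *v ?s)) \<le> C * (t * L)\<^sup>2 + D G' * (C * (t * \<nu>)\<^sup>2)"
        unfolding eq by (intro order.trans[OF norm_triangle_ineq] add_mono)
      also have "\<dots> = t * (t * E)" by (simp add: E_def L_def power2_eq_square algebra_simps)
      finally have "norm (?s - G' *v (G *v ?s)) \<le> t * (t * E)" .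
      moreover have "?s - G' *v (G *v ?s) = of_real t *s w"
        by (simp add: w_def vec_eq_iff matrix_vector_mult_def sum_distrib_left algebra_simps)
      ultimately have "t * norm w \<le> t * (t * E)" using t by (simp add: norm_smult_vec)
      thus ?thesis using t by simp
    qed
    have "eventually (\<lambda>t::real. 0 < t \<and> t < 1 \<and> t * \<nu> < r \<and> t * L < r) (at_right 0)"
    proof (intro eventually_conj)
      show "eventually (\<lambda>t::real. 0 < t) (at_right 0)" by (simp add: eventually_at_right_less)
      have "((\<lambda>t::real. t) \<longlongrightarrow> 0) (at_right 0)" by (rule tendsto_ident_at)
      thus "eventually (\<lambda>t::real. t < 1) (at_right 0)" by (rule order_tendstoD) simp
      have "((\<lambda>t::real. t * \<nu>) \<longlongrightarrow> 0 * \<nu>) (at_right 0)" by (intro tendsto_intros)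
      thus "eventually (\<lambda>t::real. t * \<nu> < r) (at_right 0)" by (rule order_tendstoD) (use r in simp)
      have "((\<lambda>t::real. t * L) \<longlongrightarrow> 0 * L) (at_right 0)" by (intro tendsto_intros)
      thus "eventually (\<lambda>t::real. t * L < r) (at_right 0)" by (rule order_tendstoD) (use r in simp)
    qed
    hence ev: "eventually (\<lambda>t. norm w \<le> t * E) (at_right 0)" by eventually_elim (use key in blast)
    have "((\<lambda>t::real. t * E) \<longlongrightarrow> 0 * E) (at_right 0)" by (intro tendsto_intros)
    hence "norm w \<le> 0 * E" by (rule tendsto_lowerbound[OF _ ev]) simp
    thus ?thesis by (simp add: w_def)
  qed
  hence "(G' ** G) *v s = mat 1 *v s" for s by (simp add: matrix_vector_mul_assoc[symmetric])
  thus ?thesis unfolding G_def G'_def by (simp add: matrix_eq)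
qed

section \<open>Gluing over adjacent rectangles\<close>

definition hasfam :: "('a::t2_space set \<times> ('a \<Rightarrow> complex ^ 'n)) set \<Rightarrow> (complex \<Rightarrow> 'a) \<Rightarrow> complex set \<Rightarrow> bool" where
  "hasfam A f R \<longleftrightarrow> (\<exists>\<Omega> \<delta> F \<psi>. R \<subseteq> \<Omega> \<and> fam A f \<Omega> \<delta> F \<psi>)"

lemma rectangle_margin:
  assumes \<Omega>: "open \<Omega>" and R: "cbox (Complex a c) (Complex b d) \<subseteq> \<Omega>" and ab: "a \<le> b" "c \<le> d"
  obtains \<eta> where "\<eta> > 0" "cbox (Complex (a - \<eta>) (c - \<eta>)) (Complex (b + \<eta>) (d + \<eta>)) \<subseteq> \<Omega>"
proof -
  obtain e where e: "e > 0" "(\<Union>x\<in>cbox (Complex a c) (Complex b d). ball x e) \<subseteq> \<Omega>"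
    using compact_subset_open_imp_ball_epsilon_subset[OF compact_cbox \<Omega> R] by blast
  show thesis
  proof (rule that[of "e / 3"])
    show "cbox (Complex (a - e/3) (c - e/3)) (Complex (b + e/3) (d + e/3)) \<subseteq> \<Omega>"
    proof
      fix z assume z: "z \<in> cbox (Complex (a - e/3) (c - e/3)) (Complex (b + e/3) (d + e/3))"
      \<comment> \<open>The nearest point of the rectangle; each coordinate differs by at most e/3,
        so the distance is below e.\<close>
      define w where "w = Complex (max a (min b (Re z))) (max c (min d (Im z)))"
      have w: "w \<in> cbox (Complex a c) (Complex b d)" using ab by (auto simp: w_def in_cbox_complex_iff)
      have "\<bar>Re (w - z)\<bar> \<le> e/3" "\<bar>Im (w - z)\<bar> \<le> e/3" using z ab e(1) by (auto simp: w_def in_cbox_complex_iff min_def max_def)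
      hence "dist w z < e" using cmod_le[of "w - z"] e by (simp add: dist_norm)
      hence "z \<in> (\<Union>x\<in>cbox (Complex a c) (Complex b d). ball x e)" by (intro UN_I[OF w]) simp
      thus "z \<in> \<Omega>" using e(2) by blast
    qed
  qed (use e in simp)
qed

text \<open>Let \<gamma> be the transition map, \<alpha> an approximate inverse of its linear part
  with inverse \<beta>, and \<open>er\<close> the deviation of \<alpha> \<gamma> from the identity.
  The splitting then reads \<open>\<alpha> \<gamma> (s + u1) = s + u2\<close>, hence
  \<open>F1 (s + u1) = F2 (\<gamma> (s + u1)) = F2 (\<beta> (s + u2))\<close>, and the corrected
  families agree on the overlap.\<close>

lemma fam_glue:
  fixes A :: "('a::t2_space set \<times> ('a \<Rightarrow> complex ^ 'n)) set"
  assumes A: "complex_atlas A" and ab: "a \<le> b" "b \<le> e" "c \<le> d"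
    and h1: "hasfam A f (cbox (Complex a c) (Complex b d))" and h2: "hasfam A f (cbox (Complex b c) (Complex e d))"
  shows "hasfam A f (cbox (Complex a c) (Complex e d))"
proof -
  obtain \<Omega>1 \<delta>1 F1 \<psi>1 where f1: "fam A f \<Omega>1 \<delta>1 F1 \<psi>1" and R1: "cbox (Complex a c) (Complex b d) \<subseteq> \<Omega>1"
    using h1 unfolding hasfam_def by blast
  obtain \<Omega>2 \<delta>2 F2 \<psi>2 where f2: "fam A f \<Omega>2 \<delta>2 F2 \<psi>2" and R2: "cbox (Complex b c) (Complex e d) \<subseteq> \<Omega>2"
    using h2 unfolding hasfam_def by blast
  obtain \<eta>1 where \<eta>1: "\<eta>1 > 0" "cbox (Complex (a - \<eta>1) (c - \<eta>1)) (Complex (b + \<eta>1) (d + \<eta>1)) \<subseteq> \<Omega>1"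
    using rectangle_margin[OF famD(1)[OF f1] R1 ab(1,3)] by blast
  obtain \<eta>2 where \<eta>2: "\<eta>2 > 0" "cbox (Complex (b - \<eta>2) (c - \<eta>2)) (Complex (e + \<eta>2) (d + \<eta>2)) \<subseteq> \<Omega>2"
    using rectangle_margin[OF famD(1)[OF f2] R2 ab(2,3)] by blast
  \<comment> \<open>The overlap rectangle has margin \<eta> and the frames are needed on a further
    margin 3\<eta>; together this is the 4\<eta> of K.\<close>
  define \<eta> where "\<eta> = min \<eta>1 \<eta>2 / 4"
  have \<eta>: "\<eta> > 0" "4 * \<eta> \<le> \<eta>1" "4 * \<eta> \<le> \<eta>2" using \<eta>1 \<eta>2 by (auto simp: \<eta>_def)
  define p where "p = Complex (b - \<eta>) (c - \<eta>)"
  define q where "q = Complex (b + \<eta>) (d + \<eta>)"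
  have pq: "Re p < Re q" "Im p < Im q" using \<eta> ab by (auto simp: p_def q_def)
  define K where "K = cbox (Complex (b - 4 * \<eta>) (c - 4 * \<eta>)) (Complex (b + 4 * \<eta>) (d + 4 * \<eta>))"
  have K: "compact K" "K \<subseteq> \<Omega>1" "K \<subseteq> \<Omega>2"
  proof -
    show "compact K" by (simp add: K_def)
    show "K \<subseteq> \<Omega>1" using \<eta> ab by (intro order.trans[OF _ \<eta>1(2)]) (auto simp: K_def in_cbox_complex_iff)
    show "K \<subseteq> \<Omega>2" using \<eta> ab by (intro order.trans[OF _ \<eta>2(2)]) (auto simp: K_def in_cbox_complex_iff)
  qed
  let ?B3 = "box (p - of_real (3 * \<eta>) * (1 + \<i>)) (q + of_real (3 * \<eta>) * (1 + \<i>))"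
  have B3K: "?B3 \<subseteq> K" by (auto simp: K_def p_def q_def in_cbox_complex_iff in_box_complex_iff)
  have SK: "cbox p q \<subseteq> K" using \<eta> by (auto simp: K_def p_def q_def in_cbox_complex_iff)
  \<comment> \<open>The left piece ends at Re q and the right one begins at Re p, so they overlap
    only where the splitting holds, while the common side lies in the interior of both.\<close>
  define \<Omega>1' where "\<Omega>1' = box (Complex (a - \<eta>) (c - \<eta>)) q"
  define \<Omega>2' where "\<Omega>2' = box p (Complex (e + \<eta>) (d + \<eta>))"
  have O1': "open \<Omega>1'" "\<Omega>1' \<subseteq> \<Omega>1" and O2': "open \<Omega>2'" "\<Omega>2' \<subseteq> \<Omega>2"
  proof -
    show "open \<Omega>1'" "open \<Omega>2'" by (auto simp: \<Omega>1'_def \<Omega>2'_def)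
    show "\<Omega>1' \<subseteq> \<Omega>1" using \<eta> ab by (intro order.trans[OF _ \<eta>1(2)]) (auto simp: \<Omega>1'_def q_def in_cbox_complex_iff in_box_complex_iff)
    show "\<Omega>2' \<subseteq> \<Omega>2" using \<eta> ab by (intro order.trans[OF _ \<eta>2(2)]) (auto simp: \<Omega>2'_def p_def in_cbox_complex_iff in_box_complex_iff)
  qed
  have overlap: "\<Omega>1' \<inter> \<Omega>2' \<subseteq> box p q" by (auto simp: \<Omega>1'_def \<Omega>2'_def p_def q_def in_box_complex_iff)
  have cover: "cbox (Complex a c) (Complex e d) \<subseteq> \<Omega>1' \<union> \<Omega>2'"
    using \<eta> ab by (auto simp: \<Omega>1'_def \<Omega>2'_def p_def q_def in_box_complex_iff in_cbox_complex_iff)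
  define \<gamma> where "\<gamma> = (\<lambda>x. \<psi>2 (fst x, F1 x))"
  define \<gamma>' where "\<gamma>' = (\<lambda>x. \<psi>1 (fst x, F2 x))"
  obtain \<delta>3 where \<delta>3: "0 < \<delta>3" "\<delta>3 \<le> \<delta>1" and \<gamma>: "jholo (K \<times> ball 0 \<delta>3) \<gamma>" "\<And>\<zeta>. \<zeta> \<in> K \<Longrightarrow> \<gamma> (\<zeta>, 0) = 0"
      "\<And>x. x \<in> K \<times> ball 0 \<delta>3 \<Longrightarrow> norm (\<gamma> x) < \<delta>2" "\<And>x. x \<in> K \<times> ball 0 \<delta>3 \<Longrightarrow> F2 (fst x, \<gamma> x) = F1 x"
    by (rule fam_transition[OF f1 f2 K]) (auto simp: \<gamma>_def)
  obtain \<delta>4 where \<delta>4: "0 < \<delta>4" "\<delta>4 \<le> \<delta>2" and \<gamma>': "jholo (K \<times> ball 0 \<delta>4) \<gamma>'" "\<And>\<zeta>. \<zeta> \<in> K \<Longrightarrow> \<gamma>' (\<zeta>, 0) = 0"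
      "\<And>x. x \<in> K \<times> ball 0 \<delta>4 \<Longrightarrow> norm (\<gamma>' x) < \<delta>1"
    by (rule fam_transition[OF f2 f1 K(1,3,2)]) (auto simp: \<gamma>'_def)
  have Ginv: "jmat \<gamma>' \<zeta> ** jmat \<gamma> \<zeta> = mat 1" if z: "\<zeta> \<in> K" for \<zeta>
  proof (rule linear_part_inverse[of "min \<delta>3 \<delta>4" \<zeta> \<gamma> "max \<delta>1 \<delta>2" \<gamma>'])
    show "0 < min \<delta>3 \<delta>4" using \<delta>3 \<delta>4 by simp
    show "jholo ({\<zeta>} \<times> ball 0 (min \<delta>3 \<delta>4)) \<gamma>" "jholo ({\<zeta>} \<times> ball 0 (min \<delta>3 \<delta>4)) \<gamma>'"
      by (rule jholo_subset[OF \<gamma>(1)] jholo_subset[OF \<gamma>'(1)], use z in auto)+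
    show "norm (\<gamma> (\<zeta>, s)) \<le> max \<delta>1 \<delta>2" if "s \<in> ball 0 (min \<delta>3 \<delta>4)" for s
      using \<gamma>(3)[of "(\<zeta>, s)"] that z by (auto simp: le_max_iff_disj)
    show "norm (\<gamma>' (\<zeta>, s)) \<le> max \<delta>1 \<delta>2" if "s \<in> ball 0 (min \<delta>3 \<delta>4)" for s
      using \<gamma>'(3)[of "(\<zeta>, s)"] that z by (auto simp: le_max_iff_disj)
    show "\<gamma>' (\<zeta>, \<gamma> (\<zeta>, s)) = s" if "s \<in> ball 0 (min \<delta>3 \<delta>4)" for s
    proof -
      have "F2 (\<zeta>, \<gamma> (\<zeta>, s)) = F1 (\<zeta>, s)" using \<gamma>(4)[of "(\<zeta>, s)"] that z by auto
      moreover have "\<psi>1 (\<zeta>, F1 (\<zeta>, s)) = s" using famD(6)[OF f1, of "(\<zeta>, s)"] that z K \<delta>3 by auto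
      ultimately show ?thesis by (simp add: \<gamma>'_def)
    qed
  qed (use \<gamma>(2) \<gamma>'(2) z in auto)
  let ?n = "real CARD('n)"
  have n1: "?n \<ge> 1" using one_le_card_finite[where 'a='n] by linarith
  \<comment> \<open>Q is the constant in the smallness condition of
    \<open>nonlinear_splitting\<close>. The linear error \<epsilon> is chosen to use up half of what
    that condition allows, whatever \<delta> will be.\<close>
  define Q where "Q = 16 * ?n * (?n * Cop p q)"
  have Q: "Q > 0" using n1 Cop_pos[OF pq] by (auto simp: Q_def intro!: mult_pos_pos)
  define \<epsilon> where "\<epsilon> = 1 / (2 * Q * (4 * ?n * ?n))"
  have \<epsilon>: "\<epsilon> > 0" using Q n1 by (auto simp: \<epsilon>_def intro!: divide_pos_pos mult_pos_pos)
  have G: "(\<lambda>\<zeta>. jmat \<gamma> \<zeta> $ i $ j) holomorphic_on ?B3" "(\<lambda>\<zeta>. jmat \<gamma>' \<zeta> $ i $ j) holomorphic_on ?B3" for i j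
    using jmat_holomorphic[OF \<gamma>(1) open_box _ \<delta>3(1)] jmat_holomorphic[OF \<gamma>'(1) open_box _ \<delta>4(1)] B3K by (meson Sigma_mono order.refl)+
  \<comment> \<open>Extending the frame by 2\<eta> instead of \<eta> puts the closed second
    rectangle inside its domain, so that \<beta> is bounded there.\<close>
  have E: "Re q + \<eta> \<le> e + 2 * \<eta>" using ab by (simp add: q_def)
  let ?\<Omega> = "box (p - of_real \<eta> * (1 + \<i>)) (Complex (e + 2 * \<eta>) (Im q + \<eta>))"
  show ?thesis
  proof (rule frame_approximation[OF pq \<eta>(1) \<epsilon> E G(1) G(2) Ginv])
    fix \<zeta> assume "\<zeta> \<in> ?B3" thus "\<zeta> \<in> K" using B3K by blast
  next
    fix \<alpha> \<beta> :: "complex \<Rightarrow> complex ^ 'n ^ 'n"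
    assume \<alpha>: "\<And>i j. (\<lambda>\<zeta>. \<alpha> \<zeta> $ i $ j) holomorphic_on ?\<Omega>" and \<beta>: "\<And>i j. (\<lambda>\<zeta>. \<beta> \<zeta> $ i $ j) holomorphic_on ?\<Omega>"
      and \<alpha>\<beta>: "\<And>\<zeta>. \<zeta> \<in> ?\<Omega> \<Longrightarrow> \<alpha> \<zeta> ** \<beta> \<zeta> = mat 1" "\<And>\<zeta>. \<zeta> \<in> ?\<Omega> \<Longrightarrow> \<beta> \<zeta> ** \<alpha> \<zeta> = mat 1"
      and close: "\<And>\<zeta> i j. \<zeta> \<in> cbox p q \<Longrightarrow> cmod ((\<alpha> \<zeta> ** jmat \<gamma> \<zeta> - mat 1) $ i $ j) \<le> \<epsilon>"
    have S\<Omega>: "cbox p q \<subseteq> ?\<Omega>" using \<eta> ab by (auto simp: p_def q_def in_box_complex_iff in_cbox_complex_iff)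
    have c2\<Omega>: "cbox p (Complex (e + \<eta>) (d + \<eta>)) \<subseteq> ?\<Omega>" using \<eta> ab by (auto simp: p_def q_def in_box_complex_iff in_cbox_complex_iff)
    have O2\<Omega>: "\<Omega>2' \<subseteq> cbox p (Complex (e + \<eta>) (d + \<eta>))" unfolding \<Omega>2'_def by (rule box_subset_cbox)
    obtain ca where ca: "ca \<ge> 1" "\<And>\<zeta> i j. \<zeta> \<in> cbox p q \<Longrightarrow> cmod (\<alpha> \<zeta> $ i $ j) \<le> ca"
      by (rule compact_matrix_entries_bounded[OF compact_cbox holomorphic_on_imp_continuous_on[OF holomorphic_on_subset[OF \<alpha> S\<Omega>]]]) blast
    obtain cb where cb: "cb \<ge> 1" "\<And>\<zeta> i j. \<zeta> \<in> cbox p (Complex (e + \<eta>) (d + \<eta>)) \<Longrightarrow> cmod (\<beta> \<zeta> $ i $ j) \<le> cb"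
      by (rule compact_matrix_entries_bounded[OF compact_cbox holomorphic_on_imp_continuous_on[OF holomorphic_on_subset[OF \<beta> c2\<Omega>]]]) blast
    define C1 where "C1 = ?n * (4 * \<delta>2 / \<delta>3\<^sup>2)"
    have C1: "C1 \<ge> 0" using famD(2)[OF f2] by (simp add: C1_def)
    \<comment> \<open>Collects the quadratic remainder of \<gamma>, which enters m as
      \<open>D2 * \<delta>\<^sup>2\<close>. Being quadratic, it fits into the other half of the
      condition for small \<delta>.\<close>
    define D2 where "D2 = 16 * (?n * (?n * (ca * C1)))"
    have D2: "D2 \<ge> 0" using ca C1 by (simp add: D2_def)
    \<comment> \<open>The three bounds: \<gamma> is available on radius 4\<delta>, the quadratic
      error is small enough, and \<beta> maps the ball of radius \<delta> into that of radius
      \<delta>2.\<close>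
    define \<delta> where "\<delta> = min (\<delta>3 / 4) (min (1 / (2 * Q * (D2 + 1))) (\<delta>2 / (?n * (?n * cb))))"
    have nb: "?n * (?n * cb) > 0" using n1 cb by (intro mult_pos_pos) linarith+
    have \<delta>: "\<delta> > 0" "4 * \<delta> \<le> \<delta>3" "\<delta> * (2 * Q * (D2 + 1)) \<le> 1" "?n * (?n * cb) * \<delta> \<le> \<delta>2"
    proof -
      have QD: "2 * Q * (D2 + 1) > 0" using Q D2 by (intro mult_pos_pos) auto
      show "\<delta> > 0" using \<delta>3 QD nb famD(2)[OF f2] by (auto simp: \<delta>_def)
      show "4 * \<delta> \<le> \<delta>3" by (auto simp: \<delta>_def min_le_iff_disj)
      have "\<delta> \<le> 1 / (2 * Q * (D2 + 1))" by (auto simp: \<delta>_def min_le_iff_disj)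
      thus "\<delta> * (2 * Q * (D2 + 1)) \<le> 1" using QD by (simp only: pos_le_divide_eq)
      have "\<delta> \<le> \<delta>2 / (?n * (?n * cb))" by (auto simp: \<delta>_def min_le_iff_disj)
      thus "?n * (?n * cb) * \<delta> \<le> \<delta>2" using nb by (simp only: pos_le_divide_eq mult.commute)
    qed
    define er where "er = (\<lambda>x. \<alpha> (fst x) *v \<gamma> x - snd x)"
    have jer: "jholo (cbox p q \<times> ball 0 (4 * \<delta>)) er" unfolding er_def
    proof (intro jholo_diff jholo_snd jholo_matrix_vector[OF \<alpha>])
      show "jholo (cbox p q \<times> ball 0 (4 * \<delta>)) \<gamma>" by (rule jholo_subset[OF \<gamma>(1)]) (use SK \<delta> in auto)
    qed (use S\<Omega> in auto)
    define m where "m = ?n * (?n * (\<epsilon> * (4 * \<delta>))) + ?n * (?n * (ca * (C1 * (4 * \<delta>)\<^sup>2)))"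
    have erm: "norm (er x) \<le> m" if x: "x \<in> cbox p q \<times> ball 0 (4 * \<delta>)" for x
    proof -
      obtain \<zeta> s where [simp]: "x = (\<zeta>, s)" by force
      have z: "\<zeta> \<in> cbox p q" and zK: "\<zeta> \<in> K" and s: "norm s < 4 * \<delta>" using x SK by auto
      have lin: "norm (\<gamma> (\<zeta>, s) - jmat \<gamma> \<zeta> *v s) \<le> C1 * (norm s)\<^sup>2"
      proof -
        have "norm (\<gamma> (\<zeta>, s) - \<gamma> (\<zeta>, 0) - jmat \<gamma> \<zeta> *v s) \<le> ?n * (4 * \<delta>2 / \<delta>3\<^sup>2) * (norm s)\<^sup>2"
        proof (rule jholo_linearization[OF \<gamma>(1)])
          show "{\<zeta>} \<times> ball 0 \<delta>3 \<subseteq> K \<times> ball 0 \<delta>3" using zK by auto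
          show "norm (\<gamma> (\<zeta>, s)) \<le> \<delta>2" if "s \<in> ball 0 \<delta>3" for s using \<gamma>(3)[of "(\<zeta>, s)"] that zK by auto
          show "s \<in> ball 0 \<delta>3" using s \<delta> by simp
        qed
        thus ?thesis using \<gamma>(2)[OF zK] by (simp add: C1_def)
      qed
      have "er x = (\<alpha> \<zeta> ** jmat \<gamma> \<zeta> - mat 1) *v s + \<alpha> \<zeta> *v (\<gamma> (\<zeta>, s) - jmat \<gamma> \<zeta> *v s)"
        by (simp add: er_def matrix_vector_mult_diff_distrib matrix_vector_mult_diff_rdistrib matrix_vector_mul_assoc)
      also have "norm \<dots> \<le> ?n * (?n * (\<epsilon> * norm s)) + ?n * (?n * (ca * norm (\<gamma> (\<zeta>, s) - jmat \<gamma> \<zeta> *v s)))"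
        by (intro order.trans[OF norm_triangle_ineq] add_mono matrix_vector_norm_bound close ca(2) z)
      also have "\<dots> \<le> m" unfolding m_def
      proof (intro add_mono mult_left_mono)
        have "C1 * (norm s)\<^sup>2 \<le> C1 * (4 * \<delta>)\<^sup>2" using s C1 by (intro mult_left_mono power_mono) auto
        thus "norm (\<gamma> (\<zeta>, s) - jmat \<gamma> \<zeta> *v s) \<le> C1 * (4 * \<delta>)\<^sup>2" using lin by linarith
      qed (use s \<epsilon> ca in auto)
      finally show ?thesis .
    qed
    have small: "16 * ?n * (?n * Cop p q) * m \<le> \<delta>"
    proof -
      have m: "m = (\<epsilon> * (4 * ?n * ?n) + D2 * \<delta>) * \<delta>" by (simp add: m_def D2_def power2_eq_square algebra_simps)
      have "Q * (\<epsilon> * (4 * ?n * ?n)) = 1/2" using Q n1 by (simp add: \<epsilon>_def)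
      moreover have "Q * (D2 * \<delta>) \<le> 1/2"
      proof -
        have "0 \<le> Q * \<delta>" using Q \<delta>(1) by simp
        hence "2 * (Q * (D2 * \<delta>)) \<le> \<delta> * (2 * Q * (D2 + 1))" by (simp add: algebra_simps)
        thus ?thesis using \<delta>(3) by linarith
      qed
      ultimately have "Q * (\<epsilon> * (4 * ?n * ?n) + D2 * \<delta>) \<le> 1" by (simp add: distrib_left)
      hence "Q * (\<epsilon> * (4 * ?n * ?n) + D2 * \<delta>) * \<delta> \<le> 1 * \<delta>" using \<delta>(1) by (intro mult_right_mono) auto
      thus ?thesis by (simp add: m Q_def mult.assoc)
    qed
    have er0: "er (w, 0) = 0" if "w \<in> cbox p q" for w using \<gamma>(2)[of w] SK that by (auto simp: er_def)
    have chol: "chol p q (ball 0 (4 * \<delta>)) er"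
      unfolding chol_def using jer box_subset_cbox by (meson Sigma_mono jholo_continuous jholo_subset order.refl)
    show ?thesis
    proof (rule nonlinear_splitting[OF pq \<delta>(1) chol erm small er0])
      fix u1 u2 :: "complex \<times> (complex ^ 'n) \<Rightarrow> complex ^ 'n"
      assume u1: "jholo ({\<zeta>. Im p < Im \<zeta> \<and> Im \<zeta> < Im q \<and> Re \<zeta> < Re q} \<times> ball 0 \<delta>) u1"
        and u2: "jholo ({\<zeta>. Im p < Im \<zeta> \<and> Im \<zeta> < Im q \<and> Re p < Re \<zeta>} \<times> ball 0 \<delta>) u2"
        and b1: "\<And>a. a \<in> {\<zeta>. Im p < Im \<zeta> \<and> Im \<zeta> < Im q \<and> Re \<zeta> < Re q} \<times> ball 0 \<delta> \<Longrightarrow> norm (u1 a) \<le> \<delta> / (8 * real CARD('n))"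
        and b2: "\<And>a. a \<in> {\<zeta>. Im p < Im \<zeta> \<and> Im \<zeta> < Im q \<and> Re p < Re \<zeta>} \<times> ball 0 \<delta> \<Longrightarrow> norm (u2 a) \<le> \<delta> / (8 * real CARD('n))"
        and z1: "\<And>\<zeta>. u1 (\<zeta>, 0) = 0" and z2: "\<And>\<zeta>. u2 (\<zeta>, 0) = 0"
        and eq: "\<And>\<zeta> s. \<zeta> \<in> box p q \<Longrightarrow> s \<in> ball 0 \<delta> \<Longrightarrow> er (\<zeta>, s + u1 (\<zeta>, s)) = u2 (\<zeta>, s) - u1 (\<zeta>, s)"
      have s1: "\<Omega>1' \<subseteq> {\<zeta>. Im p < Im \<zeta> \<and> Im \<zeta> < Im q \<and> Re \<zeta> < Re q}"
        by (auto simp: \<Omega>1'_def p_def q_def in_box_complex_iff)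
      have s2: "\<Omega>2' \<subseteq> {\<zeta>. Im p < Im \<zeta> \<and> Im \<zeta> < Im q \<and> Re p < Re \<zeta>}"
        by (auto simp: \<Omega>2'_def p_def q_def in_box_complex_iff)
      have \<delta>\<delta>1: "\<delta> \<le> \<delta>1" using \<delta> \<delta>3 by linarith
      obtain \<psi>3 where f3: "fam A f \<Omega>1' (\<delta> / 2) (\<lambda>x. F1 (fst x, snd x + u1 x)) \<psi>3"
        using fam_perturb[OF f1 O1' \<delta>(1) \<delta>\<delta>1 jholo_subset[OF u1] b1 z1] s1 by blast
      have f4: "fam A f \<Omega>2' \<delta> (\<lambda>x. F2 (fst x, \<beta> (fst x) *v snd x)) (\<lambda>y. \<alpha> (fst y) *v \<psi>2 y)"
      proof (rule fam_linear[OF f2 O2' \<delta>(1)])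
        show "(\<lambda>\<zeta>. \<alpha> \<zeta> $ i $ j) holomorphic_on \<Omega>2'" for i j by (rule holomorphic_on_subset[OF \<alpha> order.trans[OF O2\<Omega> c2\<Omega>]])
        show "(\<lambda>\<zeta>. \<beta> \<zeta> $ i $ j) holomorphic_on \<Omega>2'" for i j by (rule holomorphic_on_subset[OF \<beta> order.trans[OF O2\<Omega> c2\<Omega>]])
        show "\<alpha> \<zeta> ** \<beta> \<zeta> = mat 1" "\<beta> \<zeta> ** \<alpha> \<zeta> = mat 1" if "\<zeta> \<in> \<Omega>2'" for \<zeta> using \<alpha>\<beta>[of \<zeta>] that O2\<Omega> c2\<Omega> by auto
        show "\<beta> \<zeta> *v s \<in> ball 0 \<delta>2" if z: "\<zeta> \<in> \<Omega>2'" and s: "s \<in> ball 0 \<delta>" for \<zeta> s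
        proof -
          have "norm (\<beta> \<zeta> *v s) \<le> ?n * (?n * (cb * norm s))"
            by (rule matrix_vector_norm_bound[OF cb(2)]) (use z O2\<Omega> in blast)
          also have "\<dots> = ?n * (?n * cb) * norm s" by (simp add: mult.assoc)
          also have "\<dots> < ?n * (?n * cb) * \<delta>" using s nb by (intro mult_strict_left_mono) auto
          also have "\<dots> \<le> \<delta>2" by (rule \<delta>(4))
          finally show ?thesis by simp
        qed
      qed
      obtain \<psi>5 where f5: "fam A f \<Omega>2' (\<delta> / 2) (\<lambda>x. F2 (fst (fst x, snd x + u2 x), \<beta> (fst (fst x, snd x + u2 x)) *v snd (fst x, snd x + u2 x))) \<psi>5"
        using fam_perturb[OF f4 O2'(1) order.refl \<delta>(1) order.refl jholo_subset[OF u2] b2 z2] s2 by blast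
      have "\<exists>F \<psi>. fam A f (\<Omega>1' \<union> \<Omega>2') (\<delta> / 2) F \<psi>"
      proof (rule fam_union[OF A f3 f5])
        fix \<zeta> :: complex and s :: "complex ^ 'n" assume z: "\<zeta> \<in> \<Omega>1'" "\<zeta> \<in> \<Omega>2'" and s: "s \<in> ball 0 (\<delta> / 2)"
        have zb: "\<zeta> \<in> box p q" using z overlap by blast
        hence zc: "\<zeta> \<in> cbox p q" using box_subset_cbox by blast
        have s': "s \<in> ball 0 \<delta>" using s \<delta>(1) by auto
        have "norm (u1 (\<zeta>, s)) \<le> \<delta> / (8 * real CARD('n))" using b1[of "(\<zeta>, s)"] z s1 s' by auto
        also have "\<dots> \<le> \<delta> / 2" using \<delta> n1 by (intro divide_left_mono; linarith)
        finally have ss: "s + u1 (\<zeta>, s) \<in> ball 0 \<delta>" using s norm_triangle_ineq[of s "u1 (\<zeta>, s)"] by simp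
        have "\<alpha> \<zeta> *v \<gamma> (\<zeta>, s + u1 (\<zeta>, s)) = s + u2 (\<zeta>, s)"
          using eq[OF zb s'] by (simp add: er_def algebra_simps)
        hence "\<beta> \<zeta> *v (s + u2 (\<zeta>, s)) = \<beta> \<zeta> *v (\<alpha> \<zeta> *v \<gamma> (\<zeta>, s + u1 (\<zeta>, s)))" by simp
        also have "\<dots> = \<gamma> (\<zeta>, s + u1 (\<zeta>, s))" using \<alpha>\<beta>(2)[of \<zeta>] zc S\<Omega> by (auto simp: matrix_vector_mul_assoc)
        finally have "F2 (\<zeta>, \<beta> \<zeta> *v (s + u2 (\<zeta>, s))) = F2 (\<zeta>, \<gamma> (\<zeta>, s + u1 (\<zeta>, s)))" by simp
        also have "\<dots> = F1 (\<zeta>, s + u1 (\<zeta>, s))" using \<gamma>(4)[of "(\<zeta>, s + u1 (\<zeta>, s))"] zc SK ss \<delta> by auto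
        finally show "F1 (fst (\<zeta>, s), snd (\<zeta>, s) + u1 (\<zeta>, s)) =
           F2 (fst (fst (\<zeta>, s), snd (\<zeta>, s) + u2 (\<zeta>, s)), \<beta> (fst (fst (\<zeta>, s), snd (\<zeta>, s) + u2 (\<zeta>, s))) *v snd (fst (\<zeta>, s), snd (\<zeta>, s) + u2 (\<zeta>, s)))"
          by simp
      qed
      thus ?thesis unfolding hasfam_def using cover by blast
    qed
  qed
qed

text \<open>Base change along \<rho>. The graph neighbourhood is the preimage of the old one under
  \<rho> in the base and the identity in the manifold, so it is open.\<close>

lemma fam_pullback:
  assumes fm: "fam A f \<Omega> \<delta> F \<psi>" and \<Omega>': "open \<Omega>'" and \<rho>: "\<rho> holomorphic_on \<Omega>'" "\<rho> ` \<Omega>' \<subseteq> \<Omega>"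
    and f': "\<And>\<zeta>. \<zeta> \<in> \<Omega>' \<Longrightarrow> f' \<zeta> = f (\<rho> \<zeta>)"
  shows "fam A f' \<Omega>' \<delta> (\<lambda>a. F (\<rho> (fst a), snd a)) (\<lambda>b. \<psi> (\<rho> (fst b), snd b))"
proof -
  note fd = famD[OF fm]
  let ?W = "\<Omega>' \<times> ball (0 :: complex ^ 'b) \<delta>" and ?F = "\<lambda>a. F (\<rho> (fst a), snd a)"
  let ?N = "(\<lambda>a. (fst a, F a)) ` (\<Omega> \<times> ball 0 \<delta>)" and ?N' = "(\<lambda>a. (fst a, ?F a)) ` ?W"
  have c1: "continuous_on X (\<lambda>a. \<rho> (fst a))" if "fst ` X \<subseteq> \<Omega>'" for X :: "(complex \<times> 'x::topological_space) set"
    by (rule continuous_on_compose2[OF holomorphic_on_imp_continuous_on[OF \<rho>(1)]]) (use that in \<open>auto intro!: continuous_intros\<close>)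
  have N': "?N' = (\<Omega>' \<times> UNIV) \<inter> (\<lambda>b. (\<rho> (fst b), snd b)) -` ?N"
  proof (intro equalityI subsetI)
    fix b assume "b \<in> ?N'"
    then obtain \<zeta> s where "\<zeta> \<in> \<Omega>'" "s \<in> ball 0 \<delta>" "b = (\<zeta>, F (\<rho> \<zeta>, s))" by auto
    thus "b \<in> (\<Omega>' \<times> UNIV) \<inter> (\<lambda>b. (\<rho> (fst b), snd b)) -` ?N"
      using \<rho>(2) by (auto intro!: image_eqI[of _ _ "(\<rho> \<zeta>, s)"])
  next
    fix b assume b: "b \<in> (\<Omega>' \<times> UNIV) \<inter> (\<lambda>b. (\<rho> (fst b), snd b)) -` ?N"
    then obtain a where a: "a \<in> \<Omega> \<times> ball 0 \<delta>" "(\<rho> (fst b), snd b) = (fst a, F a)" by auto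
    hence "b = (fst b, F (\<rho> (fst b), snd a))" by (cases a, cases b) auto
    thus "b \<in> ?N'" using a(1) b by (intro image_eqI[of _ _ "(fst b, snd a)"]) auto
  qed
  have N'N: "(\<rho> (fst b), snd b) \<in> ?N" if "b \<in> ?N'" for b using that unfolding N' by blast
  have cN: "continuous_on ?N' (\<lambda>b. (\<rho> (fst b), snd b))" by (intro continuous_intros c1) auto
  show ?thesis unfolding fam_def
  proof (intro conjI allI impI ballI)
    show "open \<Omega>'" "0 < \<delta>" using \<Omega>' fd by auto
    show "continuous_on ?W ?F"
      by (rule continuous_on_compose2[OF fd(3)]) (use \<rho>(2) in \<open>auto intro!: continuous_intros c1\<close>)
    show "mholo A T (\<lambda>\<tau>. ?F (g \<tau>, \<sigma> \<tau>))" if T: "open T" and g: "g holomorphic_on T" and \<sigma>: "vholo T \<sigma>" and W: "\<forall>\<tau>\<in>T. (g \<tau>, \<sigma> \<tau>) \<in> ?W" for T g \<sigma>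
    proof -
      have "(\<lambda>\<tau>. \<rho> (g \<tau>)) holomorphic_on T"
        by (rule holomorphic_on_compose_gen[OF g \<rho>(1), unfolded o_def]) (use W in auto)
      from fd(4)[OF T this \<sigma>] show ?thesis using W \<rho>(2) by (simp add: image_subset_iff)
    qed
    show "?F (\<zeta>, 0) = f' \<zeta>" if "\<zeta> \<in> \<Omega>'" for \<zeta> using fd(5)[of "\<rho> \<zeta>"] \<rho>(2) f' that by auto
    show "\<psi> (\<rho> (fst (fst a, ?F a)), snd (fst a, ?F a)) = snd a" if "a \<in> ?W" for a
      using fd(6)[of "(\<rho> (fst a), snd a)"] \<rho>(2) that by auto
    show "open ?N'" unfolding N'
      by (rule continuous_open_preimage[OF _ _ fd(7)]) (use \<Omega>' in \<open>auto intro!: continuous_intros c1 open_Times\<close>)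
    show "continuous_on ?N' (\<lambda>b. \<psi> (\<rho> (fst b), snd b))"
      by (rule continuous_on_compose2[OF fd(8) cN]) (use N'N in blast)
    show "vholo T (\<lambda>\<tau>. \<psi> (\<rho> (fst (g \<tau>, c \<tau>)), snd (g \<tau>, c \<tau>)))" if T: "open T" and g: "g holomorphic_on T" and c: "mholo A T c" and W: "\<forall>\<tau>\<in>T. (g \<tau>, c \<tau>) \<in> ?N'" for T g c
    proof -
      have "(\<lambda>\<tau>. \<rho> (g \<tau>)) holomorphic_on T"
        by (rule holomorphic_on_compose_gen[OF g \<rho>(1), unfolded o_def]) (use W in auto)
      hence "vholo T (\<lambda>\<tau>. \<psi> (\<rho> (g \<tau>), c \<tau>))"
      proof (rule fd(9)[OF T _ c])
        show "(\<rho> (g \<tau>), c \<tau>) \<in> ?N" if "\<tau> \<in> T" for \<tau> using N'N[of "(g \<tau>, c \<tau>)"] W that by simp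
      qed
      thus ?thesis by simp
    qed
  qed
qed

text \<open>Inside one chart the family is translation: the fibre variable is added to the
  coordinate of f, and the fibre coordinate of a point is its difference from f.\<close>

lemma local_fam:
  fixes A :: "('a::t2_space set \<times> ('a \<Rightarrow> complex ^ 'n)) set"
  assumes A: "complex_atlas A" and \<Omega>: "open \<Omega>" and f: "mholo A \<Omega> f" and z: "z \<in> \<Omega>"
  shows "\<exists>r>0. hasfam A f (ball z r)"
proof -
  obtain U \<phi> where U: "(U, \<phi>) \<in> A" and fU: "f z \<in> U" using atlas_cover[OF A] by blast
  note c = atlas_chartD[OF A U]
  define \<Omega>' where "\<Omega>' = \<Omega> \<inter> f -` U"
  have O': "open \<Omega>'" unfolding \<Omega>'_def by (rule continuous_open_preimage[OF mholo_continuous[OF f] \<Omega> c(1)])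
  have zO: "z \<in> \<Omega>'" using z fU by (simp add: \<Omega>'_def)
  have v: "vholo \<Omega>' (\<lambda>\<zeta>. \<phi> (f \<zeta>))" unfolding \<Omega>'_def by (rule mholo_chart[OF f U])
  obtain e where e: "e > 0" "ball (\<phi> (f z)) e \<subseteq> \<phi> ` U" by (rule openE[OF c(2)]) (use fU in auto)
  \<comment> \<open>Half of e is for the motion of f over the small disc and half for the fibre
    variable.\<close>
  define \<delta> where "\<delta> = e / 2"
  have \<delta>: "\<delta> > 0" using e by (simp add: \<delta>_def)
  have "open (\<Omega>' \<inter> (\<lambda>\<zeta>. \<phi> (f \<zeta>)) -` ball (\<phi> (f z)) \<delta>)"
    by (rule continuous_open_preimage[OF vholo_continuous[OF v] O' open_ball])
  moreover have "z \<in> \<Omega>' \<inter> (\<lambda>\<zeta>. \<phi> (f \<zeta>)) -` ball (\<phi> (f z)) \<delta>" using zO \<delta> by simp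
  ultimately obtain r where r: "r > 0" "ball z r \<subseteq> \<Omega>' \<inter> (\<lambda>\<zeta>. \<phi> (f \<zeta>)) -` ball (\<phi> (f z)) \<delta>" by (rule openE)
  let ?\<Omega> = "ball z r" and ?B = "ball (0 :: complex ^ 'n) \<delta>"
  define F where "F = (\<lambda>a. inv_into U \<phi> (\<phi> (f (fst a)) + snd a))"
  define \<psi> where "\<psi> = (\<lambda>b. \<phi> (snd b) - \<phi> (f (fst b)))"
  have rU: "f \<zeta> \<in> U" "\<zeta> \<in> \<Omega>'" if "\<zeta> \<in> ?\<Omega>" for \<zeta> using r(2) that by (auto simp: \<Omega>'_def)
  have inU: "\<phi> (f \<zeta>) + s \<in> \<phi> ` U" if "\<zeta> \<in> ?\<Omega>" "s \<in> ?B" for \<zeta> s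
  proof -
    have "dist (\<phi> (f z)) (\<phi> (f \<zeta>)) < \<delta>" using r(2) that by auto
    hence "dist (\<phi> (f z)) (\<phi> (f \<zeta>) + s) < e" using that dist_triangle[of "\<phi> (f z)" "\<phi> (f \<zeta>) + s" "\<phi> (f \<zeta>)"]
      by (simp add: \<delta>_def dist_norm)
    thus ?thesis using e(2) by auto
  qed
  have FU: "F (\<zeta>, s) \<in> U" "\<phi> (F (\<zeta>, s)) = \<phi> (f \<zeta>) + s" if "\<zeta> \<in> ?\<Omega>" "s \<in> ?B" for \<zeta> s
    using inU[OF that] by (auto simp: F_def inv_into_into f_inv_into_f)
  have vr: "vholo ?\<Omega> (\<lambda>\<zeta>. \<phi> (f \<zeta>))" by (rule vholo_subset[OF v]) (use rU in auto)
  let ?N = "(\<lambda>a. (fst a, F a)) ` (?\<Omega> \<times> ?B)"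
  have c\<psi>: "continuous_on (?\<Omega> \<times> U) \<psi>" unfolding \<psi>_def
    by (intro continuous_intros continuous_on_compose2[OF c(3)] continuous_on_compose2[OF vholo_continuous[OF vr]]) auto
  have N: "?N = (?\<Omega> \<times> U) \<inter> \<psi> -` ?B"
  proof (intro equalityI subsetI)
    fix b assume "b \<in> ?N"
    then obtain \<zeta> s where b: "\<zeta> \<in> ?\<Omega>" "s \<in> ?B" "b = (\<zeta>, F (\<zeta>, s))" by auto
    thus "b \<in> (?\<Omega> \<times> U) \<inter> \<psi> -` ?B" using FU[OF b(1,2)] by (auto simp: \<psi>_def)
  next
    fix b assume b: "b \<in> (?\<Omega> \<times> U) \<inter> \<psi> -` ?B"
    have "F (fst b, \<psi> b) = snd b" using b c(6) by (auto simp: F_def \<psi>_def)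
    thus "b \<in> ?N" using b by (intro image_eqI[of _ _ "(fst b, \<psi> b)"]) auto
  qed
  have "fam A f ?\<Omega> \<delta> F \<psi>" unfolding fam_def
  proof (intro conjI allI impI ballI)
    show "0 < \<delta>" by fact
    show "continuous_on (?\<Omega> \<times> ?B) F" unfolding F_def
      by (rule continuous_on_compose2[OF c(4)])
         (use inU in \<open>auto intro!: continuous_intros continuous_on_compose2[OF vholo_continuous[OF vr]]\<close>)
    show "mholo A T (\<lambda>\<tau>. F (g \<tau>, \<sigma> \<tau>))" if T: "open T" and g: "g holomorphic_on T" and \<sigma>: "vholo T \<sigma>" and W: "\<forall>\<tau>\<in>T. (g \<tau>, \<sigma> \<tau>) \<in> ?\<Omega> \<times> ?B" for T g \<sigma>
    proof -
      have "vholo T (\<lambda>\<tau>. \<phi> (f (g \<tau>)) + \<sigma> \<tau>)"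
        by (intro vholo_add \<sigma> vholo_compose[OF vr g]) (use W in auto)
      from mholo_inv_chart[OF A U T this] show ?thesis using W inU by (auto simp: F_def image_subset_iff)
    qed
    show "F (\<zeta>, 0) = f \<zeta>" if "\<zeta> \<in> ?\<Omega>" for \<zeta> using rU[OF that] c(6) by (simp add: F_def)
    show "\<psi> (fst a, F a) = snd a" if "a \<in> ?\<Omega> \<times> ?B" for a using FU(2)[of "fst a" "snd a"] that by (auto simp: \<psi>_def)
    show "open ?N" unfolding N
      by (rule continuous_open_preimage[OF c\<psi>]) (use c(1) in \<open>auto intro!: open_Times\<close>)
    show "continuous_on ?N \<psi>" by (rule continuous_on_subset[OF c\<psi>]) (use N in blast)
    show "vholo T (\<lambda>\<tau>. \<psi> (g \<tau>, d \<tau>))" if T: "open T" and g: "g holomorphic_on T" and d: "mholo A T d" and W: "\<forall>\<tau>\<in>T. (g \<tau>, d \<tau>) \<in> ?N" for T g d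
    proof -
      have W': "g \<tau> \<in> ?\<Omega> \<and> d \<tau> \<in> U" if "\<tau> \<in> T" for \<tau> using W that unfolding N by auto
      have "vholo T (\<lambda>\<tau>. \<phi> (d \<tau>))" by (rule vholo_subset[OF mholo_chart[OF d U]]) (use W' in auto)
      moreover have "vholo T (\<lambda>\<tau>. \<phi> (f (g \<tau>)))" by (rule vholo_compose[OF vr g]) (use W' in auto)
      ultimately show ?thesis unfolding \<psi>_def by (simp add: vholo_diff)
    qed
  qed simp
  hence "hasfam A f ?\<Omega>" unfolding hasfam_def by blast
  thus ?thesis using r by blast
qed

section \<open>From small balls to squares and to the disc\<close>

lemma hasfam_subset: "hasfam A f R \<Longrightarrow> R' \<subseteq> R \<Longrightarrow> hasfam A f R'"
  unfolding hasfam_def by blast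

lemma hasfam_rotate:
  assumes h: "hasfam A f R" and u: "u \<noteq> 0"
  shows "hasfam A (\<lambda>\<zeta>. f (u * \<zeta>)) ((\<lambda>\<zeta>. \<zeta> / u) ` R)"
proof -
  obtain \<Omega> \<delta> F \<psi> where fm: "fam A f \<Omega> \<delta> F \<psi>" and R: "R \<subseteq> \<Omega>" using h unfolding hasfam_def by blast
  have "open ((\<lambda>\<zeta>. u * \<zeta>) -` \<Omega>)" using famD(1)[OF fm] by (intro open_vimage continuous_intros)
  from fam_pullback[OF fm this, of "\<lambda>\<zeta>. u * \<zeta>" "\<lambda>\<zeta>. f (u * \<zeta>)"]
  have "fam A (\<lambda>\<zeta>. f (u * \<zeta>)) ((\<lambda>\<zeta>. u * \<zeta>) -` \<Omega>) \<delta> (\<lambda>a. F (u * fst a, snd a)) (\<lambda>b. \<psi> (u * fst b, snd b))"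
    by (auto intro!: holomorphic_intros)
  moreover have "(\<lambda>\<zeta>. \<zeta> / u) ` R \<subseteq> (\<lambda>\<zeta>. u * \<zeta>) -` \<Omega>" using R u by auto
  ultimately show ?thesis unfolding hasfam_def by blast
qed

text \<open>Division by the imaginary unit turns the vertical stack into a horizontal one, the
  imaginary bounds becoming real bounds in the same order; the glued family is then rotated
  back.\<close>

lemma fam_glue_vertical:
  assumes A: "complex_atlas A" and ab: "a \<le> b" "c \<le> d" "d \<le> e"
    and h1: "hasfam A f (cbox (Complex a c) (Complex b d))" and h2: "hasfam A f (cbox (Complex a d) (Complex b e))"
  shows "hasfam A f (cbox (Complex a c) (Complex b e))"
proof -
  have rot: "(\<lambda>\<zeta>. \<zeta> / \<i>) ` cbox (Complex x1 y1) (Complex x2 y2) = cbox (Complex y1 (- x2)) (Complex y2 (- x1))" for x1 x2 y1 y2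
  proof (intro equalityI subsetI)
    fix z assume "z \<in> cbox (Complex y1 (- x2)) (Complex y2 (- x1))"
    thus "z \<in> (\<lambda>\<zeta>. \<zeta> / \<i>) ` cbox (Complex x1 y1) (Complex x2 y2)"
      by (intro image_eqI[of _ _ "\<i> * z"]) (auto simp: in_cbox_complex_iff)
  qed (auto simp: in_cbox_complex_iff)
  have rot': "(\<lambda>\<zeta>. \<zeta> / (- \<i>)) ` cbox (Complex x1 y1) (Complex x2 y2) = cbox (Complex (- y2) x1) (Complex (- y1) x2)" for x1 x2 y1 y2
  proof (intro equalityI subsetI)
    fix z assume "z \<in> cbox (Complex (- y2) x1) (Complex (- y1) x2)"
    thus "z \<in> (\<lambda>\<zeta>. \<zeta> / (- \<i>)) ` cbox (Complex x1 y1) (Complex x2 y2)"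
      by (intro image_eqI[of _ _ "- \<i> * z"]) (auto simp: in_cbox_complex_iff)
  qed (auto simp: in_cbox_complex_iff)
  have "hasfam A (\<lambda>\<zeta>. f (\<i> * \<zeta>)) (cbox (Complex c (- b)) (Complex e (- a)))"
    by (rule fam_glue[OF A, of c d e "- b" "- a"]) (use ab hasfam_rotate[OF h1, of \<i>, unfolded rot] hasfam_rotate[OF h2, of \<i>, unfolded rot] in simp_all)
  from hasfam_rotate[OF this, of "- \<i>", unfolded rot'] show ?thesis by (simp add: mult.assoc[symmetric])
qed

lemma rectangle_fam:
  assumes A: "complex_atlas A" and \<Omega>: "open \<Omega>" and f: "mholo A \<Omega> f" and l: "l > 0"
    and R: "cbox (Complex x y) (Complex (x + l) (y + l)) \<subseteq> \<Omega>"
  shows "hasfam A f (cbox (Complex x y) (Complex (x + l) (y + l)))"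
proof -
  let ?R = "cbox (Complex x y) (Complex (x + l) (y + l))"
  define \<G> where "\<G> = {ball z r | z r. hasfam A f (ball z r)}"
  have "?R \<subseteq> \<Union>\<G>"
  proof
    fix z assume "z \<in> ?R"
    then obtain r where "r > 0" "hasfam A f (ball z r)" using local_fam[OF A \<Omega> f] R by blast
    thus "z \<in> \<Union>\<G>" unfolding \<G>_def by (intro UnionI[of "ball z r"]) auto
  qed
  note cov = this
  have "open G" if "G \<in> \<G>" for G using that by (auto simp: \<G>_def)
  \<comment> \<open>A Lebesgue number for the cover by balls that carry a trivialization.\<close>
  then obtain e where e: "e > 0" "\<And>z. z \<in> ?R \<Longrightarrow> \<exists>G\<in>\<G>. ball z e \<subseteq> G"
    using Heine_Borel_lemma[OF compact_cbox cov] by blast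
  have loc: "hasfam A f (ball z e)" if "z \<in> ?R" for z
    using e(2)[OF that] hasfam_subset unfolding \<G>_def by blast
  obtain N :: nat where N: "2 * l / e < real N" using reals_Archimedean2 by blast
  have N0: "N > 0" using N l e(1) by (cases N) (auto simp: field_simps)
  define h where "h = l / real N"
  have h: "h > 0" "2 * h < e" "real N * h = l" using N N0 l e(1) by (auto simp: h_def field_simps)
  \<comment> \<open>Only the lower left corner has to lie in the square; the cell itself fits into
    the ball of radius e about that corner because its side h satisfies
    \<open>2 * h < e\<close>.\<close>
  have cell: "hasfam A f (cbox (Complex (x + i * h) (y + j * h)) (Complex (x + (i + 1) * h) (y + (j + 1) * h)))"
    if ij: "0 \<le> i" "i * h \<le> l" "0 \<le> j" "j * h \<le> l" for i j :: real
  proof (rule hasfam_subset[OF loc[of "Complex (x + i * h) (y + j * h)"]])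
    show "Complex (x + i * h) (y + j * h) \<in> ?R" using ij h by (auto simp: in_cbox_complex_iff)
    show "cbox (Complex (x + i * h) (y + j * h)) (Complex (x + (i + 1) * h) (y + (j + 1) * h)) \<subseteq> ball (Complex (x + i * h) (y + j * h)) e"
    proof
      fix z assume z: "z \<in> cbox (Complex (x + i * h) (y + j * h)) (Complex (x + (i + 1) * h) (y + (j + 1) * h))"
      let ?w = "z - Complex (x + i * h) (y + j * h)"
      have "\<bar>Re ?w\<bar> \<le> h" "\<bar>Im ?w\<bar> \<le> h" using z by (auto simp: in_cbox_complex_iff algebra_simps)
      hence "cmod ?w < e" using cmod_le[of ?w] h by linarith
      thus "z \<in> ball (Complex (x + i * h) (y + j * h)) e" by (simp add: dist_norm norm_minus_commute)
    qed
  qed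
  have le: "real k * h \<le> l" if "k \<le> N" for k
  proof -
    have "real k * h \<le> real N * h" using that h by (intro mult_right_mono) auto
    thus ?thesis using h by simp
  qed
  have row: "hasfam A f (cbox (Complex x (y + real j * h)) (Complex (x + real (Suc k) * h) (y + (real j + 1) * h)))" if j: "j \<le> N" and "Suc k \<le> N" for j k
    using that(2)
  proof (induction k)
    case 0
    show ?case using cell[of 0 "real j"] le[OF j] l by simp
  next
    case (Suc k)
    show ?case
    proof (rule fam_glue[OF A, of x "x + real (Suc k) * h"])
      show "hasfam A f (cbox (Complex x (y + real j * h)) (Complex (x + real (Suc k) * h) (y + (real j + 1) * h)))"
        using Suc by simp
      show "hasfam A f (cbox (Complex (x + real (Suc k) * h) (y + real j * h)) (Complex (x + real (Suc (Suc k)) * h) (y + (real j + 1) * h)))"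
        using cell[of "real (Suc k)" "real j"] le[OF j] le[of "Suc k"] Suc.prems by (simp add: add.commute)
    qed (use h in \<open>auto simp: algebra_simps\<close>)
  qed
  have row': "hasfam A f (cbox (Complex x (y + real j * h)) (Complex (x + l) (y + (real j + 1) * h)))" if "j \<le> N" for j
    using row[OF that, of "N - 1"] N0 h(3) by simp
  have "hasfam A f (cbox (Complex x y) (Complex (x + l) (y + real (Suc k) * h)))" if "Suc k \<le> N" for k
    using that
  proof (induction k)
    case 0
    show ?case using row'[of 0] by simp
  next
    case (Suc k)
    show ?case
    proof (rule fam_glue_vertical[OF A, of x "x + l" y "y + real (Suc k) * h"])
      show "hasfam A f (cbox (Complex x y) (Complex (x + l) (y + real (Suc k) * h)))" using Suc by simp
      show "hasfam A f (cbox (Complex x (y + real (Suc k) * h)) (Complex (x + l) (y + real (Suc (Suc k)) * h)))"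
        using row'[of "Suc k"] Suc.prems by (simp add: add.commute)
    qed (use h l in \<open>auto simp: algebra_simps\<close>)
  qed
  from this[of "N - 1"] show ?thesis using N0 h(3) by simp
qed

text \<open>Gluing works over squares, so a Riemann map h from an open square to the disc carries
  the problem to the square. Its inverse g sends the compact disc of radius r into a smaller closed
  square, and the trivialization found there is pulled back along g.\<close>

lemma disc_fam:
  assumes A: "complex_atlas A" and f: "holo_disc A f" and r: "0 < r" "r < 1"
  shows "hasfam A f (cball 0 r)"
proof -
  let ?Q = "box (Complex (-1) (-1)) (Complex 1 1)"
  have m: "mholo A (ball 0 1) f" using f by (simp add: holo_disc_iff_mholo)
  have ne: "0 \<in> ?Q" by (simp add: in_box_complex_iff)
  have nU: "?Q \<noteq> UNIV" using bounded_box[of "Complex (-1) (-1)" "Complex 1 1"] not_bounded_UNIV by metis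
  have "simply_connected ?Q" by (intro convex_imp_simply_connected convex_box)
  hence "open ?Q \<and> simply_connected ?Q" by (simp add: open_box)
  then obtain h g where h: "h holomorphic_on ?Q" and g: "g holomorphic_on ball 0 1"
    and hg: "\<forall>z\<in>?Q. h z \<in> ball 0 1 \<and> g (h z) = z" and gh: "\<forall>z\<in>ball 0 1. g z \<in> ?Q \<and> h (g z) = z"
    using ne nU unfolding Riemann_mapping_theorem by blast
  have fh: "mholo A ?Q (\<lambda>\<zeta>. f (h \<zeta>))" by (rule mholo_compose[OF m h]) (use hg in blast)
  have cg: "continuous_on (cball 0 r) g"
    by (rule continuous_on_subset[OF holomorphic_on_imp_continuous_on[OF g]]) (use r in auto)
  have "\<exists>x\<in>cball 0 r. \<forall>y\<in>cball 0 r. max \<bar>Re (g y)\<bar> \<bar>Im (g y)\<bar> \<le> max \<bar>Re (g x)\<bar> \<bar>Im (g x)\<bar>"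
    by (rule continuous_attains_sup) (use r in \<open>auto intro!: continuous_intros cg\<close>)
  then obtain x where x: "x \<in> cball 0 r" "\<And>y. y \<in> cball 0 r \<Longrightarrow> max \<bar>Re (g y)\<bar> \<bar>Im (g y)\<bar> \<le> max \<bar>Re (g x)\<bar> \<bar>Im (g x)\<bar>" by blast
  define \<mu> where "\<mu> = max \<bar>Re (g x)\<bar> \<bar>Im (g x)\<bar>"
  have "g x \<in> ?Q" using gh x r by auto
  hence \<mu>: "\<mu> < 1" "\<mu> \<ge> 0" by (auto simp: \<mu>_def in_box_complex_iff)
  define t where "t = (\<mu> + 1) / 2"
  have t: "\<mu> < t" "t < 1" "0 < t" using \<mu> by (auto simp: t_def)
  let ?S = "cbox (Complex (- t) (- t)) (Complex (- t + 2 * t) (- t + 2 * t))"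
  have "hasfam A (\<lambda>\<zeta>. f (h \<zeta>)) ?S"
    by (rule rectangle_fam[OF A open_box fh]) (use t in \<open>auto simp: in_box_complex_iff in_cbox_complex_iff\<close>)
  then obtain \<Omega> \<delta> F \<psi> where fm: "fam A (\<lambda>\<zeta>. f (h \<zeta>)) \<Omega> \<delta> F \<psi>" and S: "?S \<subseteq> \<Omega>" unfolding hasfam_def by blast
  define \<Omega>' where "\<Omega>' = ball 0 1 \<inter> g -` \<Omega>"
  have O': "open \<Omega>'" unfolding \<Omega>'_def by (rule continuous_open_preimage[OF holomorphic_on_imp_continuous_on[OF g] open_ball famD(1)[OF fm]])
  have "fam A f \<Omega>' \<delta> (\<lambda>a. F (g (fst a), snd a)) (\<lambda>b. \<psi> (g (fst b), snd b))"
    by (rule fam_pullback[OF fm O']) (use gh in \<open>auto simp: \<Omega>'_def intro: holomorphic_on_subset[OF g]\<close>)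
  moreover have "cball 0 r \<subseteq> \<Omega>'"
  proof
    fix y assume y: "y \<in> cball (0::complex) r"
    have "\<bar>Re (g y)\<bar> \<le> \<mu>" "\<bar>Im (g y)\<bar> \<le> \<mu>" using x(2)[OF y] by (auto simp: \<mu>_def)
    hence "g y \<in> ?S" using t by (auto simp: in_cbox_complex_iff)
    thus "y \<in> \<Omega>'" using S y r by (auto simp: \<Omega>'_def)
  qed
  ultimately show ?thesis unfolding hasfam_def by blast
qed

section \<open>The Lempert function near a point\<close>

lemma artanh_le: "0 \<le> x \<Longrightarrow> x < 1 \<Longrightarrow> artanh (x::real) \<le> x / (1 - x)"
proof -
  assume x: "0 \<le> x" "x < 1"
  have "ln ((1 + x) / (1 - x)) \<le> (1 + x) / (1 - x) - 1" using x by (intro ln_le_minus_one) auto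
  also have "\<dots> = 2 * (x / (1 - x))" using x by (simp add: field_simps)
  finally show ?thesis by (simp add: artanh_def mult.commute)
qed

lemma artanh_mono_real: "0 \<le> x \<Longrightarrow> x \<le> y \<Longrightarrow> y < 1 \<Longrightarrow> artanh (x::real) \<le> artanh y"
  unfolding artanh_def by (intro divide_right_mono ln_mono frac_le) auto

lemma artanh_ge: "0 \<le> x \<Longrightarrow> x < 1 \<Longrightarrow> x \<le> artanh (x::real)"
proof -
  assume x: "0 \<le> x" "x < 1"
  have "artanh 0 - 0 \<le> artanh x - x"
  proof (rule DERIV_nonneg_imp_nondecreasing[OF x(1)])
    fix y assume y: "0 \<le> y" "y \<le> x"
    hence "y\<^sup>2 < 1" using x by (simp add: power_less_one_iff abs_square_less_1)
    have "((\<lambda>y. artanh y - y) has_real_derivative (1 / (1 - y\<^sup>2) - 1)) (at y)"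
      using y x by (auto intro!: derivative_eq_intros)
    moreover have "1 / (1 - y\<^sup>2) - 1 \<ge> 0" using \<open>y\<^sup>2 < 1\<close> by (simp add: field_simps)
    ultimately show "\<exists>z. ((\<lambda>y. artanh y - y) has_real_derivative z) (at y) \<and> 0 \<le> z" by blast
  qed
  thus ?thesis by simp
qed

lemma lempert_star_nonneg: "0 \<le> lempert_star A w w'"
  unfolding lempert_star_def by (rule Inf_greatest) auto

lemma lempert_star_le:
  assumes "holo_disc A g" "g 0 = w" "g \<beta> = w'" "cmod \<beta> < 1"
  shows "lempert_star A w w' \<le> ereal (cmod \<beta>)"
  unfolding lempert_star_def by (rule Inf_lower) (use assms in auto)

lemma lempert_star_real:
  assumes "lempert_star A w w' < 1"
  obtains x where "0 \<le> x" "x < 1" "lempert_star A w w' = ereal x" "lempert A w w' = ereal (artanh x)"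
proof -
  obtain x where x: "lempert_star A w w' = ereal x"
    using assms lempert_star_nonneg[of A w w'] by (cases "lempert_star A w w'") auto
  show thesis using assms lempert_star_nonneg[of A w w'] x by (intro that[of x]) (auto simp: lempert_def one_ereal_def)
qed

lemma lempert_nonneg: "0 \<le> lempert A w w'"
proof (cases "lempert_star A w w' < 1")
  case True
  then obtain x where "0 \<le> x" "x < 1" "lempert A w w' = ereal (artanh x)" by (rule lempert_star_real)
  thus ?thesis using artanh_ge[of x] by simp
qed (simp add: lempert_def)

lemma lempert_le:
  assumes "holo_disc A g" "g 0 = w" "g \<beta> = w'" "cmod \<beta> < 1"
  shows "lempert A w w' \<le> ereal (artanh (cmod \<beta>))"
proof -
  have le: "lempert_star A w w' \<le> ereal (cmod \<beta>)" by (rule lempert_star_le[OF assms])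
  hence "lempert_star A w w' < 1" using assms(4) by (metis ereal_less(3) le_less_trans)
  then obtain x where "0 \<le> x" "x < 1" "lempert_star A w w' = ereal x" "lempert A w w' = ereal (artanh x)" by (rule lempert_star_real)
  thus ?thesis using le assms(4) artanh_mono_real[of x "cmod \<beta>"] by simp
qed

text \<open>Since \<open>x \<le> artanh x\<close>, a bound on the Lempert function bounds the
  parameter \<beta> by the same number.\<close>

lemma lempert_lessD:
  assumes "lempert A w w' < ereal c"
  obtains g \<beta> where "holo_disc A g" "g 0 = w" "g \<beta> = w'" "cmod \<beta> < 1" "cmod \<beta> < c"
proof -
  have "lempert_star A w w' < 1" using assms by (auto simp: lempert_def split: if_splits)
  then obtain x where x: "0 \<le> x" "x < 1" "lempert_star A w w' = ereal x" "lempert A w w' = ereal (artanh x)" by (rule lempert_star_real)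
  have "ereal x < ereal c" using assms x artanh_ge[of x] by simp
  hence "lempert_star A w w' < ereal c" using x by simp
  then obtain y where "y \<in> {ereal (cmod \<alpha>) | \<alpha>. \<alpha> \<in> ball 0 1 \<and> (\<exists>f. holo_disc A f \<and> f 0 = w \<and> f \<alpha> = w')}" "y < ereal c"
    unfolding lempert_star_def Inf_less_iff by blast
  thus thesis using that by auto
qed

section \<open>Discs inside a chart and localization by hyperbolicity\<close>

lemma chart_ball_nbhd:
  assumes A: "complex_atlas A" and U: "(U, \<phi>) \<in> A" and z: "z \<in> U"
  shows "open (U \<inter> \<phi> -` ball (\<phi> z) e)"
  by (rule continuous_open_preimage[OF atlas_chartD(3,1)[OF A U] open_ball])

text \<open>The disc is affine in the chart, scaled so that it meets y at the real parameter
  \<beta>; the condition on the distance keeps it in the chart ball for all parameters of modulus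
  below one.\<close>

lemma chart_disc:
  assumes A: "complex_atlas A" and U: "(U, \<phi>) \<in> A" and xy: "x \<in> U" "y \<in> U" and \<beta>: "0 < \<beta>" "\<beta> < 1"
    and b: "ball (\<phi> x) R \<subseteq> \<phi> ` U" "norm (\<phi> y - \<phi> x) < \<beta> * R"
  shows "lempert A x y \<le> ereal (artanh \<beta>)"
proof -
  note c = atlas_chartD[OF A U]
  define g where "g = (\<lambda>\<zeta>. inv_into U \<phi> (\<phi> x + \<zeta> *s (of_real (1 / \<beta>) *s (\<phi> y - \<phi> x))))"
  have "mholo A (ball 0 1) g" unfolding g_def
  proof (rule mholo_inv_chart[OF A U open_ball vholo_affine])
    show "(\<lambda>\<zeta>. \<phi> x + \<zeta> *s (of_real (1 / \<beta>) *s (\<phi> y - \<phi> x))) ` ball 0 1 \<subseteq> \<phi> ` U"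
    proof (rule image_subsetI, rule subsetD[OF b(1)])
      fix \<zeta> assume "\<zeta> \<in> ball (0::complex) 1"
      hence "cmod \<zeta> * (norm (\<phi> y - \<phi> x) / \<beta>) \<le> 1 * (norm (\<phi> y - \<phi> x) / \<beta>)" using \<beta> by (intro mult_right_mono) auto
      also have "\<dots> < R" using b(2) \<beta> by (simp add: field_simps)
      finally have "norm (\<zeta> *s (of_real (1 / \<beta>) *s (\<phi> y - \<phi> x))) < R" using \<beta>
        unfolding norm_smult_vec by (simp add: norm_divide)
      thus "\<phi> x + \<zeta> *s (of_real (1 / \<beta>) *s (\<phi> y - \<phi> x)) \<in> ball (\<phi> x) R" by (simp add: dist_norm norm_minus_commute del: of_real_divide)
    qed
  qed
  hence "holo_disc A g" by (simp add: holo_disc_iff_mholo)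
  moreover have "g 0 = x" using c(6)[OF xy(1)] by (simp add: g_def)
  moreover have "g (of_real \<beta>) = y"
  proof -
    have "of_real \<beta> *s (of_real (1 / \<beta>) *s (\<phi> y - \<phi> x)) = \<phi> y - \<phi> x" using \<beta>
      by (simp add: vector_smult_assoc flip: of_real_mult del: of_real_divide)
    thus ?thesis using c(6)[OF xy(2)] by (simp add: g_def del: of_real_divide)
  qed
  ultimately show ?thesis using lempert_le[of A g x "of_real \<beta>" y] \<beta> by simp
qed

lemma lempert_local:
  assumes A: "complex_atlas A" and c: "c > 0"
  obtains V where "open V" "x \<in> V" "\<And>y. y \<in> V \<Longrightarrow> lempert A x y < ereal c" "\<And>y. y \<in> V \<Longrightarrow> lempert A y x < ereal c"
proof -
  obtain U \<phi> where U: "(U, \<phi>) \<in> A" and x: "x \<in> U" using atlas_cover[OF A] by blast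
  note ch = atlas_chartD[OF A U]
  obtain R where R: "R > 0" "ball (\<phi> x) R \<subseteq> \<phi> ` U" by (rule openE[OF ch(2)]) (use x in auto)
  \<comment> \<open>Since artanh \<beta> is at most \<beta>/(1 - \<beta>), and this at most
    2\<beta>, the choice c/4 leaves it strictly below c.\<close>
  define \<beta> where "\<beta> = min (1/2) (c / 4)"
  have \<beta>: "0 < \<beta>" "\<beta> < 1" "\<beta> \<le> 1/2" "4 * \<beta> \<le> c" using c by (auto simp: \<beta>_def)
  have art: "artanh \<beta> < c"
  proof -
    have "\<beta> / (1 - \<beta>) \<le> \<beta> / (1/2)" using \<beta> by (intro divide_left_mono) auto
    hence "\<beta> / (1 - \<beta>) \<le> 2 * \<beta>" by simp
    thus ?thesis using artanh_le[OF less_imp_le[OF \<beta>(1)] \<beta>(2)] \<beta> c by linarith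
  qed
  \<comment> \<open>The radius R/2 serves the reversed pair: the ball of radius R/2 about \<phi> y
    is still inside the one of radius R about \<phi> x.\<close>
  define V where "V = U \<inter> \<phi> -` ball (\<phi> x) (\<beta> * (R / 2))"
  show thesis
  proof (rule that[of V])
    show "open V" unfolding V_def by (rule chart_ball_nbhd[OF A U x])
    show "x \<in> V" using x \<beta> R by (simp add: V_def)
    fix y assume y: "y \<in> V"
    hence yU: "y \<in> U" and d: "norm (\<phi> y - \<phi> x) < \<beta> * (R / 2)" by (auto simp: V_def dist_norm norm_minus_commute)
    have "\<beta> * (R / 2) \<le> 1 * (R / 2)" using \<beta> R by (intro mult_right_mono) auto
    hence d': "norm (\<phi> y - \<phi> x) < R / 2" using d by linarith
    have "\<beta> * (R / 2) \<le> \<beta> * R" using \<beta> R by (intro mult_left_mono) auto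
    hence "norm (\<phi> y - \<phi> x) < \<beta> * R" using d by linarith
    hence "lempert A x y \<le> ereal (artanh \<beta>)" by (rule chart_disc[OF A U x yU \<beta>(1,2) R(2)])
    thus "lempert A x y < ereal c" using art by (meson ereal_less_eq(3) le_less_trans less_ereal.simps(1))
    have "ball (\<phi> y) (R / 2) \<subseteq> ball (\<phi> x) R"
    proof
      fix p assume "p \<in> ball (\<phi> y) (R / 2)"
      thus "p \<in> ball (\<phi> x) R" using d' dist_triangle[of "\<phi> x" p "\<phi> y"] by (simp add: dist_norm norm_minus_commute)
    qed
    hence "lempert A y x \<le> ereal (artanh \<beta>)"
      using chart_disc[OF A U yU x \<beta>(1,2), of "R / 2"] R(2) d by (auto simp: norm_minus_commute)
    thus "lempert A y x < ereal c" using art by (meson ereal_less_eq(3) le_less_trans less_ereal.simps(1))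
  qed
qed

lemma kobayashi_le_three:
  "kobayashi A z x \<le> lempert A z a + lempert A a b + lempert A b x"
proof -
  define c where "c = (\<lambda>j::nat. if j = 0 then z else if j = 1 then a else if j = 2 then b else x)"
  have "kobayashi A z x \<le> kchain A 3 z x" unfolding kobayashi_def by (rule INF_lower) simp
  also have "\<dots> \<le> (\<Sum>j<3. lempert A (c j) (c (Suc j)))" unfolding kchain_def
    by (rule Inf_lower) (auto simp: c_def intro!: exI[of _ c])
  also have "\<dots> = lempert A z a + lempert A a b + lempert A b x"
    by (simp add: c_def eval_nat_numeral)
  finally show ?thesis .
qed

text \<open>A disc starting near z can leave the chart ball only through the compact sphere K.
  Reaching K at a parameter below r0 would give a chain of three short links from z to a point of K,
  against the positive Kobayashi distance; a finite cover of K makes r0 and V uniform over all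
  discs.\<close>

lemma hyperbolic_localization:
  fixes A :: "('a::t2_space set \<times> ('a \<Rightarrow> complex ^ 'n)) set"
  assumes A: "complex_atlas A" and U: "(U, \<phi>) \<in> A" and z: "z \<in> U" and hyp: "hyperbolic_at A z"
    and \<rho>: "\<rho> > 0" "cball (\<phi> z) \<rho> \<subseteq> \<phi> ` U"
  obtains r0 V where "0 < r0" "r0 < 1" "open V" "z \<in> V"
    "\<And>f \<zeta>. holo_disc A f \<Longrightarrow> f 0 \<in> V \<Longrightarrow> cmod \<zeta> < r0 \<Longrightarrow> f \<zeta> \<in> U \<and> norm (\<phi> (f \<zeta>) - \<phi> z) < \<rho>"
proof -
  note ch = atlas_chartD[OF A U]
  define K where "K = inv_into U \<phi> ` sphere (\<phi> z) \<rho>"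
  define C where "C = inv_into U \<phi> ` cball (\<phi> z) \<rho>"
  define W where "W = U \<inter> \<phi> -` ball (\<phi> z) \<rho>"
  have sph: "sphere (\<phi> z) \<rho> \<subseteq> \<phi> ` U" using \<rho>(2) by force
  have cK: "compact K" unfolding K_def by (rule compact_continuous_image[OF continuous_on_subset[OF ch(4) sph] compact_sphere])
  have cC: "compact C" unfolding C_def by (rule compact_continuous_image[OF continuous_on_subset[OF ch(4) \<rho>(2)] compact_cball])
  have oW: "open W" unfolding W_def by (rule chart_ball_nbhd[OF A U z])
  have CWK: "C \<subseteq> W \<union> K"
  proof
    fix x assume "x \<in> C"
    then obtain p where p: "p \<in> cball (\<phi> z) \<rho>" "x = inv_into U \<phi> p" by (auto simp: C_def)
    have pU: "p \<in> \<phi> ` U" using p \<rho>(2) by blast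
    have xU: "x \<in> U" "\<phi> x = p" using pU p(2) by (auto simp: inv_into_into f_inv_into_f)
    show "x \<in> W \<union> K"
    proof (cases "p \<in> ball (\<phi> z) \<rho>")
      case True thus ?thesis using xU by (simp add: W_def)
    next
      case False
      hence "p \<in> sphere (\<phi> z) \<rho>" using p(1) by simp
      thus ?thesis using p(2) by (simp add: K_def)
    qed
  qed
  have WC: "W \<subseteq> C"
  proof
    fix x assume "x \<in> W"
    thus "x \<in> C" unfolding C_def W_def using ch(6) by (intro image_eqI[of _ _ "\<phi> x"]) auto
  qed
  have zK: "x \<noteq> z" if x: "x \<in> K" for x
  proof -
    obtain p where p: "p \<in> sphere (\<phi> z) \<rho>" "x = inv_into U \<phi> p" using x by (auto simp: K_def)
    have "\<phi> x = p" using sph p by (auto simp: f_inv_into_f)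
    thus ?thesis using p \<rho>(1) by auto
  qed
  \<comment> \<open>A third of the distance is allotted to each link. The last link leads from any
    point near x to x itself, so that finitely many x suffice and no continuity of the distance in x
    is invoked.\<close>
  have "\<exists>c V. 0 < c \<and> ereal (3 * c) \<le> kobayashi A z x \<and> open V \<and> x \<in> V \<and> (\<forall>y\<in>V. lempert A y x < ereal c)" if x: "x \<in> K" for x
  proof -
    have pos: "kobayashi A z x > 0" using hyp zK[OF x] by (simp add: hyperbolic_at_def)
    obtain c where c: "0 < c" "ereal (3 * c) \<le> kobayashi A z x"
    proof (cases "kobayashi A z x")
      case (real k)
      thus ?thesis using pos that[of "k / 3"] by simp
    next
      case PInf
      thus ?thesis using that[of 1] by simp
    qed (use pos in auto)
    show ?thesis by (rule lempert_local[OF A c(1), of x]) (use c in blast)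
  qed
  then obtain c V where cV: "\<And>x. x \<in> K \<Longrightarrow> 0 < c x" "\<And>x. x \<in> K \<Longrightarrow> ereal (3 * c x) \<le> kobayashi A z x" "\<And>x. x \<in> K \<Longrightarrow> open (V x)"
     "\<And>x. x \<in> K \<Longrightarrow> x \<in> V x" "\<And>x y. x \<in> K \<Longrightarrow> y \<in> V x \<Longrightarrow> lempert A y x < ereal (c x)" by metis
  have "K \<subseteq> (\<Union>x\<in>K. V x)" using cV(4) by blast
  from compactE_image[OF cK cV(3) this] obtain D where D: "D \<subseteq> K" "finite D" "K \<subseteq> (\<Union>x\<in>D. V x)" by blast
  define m where "m = Min (insert 1 (c ` D))"
  have m: "m > 0" "\<And>x. x \<in> D \<Longrightarrow> m \<le> c x" using D cV(1) by (auto simp: m_def)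
  obtain V0 where V0: "open V0" "z \<in> V0" "\<And>y. y \<in> V0 \<Longrightarrow> lempert A z y < ereal m"
    by (rule lempert_local[OF A m(1), of z]) blast
  define r0 where "r0 = min (1/2) (m / 4)"
  have r0: "0 < r0" "r0 < 1" "r0 \<le> 1/2" "4 * r0 \<le> m" using m by (auto simp: r0_def)
  have art: "artanh r0 < m"
  proof -
    have "r0 / (1 - r0) \<le> r0 / (1/2)" using r0 by (intro divide_left_mono) auto
    hence "r0 / (1 - r0) \<le> 2 * r0" by simp
    thus ?thesis using artanh_le[OF less_imp_le[OF r0(1)] r0(2)] r0 m(1) by linarith
  qed
  show thesis
  proof (rule that[of r0 "V0 \<inter> W"])
    show "open (V0 \<inter> W)" "z \<in> V0 \<inter> W" using V0 oW z \<rho> by (auto simp: W_def)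
    fix f \<zeta> assume f: "holo_disc A f" and f0: "f 0 \<in> V0 \<inter> W" and \<zeta>: "cmod \<zeta> < r0"
    have no: "f \<xi> \<notin> K" if "\<xi> \<in> closed_segment 0 \<zeta>" for \<xi>
    proof
      assume "f \<xi> \<in> K"
      then obtain x where x: "x \<in> D" "f \<xi> \<in> V x" using D by blast
      have xK: "x \<in> K" using x D by blast
      have "cmod \<xi> \<le> cmod \<zeta>" using that segment_bound1[of \<xi> 0 \<zeta>] by simp
      hence \<xi>: "cmod \<xi> < r0" using \<zeta> by simp
      have "lempert A (f 0) (f \<xi>) \<le> ereal (artanh (cmod \<xi>))" by (rule lempert_le[OF f refl refl]) (use \<xi> r0 in simp)
      moreover have "artanh (cmod \<xi>) < m" using artanh_mono_real[of "cmod \<xi>" r0] \<xi> r0 art by simp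
      ultimately have l2: "lempert A (f 0) (f \<xi>) < ereal (c x)" using m(2)[OF x(1)] by (meson ereal_less_eq(3) le_less_trans less_ereal.simps(1) order.strict_trans2)
      have l1: "lempert A z (f 0) < ereal (c x)" using V0(3)[of "f 0"] f0 m(2)[OF x(1)] by (meson IntD1 ereal_less_eq(3) order.strict_trans2)
      have l3: "lempert A (f \<xi>) x < ereal (c x)" by (rule cV(5)[OF xK x(2)])
      have "lempert A z (f 0) + lempert A (f 0) (f \<xi>) + lempert A (f \<xi>) x < ereal (c x) + ereal (c x) + ereal (c x)"
        by (intro ereal_add_strict_mono2 l1 l2 l3)
      hence "kobayashi A z x < ereal (3 * c x)" using kobayashi_le_three[of A z x "f 0" "f \<xi>"] by (simp add: le_less_trans)
      thus False using cV(2)[OF xK] by simp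
    qed
    \<comment> \<open>If K is avoided, W and the complement of the compact set C separate the image
      of the segment, which is connected and starts in W.\<close>
    have "f \<zeta> \<in> W"
    proof (rule ccontr)
      assume nW: "f \<zeta> \<notin> W"
      have seg: "closed_segment 0 \<zeta> \<subseteq> ball 0 1"
      proof
        fix \<xi> assume "\<xi> \<in> closed_segment 0 \<zeta>"
        thus "\<xi> \<in> ball 0 1" using segment_bound1[of \<xi> 0 \<zeta>] \<zeta> r0 by simp
      qed
      have "continuous_on (closed_segment 0 \<zeta>) f"
        using f seg by (auto simp: holo_disc_def intro: continuous_on_subset)
      hence conn: "connected (f ` closed_segment 0 \<zeta>)" by (rule connected_continuous_image) auto
      have "f ` closed_segment 0 \<zeta> \<subseteq> W \<union> - C" using no CWK by blast
      moreover have "W \<inter> - C \<inter> f ` closed_segment 0 \<zeta> = {}" using WC by blast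
      moreover have "open (- C)" using compact_imp_closed[OF cC] by (simp add: open_Compl)
      ultimately have "W \<inter> f ` closed_segment 0 \<zeta> = {} \<or> - C \<inter> f ` closed_segment 0 \<zeta> = {}"
        using connectedD[OF conn oW] by blast
      moreover have "f 0 \<in> W \<inter> f ` closed_segment 0 \<zeta>" using f0 by auto
      moreover have "f \<zeta> \<in> - C \<inter> f ` closed_segment 0 \<zeta>" using nW no[of \<zeta>] CWK by auto
      ultimately show False by blast
    qed
    thus "f \<zeta> \<in> U \<and> norm (\<phi> (f \<zeta>) - \<phi> z) < \<rho>" by (auto simp: W_def dist_norm norm_minus_commute)
  qed (use r0 in auto)
qed

lemma eventually_tangent_filter:
  fixes \<phi> :: "'a::t2_space \<Rightarrow> complex ^ 'n"
  assumes V: "open V" "z \<in> V" and e: "e > 0" and P: "\<And>t w Y. t \<noteq> 0 \<Longrightarrow> cmod t < e \<Longrightarrow> w \<in> V \<Longrightarrow> norm (Y - X) < e \<Longrightarrow> P (t, w, Y)"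
  shows "eventually P (at (0::complex) \<times>\<^sub>F nhds z \<times>\<^sub>F nhds (X :: complex ^ 'n))"
proof -
  have 1: "\<forall>\<^sub>F t in at (0::complex). t \<noteq> 0 \<and> cmod t < e" using e unfolding eventually_at by (intro exI[of _ e]) auto
  have 2: "\<forall>\<^sub>F w in nhds z. w \<in> V" using V by (rule eventually_nhds_in_open)
  have "\<forall>\<^sub>F Y in nhds X. Y \<in> ball X e" using e by (intro eventually_nhds_in_open) auto
  hence 3: "\<forall>\<^sub>F Y in nhds X. norm (Y - X) < e" by eventually_elim (simp add: dist_norm norm_minus_commute)
  have "\<forall>\<^sub>F x in at 0 \<times>\<^sub>F nhds z \<times>\<^sub>F nhds X. (fst x \<noteq> 0 \<and> cmod (fst x) < e) \<and> (fst (snd x) \<in> V \<and> norm (snd (snd x) - X) < e)"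
    by (rule eventually_prodI[OF 1 eventually_prodI[OF 2 3]])
  thus ?thesis by eventually_elim (use P in \<open>auto simp: case_prod_unfold\<close>)
qed

section \<open>Derivatives of the Lempert function\<close>

lemma dquot_nonneg: "0 \<le> dquot (lempert A) U \<phi> (t, w, Y)"
  by (simp add: dquot_def lempert_nonneg)

text \<open>If the quotient at (t, w, Y) were below C < \<kappa>(z; X), a disc g from w would reach
  the target at some \<beta> of modulus below C |t|. By Taylor's formula (\<beta>/t) g'(0) differs
  from Y by O(|t|), so it is a vector near X, based near z, with \<kappa> at most |\<beta>/t| < C,
  which continuity forbids.\<close>

lemma kappa_le_Dlower:
  fixes A :: "('a::t2_space set \<times> ('a \<Rightarrow> complex ^ 'n)) set"
  assumes A: "complex_atlas A" and U: "(U, \<phi>) \<in> A" and z: "z \<in> U" and hyp: "hyperbolic_at A z"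
    and cont: "continuous (at (z, X)) (\<lambda>(w, Y). kappa A \<phi> w Y)"
  shows "kappa A \<phi> z X \<le> Dlower (lempert A) U \<phi> z X"
proof (rule dense_le)
  fix C0 assume C0: "C0 < kappa A \<phi> z X"
  show "C0 \<le> Dlower (lempert A) U \<phi> z X"
  proof (cases "C0 \<le> 0")
    case True
    have "0 \<le> Dlower (lempert A) U \<phi> z X" unfolding Dlower_def
      by (rule Liminf_bounded) (use dquot_nonneg in \<open>auto intro!: always_eventually\<close>)
    thus ?thesis using True by (rule order.trans[rotated])
  next
    case False
    then obtain C where C: "C0 = ereal C" "C > 0" using C0 by (cases C0) auto
    note ch = atlas_chartD[OF A U]
    let ?n = "real CARD('n)"
    have "((\<lambda>(w, Y). kappa A \<phi> w Y) \<longlongrightarrow> kappa A \<phi> z X) (nhds (z, X))"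
      using cont unfolding continuous_at tendsto_at_iff_tendsto_nhds by simp
    hence "\<forall>\<^sub>F p in nhds (z, X). ereal C < (\<lambda>(w, Y). kappa A \<phi> w Y) p" by (rule order_tendstoD) (use C0 C in simp)
    then obtain S where S: "open S" "(z, X) \<in> S" "\<And>w Y. (w, Y) \<in> S \<Longrightarrow> ereal C < kappa A \<phi> w Y"
      unfolding eventually_nhds by force
    obtain V1 B1 where V1: "open V1" "open B1" "(z, X) \<in> V1 \<times> B1" "V1 \<times> B1 \<subseteq> S" by (rule open_prod_elim[OF S(1,2)])
    obtain e1 where e1: "e1 > 0" "ball X e1 \<subseteq> B1" by (rule openE[OF V1(2), of X]) (use V1(3) in auto)
    obtain \<rho> where \<rho>: "\<rho> > 0" "cball (\<phi> z) \<rho> \<subseteq> \<phi> ` U" using ch(2) z open_contains_cball by blast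
    obtain r0 V where r0: "0 < r0" "r0 < 1" and V: "open V" "z \<in> V"
      and loc: "\<And>f \<zeta>. holo_disc A f \<Longrightarrow> f 0 \<in> V \<Longrightarrow> cmod \<zeta> < r0 \<Longrightarrow> f \<zeta> \<in> U \<and> norm (\<phi> (f \<zeta>) - \<phi> z) < \<rho>"
      by (rule hyperbolic_localization[OF A U z hyp \<rho>]) blast
    define m where "m = norm (\<phi> z) + \<rho>"
    define CC where "CC = ?n * (4 * m / r0\<^sup>2)"
    have CC: "CC \<ge> 0" using \<rho> by (simp add: CC_def m_def)
    define V2 where "V2 = V \<inter> V1 \<inter> (U \<inter> \<phi> -` ball (\<phi> z) (\<rho> / 2))"
    have V2: "open V2" "z \<in> V2" using V V1 chart_ball_nbhd[OF A U z] z \<rho> by (auto simp: V2_def)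
    \<comment> \<open>\<open>r0 / C\<close> puts \<beta> into the localized disc, the \<rho> term
      keeps the target in the chart with |Y| < |X| + 1, and e1/2 is spent once on Y - X and once on
      the Taylor error \<open>CC * C\<^sup>2 * e\<close>.\<close>
    define e where "e = min (r0 / C) (min (\<rho> / (2 * (norm X + 1))) (min 1 (min (e1 / 2) (e1 / (2 * (CC * C\<^sup>2 + 1))))))"
    have pos: "norm X + 1 > 0" "CC * C\<^sup>2 + 1 > 0" using CC by (auto simp: add_nonneg_pos)
    have e: "e > 0" "e \<le> r0 / C" "e \<le> \<rho> / (2 * (norm X + 1))" "e \<le> 1" "e \<le> e1 / 2" "e \<le> e1 / (2 * (CC * C\<^sup>2 + 1))"
    proof -
      show "e > 0" using r0 C(2) \<rho>(1) e1(1) pos by (simp add: e_def)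
    qed (unfold e_def, (rule min.coboundedI1 min.coboundedI2 order.refl | simp only: min_le_iff_disj simp_thms order.refl)+)
    have "\<forall>\<^sub>F p in at 0 \<times>\<^sub>F nhds z \<times>\<^sub>F nhds X. ereal C \<le> dquot (lempert A) U \<phi> p"
    proof (rule eventually_tangent_filter[OF V2 e(1)], rule ccontr)
      fix t w Y assume t: "t \<noteq> 0" "cmod t < e" and w: "w \<in> V2" and Y: "norm (Y - X) < e"
        and neg: "\<not> ereal C \<le> dquot (lempert A) U \<phi> (t, w, Y)"
      define w' where "w' = inv_into U \<phi> (\<phi> w + t *s Y)"
      have t0: "cmod t > 0" using t by simp
      have "lempert A w w' / ereal (cmod t) < ereal C" using neg by (simp add: dquot_def w'_def)
      hence "lempert A w w' < ereal (C * cmod t)" using t0 by (subst (asm) ereal_divide_less_iff) auto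
      then obtain g \<beta> where g: "holo_disc A g" "g 0 = w" "g \<beta> = w'" "cmod \<beta> < C * cmod t" by (rule lempert_lessD)
      have \<beta>r: "cmod \<beta> < r0"
      proof -
        have "C * cmod t \<le> C * e" using t C by (intro mult_left_mono) auto
        also have "\<dots> \<le> r0" using e(2) C(2) by (simp add: field_simps)
        finally show ?thesis using g(4) by simp
      qed
      have wU: "w \<in> U" "w \<in> V" "w \<in> V1" "norm (\<phi> w - \<phi> z) < \<rho> / 2" using w by (auto simp: V2_def dist_norm norm_minus_commute)
      have inb: "\<And>\<zeta>. cmod \<zeta> < r0 \<Longrightarrow> g \<zeta> \<in> U \<and> norm (\<phi> (g \<zeta>) - \<phi> z) < \<rho>" using loc[OF g(1)] g(2) wU by simp
      \<comment> \<open>The target must be a genuine chart point, since outside the image of the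
        chart \<open>inv_into\<close> has an unspecified value.\<close>
      have "norm (t *s Y) < \<rho> / 2"
      proof -
        have "norm Y < norm X + 1" using Y e(4) norm_triangle_sub[of Y X] by linarith
        hence "cmod t * norm Y \<le> cmod t * (norm X + 1)" by (intro mult_left_mono) auto
        also have "\<dots> < e * (norm X + 1)" using t pos by (intro mult_strict_right_mono) auto
        also have "\<dots> \<le> \<rho> / 2" using e(3) pos by (simp add: field_simps)
        finally show ?thesis by (simp add: norm_smult_vec)
      qed
      hence "norm (\<phi> w + t *s Y - \<phi> z) < \<rho>" using wU(4) norm_triangle_ineq[of "\<phi> w - \<phi> z" "t *s Y"] by (simp add: algebra_simps)
      hence "\<phi> w + t *s Y \<in> \<phi> ` U" using \<rho>(2) by (auto simp: dist_norm norm_minus_commute subset_iff)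
      hence \<phi>w': "\<phi> w' = \<phi> w + t *s Y" by (simp add: w'_def f_inv_into_f)
      have hol: "(\<lambda>\<zeta>. \<phi> (g \<zeta>) $ i) holomorphic_on ball 0 r0" for i
      proof -
        have "(\<lambda>\<zeta>. \<phi> (g \<zeta>) $ i) holomorphic_on (ball 0 1 \<inter> g -` U)" using g(1) U unfolding holo_disc_def by blast
        thus ?thesis by (rule holomorphic_on_subset) (use inb r0 in auto)
      qed
      define v where "v = (\<chi> i. deriv (\<lambda>\<zeta>. \<phi> (g \<zeta>) $ i) 0)"
      have "((\<lambda>\<zeta>. \<phi> (g \<zeta>)) has_derivative (\<lambda>h. h *s v)) (at 0)" unfolding has_derivative_vec_iff v_def
        using holomorphic_derivI[OF hol open_ball, of 0] r0 by simp
      hence kap: "kappa A \<phi> w ((\<beta> / t) *s v) \<le> ereal (cmod (\<beta> / t))"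
        unfolding kappa_def by (intro Inf_lower) (use g in blast)
      have "norm (\<phi> (g \<beta>) - \<phi> (g 0) - \<beta> *s v) \<le> ?n * (4 * m / r0\<^sup>2 * (cmod \<beta>)\<^sup>2)"
      proof (rule norm_vec_le_card)
        fix i
        have "cmod (\<phi> (g \<beta>) $ i - \<phi> (g 0) $ i - deriv (\<lambda>\<zeta>. \<phi> (g \<zeta>) $ i) 0 * (\<beta> - 0)) \<le> 4 * m / r0\<^sup>2 * (cmod (\<beta> - 0))\<^sup>2"
        proof (rule taylor1_bound[OF hol r0(1)])
          show "cmod (\<phi> (g x) $ i) \<le> m" if "x \<in> ball 0 r0" for x
          proof -
            have "norm (\<phi> (g x)) \<le> norm (\<phi> z) + norm (\<phi> (g x) - \<phi> z)" by (rule norm_triangle_sub)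
            also have "\<dots> \<le> m" using inb[of x] that by (simp add: m_def)
            finally show ?thesis by (rule order.trans[OF Finite_Cartesian_Product.norm_nth_le])
          qed
        qed (use \<beta>r in simp)
        thus "cmod ((\<phi> (g \<beta>) - \<phi> (g 0) - \<beta> *s v) $ i) \<le> 4 * m / r0\<^sup>2 * (cmod \<beta>)\<^sup>2" by (simp add: v_def mult.commute)
      qed
      moreover have "\<phi> (g \<beta>) - \<phi> (g 0) - \<beta> *s v = t *s (Y - (\<beta> / t) *s v)"
        using t by (simp add: g(2,3) \<phi>w' vec_eq_iff right_diff_distrib)
      ultimately have "cmod t * norm (Y - (\<beta> / t) *s v) \<le> CC * (cmod \<beta>)\<^sup>2" by (simp only: norm_smult_vec CC_def mult.assoc)
      also have "\<dots> \<le> CC * (C * cmod t)\<^sup>2" using g(4) CC by (intro mult_left_mono power_mono) auto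
      also have "\<dots> = cmod t * (CC * C\<^sup>2 * cmod t)" by (simp add: power2_eq_square)
      finally have "norm (Y - (\<beta> / t) *s v) \<le> CC * C\<^sup>2 * cmod t" using t0 by simp
      also have "\<dots> \<le> CC * C\<^sup>2 * e" using t CC by (intro mult_left_mono) auto
      also have "\<dots> < (CC * C\<^sup>2 + 1) * e" using e(1) by (simp add: algebra_simps)
      also have "\<dots> \<le> e1 / 2" using e(6) pos by (simp add: field_simps)
      finally have "norm (Y - (\<beta> / t) *s v) < e1 / 2" .
      hence "dist X ((\<beta> / t) *s v) < e1" using Y e(5) dist_triangle[of X "(\<beta> / t) *s v" Y] by (simp add: dist_norm norm_minus_commute)
      hence "(w, (\<beta> / t) *s v) \<in> S" using e1(2) V1(4) wU(3) by (auto simp: subset_iff)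
      from S(3)[OF this] kap have "ereal C < ereal (cmod (\<beta> / t))" by (rule less_le_trans)
      moreover have "cmod (\<beta> / t) < C" using g(4) t0 by (simp add: norm_divide field_simps)
      ultimately show False by simp
    qed
    thus ?thesis unfolding Dlower_def C(1) by (rule Liminf_bounded)
  qed
qed

text \<open>In the trivialization the wanted disc is an affine section, passing through the fibre
  coordinate of w at 0 and of the target at \<open>\<beta> = t * \<alpha>\<close>. It stays in the
  family if its slope is small. The slope is a difference quotient of a function close to one that
  vanishes to first order, because f, which is tangent to v, is the zero section. Restricting to
  radius r < 1 costs a factor that the gap between |\<alpha>| and C pays for.\<close>

lemma Dupper_le_disc:
  fixes A :: "('a::t2_space set \<times> ('a \<Rightarrow> complex ^ 'n)) set"
  assumes A: "complex_atlas A" and U: "(U, \<phi>) \<in> A" and z: "z \<in> U"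
    and f: "holo_disc A f" "f 0 = z" and fv: "((\<lambda>\<zeta>. \<phi> (f \<zeta>)) has_derivative (\<lambda>h. h *s v)) (at 0)"
    and \<alpha>: "\<alpha> \<noteq> 0" "\<alpha> *s v = X"
  shows "Dupper (lempert A) U \<phi> z X \<le> ereal (cmod \<alpha>)"
proof (rule dense_ge)
  fix C0 assume C0: "ereal (cmod \<alpha>) < C0"
  show "Dupper (lempert A) U \<phi> z X \<le> C0"
  proof (cases C0)
    case (real C)
    note ch = atlas_chartD[OF A U]
    let ?n = "real CARD('n)"
    have a0: "cmod \<alpha> > 0" using \<alpha> by simp
    have C: "cmod \<alpha> < C" using C0 real by simp
    have C0': "C > 0" using C a0 by linarith
    \<comment> \<open>The midpoint of |\<alpha>|/C and 1: close enough to 1 that the gap between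
      |\<alpha>| and C covers the loss of radius.\<close>
    define r where "r = (cmod \<alpha> / C + 1) / 2"
    have aC: "cmod \<alpha> / C < 1" using C C0' by simp
    have r: "0 < r" "r < 1" "cmod \<alpha> / C < r" using aC a0 C0' by (auto simp: r_def field_simps add_pos_pos)
    obtain \<Omega> \<delta> F \<psi> where fm: "fam A f \<Omega> \<delta> F \<psi>" and \<Omega>: "cball 0 r \<subseteq> \<Omega>"
      using disc_fam[OF A f(1) r(1,2)] unfolding hasfam_def by blast
    note fd = famD[OF fm]
    let ?N = "(\<lambda>a. (fst a, F a)) ` (\<Omega> \<times> ball 0 \<delta>)"
    have z\<Omega>: "0 \<in> \<Omega>" using \<Omega> r by auto
    \<comment> \<open>The fibre coordinate, over a base point, of the manifold point whose chart
      coordinate is \<phi> z plus the second argument.\<close>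
    define u where "u = (\<lambda>a. \<psi> (fst a, inv_into U \<phi> (\<phi> z + snd a)))"
    define P where "P = \<Omega> \<times> ((\<lambda>s. \<phi> z + s) -` (\<phi> ` U))"
    have oP: "open P" unfolding P_def using fd(1) ch(2) by (intro open_Times open_vimage continuous_intros)
    have cP: "continuous_on P (\<lambda>a. (fst a, inv_into U \<phi> (\<phi> z + snd a)))"
      by (intro continuous_intros continuous_on_compose2[OF ch(4)]) (auto simp: P_def)
    define O1 where "O1 = P \<inter> (\<lambda>a. (fst a, inv_into U \<phi> (\<phi> z + snd a))) -` ?N"
    have oO: "open O1" unfolding O1_def by (rule continuous_open_preimage[OF cP oP fd(7)])
    have z0: "(0, z) = (fst (0, 0 :: complex ^ 'n), F (0, 0))" using fd(5)[OF z\<Omega>] f(2) by simp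
    have zN: "(0, z) \<in> ?N" by (rule image_eqI[of _ _ "(0, 0)"]) (use z0 z\<Omega> fd(2) in auto)
    have "(0, 0) \<in> O1" using z\<Omega> z zN ch(6)[OF z] by (auto simp: O1_def P_def)
    then obtain e0 where e0: "e0 > 0" "ball (0, 0) e0 \<subseteq> O1" by (rule openE[OF oO])
    define \<rho> where "\<rho> = e0 / 2"
    have \<rho>: "\<rho> > 0" using e0 by (simp add: \<rho>_def)
    let ?W = "ball (0::complex) \<rho> \<times> ball (0 :: complex ^ 'n) \<rho>"
    have WO: "?W \<subseteq> O1"
    proof
      fix a assume "a \<in> ?W"
      hence "norm (fst a) + norm (snd a) < e0" by (auto simp: \<rho>_def)
      hence "norm a < e0" using norm_Pair_le[of "fst a" "snd a"] by simp
      hence "a \<in> ball (0, 0) e0" by (simp add: dist_norm flip: zero_prod_def)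
      thus "a \<in> O1" using e0(2) by blast
    qed
    have WP: "?W \<subseteq> P" using WO by (auto simp: O1_def)
    have uN: "(fst a, inv_into U \<phi> (\<phi> z + snd a)) \<in> ?N" if "a \<in> ?W" for a using WO that by (auto simp: O1_def)
    have Fu: "norm (u a) < \<delta> \<and> F (fst a, u a) = inv_into U \<phi> (\<phi> z + snd a)" if a: "a \<in> ?W" for a
    proof -
      obtain x where x: "x \<in> \<Omega> \<times> ball 0 \<delta>" "(fst a, inv_into U \<phi> (\<phi> z + snd a)) = (fst x, F x)" using uN[OF a] by blast
      have "u a = snd x" using fd(6)[OF x(1)] x(2) by (simp add: u_def)
      thus ?thesis using x by auto
    qed
    have ju: "jholo ?W u" unfolding jholo_def
    proof (intro conjI allI impI)
      show "continuous_on ?W u" unfolding u_def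
        by (rule continuous_on_compose2[OF fd(8) continuous_on_subset[OF cP WP]]) (use uN in blast)
      fix T g and \<sigma> :: "complex \<Rightarrow> complex ^ 'n"
      assume T: "open T" "g holomorphic_on T" "vholo T \<sigma>" and gW: "\<forall>\<tau>\<in>T. (g \<tau>, \<sigma> \<tau>) \<in> ?W"
      have "mholo A T (\<lambda>\<tau>. inv_into U \<phi> (\<phi> z + \<sigma> \<tau>))"
      proof (rule mholo_inv_chart[OF A U T(1)])
        show "vholo T (\<lambda>\<tau>. \<phi> z + \<sigma> \<tau>)" by (intro vholo_add vholo_const T)
        show "(\<lambda>\<tau>. \<phi> z + \<sigma> \<tau>) ` T \<subseteq> \<phi> ` U" using gW WP by (auto simp: P_def subset_iff)
      qed
      hence "vholo T (\<lambda>\<tau>. \<psi> (g \<tau>, inv_into U \<phi> (\<phi> z + \<sigma> \<tau>)))"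
      proof (rule fd(9)[OF T(1,2)])
        show "(g \<tau>, inv_into U \<phi> (\<phi> z + \<sigma> \<tau>)) \<in> ?N" if "\<tau> \<in> T" for \<tau> using uN[of "(g \<tau>, \<sigma> \<tau>)"] gW that by simp
      qed
      thus "vholo T (\<lambda>\<tau>. u (g \<tau>, \<sigma> \<tau>))" by (simp add: u_def)
    qed
    define L where "L = ?n * (4 * \<delta> / \<rho>)"
    have L0: "L \<ge> 0" using fd(2) \<rho> by (simp add: L_def)
    have lip: "norm (u (\<tau>, s) - u (\<tau>, s')) \<le> L * norm (s - s')" if "cmod \<tau> < \<rho>" "norm s < \<rho> / 2" "norm s' < \<rho> / 2" for \<tau> s s'
      unfolding L_def
    proof (rule jholo_lipschitz[OF ju])
      show "norm (u (\<tau>, s)) \<le> \<delta>" if "s \<in> ball 0 \<rho>" for s using Fu[of "(\<tau>, s)"] that \<open>cmod \<tau> < \<rho>\<close> by auto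
    qed (use that in auto)
    have u00: "u (0, 0) = 0" using fd(6)[of "(0, 0)"] z0 z\<Omega> fd(2) ch(6)[OF z] by (simp add: u_def)
    have fc: "continuous_on (ball 0 1) f" using f(1) by (simp add: holo_disc_def)
    have "open (ball 0 1 \<inter> f -` U)" by (rule continuous_open_preimage[OF fc open_ball ch(1)])
    moreover have "0 \<in> ball 0 1 \<inter> f -` U" using f(2) z by simp
    ultimately obtain d1 where d1: "d1 > 0" "ball 0 d1 \<subseteq> ball 0 1 \<inter> f -` U" by (rule openE)
    obtain d2 where d2: "d2 > 0" "ball 0 d2 \<subseteq> \<Omega>" by (rule openE[OF fd(1) z\<Omega>])
    \<comment> \<open>In the chart f differs from the line \<tau> v by o(\<tau>), and f has fibre
      coordinate 0; the Lipschitz bound for u transfers this to the line.\<close>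
    have small0: "\<exists>d>0. \<forall>\<tau>. cmod \<tau> < d \<longrightarrow> norm (u (\<tau>, \<tau> *s v)) \<le> \<epsilon> * cmod \<tau>" if \<epsilon>: "\<epsilon> > 0" for \<epsilon>
    proof -
      define \<epsilon>' where "\<epsilon>' = min 1 (\<epsilon> / (L + 1))"
      have \<epsilon>': "\<epsilon>' > 0" "\<epsilon>' \<le> 1" "L * \<epsilon>' \<le> \<epsilon>"
      proof -
        show "\<epsilon>' > 0" "\<epsilon>' \<le> 1" using \<epsilon> L0 by (auto simp: \<epsilon>'_def)
        have "L * \<epsilon>' \<le> (L + 1) * (\<epsilon> / (L + 1))" using L0 \<epsilon> by (intro mult_mono) (auto simp: \<epsilon>'_def)
        thus "L * \<epsilon>' \<le> \<epsilon>" using L0 by simp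
      qed
      obtain d3 where d3: "d3 > 0" "\<And>\<tau>. cmod \<tau> < d3 \<Longrightarrow> norm (\<phi> (f \<tau>) - \<phi> z - \<tau> *s v) \<le> \<epsilon>' * cmod \<tau>"
        using fv \<epsilon>'(1) f(2) unfolding has_derivative_at_alt by force
      define d where "d = min (min d1 d2) (min d3 (min \<rho> (\<rho> / (2 * (norm v + 1)))))"
      have nv: "norm v + 1 > 0" by (simp add: add_nonneg_pos)
      have d: "d > 0" "d \<le> d1" "d \<le> d2" "d \<le> d3" "d \<le> \<rho>" "d \<le> \<rho> / (2 * (norm v + 1))" using d1 d2 d3 \<rho> nv by (auto simp: d_def)
      show ?thesis
      proof (intro exI[of _ d] conjI allI impI)
        fix \<tau> assume \<tau>: "cmod \<tau> < d"
        have fU: "f \<tau> \<in> U" using d1(2) \<tau> d by (auto simp: subset_iff)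
        have t\<Omega>: "\<tau> \<in> \<Omega>" using d2(2) \<tau> d by (auto simp: subset_iff)
        have D: "norm (\<phi> (f \<tau>) - \<phi> z - \<tau> *s v) \<le> \<epsilon>' * cmod \<tau>" using d3 \<tau> d by simp
        have *: "cmod \<tau> * (norm v + 1) < \<rho> / 2"
        proof -
          have "cmod \<tau> * (norm v + 1) < d * (norm v + 1)" using \<tau> nv by (intro mult_strict_right_mono) auto
          also have "\<dots> \<le> \<rho> / 2" using d(6) nv by (simp add: field_simps)
          finally show ?thesis .
        qed
        have n1: "norm (\<tau> *s v) < \<rho> / 2" using * by (simp add: norm_smult_vec distrib_left) (use norm_ge_zero[of \<tau>] in linarith)
        have "norm (\<phi> (f \<tau>) - \<phi> z) \<le> norm (\<tau> *s v) + norm (\<phi> (f \<tau>) - \<phi> z - \<tau> *s v)" by (rule norm_triangle_sub)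
        also have "\<dots> \<le> cmod \<tau> * norm v + 1 * cmod \<tau>" using D \<epsilon>'(2) mult_right_mono[of \<epsilon>' 1 "cmod \<tau>"] by (simp add: norm_smult_vec)
        also have "\<dots> < \<rho> / 2" using * by (simp add: algebra_simps)
        finally have n2: "norm (\<phi> (f \<tau>) - \<phi> z) < \<rho> / 2" .
        have "u (\<tau>, \<phi> (f \<tau>) - \<phi> z) = \<psi> (\<tau>, F (\<tau>, 0))" using ch(6)[OF fU] fd(5)[OF t\<Omega>] by (simp add: u_def)
        also have "\<dots> = 0" using fd(6)[of "(\<tau>, 0)"] t\<Omega> fd(2) by simp
        finally have "norm (u (\<tau>, \<tau> *s v)) = norm (u (\<tau>, \<tau> *s v) - u (\<tau>, \<phi> (f \<tau>) - \<phi> z))" by simp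
        also have "\<dots> \<le> L * norm (\<tau> *s v - (\<phi> (f \<tau>) - \<phi> z))" by (rule lip) (use \<tau> d n1 n2 in auto)
        also have "\<dots> \<le> L * (\<epsilon>' * cmod \<tau>)" using D L0 by (intro mult_left_mono) (auto simp: norm_minus_commute algebra_simps)
        also have "\<dots> \<le> \<epsilon> * cmod \<tau>" using \<epsilon>'(3) mult_right_mono[of "L * \<epsilon>'" \<epsilon> "cmod \<tau>"] by (simp add: mult.assoc)
        finally show "norm (u (\<tau>, \<tau> *s v)) \<le> \<epsilon> * cmod \<tau>" .
      qed (rule d(1))
    qed
    obtain d where d: "d > 0" "\<And>\<tau>. cmod \<tau> < d \<Longrightarrow> norm (u (\<tau>, \<tau> *s v)) \<le> \<delta> / 4 * cmod \<tau>"
      using small0[of "\<delta> / 4"] fd(2) by auto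
    \<comment> \<open>With |Y'| at most |v| + 1, this radius keeps the chart lines used below within
      \<rho>/2, where u is Lipschitz.\<close>
    define \<rho>1 where "\<rho>1 = \<rho> / (4 * (norm v + 1))"
    have nv: "norm v + 1 > 0" by (simp add: add_nonneg_pos)
    have \<rho>1: "\<rho>1 > 0" "\<rho>1 \<le> \<rho>" "\<rho>1 * (norm v + 1) \<le> \<rho> / 4"
    proof -
      have *: "\<rho> / (4 * k) * k = \<rho> / 4" if "k > 0" for k :: real using that by simp
      show "\<rho>1 > 0" using \<rho> nv by (simp add: \<rho>1_def)
      show "\<rho>1 * (norm v + 1) \<le> \<rho> / 4" using *[OF nv] by (simp only: \<rho>1_def order.refl)
      have "\<rho> / (4 * (norm v + 1)) \<le> \<rho> / 1" using \<rho> by (intro divide_left_mono) (auto simp: add_nonneg_pos)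
      thus "\<rho>1 \<le> \<rho>" by (simp add: \<rho>1_def)
    qed
    \<comment> \<open>For |\<beta>| < s0 one has
      \<open>cmod \<alpha> / C \<le> r - cmod \<beta>\<close>, the inequality on which the final
      estimate of \<open>artanh\<close> rests.\<close>
    define s0 where "s0 = r - cmod \<alpha> / C"
    have s0: "s0 > 0" using r by (simp add: s0_def)
    \<comment> \<open>\<open>Q * e\<close> bounds the increment rate of D below: the supremum of D
      is at most L times a multiple of e, and Schwarz's lemma divides it by \<rho>1. The summand 1
      makes Q positive.\<close>
    define Q where "Q = ?n * (2 * L / \<rho>1) * (1 + \<rho>1 / cmod \<alpha>) + 1"
    have Q: "Q > 0" unfolding Q_def using L0 \<rho>1(1) a0 by (intro add_nonneg_pos mult_nonneg_nonneg divide_nonneg_pos add_nonneg_nonneg of_nat_0_le_iff) auto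
    \<comment> \<open>The entries secure in turn that y0 is small, that |Y' - v| is at most 1, that
      the initial fibre coordinate and the error of the slope are at most \<delta>/4 each, and that
      |\<beta>| is below \<rho>1, d and s0.\<close>
    define e where "e = min (\<rho> / 4) (min (cmod \<alpha>) (min (\<delta> / (4 * (L + 1))) (min (\<delta> / (4 * Q)) (min \<rho>1 (min d s0) / cmod \<alpha>))))"
    have e: "e > 0" "e \<le> \<rho> / 4" "e \<le> cmod \<alpha>" "L * e \<le> \<delta> / 4" "Q * e \<le> \<delta> / 4" "e * cmod \<alpha> \<le> \<rho>1" "e * cmod \<alpha> \<le> d" "e * cmod \<alpha> \<le> s0"
    proof -
      show e0: "e > 0" unfolding e_def min_less_iff_conj
        using \<rho> a0 fd(2) L0 Q \<rho>1(1) d(1) s0 by (intro conjI divide_pos_pos) auto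
      show "e \<le> \<rho> / 4" "e \<le> cmod \<alpha>" by (simp_all only: e_def min_le_iff_disj order.refl simp_thms)
      have "e \<le> \<delta> / (4 * (L + 1))" by (simp only: e_def min_le_iff_disj order.refl simp_thms)
      hence "(L + 1) * e \<le> \<delta> / 4" using L0 by (simp add: field_simps)
      moreover have "L * e \<le> (L + 1) * e" using e0 by simp
      ultimately show "L * e \<le> \<delta> / 4" by linarith
      have "e \<le> \<delta> / (4 * Q)" by (simp only: e_def min_le_iff_disj order.refl simp_thms)
      thus "Q * e \<le> \<delta> / 4" using Q by (simp add: field_simps)
      have "e \<le> min \<rho>1 (min d s0) / cmod \<alpha>" unfolding e_def by (intro min.coboundedI2 order.refl)
      hence "e * cmod \<alpha> \<le> min \<rho>1 (min d s0)" using a0 by (simp only: pos_le_divide_eq)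
      thus "e * cmod \<alpha> \<le> \<rho>1" "e * cmod \<alpha> \<le> d" "e * cmod \<alpha> \<le> s0" by auto
    qed
    have "\<forall>\<^sub>F p in at 0 \<times>\<^sub>F nhds z \<times>\<^sub>F nhds X. dquot (lempert A) U \<phi> p \<le> ereal C"
    proof (rule eventually_tangent_filter[of "U \<inter> \<phi> -` ball (\<phi> z) e", OF chart_ball_nbhd[OF A U z] _ e(1)])
      show "z \<in> U \<inter> \<phi> -` ball (\<phi> z) e" using z e(1) by simp
      fix t w Y assume t: "t \<noteq> 0" "cmod t < e" and w: "w \<in> U \<inter> \<phi> -` ball (\<phi> z) e" and Y: "norm (Y - X) < e"
      define y0 where "y0 = \<phi> w - \<phi> z"
      have y0: "norm y0 < e" and wU: "w \<in> U" using w by (auto simp: y0_def dist_norm norm_minus_commute)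
      \<comment> \<open>Since \<open>\<beta> *s Y' = t *s Y\<close>, the chart line from w in
        direction Y' meets the target at \<beta>, and Y' is close to v.\<close>
      define Y' where "Y' = (1 / \<alpha>) *s Y"
      define \<beta> where "\<beta> = t * \<alpha>"
      have \<beta>0: "\<beta> \<noteq> 0" using t \<alpha> by (simp add: \<beta>_def)
      have \<beta>: "cmod \<beta> < \<rho>1" "cmod \<beta> < d" "cmod \<beta> < s0"
      proof -
        have "cmod \<beta> < e * cmod \<alpha>" using t a0 by (simp add: \<beta>_def norm_mult)
        thus "cmod \<beta> < \<rho>1" "cmod \<beta> < d" "cmod \<beta> < s0" using e by auto
      qed
      have \<beta>r: "cmod \<beta> < r" using \<beta>(3) a0 C0' by (simp add: s0_def) (use divide_pos_pos[OF a0 C0'] in linarith)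
      have Yv: "norm (Y' - v) \<le> e / cmod \<alpha>"
      proof -
        have "Y' - v = (1 / \<alpha>) *s (Y - X)" using \<alpha> by (auto simp: Y'_def vec_eq_iff field_simps)
        hence "norm (Y' - v) = norm (Y - X) / cmod \<alpha>" by (simp only: norm_smult_vec norm_divide norm_one) simp
        thus ?thesis using Y a0 by (simp add: divide_right_mono)
      qed
      have "e / cmod \<alpha> \<le> 1" using e(3) a0 by simp
      hence Yb: "norm Y' \<le> norm v + 1" using Yv norm_triangle_sub[of Y' v] by linarith
      have nb: "norm (y0 + \<tau> *s Y') < \<rho> / 2" "norm (\<tau> *s v) < \<rho> / 2" if "\<tau> \<in> ball 0 \<rho>1" for \<tau>
      proof -
        have "cmod \<tau> * norm Y' \<le> \<rho>1 * (norm v + 1)" using that Yb \<rho>1 by (intro mult_mono) auto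
        hence "norm (\<tau> *s Y') \<le> \<rho> / 4" using \<rho>1(3) by (simp add: norm_smult_vec)
        thus "norm (y0 + \<tau> *s Y') < \<rho> / 2" using y0 e(2) norm_triangle_ineq[of y0 "\<tau> *s Y'"] by linarith
        have "cmod \<tau> * norm v \<le> \<rho>1 * (norm v + 1)" using that \<rho>1 by (intro mult_mono) auto
        thus "norm (\<tau> *s v) < \<rho> / 2" using \<rho>1(3) \<rho> by (simp add: norm_smult_vec)
      qed
      have lt\<rho>: "cmod \<tau> < \<rho>" if "\<tau> \<in> ball 0 \<rho>1" for \<tau> using that \<rho>1(2) by simp
      define g where "g = (\<lambda>\<tau>. u (\<tau>, y0 + \<tau> *s Y'))"
      \<comment> \<open>Comparison with the line through z in direction v: D is uniformly small on a
        disc of fixed radius, so by Schwarz's lemma its increment is small relative to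
        |\<beta>|.\<close>
      define D where "D = (\<lambda>\<tau>. g \<tau> - u (\<tau>, \<tau> *s v))"
      have gh: "vholo (ball 0 \<rho>1) g" unfolding g_def
        by (rule jholo_curve[OF ju open_ball _ vholo_affine]) (use nb(1) lt\<rho> \<rho> in \<open>force intro!: holomorphic_intros\<close>)+
      have "vholo (ball 0 \<rho>1) (\<lambda>\<tau>. u (\<tau>, 0 + \<tau> *s v))"
        by (rule jholo_curve[OF ju open_ball _ vholo_affine]) (use nb(2) lt\<rho> \<rho> in \<open>force intro!: holomorphic_intros\<close>)+
      hence Dh: "vholo (ball 0 \<rho>1) D" unfolding D_def using gh by (simp add: vholo_diff)
      define \<eta> where "\<eta> = L * (e + \<rho>1 * (e / cmod \<alpha>))"
      have Db: "norm (D \<tau>) \<le> \<eta>" if "\<tau> \<in> ball 0 \<rho>1" for \<tau>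
      proof -
        have "norm (D \<tau>) \<le> L * norm ((y0 + \<tau> *s Y') - \<tau> *s v)"
          unfolding D_def g_def by (rule lip) (use lt\<rho>[OF that] nb[OF that] in auto)
        also have "norm ((y0 + \<tau> *s Y') - \<tau> *s v) \<le> e + \<rho>1 * (e / cmod \<alpha>)"
        proof -
          have *: "(y0 + \<tau> *s Y') - \<tau> *s v = y0 + \<tau> *s (Y' - v)" by (simp add: vec_eq_iff algebra_simps)
          have "cmod \<tau> * norm (Y' - v) \<le> \<rho>1 * (e / cmod \<alpha>)" using that Yv \<rho>1 by (intro mult_mono) auto
          thus ?thesis using norm_triangle_ineq[of y0 "\<tau> *s (Y' - v)"] y0 unfolding * norm_smult_vec by linarith
        qed
        finally show ?thesis unfolding \<eta>_def using L0 by (simp add: mult_left_mono)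
      qed
      have "norm (D \<beta> - D 0) \<le> ?n * (2 * \<eta> / \<rho>1 * cmod (\<beta> - 0))"
      proof (rule norm_vec_le_card)
        fix i
        have "cmod ((\<lambda>\<tau>. D \<tau> $ i) \<beta> - (\<lambda>\<tau>. D \<tau> $ i) 0) \<le> 2 * \<eta> / \<rho>1 * cmod (\<beta> - 0)"
        proof (rule increment_bound)
          show "(\<lambda>\<tau>. D \<tau> $ i) holomorphic_on ball 0 \<rho>1" using Dh by (simp add: vholo_def)
          show "cmod (D x $ i) \<le> \<eta>" if "x \<in> ball 0 \<rho>1" for x
            by (rule order.trans[OF Finite_Cartesian_Product.norm_nth_le Db[OF that]])
        qed (use \<rho>1 \<beta> in auto)
        thus "cmod ((D \<beta> - D 0) $ i) \<le> 2 * \<eta> / \<rho>1 * cmod (\<beta> - 0)" by simp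
      qed
      also have "?n * (2 * \<eta> / \<rho>1 * cmod (\<beta> - 0)) = (?n * (2 * L / \<rho>1) * (1 + \<rho>1 / cmod \<alpha>) * e) * cmod \<beta>"
        unfolding \<eta>_def by (simp add: algebra_simps add_divide_distrib)
      also have "\<dots> \<le> \<delta> / 4 * cmod \<beta>"
      proof (rule mult_right_mono)
        have "?n * (2 * L / \<rho>1) * (1 + \<rho>1 / cmod \<alpha>) * e \<le> Q * e" unfolding Q_def using e(1) by (intro mult_right_mono) auto
        thus "?n * (2 * L / \<rho>1) * (1 + \<rho>1 / cmod \<alpha>) * e \<le> \<delta> / 4" using e(5) by linarith
      qed simp
      finally have D1: "norm (D \<beta> - D 0) \<le> \<delta> / 4 * cmod \<beta>" .
      have D2: "norm (u (\<beta>, \<beta> *s v)) \<le> \<delta> / 4 * cmod \<beta>" by (rule d(2)[OF \<beta>(2)])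
      have "g \<beta> - g 0 = (D \<beta> - D 0) + u (\<beta>, \<beta> *s v)" by (simp add: D_def u00)
      hence gd: "norm (g \<beta> - g 0) \<le> \<delta> / 2 * cmod \<beta>" using D1 D2 norm_triangle_ineq[of "D \<beta> - D 0" "u (\<beta>, \<beta> *s v)"] by simp
      define b where "b = (1 / \<beta>) *s (g \<beta> - g 0)"
      have nbb: "norm b \<le> \<delta> / 2"
      proof -
        have "norm b = norm (g \<beta> - g 0) / cmod \<beta>" by (simp only: b_def norm_smult_vec norm_divide norm_one) simp
        thus ?thesis using gd \<beta>0 by (simp add: divide_le_eq)
      qed
      have na: "norm (g 0) \<le> \<delta> / 4"
      proof -
        have "norm (u (0, y0) - u (0, 0)) \<le> L * norm (y0 - 0)" by (rule lip) (use \<rho> y0 e(2) in auto)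
        also have "\<dots> \<le> L * e" using y0 L0 by (intro mult_left_mono) auto
        finally show ?thesis using e(4) by (simp add: g_def u00)
      qed
      \<comment> \<open>The disc of radius r is rescaled to the unit disc, so the target is met at
        \<beta>/r.\<close>
      define G where "G = (\<lambda>\<zeta>. F (of_real r * \<zeta>, g 0 + (of_real r * \<zeta>) *s b))"
      have Gh: "holo_disc A G" unfolding holo_disc_iff_mholo G_def
      proof (rule fd(4)[OF open_ball])
        show "(\<lambda>\<zeta>. of_real r * \<zeta>) holomorphic_on ball 0 1" by (intro holomorphic_intros)
        show "vholo (ball 0 1) (\<lambda>\<zeta>. g 0 + (of_real r * \<zeta>) *s b)" by (intro vholo_add vholo_const vholo_smult holomorphic_intros)
        fix \<tau> assume "\<tau> \<in> ball (0::complex) 1"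
        hence "r * cmod \<tau> \<le> r" using r by (simp add: mult_left_le)
        hence rt: "cmod (of_real r * \<tau>) < 1 \<and> cmod (of_real r * \<tau>) \<le> r" using r(1,2) unfolding norm_mult norm_of_real abs_of_pos[OF r(1)] by linarith
        hence "cmod (of_real r * \<tau>) * norm b \<le> 1 * (\<delta> / 2)" using nbb by (intro mult_mono) auto
        hence "norm (g 0 + (of_real r * \<tau>) *s b) < \<delta>"
          using na fd(2) norm_triangle_ineq[of "g 0" "(of_real r * \<tau>) *s b"] unfolding norm_smult_vec by linarith
        moreover have "of_real r * \<tau> \<in> \<Omega>" using rt \<Omega> by (auto simp: subset_iff)
        ultimately show "(of_real r * \<tau>, g 0 + (of_real r * \<tau>) *s b) \<in> \<Omega> \<times> ball 0 \<delta>" by simp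
      qed
      have G0: "G 0 = w"
      proof -
        have "F (0, u (0, y0)) = inv_into U \<phi> (\<phi> z + y0)" using Fu[of "(0, y0)"] \<rho> y0 e(2) by simp
        thus ?thesis using ch(6)[OF wU] by (simp add: G_def g_def y0_def)
      qed
      have G1: "G (\<beta> / of_real r) = inv_into U \<phi> (\<phi> w + t *s Y)"
      proof -
        have rb: "of_real r * (\<beta> / of_real r) = \<beta>" using r by simp
        have "g 0 + \<beta> *s b = g \<beta>" using \<beta>0 by (simp add: b_def vec_eq_iff)
        hence "G (\<beta> / of_real r) = F (\<beta>, u (\<beta>, y0 + \<beta> *s Y'))" unfolding G_def rb by (simp add: g_def)
        also have "\<dots> = inv_into U \<phi> (\<phi> z + (y0 + \<beta> *s Y'))"
          using Fu[of "(\<beta>, y0 + \<beta> *s Y')"] nb(1)[of \<beta>] lt\<rho>[of \<beta>] \<beta>(1) \<rho> by simp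
        also have "\<phi> z + (y0 + \<beta> *s Y') = \<phi> w + t *s Y" using \<alpha> by (simp add: y0_def \<beta>_def Y'_def vec_eq_iff)
        finally show ?thesis .
      qed
      let ?x = "cmod \<beta> / r"
      have x1: "cmod (\<beta> / of_real r) = ?x" "?x < 1" "0 \<le> ?x" using r \<beta>r by (auto simp: norm_divide)
      have "lempert A w (inv_into U \<phi> (\<phi> w + t *s Y)) \<le> ereal (artanh ?x)"
        using lempert_le[OF Gh G0 G1] x1 by simp
      also have "artanh ?x \<le> ?x / (1 - ?x)" by (rule artanh_le[OF x1(3,2)])
      finally have le: "lempert A w (inv_into U \<phi> (\<phi> w + t *s Y)) \<le> ereal (?x / (1 - ?x))" by simp
      have "?x / (1 - ?x) \<le> C * cmod t"
      proof -
        have "?x / (1 - ?x) = cmod \<beta> / (r - cmod \<beta>)" using r \<beta>r by (simp add: field_simps)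
        also have "\<dots> \<le> C * cmod t"
        proof -
          have "cmod \<alpha> / C \<le> r - cmod \<beta>" using \<beta>(3) by (simp add: s0_def)
          hence "cmod \<alpha> \<le> C * (r - cmod \<beta>)" using C0' by (simp add: field_simps)
          hence "cmod t * cmod \<alpha> \<le> cmod t * (C * (r - cmod \<beta>))" by (intro mult_left_mono) auto
          thus ?thesis using \<beta>r by (simp add: \<beta>_def norm_mult divide_le_eq mult_ac)
        qed
        finally show ?thesis .
      qed
      hence le2: "lempert A w (inv_into U \<phi> (\<phi> w + t *s Y)) \<le> ereal (C * cmod t)" using le by (meson ereal_less_eq(3) order.trans)
      have "\<not> ereal C < dquot (lempert A) U \<phi> (t, w, Y)"
      proof -
        obtain l where "lempert A w (inv_into U \<phi> (\<phi> w + t *s Y)) = ereal l" "l \<le> C * cmod t"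
          using le2 lempert_nonneg[of A w "inv_into U \<phi> (\<phi> w + t *s Y)"] by (cases "lempert A w (inv_into U \<phi> (\<phi> w + t *s Y))") auto
        thus ?thesis using t by (simp add: dquot_def not_less divide_le_eq)
      qed
      thus "dquot (lempert A) U \<phi> (t, w, Y) \<le> ereal C" by simp
    qed
    thus ?thesis unfolding Dupper_def real by (rule Limsup_bounded)
  qed (use C0 in auto)
qed

lemma Dupper_le_kappa:
  fixes A :: "('a::t2_space set \<times> ('a \<Rightarrow> complex ^ 'n)) set"
  assumes A: "complex_atlas A" and U: "(U, \<phi>) \<in> A" and z: "z \<in> U"
  shows "Dupper (lempert A) U \<phi> z X \<le> kappa A \<phi> z X"
  unfolding kappa_def
proof (rule Inf_greatest, clarify)
  fix \<alpha> f v assume f: "holo_disc A f" and z0: "z = f 0"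
    and v: "((\<lambda>\<zeta>. \<phi> (f \<zeta>)) has_derivative (\<lambda>h. h *s v)) (at 0)" and X: "X = \<alpha> *s v"
  show "Dupper (lempert A) U \<phi> (f 0) (\<alpha> *s v) \<le> ereal (cmod \<alpha>)"
  proof (cases "\<alpha> = 0")
    case False
    thus ?thesis using Dupper_le_disc[OF A U z f z0[symmetric] v False X[symmetric]] z0 X by simp
  next
    case True
    \<comment> \<open>For \<alpha> = 0 the vector X is zero, and the constant disc represents it
      with every multiplier e > 0; then e tends to 0.\<close>
    have const: "holo_disc A (\<lambda>_. z)" unfolding holo_disc_def by (auto intro!: continuous_intros holomorphic_intros)
    have d0: "((\<lambda>\<zeta>. \<phi> z) has_derivative (\<lambda>h. h *s 0)) (at (0::complex))" by simp
    have le: "Dupper (lempert A) U \<phi> z X \<le> ereal e" if "e > 0" for e :: real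
    proof -
      have "Dupper (lempert A) U \<phi> z X \<le> ereal (cmod (of_real e))"
        by (rule Dupper_le_disc[OF A U z const refl d0]) (use that True X in auto)
      thus ?thesis using that by simp
    qed
    have "Dupper (lempert A) U \<phi> z X \<le> 0" by (rule ereal_le_epsilon2) (use le in simp)
    thus ?thesis using True z0 X by (simp flip: zero_ereal_def)
  qed
qed

theorem theorem1:
  fixes A :: "('a::t2_space set \<times> ('a \<Rightarrow> complex ^ 'n)) set"
    and U :: "'a set" and \<phi> :: "'a \<Rightarrow> complex ^ 'n" and z :: 'a and X :: "complex ^ 'n"
  assumes "complex_atlas A"
    and "(U, \<phi>) \<in> A" and "z \<in> U"
    and "hyperbolic_at A z"
    and "continuous (at (z, X)) (\<lambda>(w, Y). kappa A \<phi> w Y)"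
  shows "kappa A \<phi> z X = Dupper (lempert A) U \<phi> z X
       \<and> Dupper (lempert A) U \<phi> z X = Dlower (lempert A) U \<phi> z X"
proof -
  have "kappa A \<phi> z X \<le> Dlower (lempert A) U \<phi> z X" by (rule kappa_le_Dlower[OF assms])
  moreover have "Dlower (lempert A) U \<phi> z X \<le> Dupper (lempert A) U \<phi> z X"
    unfolding Dlower_def Dupper_def by (rule Liminf_le_Limsup) (simp add: prod_filter_eq_bot)
  moreover have "Dupper (lempert A) U \<phi> z X \<le> kappa A \<phi> z X" by (rule Dupper_le_kappa[OF assms(1-3)])
  ultimately show ?thesis by (metis order.antisym order.trans)
qed

end
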